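(* Let $C$ be a commutative ring with identity, $\lambda\in C$, and $A$ a $C$-algebra with identity. 1. The Baxter algebra $(\mathfrak A(A),P'_A)$ is complete. 2. Assume that $\lambda\in C$ is not a zero divisor in $\overline A$. The isomorphism $\Phi:\mathrm{Sh}_C(A)\to\mathfrak S(A)$ extends to an isomorphism of complete Baxter algebras $$\widehat\Phi:\widehat{\mathrm{Sh}}_C(A)\to\tilde{\mathfrak S}(A).$$
   Context: All rings and algebras are associative, commutative, with identity; $\otimes=\otimes_C$; $\mathbb N=\{0,1,2,\dots\}$. A Baxter $C$-algebra (of weight $\lambda$) is a pair $(R,P)$ with $R$ a $C$-algebra and $P:R\to R$ a $C$-linear map satisfying $P(x)P(y)=P(xP(y))+P(yP(x))+\lambda P(xy)$. A homomorphism $f:(R,P)\to(S,Q)$ is a $C$-algebra homomorphism with $f\circ P=Q\circ f$. A Baxter ideal is an ideal $I$ with $P(I)\subseteq I$; $\langle U\rangle_B$ is the Baxter ideal generated by $U$. Baxter filtration: $\mathrm{Fil}^0R=R$, $\mathrm{Fil}^{n+1}R=\langle P(\mathrm{Fil}^nR)\rangle_B$. $(R,P)$ is proper if $\mathrm{Fil}^1R\ne R$. For proper $(R,P)$ the completion is $\widehat R=\varprojlim R/\mathrm{Fil}^nR$ with the induced Baxter operator; $\pi_R:R\to\widehat R$ is the natural map; a proper $(R,P)$ is complete if $\pi_R$ is an isomorphism. Shuffle Baxter algebra. For $m,n\ge1$ let $S(m,n)$ be the set of $\sigma\in S_{m+n}$ with $\sigma^{-1}(1)<\dots<\sigma^{-1}(m)$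 and $\sigma^{-1}(m+1)<\dots<\sigma^{-1}(m+n)$. A pair $(k,k+1)$, $1\le k<m+n$, is admissible for $\sigma$ if $\sigma(k)\le m<\sigma(k+1)$; $\mathcal T^\sigma$ is the set of admissible pairs; $\bar S(m,n)=\{(\sigma,T):\sigma\in S(m,n),\,T\subseteq\mathcal T^\sigma\}$. For $x=x_1\otimes\dots\otimes x_m$, $y=y_1\otimes\dots\otimes y_n$, put $u_k=x_k$ for $k\le m$, $u_k=y_{k-m}$ for $k>m$, and let $\sigma(x\otimes y;T)$ be obtained from $u_{\sigma(1)}\otimes\dots\otimes u_{\sigma(m+n)}$ by replacing, for each $(k,k+1)\in T$, the tensor symbol between $u_{\sigma(k)}$ and $u_{\sigma(k+1)}$ by the product in $A$. Let $\mathrm{Sh}_C(A)=\bigoplus_{k\in\mathbb N}A^{\otimes(k+1)}$ with $C$-bilinear product determined by $$(x_0\otimes x)\diamond(y_0\otimes y)=\sum_{(\sigma,T)\in\bar S(m,n)}\lambda^{|T|}\,x_0y_0\otimes\sigma(x\otimes y;T)$$ for $m,n\ge1$ and $x_0\diamond(y_0\otimes\dots\otimes y_n)=(y_0\otimes\dots\otimes y_n)\diamond x_0=x_0y_0\otimes y_1\otimes\dots\otimes y_n$ for $x_0\in A$. With $P_A(x_0\otimes\dots\otimes x_n)=1_A\otimes x_0\otimes\dots\otimes x_n$ and the inclusion of $A$ as the $k=0$ summand, $(\mathrm{Sh}_C(A),P_A)$ is a free Baxter $C$-algebra of weight $\lambda$ on $A$. $\widehat{\mathrm{Sh}}_C(A)=\varprojlim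 \mathrm{Sh}_C(A)/\mathrm{Fil}^k\mathrm{Sh}_C(A)$ is its Baxter completion. Standard Baxter algebra. $\overline A=\varinjlim A^{\otimes n}$ is the direct limit of the tensor power $C$-algebras along $A^{\otimes n}\to A^{\otimes(n+1)}$, $x\mapsto x\otimes1_A$. $\mathfrak A(A)$ is the algebra of sequences $(a_1,a_2,\dots)$ with entries in $\overline A$, with componentwise operations, and $P'_A(a_1,a_2,a_3,\dots)=\lambda(0,a_1,a_1+a_2,a_1+a_2+a_3,\dots)$; $(\mathfrak A(A),P'_A)$ is a Baxter $C$-algebra of weight $\lambda$. For $a\in A$, $t^{(a)}=(t^{(a)}_k)_{k\ge1}$ with $t^{(a)}_k=1\otimes\dots\otimes1\otimes a$ ($k$ factors, $a$ in position $k$). $\mathfrak S(A)$ is the (unital) Baxter subalgebra of $\mathfrak A(A)$ generated by the $t^{(a)}$, $a\in A$. $\Phi:\mathrm{Sh}_C(A)\to\mathfrak S(A)$ is the unique Baxter homomorphism with $\Phi(a)=t^{(a)}$ for $a\in A$; it is an isomorphism when $\lambda$ is not a zero divisor in $\overline A$. For $k\in\mathbb N$, $F^k\mathfrak A(A)=\{(a_i)\in\mathfrak A(A):a_i=0\text{ for }i\le k\}$ and $F^k\mathfrak S(A)=\mathfrak S(A)\cap F^k\mathfrak A(A)$. $\tilde{\mathfrak S}(A)$ denotes the image of $\varprojlim\mathfrak S(A)/F^k\mathfrak S(A)\hookrightarrow\varprojlim\mathfrak A(A)/F^k\mathfrak A(A)\cong\mathfrak A(A)$ with the induced Baxter algebra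 structure; it contains $\mathfrak S(A)$. "$\widehat\Phi$ extends $\Phi$" means $\widehat\Phi\circ\pi_{\mathrm{Sh}_C(A)}=\Phi$ as maps into $\tilde{\mathfrak S}(A)\supseteq\mathfrak S(A)$.
   Formalization: A is assumed nonzero; in part 2 "complete" means complete for the filtrations that the completion of Sh_C(A) and the algebra S-tilde carry as inverse limits, since completeness for their own Baxter filtrations Fil^n fails in general (e.g. C=Q[h], lambda=h, A=C[x_1,x_2,...]). *)

theory Defs
  imports "HOL-Combinatorics.Permutations" "HOL-Algebra.QuotRing" "HOL-Algebra.Subrings"
begin

section \<open>Quotient algebras and inverse limits\<close>

text \<open>The map on cosets induced by \<open>h\<close>, with values in the quotient of \<open>S\<close> by \<open>J\<close>. As in the
  definition of \<^const>\<open>rcoset_mult\<close>, the union over all representatives avoids choosing one: when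
  the induced map is well defined, all the cosets in the union are equal.\<close>

definition coset_map :: "('s, 'x) ring_scheme \<Rightarrow> 's set \<Rightarrow> ('r \<Rightarrow> 's) \<Rightarrow> 'r set \<Rightarrow> 's set" where
  "coset_map S J h X = (\<Union>x\<in>X. J +>\<^bsub>S\<^esub> h x)"

definition quot_alg :: "('c, 'r, 'x) module_scheme \<Rightarrow> 'r set \<Rightarrow> ('c, 'r set) module" where
  "quot_alg R I =
    \<lparr>carrier = carrier (R Quot I), mult = mult (R Quot I), one = one (R Quot I),
     zero = zero (R Quot I), add = add (R Quot I),
     smult = (\<lambda>c. coset_map R I (\<lambda>x. c \<odot>\<^bsub>R\<^esub> x))\<rparr>"

text \<open>\<open>F\<close> is a decreasing sequence of ideals of \<open>R\<close>; \<open>lim_alg R F\<close> is the inverse limit of the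
  quotients \<open>R / F n\<close>.\<close>

definition lim_alg ::
  "('c, 'r, 'x) module_scheme \<Rightarrow> (nat \<Rightarrow> 'r set) \<Rightarrow> ('c, nat \<Rightarrow> 'r set) module" where
  "lim_alg R F =
    \<lparr>carrier = {X. (\<forall>n. X n \<in> carrier (quot_alg R (F n))) \<and>
                   (\<forall>n. coset_map R (F n) (\<lambda>x. x) (X (Suc n)) = X n)},
     mult = (\<lambda>X Y n. X n \<otimes>\<^bsub>quot_alg R (F n)\<^esub> Y n),
     one = (\<lambda>n. \<one>\<^bsub>quot_alg R (F n)\<^esub>),
     zero = (\<lambda>n. \<zero>\<^bsub>quot_alg R (F n)\<^esub>),
     add = (\<lambda>X Y n. X n \<oplus>\<^bsub>quot_alg R (F n)\<^esub> Y n),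
     smult = (\<lambda>c X n. c \<odot>\<^bsub>quot_alg R (F n)\<^esub> X n)\<rparr>"

definition lim_op ::
  "('c, 'r, 'x) module_scheme \<Rightarrow> (nat \<Rightarrow> 'r set) \<Rightarrow> ('r \<Rightarrow> 'r) \<Rightarrow> (nat \<Rightarrow> 'r set) \<Rightarrow> nat \<Rightarrow> 'r set" where
  "lim_op R F P X = (\<lambda>n. coset_map R (F n) P (X n))"

definition lim_map ::
  "('c, 'r, 'x) module_scheme \<Rightarrow> (nat \<Rightarrow> 'r set) \<Rightarrow> 'r \<Rightarrow> nat \<Rightarrow> 'r set" where
  "lim_map R F x = (\<lambda>n. F n +>\<^bsub>R\<^esub> x)"

text \<open>The filtration on the inverse limit that defines its topology: the \<open>k\<close>-th term is the kernel of
  the projection to \<open>R / F k\<close>.\<close>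

definition lim_fil ::
  "('c, 'r, 'x) module_scheme \<Rightarrow> (nat \<Rightarrow> 'r set) \<Rightarrow> nat \<Rightarrow> (nat \<Rightarrow> 'r set) set" where
  "lim_fil R F k = {X \<in> carrier (lim_alg R F). X k = \<zero>\<^bsub>quot_alg R (F k)\<^esub>}"


section \<open>Baxter algebras\<close>

definition baxter_algebra ::
  "('c, 'k) ring_scheme \<Rightarrow> 'c \<Rightarrow> ('c, 'r, 'x) module_scheme \<Rightarrow> ('r \<Rightarrow> 'r) \<Rightarrow> bool" where
  "baxter_algebra C l R P \<longleftrightarrow>
     algebra C R \<and> l \<in> carrier C \<and> P \<in> carrier R \<rightarrow> carrier R \<and>
     (\<forall>x\<in>carrier R. \<forall>y\<in>carrier R. P (x \<oplus>\<^bsub>R\<^esub> y) = P x \<oplus>\<^bsub>R\<^esub> P y) \<and>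
     (\<forall>c\<in>carrier C. \<forall>x\<in>carrier R. P (c \<odot>\<^bsub>R\<^esub> x) = c \<odot>\<^bsub>R\<^esub> P x) \<and>
     (\<forall>x\<in>carrier R. \<forall>y\<in>carrier R.
        P x \<otimes>\<^bsub>R\<^esub> P y =
        P (x \<otimes>\<^bsub>R\<^esub> P y) \<oplus>\<^bsub>R\<^esub> P (y \<otimes>\<^bsub>R\<^esub> P x) \<oplus>\<^bsub>R\<^esub> l \<odot>\<^bsub>R\<^esub> P (x \<otimes>\<^bsub>R\<^esub> y))"

definition baxter_hom ::
  "('c, 'k) ring_scheme \<Rightarrow> 'c \<Rightarrow> ('c, 'r, 'x) module_scheme \<Rightarrow> ('r \<Rightarrow> 'r) \<Rightarrow>
   ('c, 's, 'y) module_scheme \<Rightarrow> ('s \<Rightarrow> 's) \<Rightarrow> ('r \<Rightarrow> 's) \<Rightarrow> bool" where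
  "baxter_hom C l R P S Q f \<longleftrightarrow>
     baxter_algebra C l R P \<and> baxter_algebra C l S Q \<and> f \<in> ring_hom R S \<and>
     (\<forall>c\<in>carrier C. \<forall>x\<in>carrier R. f (c \<odot>\<^bsub>R\<^esub> x) = c \<odot>\<^bsub>S\<^esub> f x) \<and>
     (\<forall>x\<in>carrier R. f (P x) = Q (f x))"

definition baxter_iso ::
  "('c, 'k) ring_scheme \<Rightarrow> 'c \<Rightarrow> ('c, 'r, 'x) module_scheme \<Rightarrow> ('r \<Rightarrow> 'r) \<Rightarrow>
   ('c, 's, 'y) module_scheme \<Rightarrow> ('s \<Rightarrow> 's) \<Rightarrow> ('r \<Rightarrow> 's) \<Rightarrow> bool" where
  "baxter_iso C l R P S Q f \<longleftrightarrow>
     baxter_hom C l R P S Q f \<and> bij_betw f (carrier R) (carrier S)"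

definition baxter_ideal :: "('c, 'r, 'x) module_scheme \<Rightarrow> ('r \<Rightarrow> 'r) \<Rightarrow> 'r set \<Rightarrow> bool" where
  "baxter_ideal R P I \<longleftrightarrow> ideal I R \<and> P ` I \<subseteq> I"

definition gen_baxter_ideal ::
  "('c, 'r, 'x) module_scheme \<Rightarrow> ('r \<Rightarrow> 'r) \<Rightarrow> 'r set \<Rightarrow> 'r set" where
  "gen_baxter_ideal R P U = \<Inter>{I. baxter_ideal R P I \<and> U \<subseteq> I}"

primrec baxter_fil :: "('c, 'r, 'x) module_scheme \<Rightarrow> ('r \<Rightarrow> 'r) \<Rightarrow> nat \<Rightarrow> 'r set" where
  "baxter_fil R P 0 = carrier R"
| "baxter_fil R P (Suc n) = gen_baxter_ideal R P (P ` baxter_fil R P n)"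

definition baxter_proper :: "('c, 'r, 'x) module_scheme \<Rightarrow> ('r \<Rightarrow> 'r) \<Rightarrow> bool" where
  "baxter_proper R P \<longleftrightarrow> baxter_fil R P 1 \<noteq> carrier R"

abbreviation completion ::
  "('c, 'r, 'x) module_scheme \<Rightarrow> ('r \<Rightarrow> 'r) \<Rightarrow> ('c, nat \<Rightarrow> 'r set) module" where
  "completion R P \<equiv> lim_alg R (baxter_fil R P)"

abbreviation completion_op ::
  "('c, 'r, 'x) module_scheme \<Rightarrow> ('r \<Rightarrow> 'r) \<Rightarrow> (nat \<Rightarrow> 'r set) \<Rightarrow> nat \<Rightarrow> 'r set" where
  "completion_op R P \<equiv> lim_op R (baxter_fil R P) P"

abbreviation completion_map ::
  "('c, 'r, 'x) module_scheme \<Rightarrow> ('r \<Rightarrow> 'r) \<Rightarrow> 'r \<Rightarrow> nat \<Rightarrow> 'r set" where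
  "completion_map R P \<equiv> lim_map R (baxter_fil R P)"

definition baxter_complete ::
  "('c, 'k) ring_scheme \<Rightarrow> 'c \<Rightarrow> ('c, 'r, 'x) module_scheme \<Rightarrow> ('r \<Rightarrow> 'r) \<Rightarrow> bool" where
  "baxter_complete C l R P \<longleftrightarrow>
     baxter_proper R P \<and>
     baxter_iso C l R P (completion R P) (completion_op R P) (completion_map R P)"

text \<open>Completeness of \<open>(R, P)\<close> with respect to a prescribed filtration \<open>F\<close> by Baxter ideals. For a
  completion this is meant with the filtration it carries as an inverse limit. That filtration may
  be strictly larger than \<^const>\<open>baxter_fil\<close> of the completion, whose members are generated by
  finite sums, and the completion need not satisfy \<^const>\<open>baxter_complete\<close>.\<close>

definition complete_filtered_baxter ::
  "('c, 'k) ring_scheme \<Rightarrow> 'c \<Rightarrow> ('c, 'r, 'x) module_scheme \<Rightarrow> ('r \<Rightarrow> 'r) \<Rightarrow>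
   (nat \<Rightarrow> 'r set) \<Rightarrow> bool" where
  "complete_filtered_baxter C l R P F \<longleftrightarrow>
     baxter_proper R P \<and>
     F 0 = carrier R \<and>
     (\<forall>n. baxter_ideal R P (F n) \<and> F (Suc n) \<subseteq> F n \<and> P ` F n \<subseteq> F (Suc n)) \<and>
     baxter_iso C l R P (lim_alg R F) (lim_op R F P) (lim_map R F)"

definition baxter_subalgebra ::
  "('c, 'k) ring_scheme \<Rightarrow> ('c, 'r, 'x) module_scheme \<Rightarrow> ('r \<Rightarrow> 'r) \<Rightarrow> 'r set \<Rightarrow> bool" where
  "baxter_subalgebra C R P S \<longleftrightarrow>
     subring S R \<and> (\<forall>c\<in>carrier C. \<forall>x\<in>S. c \<odot>\<^bsub>R\<^esub> x \<in> S) \<and> P ` S \<subseteq> S"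

definition gen_baxter_subalgebra ::
  "('c, 'k) ring_scheme \<Rightarrow> ('c, 'r, 'x) module_scheme \<Rightarrow> ('r \<Rightarrow> 'r) \<Rightarrow> 'r set \<Rightarrow> 'r set" where
  "gen_baxter_subalgebra C R P U = \<Inter>{S. baxter_subalgebra C R P S \<and> U \<subseteq> S}"


section \<open>Tensor powers\<close>

definition single :: "('c, 'k) ring_scheme \<Rightarrow> 'w \<Rightarrow> 'w \<Rightarrow> 'c" where
  "single C w = (\<lambda>u. if u = w then \<one>\<^bsub>C\<^esub> else \<zero>\<^bsub>C\<^esub>)"

text \<open>A finitely supported function \<open>f\<close> stands for the formal linear combination of the words \<open>w\<close> with
  coefficients \<open>f w\<close>. The next two constants are the linear extension of a map \<open>h\<close> from words to
  words, and the bilinear extension of a map \<open>b\<close> from pairs of words to linear combinations.\<close>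

definition lin_ext :: "('c, 'k) ring_scheme \<Rightarrow> ('w \<Rightarrow> 'v) \<Rightarrow> ('w \<Rightarrow> 'c) \<Rightarrow> 'v \<Rightarrow> 'c" where
  "lin_ext C h f = (\<lambda>v. \<Oplus>\<^bsub>C\<^esub>w\<in>{w. f w \<noteq> \<zero>\<^bsub>C\<^esub> \<and> h w = v}. f w)"

definition bilin_ext ::
  "('c, 'k) ring_scheme \<Rightarrow> ('w \<Rightarrow> 'w \<Rightarrow> 'v \<Rightarrow> 'c) \<Rightarrow> ('w \<Rightarrow> 'c) \<Rightarrow> ('w \<Rightarrow> 'c) \<Rightarrow> 'v \<Rightarrow> 'c" where
  "bilin_ext C b f g = (\<lambda>v. \<Oplus>\<^bsub>C\<^esub>p\<in>{w. f w \<noteq> \<zero>\<^bsub>C\<^esub>} \<times> {w. g w \<noteq> \<zero>\<^bsub>C\<^esub>}.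
      f (fst p) \<otimes>\<^bsub>C\<^esub> g (snd p) \<otimes>\<^bsub>C\<^esub> b (fst p) (snd p) v)"

text \<open>The free \<open>C\<close>-module on the \<open>n\<close>-tuples of elements of \<open>A\<close>, with componentwise multiplication
  of tuples.\<close>

definition word_alg ::
  "('c, 'k) ring_scheme \<Rightarrow> ('c, 'a, 'm) module_scheme \<Rightarrow> nat \<Rightarrow> ('c, 'a list \<Rightarrow> 'c) module" where
  "word_alg C A n =
    \<lparr>carrier = {f. (\<forall>w. f w \<in> carrier C) \<and> finite {w. f w \<noteq> \<zero>\<^bsub>C\<^esub>} \<and>
                   (\<forall>w. f w \<noteq> \<zero>\<^bsub>C\<^esub> \<longrightarrow> length w = n \<and> set w \<subseteq> carrier A)},
     mult = bilin_ext C (\<lambda>u v. single C (map2 (mult A) u v)),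
     one = single C (replicate n \<one>\<^bsub>A\<^esub>),
     zero = (\<lambda>w. \<zero>\<^bsub>C\<^esub>),
     add = (\<lambda>f g w. f w \<oplus>\<^bsub>C\<^esub> g w),
     smult = (\<lambda>c f w. c \<otimes>\<^bsub>C\<^esub> f w)\<rparr>"

definition multilinear_rels ::
  "('c, 'k) ring_scheme \<Rightarrow> ('c, 'a, 'm) module_scheme \<Rightarrow> nat \<Rightarrow> ('a list \<Rightarrow> 'c) set" where
  "multilinear_rels C A n =
     {single C (u @ [a \<oplus>\<^bsub>A\<^esub> b] @ v) \<ominus>\<^bsub>word_alg C A n\<^esub>
        (single C (u @ [a] @ v) \<oplus>\<^bsub>word_alg C A n\<^esub> single C (u @ [b] @ v)) | u a b v.
        set u \<subseteq> carrier A \<and> a \<in> carrier A \<and> b \<in> carrier A \<and> set v \<subseteq> carrier A \<and>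
        length u + 1 + length v = n} \<union>
     {single C (u @ [c \<odot>\<^bsub>A\<^esub> a] @ v) \<ominus>\<^bsub>word_alg C A n\<^esub>
        (c \<odot>\<^bsub>word_alg C A n\<^esub> single C (u @ [a] @ v)) | u c a v.
        set u \<subseteq> carrier A \<and> c \<in> carrier C \<and> a \<in> carrier A \<and> set v \<subseteq> carrier A \<and>
        length u + 1 + length v = n}"

text \<open>The submodule generated by the relations is an ideal of \<^const>\<open>word_alg\<close>, so the quotient is
  the tensor power algebra with \<open>(x\<^sub>1 \<otimes> \<dots> \<otimes> x\<^sub>n) (y\<^sub>1 \<otimes> \<dots> \<otimes> y\<^sub>n) = x\<^sub>1 y\<^sub>1 \<otimes> \<dots> \<otimes> x\<^sub>n y\<^sub>n\<close>.\<close>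

definition tensor_ker ::
  "('c, 'k) ring_scheme \<Rightarrow> ('c, 'a, 'm) module_scheme \<Rightarrow> nat \<Rightarrow> ('a list \<Rightarrow> 'c) set" where
  "tensor_ker C A n = \<Inter>{N. submodule N C (word_alg C A n) \<and> multilinear_rels C A n \<subseteq> N}"

definition tensor_pow ::
  "('c, 'k) ring_scheme \<Rightarrow> ('c, 'a, 'm) module_scheme \<Rightarrow> nat \<Rightarrow> ('c, ('a list \<Rightarrow> 'c) set) module" where
  "tensor_pow C A n = quot_alg (word_alg C A n) (tensor_ker C A n)"

definition pure_tensor ::
  "('c, 'k) ring_scheme \<Rightarrow> ('c, 'a, 'm) module_scheme \<Rightarrow> 'a list \<Rightarrow> ('a list \<Rightarrow> 'c) set" where
  "pure_tensor C A w = tensor_ker C A (length w) +>\<^bsub>word_alg C A (length w)\<^esub> single C w"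

text \<open>The map to the \<open>n\<close>-th tensor power induced by a map \<open>h\<close> on words.\<close>

definition tensor_map ::
  "('c, 'k) ring_scheme \<Rightarrow> ('c, 'a, 'm) module_scheme \<Rightarrow> nat \<Rightarrow> ('a list \<Rightarrow> 'a list) \<Rightarrow>
   ('a list \<Rightarrow> 'c) set \<Rightarrow> ('a list \<Rightarrow> 'c) set" where
  "tensor_map C A n h = coset_map (word_alg C A n) (tensor_ker C A n) (lin_ext C h)"


section \<open>The shuffle Baxter algebra\<close>

definition shuffle_perms :: "nat \<Rightarrow> nat \<Rightarrow> (nat \<Rightarrow> nat) set" where
  "shuffle_perms m n = {\<sigma>. \<sigma> permutes {1..m+n} \<and>
     strict_mono_on {1..m} (inv_into UNIV \<sigma>) \<and> strict_mono_on {m+1..m+n} (inv_into UNIV \<sigma>)}"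

definition admissible_pairs :: "nat \<Rightarrow> nat \<Rightarrow> (nat \<Rightarrow> nat) \<Rightarrow> (nat \<times> nat) set" where
  "admissible_pairs m n \<sigma> = {(k, k + 1) | k. 1 \<le> k \<and> k < m + n \<and> \<sigma> k \<le> m \<and> m < \<sigma> (k + 1)}"

definition mixable_shuffles :: "nat \<Rightarrow> nat \<Rightarrow> ((nat \<Rightarrow> nat) \<times> (nat \<times> nat) set) set" where
  "mixable_shuffles m n = {(\<sigma>, T). \<sigma> \<in> shuffle_perms m n \<and> T \<subseteq> admissible_pairs m n \<sigma>}"

text \<open>\<open>contract_word A z T N\<close> is the word \<open>z 1 \<otimes> \<dots> \<otimes> z N\<close> in which the tensor symbol between
  \<open>z k\<close> and \<open>z (k + 1)\<close> is replaced by the product of \<open>A\<close> for each \<open>(k, k + 1) \<in> T\<close>.\<close>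

primrec contract_word ::
  "('a, 'm) ring_scheme \<Rightarrow> (nat \<Rightarrow> 'a) \<Rightarrow> (nat \<times> nat) set \<Rightarrow> nat \<Rightarrow> 'a list" where
  "contract_word A z T 0 = []"
| "contract_word A z T (Suc k) =
     (let w = contract_word A z T k in
      if (k, Suc k) \<in> T then butlast w @ [last w \<otimes>\<^bsub>A\<^esub> z (Suc k)] else w @ [z (Suc k)])"

definition shuffle_word ::
  "('a, 'm) ring_scheme \<Rightarrow> 'a list \<Rightarrow> 'a list \<Rightarrow> (nat \<Rightarrow> nat) \<Rightarrow> (nat \<times> nat) set \<Rightarrow> 'a list" where
  "shuffle_word A x y \<sigma> T =
     contract_word A (\<lambda>k. (x @ y) ! (\<sigma> k - 1)) T (length x + length y)"

text \<open>The product of the pure tensors \<open>x\<^sub>0 \<otimes> x\<close> and \<open>y\<^sub>0 \<otimes> y\<close> as a linear combination of words of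
  various lengths. If \<open>x\<close> or \<open>y\<close> is empty, the only mixable shuffle is the identity with
  \<open>T = {}\<close>, and the formula reads \<open>x\<^sub>0 y\<^sub>0 \<otimes> y\<close> or \<open>x\<^sub>0 y\<^sub>0 \<otimes> x\<close>.\<close>

definition mixed_shuffle ::
  "('c, 'k) ring_scheme \<Rightarrow> 'c \<Rightarrow> ('c, 'a, 'm) module_scheme \<Rightarrow> 'a list \<Rightarrow> 'a list \<Rightarrow>
   'a list \<Rightarrow> 'c" where
  "mixed_shuffle C l A u v = (\<lambda>w.
     \<Oplus>\<^bsub>C\<^esub>p\<in>mixable_shuffles (length (tl u)) (length (tl v)).
       l [^]\<^bsub>C\<^esub> card (snd p) \<otimes>\<^bsub>C\<^esub>
       single C ((hd u \<otimes>\<^bsub>A\<^esub> hd v) # shuffle_word A (tl u) (tl v) (fst p) (snd p)) w)"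

definition word_part :: "('c, 'k) ring_scheme \<Rightarrow> nat \<Rightarrow> ('a list \<Rightarrow> 'c) \<Rightarrow> 'a list \<Rightarrow> 'c" where
  "word_part C n f = (\<lambda>w. if length w = n then f w else \<zero>\<^bsub>C\<^esub>)"

text \<open>An element \<open>f\<close> of the direct sum has its \<open>k\<close>-th component \<open>f k\<close> in the \<open>(k+1)\<close>-st tensor
  power. In the product, the \<open>k\<close>-th component of the product of \<open>f m\<close> and \<open>g n\<close> is computed on
  representatives, the union over which is again a single coset.\<close>

definition Sh ::
  "('c, 'k) ring_scheme \<Rightarrow> 'c \<Rightarrow> ('c, 'a, 'm) module_scheme \<Rightarrow>
   ('c, nat \<Rightarrow> ('a list \<Rightarrow> 'c) set) module" where
  "Sh C l A =
    \<lparr>carrier = {f. (\<forall>k. f k \<in> carrier (tensor_pow C A (Suc k))) \<and>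
                   finite {k. f k \<noteq> \<zero>\<^bsub>tensor_pow C A (Suc k)\<^esub>}},
     mult = (\<lambda>f g k.
       \<Oplus>\<^bsub>tensor_pow C A (Suc k)\<^esub>p\<in>{m. f m \<noteq> \<zero>\<^bsub>tensor_pow C A (Suc m)\<^esub>} \<times>
                                     {n. g n \<noteq> \<zero>\<^bsub>tensor_pow C A (Suc n)\<^esub>}.
         (\<Union>x\<in>f (fst p). \<Union>y\<in>g (snd p).
            tensor_ker C A (Suc k) +>\<^bsub>word_alg C A (Suc k)\<^esub>
              word_part C (Suc k) (bilin_ext C (mixed_shuffle C l A) x y))),
     one = (\<lambda>k. if k = 0 then \<one>\<^bsub>tensor_pow C A 1\<^esub> else \<zero>\<^bsub>tensor_pow C A (Suc k)\<^esub>),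
     zero = (\<lambda>k. \<zero>\<^bsub>tensor_pow C A (Suc k)\<^esub>),
     add = (\<lambda>f g k. f k \<oplus>\<^bsub>tensor_pow C A (Suc k)\<^esub> g k),
     smult = (\<lambda>c f k. c \<odot>\<^bsub>tensor_pow C A (Suc k)\<^esub> f k)\<rparr>"

definition Sh_op ::
  "('c, 'k) ring_scheme \<Rightarrow> ('c, 'a, 'm) module_scheme \<Rightarrow>
   (nat \<Rightarrow> ('a list \<Rightarrow> 'c) set) \<Rightarrow> nat \<Rightarrow> ('a list \<Rightarrow> 'c) set" where
  "Sh_op C A f = (\<lambda>k. case k of
       0 \<Rightarrow> \<zero>\<^bsub>tensor_pow C A 1\<^esub>
     | Suc j \<Rightarrow> tensor_map C A (Suc k) (\<lambda>w. \<one>\<^bsub>A\<^esub> # w) (f j))"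

definition Sh_incl ::
  "('c, 'k) ring_scheme \<Rightarrow> ('c, 'a, 'm) module_scheme \<Rightarrow> 'a \<Rightarrow> nat \<Rightarrow> ('a list \<Rightarrow> 'c) set" where
  "Sh_incl C A a = (\<lambda>k. if k = 0 then pure_tensor C A [a] else \<zero>\<^bsub>tensor_pow C A (Suc k)\<^esub>)"


section \<open>The standard Baxter algebra\<close>

text \<open>\<open>tensor_lift C A m d\<close> maps the \<open>m\<close>-th to the \<open>(m+d)\<close>-th tensor power by
  \<open>x \<mapsto> x \<otimes> 1 \<otimes> \<dots> \<otimes> 1\<close>.\<close>

primrec tensor_lift ::
  "('c, 'k) ring_scheme \<Rightarrow> ('c, 'a, 'm) module_scheme \<Rightarrow> nat \<Rightarrow> nat \<Rightarrow>
   ('a list \<Rightarrow> 'c) set \<Rightarrow> ('a list \<Rightarrow> 'c) set" where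
  "tensor_lift C A m 0 X = X"
| "tensor_lift C A m (Suc d) X =
     tensor_map C A (Suc (m + d)) (\<lambda>w. w @ [\<one>\<^bsub>A\<^esub>]) (tensor_lift C A m d X)"

definition dirlim_rel ::
  "('c, 'k) ring_scheme \<Rightarrow> ('c, 'a, 'm) module_scheme \<Rightarrow>
   ((nat \<times> ('a list \<Rightarrow> 'c) set) \<times> (nat \<times> ('a list \<Rightarrow> 'c) set)) set" where
  "dirlim_rel C A = {((m, X), (n, Y)). 1 \<le> m \<and> 1 \<le> n \<and>
      X \<in> carrier (tensor_pow C A m) \<and> Y \<in> carrier (tensor_pow C A n) \<and>
      (\<exists>k. m \<le> k \<and> n \<le> k \<and> tensor_lift C A m (k - m) X = tensor_lift C A n (k - n) Y)}"

definition dirlim_class ::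
  "('c, 'k) ring_scheme \<Rightarrow> ('c, 'a, 'm) module_scheme \<Rightarrow> nat \<Rightarrow> ('a list \<Rightarrow> 'c) set \<Rightarrow>
   (nat \<times> ('a list \<Rightarrow> 'c) set) set" where
  "dirlim_class C A n X = dirlim_rel C A `` {(n, X)}"

definition dirlim_binop ::
  "('c, 'k) ring_scheme \<Rightarrow> ('c, 'a, 'm) module_scheme \<Rightarrow>
   (nat \<Rightarrow> ('a list \<Rightarrow> 'c) set \<Rightarrow> ('a list \<Rightarrow> 'c) set \<Rightarrow> ('a list \<Rightarrow> 'c) set) \<Rightarrow>
   (nat \<times> ('a list \<Rightarrow> 'c) set) set \<Rightarrow> (nat \<times> ('a list \<Rightarrow> 'c) set) set \<Rightarrow>
   (nat \<times> ('a list \<Rightarrow> 'c) set) set" where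
  "dirlim_binop C A bop X Y = (\<Union>(m, x)\<in>X. \<Union>(n, y)\<in>Y.
     dirlim_class C A (max m n)
       (bop (max m n) (tensor_lift C A m (max m n - m) x) (tensor_lift C A n (max m n - n) y)))"

definition tensor_dirlim ::
  "('c, 'k) ring_scheme \<Rightarrow> ('c, 'a, 'm) module_scheme \<Rightarrow>
   ('c, (nat \<times> ('a list \<Rightarrow> 'c) set) set) module" where
  "tensor_dirlim C A =
    \<lparr>carrier = (SIGMA n:{1..}. carrier (tensor_pow C A n)) // dirlim_rel C A,
     mult = dirlim_binop C A (\<lambda>n. mult (tensor_pow C A n)),
     one = dirlim_class C A 1 \<one>\<^bsub>tensor_pow C A 1\<^esub>,
     zero = dirlim_class C A 1 \<zero>\<^bsub>tensor_pow C A 1\<^esub>,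
     add = dirlim_binop C A (\<lambda>n. add (tensor_pow C A n)),
     smult = (\<lambda>c X. \<Union>(n, x)\<in>X. dirlim_class C A n (c \<odot>\<^bsub>tensor_pow C A n\<^esub> x))\<rparr>"

text \<open>A sequence \<open>(a\<^sub>1, a\<^sub>2, \<dots>)\<close> is represented by the function \<open>s\<close> with \<open>s i\<close> equal to the
  \<open>(i+1)\<close>-st entry.\<close>

definition seq_alg ::
  "('c, 'k) ring_scheme \<Rightarrow> ('c, 'a, 'm) module_scheme \<Rightarrow>
   ('c, nat \<Rightarrow> (nat \<times> ('a list \<Rightarrow> 'c) set) set) module" where
  "seq_alg C A =
    \<lparr>carrier = {s. \<forall>i. s i \<in> carrier (tensor_dirlim C A)},
     mult = (\<lambda>s t i. s i \<otimes>\<^bsub>tensor_dirlim C A\<^esub> t i),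
     one = (\<lambda>i. \<one>\<^bsub>tensor_dirlim C A\<^esub>),
     zero = (\<lambda>i. \<zero>\<^bsub>tensor_dirlim C A\<^esub>),
     add = (\<lambda>s t i. s i \<oplus>\<^bsub>tensor_dirlim C A\<^esub> t i),
     smult = (\<lambda>c s i. c \<odot>\<^bsub>tensor_dirlim C A\<^esub> s i)\<rparr>"

definition seq_op ::
  "('c, 'k) ring_scheme \<Rightarrow> 'c \<Rightarrow> ('c, 'a, 'm) module_scheme \<Rightarrow>
   (nat \<Rightarrow> (nat \<times> ('a list \<Rightarrow> 'c) set) set) \<Rightarrow> nat \<Rightarrow> (nat \<times> ('a list \<Rightarrow> 'c) set) set" where
  "seq_op C l A s = (\<lambda>i. l \<odot>\<^bsub>tensor_dirlim C A\<^esub> (\<Oplus>\<^bsub>tensor_dirlim C A\<^esub>j\<in>{..<i}. s j))"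

definition std_gen ::
  "('c, 'k) ring_scheme \<Rightarrow> ('c, 'a, 'm) module_scheme \<Rightarrow> 'a \<Rightarrow>
   nat \<Rightarrow> (nat \<times> ('a list \<Rightarrow> 'c) set) set" where
  "std_gen C A a = (\<lambda>i. dirlim_class C A (Suc i) (pure_tensor C A (replicate i \<one>\<^bsub>A\<^esub> @ [a])))"

definition std_alg ::
  "('c, 'k) ring_scheme \<Rightarrow> 'c \<Rightarrow> ('c, 'a, 'm) module_scheme \<Rightarrow>
   ('c, nat \<Rightarrow> (nat \<times> ('a list \<Rightarrow> 'c) set) set) module" where
  "std_alg C l A = (seq_alg C A)\<lparr>carrier :=
     gen_baxter_subalgebra C (seq_alg C A) (seq_op C l A) (std_gen C A ` carrier A)\<rparr>"

definition Phi ::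
  "('c, 'k) ring_scheme \<Rightarrow> 'c \<Rightarrow> ('c, 'a, 'm) module_scheme \<Rightarrow>
   (nat \<Rightarrow> ('a list \<Rightarrow> 'c) set) \<Rightarrow> nat \<Rightarrow> (nat \<times> ('a list \<Rightarrow> 'c) set) set" where
  "Phi C l A = (THE f. f \<in> extensional (carrier (Sh C l A)) \<and>
     baxter_hom C l (Sh C l A) (Sh_op C A) (std_alg C l A) (seq_op C l A) f \<and>
     (\<forall>a\<in>carrier A. f (Sh_incl C A a) = std_gen C A a))"

definition seq_fil ::
  "('c, 'k) ring_scheme \<Rightarrow> ('c, 'a, 'm) module_scheme \<Rightarrow> nat \<Rightarrow>
   (nat \<Rightarrow> (nat \<times> ('a list \<Rightarrow> 'c) set) set) set" where
  "seq_fil C A k = {s \<in> carrier (seq_alg C A). \<forall>i<k. s i = \<zero>\<^bsub>tensor_dirlim C A\<^esub>}"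

definition std_fil ::
  "('c, 'k) ring_scheme \<Rightarrow> 'c \<Rightarrow> ('c, 'a, 'm) module_scheme \<Rightarrow> nat \<Rightarrow>
   (nat \<Rightarrow> (nat \<times> ('a list \<Rightarrow> 'c) set) set) set" where
  "std_fil C l A k = carrier (std_alg C l A) \<inter> seq_fil C A k"

text \<open>The carrier below consists of the sequences \<open>s\<close> whose image under the isomorphism
  \<^term>\<open>lim_map (seq_alg C A) (seq_fil C A)\<close> from the algebra of sequences to the inverse limit of its
  quotients comes from the inverse limit of the quotients of \<^term>\<open>std_alg C l A\<close>. As that
  isomorphism respects the operations, the induced structure is the restriction of the
  componentwise one.\<close>

definition std_completion ::
  "('c, 'k) ring_scheme \<Rightarrow> 'c \<Rightarrow> ('c, 'a, 'm) module_scheme \<Rightarrow>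
   ('c, nat \<Rightarrow> (nat \<times> ('a list \<Rightarrow> 'c) set) set) module" where
  "std_completion C l A = (seq_alg C A)\<lparr>carrier := {s \<in> carrier (seq_alg C A).
     lim_map (seq_alg C A) (seq_fil C A) s \<in>
       (\<lambda>X k. coset_map (seq_alg C A) (seq_fil C A k) (\<lambda>x. x) (X k)) `
         carrier (lim_alg (std_alg C l A) (std_fil C l A))}\<rparr>"

definition std_completion_fil ::
  "('c, 'k) ring_scheme \<Rightarrow> 'c \<Rightarrow> ('c, 'a, 'm) module_scheme \<Rightarrow> nat \<Rightarrow>
   (nat \<Rightarrow> (nat \<times> ('a list \<Rightarrow> 'c) set) set) set" where
  "std_completion_fil C l A k = carrier (std_completion C l A) \<inter> seq_fil C A k"

end

(*
  The n-th filtration step of the algebra of sequences consists of the sequences that vanish in the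
  first n entries and take values in the multiples of l^n.  Hence a coherent family of residues has
  eventually constant entries, and these form its only preimage.

  Phi sends a word x_0 ... x_n to the sequence whose k-th entry is l^n times the sum, over all
  k > i_1 > ... > i_n, of the products of x_0, ..., x_n placed at k, i_1, ..., i_n.  The recursion of
  mixable shuffles on the last position makes this multiplicative on the free module of words.  For
  regular l, the words of length k first contribute to the k-th entry, namely l^(k-1) times their
  reversed tensor.  So by induction on the length the kernel consists of exactly the multilinear
  relations.  The shuffle product on tensors is therefore well defined and inherits all identities
  from the algebra of sequences, where they are pointwise.  The k-th filtration step of the shuffle
  algebra, the tensors with more than k factors, corresponds to vanishing of the first k entries, and
  its completion is the closure of the standard algebra.
*)
theory Submission
  imports Defs
begin

section \<open>Quotients, filtrations and inverse limits\<close>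

text \<open>The product of \<open>Sh\<close> is a sum over unions of cosets. A direct proof that it
  respects the multilinear relations and is associative would have to manipulate mixable shuffles of
  tensors. Instead everything happens one level higher, on finitely supported functions on words:
  there shuffles extend bilinearly with nothing to check, and one linear map \<open>Psi\<close> into
  sequences decides all equalities of classes. For this its kernel must not exceed the relations,
  which rests on two injectivity facts: a tensor power embeds in the direct limit, because
  multiplying the last two letters undoes the padding by ones, and powers of \<open>l\<close> cancel
  there.

  In the first claim \<open>l\<close> may be a zero divisor, or even zero, so divisibility by powers
  of \<open>l\<close> has to be carried along with the vanishing of entries, and preimages under the
  operator must be chosen with care. No \<open>l\<close>-adic limit occurs, because every single
  entry becomes stationary.

  In the second claim each completion is compared with its own filtration by kernels of projections,
  so the isomorphism has to match filtrations as well as operations.\<close>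

lemma cring_cong:
  assumes "cring R" and "carrier S = carrier R" and "mult S = mult R" and "one S = one R"
    and "zero S = zero R" and "add S = add R"
  shows "cring S"
proof -
  interpret cring R by fact
  show ?thesis
    by (intro cringI abelian_groupI comm_monoidI)
       (auto simp: assms a_assoc m_assoc l_distr intro: a_comm m_comm l_neg)
qed

text \<open>\<open>coset_map\<close> is a union over representatives; it evaluates to one coset as
  soon as there is a representative and all of them give the same result.\<close>

lemma coset_map_eqI:
  assumes "X \<noteq> {}" and "\<And>y. y \<in> X \<Longrightarrow> J +>\<^bsub>S\<^esub> h y = Z"
  shows "coset_map S J h X = Z"
  using assms by (auto simp: coset_map_def)

lemma (in ideal) rcos_eq_iff:
  "x \<in> carrier R \<Longrightarrow> y \<in> carrier R \<Longrightarrow> I +> x = I +> y \<longleftrightarrow> x \<ominus> y \<in> I"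
  using quotient_eq_iff_same_a_r_cos[OF is_ideal] by blast

lemma (in ideal) mem_rcos_iff:
  "x \<in> carrier R \<Longrightarrow> y \<in> I +> x \<longleftrightarrow> y \<in> carrier R \<and> y \<ominus> x \<in> I"
  using a_rcos_module_minus[OF ring_axioms] a_elemrcos_carrier by blast

lemma (in ideal) rcos_zero: "I +> \<zero> = I"
  by (simp add: a_subset)

lemma (in ideal) rcos_eq_self_iff: "x \<in> carrier R \<Longrightarrow> I +> x = I \<longleftrightarrow> x \<in> I"
  using rcos_eq_iff[of x \<zero>] by (simp add: rcos_zero minus_eq)

text \<open>Representatives differ by an element of \<open>I\<close>, which \<open>h\<close> carries
  into \<open>J\<close>. Only additivity of \<open>h\<close> is asked for, so scalars, Baxter
  operators, transition maps and linear extensions of word maps are all covered.\<close>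

lemma coset_map_coset:
  assumes "ideal I R" and "ideal J S" and x: "x \<in> carrier R"
    and h: "\<And>y. y \<in> carrier R \<Longrightarrow> h y \<in> carrier S"
    and add: "\<And>y z. y \<in> carrier R \<Longrightarrow> z \<in> carrier R \<Longrightarrow> h (y \<oplus>\<^bsub>R\<^esub> z) = h y \<oplus>\<^bsub>S\<^esub> h z"
    and sub: "\<And>y. y \<in> I \<Longrightarrow> h y \<in> J"
  shows "coset_map S J h (I +>\<^bsub>R\<^esub> x) = J +>\<^bsub>S\<^esub> h x"
proof (rule coset_map_eqI)
  interpret I: ideal I R by fact
  interpret J: ideal J S by fact
  show "I +>\<^bsub>R\<^esub> x \<noteq> {}" using I.a_rcos_self[OF x] by auto
  fix y assume "y \<in> I +>\<^bsub>R\<^esub> x"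
  then have y: "y \<in> carrier R" "y \<ominus>\<^bsub>R\<^esub> x \<in> I" using I.mem_rcos_iff[OF x] by auto
  have "y = (y \<ominus>\<^bsub>R\<^esub> x) \<oplus>\<^bsub>R\<^esub> x" using x y by (simp add: I.minus_eq I.a_assoc I.l_neg)
  then have "h y = h (y \<ominus>\<^bsub>R\<^esub> x) \<oplus>\<^bsub>S\<^esub> h x" using x y add by (metis I.a_Hcarr)
  then have "h y \<ominus>\<^bsub>S\<^esub> h x = h (y \<ominus>\<^bsub>R\<^esub> x)"
    using h x y by (simp add: J.minus_eq J.a_assoc J.r_neg)
  then show "J +>\<^bsub>S\<^esub> h y = J +>\<^bsub>S\<^esub> h x"
    using J.rcos_eq_iff h x y sub by metis
qed

context algebra
begin

lemma smult_one_mult: "c \<in> carrier R \<Longrightarrow> x \<in> carrier M \<Longrightarrow> (c \<odot>\<^bsub>M\<^esub> \<one>\<^bsub>M\<^esub>) \<otimes>\<^bsub>M\<^esub> x = c \<odot>\<^bsub>M\<^esub> x"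
  by (simp add: smult_assoc2)

lemma smult_assoc2':
  "c \<in> carrier R \<Longrightarrow> x \<in> carrier M \<Longrightarrow> y \<in> carrier M \<Longrightarrow>
    x \<otimes>\<^bsub>M\<^esub> (c \<odot>\<^bsub>M\<^esub> y) = c \<odot>\<^bsub>M\<^esub> (x \<otimes>\<^bsub>M\<^esub> y)"
  by (metis m_comm smult_assoc2 smult_closed)

lemma smult_neg_one: "x \<in> carrier M \<Longrightarrow> (\<ominus>\<^bsub>R\<^esub> \<one>\<^bsub>R\<^esub>) \<odot>\<^bsub>M\<^esub> x = \<ominus>\<^bsub>M\<^esub> x"
  by (simp add: smult_l_minus)

lemma ideal_smult_closed:
  assumes "ideal I M" and "c \<in> carrier R" and "x \<in> I"
  shows "c \<odot>\<^bsub>M\<^esub> x \<in> I"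
proof -
  interpret I: ideal I M by fact
  show ?thesis
    using assms I.I_l_closed[of x "c \<odot>\<^bsub>M\<^esub> \<one>\<^bsub>M\<^esub>"] by (simp add: smult_one_mult)
qed

text \<open>In a unital ring negation is multiplication by minus one, so closure under
  multiplication by ring elements includes closure under inverses.\<close>

lemma idealI':
  assumes "I \<subseteq> carrier M" and "\<zero>\<^bsub>M\<^esub> \<in> I"
    and "\<And>x y. x \<in> I \<Longrightarrow> y \<in> I \<Longrightarrow> x \<oplus>\<^bsub>M\<^esub> y \<in> I"
    and "\<And>x y. x \<in> I \<Longrightarrow> y \<in> carrier M \<Longrightarrow> y \<otimes>\<^bsub>M\<^esub> x \<in> I"
  shows "ideal I M"
proof (rule idealI)
  show "ring M" using M_cring by (rule cring.axioms)
  show "subgroup I (add_monoid M)"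
  proof (rule M.add.subgroupI)
    fix a assume a: "a \<in> I"
    then have "\<ominus>\<^bsub>M\<^esub> a = (\<ominus>\<^bsub>M\<^esub> \<one>\<^bsub>M\<^esub>) \<otimes>\<^bsub>M\<^esub> a" using assms(1) by (simp add: l_minus subset_eq)
    then show "\<ominus>\<^bsub>M\<^esub> a \<in> I" using a assms(4) by simp
  qed (use assms in auto)
qed (use assms m_comm in \<open>auto simp: subset_eq\<close>)

end

text \<open>Equational axioms can be tested after a jointly injective family of operation-preserving
  maps. This principle yields the algebra of sequences and, through its Baxter version, subalgebras,
  inverse limits and the shuffle algebra.\<close>

lemma algebra_family:
  fixes S :: "'i \<Rightarrow> ('c, 's, 'y) module_scheme" and R :: "('c, 'r, 'x) module_scheme"
  assumes S: "\<And>i. algebra C (S i)"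
    and inj: "\<And>x y. x \<in> carrier R \<Longrightarrow> y \<in> carrier R \<Longrightarrow> (\<And>i. f i x = f i y) \<Longrightarrow> x = y"
    and fc: "\<And>i x. x \<in> carrier R \<Longrightarrow> f i x \<in> carrier (S i)"
    and one: "\<one>\<^bsub>R\<^esub> \<in> carrier R" "\<And>i. f i \<one>\<^bsub>R\<^esub> = \<one>\<^bsub>S i\<^esub>"
    and zero: "\<zero>\<^bsub>R\<^esub> \<in> carrier R" "\<And>i. f i \<zero>\<^bsub>R\<^esub> = \<zero>\<^bsub>S i\<^esub>"
    and add: "\<And>x y. x \<in> carrier R \<Longrightarrow> y \<in> carrier R \<Longrightarrow> x \<oplus>\<^bsub>R\<^esub> y \<in> carrier R"
      "\<And>i x y. x \<in> carrier R \<Longrightarrow> y \<in> carrier R \<Longrightarrow> f i (x \<oplus>\<^bsub>R\<^esub> y) = f i x \<oplus>\<^bsub>S i\<^esub> f i y"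
    and mult: "\<And>x y. x \<in> carrier R \<Longrightarrow> y \<in> carrier R \<Longrightarrow> x \<otimes>\<^bsub>R\<^esub> y \<in> carrier R"
      "\<And>i x y. x \<in> carrier R \<Longrightarrow> y \<in> carrier R \<Longrightarrow> f i (x \<otimes>\<^bsub>R\<^esub> y) = f i x \<otimes>\<^bsub>S i\<^esub> f i y"
    and smult: "\<And>c x. c \<in> carrier C \<Longrightarrow> x \<in> carrier R \<Longrightarrow> c \<odot>\<^bsub>R\<^esub> x \<in> carrier R"
      "\<And>i c x. c \<in> carrier C \<Longrightarrow> x \<in> carrier R \<Longrightarrow> f i (c \<odot>\<^bsub>R\<^esub> x) = c \<odot>\<^bsub>S i\<^esub> f i x"
  shows "algebra C R"
proof -
  interpret S: algebra C "S i" for i by (rule S)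
  note [simp] = fc one zero add mult smult
  \<comment> \<open>The axiom of inverses is existential and cannot simply be pulled back; the
    multiple by minus one is the witness.\<close>
  have neg: "\<exists>y\<in>carrier R. y \<oplus>\<^bsub>R\<^esub> x = \<zero>\<^bsub>R\<^esub>" if "x \<in> carrier R" for x
    using that
    by (intro bexI[of _ "(\<ominus>\<^bsub>C\<^esub> \<one>\<^bsub>C\<^esub>) \<odot>\<^bsub>R\<^esub> x"] inj) (auto simp: S.smult_neg_one S.M.l_neg)
  have "cring R"
  proof (intro cringI abelian_groupI comm_monoidI)
    show "\<exists>y\<in>carrier R. y \<oplus>\<^bsub>R\<^esub> x = \<zero>\<^bsub>R\<^esub>" if "x \<in> carrier R" for x by (rule neg[OF that])
  qed (auto intro!: inj simp: S.M.a_ac S.m_ac S.l_distr S.r_distr)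
  then show ?thesis
    by (intro algebraI S.R_cring)
       (auto intro!: inj simp: S.smult_l_distr S.smult_r_distr S.smult_assoc1 S.smult_assoc2)
qed

lemma baxter_algebraI:
  assumes "algebra C R" and "l \<in> carrier C"
    and "\<And>x. x \<in> carrier R \<Longrightarrow> P x \<in> carrier R"
    and "\<And>x y. x \<in> carrier R \<Longrightarrow> y \<in> carrier R \<Longrightarrow> P (x \<oplus>\<^bsub>R\<^esub> y) = P x \<oplus>\<^bsub>R\<^esub> P y"
    and "\<And>c x. c \<in> carrier C \<Longrightarrow> x \<in> carrier R \<Longrightarrow> P (c \<odot>\<^bsub>R\<^esub> x) = c \<odot>\<^bsub>R\<^esub> P x"
    and "\<And>x y. x \<in> carrier R \<Longrightarrow> y \<in> carrier R \<Longrightarrow> P x \<otimes>\<^bsub>R\<^esub> P y =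
        P (x \<otimes>\<^bsub>R\<^esub> P y) \<oplus>\<^bsub>R\<^esub> P (y \<otimes>\<^bsub>R\<^esub> P x) \<oplus>\<^bsub>R\<^esub> l \<odot>\<^bsub>R\<^esub> P (x \<otimes>\<^bsub>R\<^esub> y)"
  shows "baxter_algebra C l R P"
  using assms by (auto simp: baxter_algebra_def)

lemma baxter_algebraD:
  assumes "baxter_algebra C l R P"
  shows "algebra C R" and "l \<in> carrier C"
    and "\<And>x. x \<in> carrier R \<Longrightarrow> P x \<in> carrier R"
    and "\<And>x y. x \<in> carrier R \<Longrightarrow> y \<in> carrier R \<Longrightarrow> P (x \<oplus>\<^bsub>R\<^esub> y) = P x \<oplus>\<^bsub>R\<^esub> P y"
    and "\<And>c x. c \<in> carrier C \<Longrightarrow> x \<in> carrier R \<Longrightarrow> P (c \<odot>\<^bsub>R\<^esub> x) = c \<odot>\<^bsub>R\<^esub> P x"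
    and "\<And>x y. x \<in> carrier R \<Longrightarrow> y \<in> carrier R \<Longrightarrow> P x \<otimes>\<^bsub>R\<^esub> P y =
        P (x \<otimes>\<^bsub>R\<^esub> P y) \<oplus>\<^bsub>R\<^esub> P (y \<otimes>\<^bsub>R\<^esub> P x) \<oplus>\<^bsub>R\<^esub> l \<odot>\<^bsub>R\<^esub> P (x \<otimes>\<^bsub>R\<^esub> y)"
  using assms by (auto simp: baxter_algebra_def)

text \<open>The Baxter identity is one more equation to be tested through the maps
  \<open>f i\<close>. The index type is \<open>nat\<close> for an inverse limit and
  \<open>unit\<close> for a single embedding.\<close>

lemma baxter_family:
  fixes S :: "'i \<Rightarrow> ('c, 's, 'y) module_scheme" and R :: "('c, 'r, 'x) module_scheme"
  assumes S: "\<And>i. baxter_algebra C l (S i) (Q i)"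
    and inj: "\<And>x y. x \<in> carrier R \<Longrightarrow> y \<in> carrier R \<Longrightarrow> (\<And>i. f i x = f i y) \<Longrightarrow> x = y"
    and fc: "\<And>i x. x \<in> carrier R \<Longrightarrow> f i x \<in> carrier (S i)"
    and one: "\<one>\<^bsub>R\<^esub> \<in> carrier R" "\<And>i. f i \<one>\<^bsub>R\<^esub> = \<one>\<^bsub>S i\<^esub>"
    and zero: "\<zero>\<^bsub>R\<^esub> \<in> carrier R" "\<And>i. f i \<zero>\<^bsub>R\<^esub> = \<zero>\<^bsub>S i\<^esub>"
    and add: "\<And>x y. x \<in> carrier R \<Longrightarrow> y \<in> carrier R \<Longrightarrow> x \<oplus>\<^bsub>R\<^esub> y \<in> carrier R"
      "\<And>i x y. x \<in> carrier R \<Longrightarrow> y \<in> carrier R \<Longrightarrow> f i (x \<oplus>\<^bsub>R\<^esub> y) = f i x \<oplus>\<^bsub>S i\<^esub> f i y"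
    and mult: "\<And>x y. x \<in> carrier R \<Longrightarrow> y \<in> carrier R \<Longrightarrow> x \<otimes>\<^bsub>R\<^esub> y \<in> carrier R"
      "\<And>i x y. x \<in> carrier R \<Longrightarrow> y \<in> carrier R \<Longrightarrow> f i (x \<otimes>\<^bsub>R\<^esub> y) = f i x \<otimes>\<^bsub>S i\<^esub> f i y"
    and smult: "\<And>c x. c \<in> carrier C \<Longrightarrow> x \<in> carrier R \<Longrightarrow> c \<odot>\<^bsub>R\<^esub> x \<in> carrier R"
      "\<And>i c x. c \<in> carrier C \<Longrightarrow> x \<in> carrier R \<Longrightarrow> f i (c \<odot>\<^bsub>R\<^esub> x) = c \<odot>\<^bsub>S i\<^esub> f i x"
    and P: "\<And>x. x \<in> carrier R \<Longrightarrow> P x \<in> carrier R"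
      "\<And>i x. x \<in> carrier R \<Longrightarrow> f i (P x) = Q i (f i x)"
  shows "baxter_algebra C l R P"
proof -
  note D = baxter_algebraD[OF S]
  note [simp] = fc one zero add mult smult P D(2-5)
  have "algebra C R"
    by (rule algebra_family[of C S R f]) (use D(1) inj in auto)
  then show ?thesis
    by (intro baxter_algebraI D(2)) (auto intro!: inj simp: D(6))
qed

lemma baxter_subalgebra_baxter:
  assumes "baxter_algebra C l R P" and S: "baxter_subalgebra C R P S"
  shows "baxter_algebra C l (R\<lparr>carrier := S\<rparr>) P"
proof -
  note D = baxter_algebraD[OF assms(1)]
  interpret R: algebra C R by (rule D(1))
  note S' = S[unfolded baxter_subalgebra_def]
  note sub = subringE[OF conjunct1[OF S']]
  show ?thesis
    by (rule baxter_family[where S = "\<lambda>i::unit. R" and Q = "\<lambda>i. P" and f = "\<lambda>i x. x"])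
       (use assms(1) S' sub in auto)
qed

section \<open>Quotients of algebras by ideals\<close>

lemma quot_alg_simps:
  fixes R :: "('c, 'r, 'x) module_scheme" (structure)
  assumes "ideal I R"
  shows "carrier (quot_alg R I) = (\<lambda>x. I +> x) ` carrier R"
    and "zero (quot_alg R I) = I"
    and "one (quot_alg R I) = I +> \<one>"
    and "x \<in> carrier R \<Longrightarrow> y \<in> carrier R \<Longrightarrow> add (quot_alg R I) (I +> x) (I +> y) = I +> (x \<oplus> y)"
    and "x \<in> carrier R \<Longrightarrow> y \<in> carrier R \<Longrightarrow> mult (quot_alg R I) (I +> x) (I +> y) = I +> (x \<otimes> y)"
proof -
  interpret ideal I R by fact
  show "carrier (quot_alg R I) = (\<lambda>x. I +> x) ` carrier R" "zero (quot_alg R I) = I"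
    "one (quot_alg R I) = I +> \<one>"
    "x \<in> carrier R \<Longrightarrow> y \<in> carrier R \<Longrightarrow> add (quot_alg R I) (I +> x) (I +> y) = I +> (x \<oplus> y)"
    "x \<in> carrier R \<Longrightarrow> y \<in> carrier R \<Longrightarrow> mult (quot_alg R I) (I +> x) (I +> y) = I +> (x \<otimes> y)"
    by (auto simp: quot_alg_def FactRing_def A_RCOSETS_def' a_rcos_sum rcoset_mult_add)
qed

lemma quot_alg_smult:
  assumes "algebra C R" and "ideal I R" and "c \<in> carrier C" and "x \<in> carrier R"
  shows "c \<odot>\<^bsub>quot_alg R I\<^esub> (I +>\<^bsub>R\<^esub> x) = I +>\<^bsub>R\<^esub> (c \<odot>\<^bsub>R\<^esub> x)"
proof -
  interpret algebra C R by fact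
  show ?thesis
    using assms by (simp add: quot_alg_def) (rule coset_map_coset,
      auto simp: smult_r_distr ideal_smult_closed)
qed

lemma quot_alg_algebra:
  assumes "algebra C R" and "ideal I R"
  shows "algebra C (quot_alg R I)"
proof -
  interpret algebra C R by fact
  interpret I: ideal I R by fact
  have "cring (quot_alg R I)"
    by (rule cring_cong[OF I.quotient_is_cring[OF M_cring]]) (simp_all add: quot_alg_def FactRing_def)
  then show ?thesis
    by (intro algebraI R_cring)
       (auto simp: quot_alg_simps[OF assms(2)] quot_alg_smult[OF assms] smult_l_distr smult_r_distr
         smult_assoc1 smult_assoc2)
qed

section \<open>Filtrations by Baxter ideals and their inverse limits\<close>

locale filtered_baxter =
  fixes C :: "('c, 'k) ring_scheme" and l :: 'c and R :: "('c, 'r, 'x) module_scheme"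
    and P :: "'r \<Rightarrow> 'r" and F :: "nat \<Rightarrow> 'r set"
  assumes baxter: "baxter_algebra C l R P"
    and fil_0: "F 0 = carrier R"
    and fil_ideal: "ideal (F n) R"
    and fil_Suc: "F (Suc n) \<subseteq> F n"
    and fil_op: "P ` F n \<subseteq> F (Suc n)"
begin

lemmas baxterD = baxter_algebraD[OF baxter]

sublocale R: algebra C R by (rule baxterD)

sublocale F: ideal "F n" R for n by (rule fil_ideal)

lemma fil_antimono: "m \<le> n \<Longrightarrow> F n \<subseteq> F m"
  by (rule lift_Suc_antimono_le[of F, OF fil_Suc])

lemma fil_baxter_ideal: "baxter_ideal R P (F n)"
  using fil_ideal fil_op[of n] fil_Suc[of n] by (auto simp: baxter_ideal_def)

text \<open>The Baxter filtration is the smallest filtration of this kind: by induction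
  \<open>F (Suc n)\<close> is a Baxter ideal that contains the generators of the next term.\<close>

lemma baxter_fil_subset: "baxter_fil R P n \<subseteq> F n"
proof (induction n)
  case 0
  then show ?case by (simp add: fil_0)
next
  case (Suc n)
  then have "P ` baxter_fil R P n \<subseteq> F (Suc n)" using fil_op[of n] by blast
  then show ?case using fil_baxter_ideal by (auto simp: gen_baxter_ideal_def)
qed

text \<open>The first term of the Baxter filtration lies in \<open>F 1\<close>, so it is enough that
  the unit avoids this larger, explicitly known ideal.\<close>

lemma proper:
  assumes "\<one>\<^bsub>R\<^esub> \<notin> F 1"
  shows "baxter_proper R P"
  using assms baxter_fil_subset[of 1] R.one_closed unfolding baxter_proper_def by blast

lemma lim_step:
  "x \<in> carrier R \<Longrightarrow> coset_map R (F n) (\<lambda>x. x) (F (Suc n) +>\<^bsub>R\<^esub> x) = F n +>\<^bsub>R\<^esub> x"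
  by (rule coset_map_coset[OF fil_ideal fil_ideal]) (use fil_Suc in auto)

lemma lim_op_coset:
  "x \<in> carrier R \<Longrightarrow> coset_map R (F n) P (F n +>\<^bsub>R\<^esub> x) = F n +>\<^bsub>R\<^esub> P x"
  by (rule coset_map_coset[OF fil_ideal fil_ideal]) (use fil_baxter_ideal baxterD in \<open>auto simp: baxter_ideal_def\<close>)

text \<open>A coherent family of cosets is a Cauchy sequence of representatives. Choosing
  representatives level by level replaces the transition maps by membership of consecutive
  differences.\<close>

lemma lim_carrierE:
  assumes "X \<in> carrier (lim_alg R F)"
  obtains x where "\<And>n. x n \<in> carrier R" and "\<And>n. X n = F n +>\<^bsub>R\<^esub> x n"
    and "\<And>n. x (Suc n) \<ominus>\<^bsub>R\<^esub> x n \<in> F n"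
proof -
  have "\<forall>n. \<exists>x. x \<in> carrier R \<and> X n = F n +>\<^bsub>R\<^esub> x"
    using assms quot_alg_simps(1)[OF fil_ideal] by (simp add: lim_alg_def) blast
  then obtain x where x: "x n \<in> carrier R" "X n = F n +>\<^bsub>R\<^esub> x n" for n by metis
  moreover have "coset_map R (F n) (\<lambda>x. x) (X (Suc n)) = X n" for n
    using assms by (auto simp: lim_alg_def)
  ultimately have "F n +>\<^bsub>R\<^esub> x (Suc n) = F n +>\<^bsub>R\<^esub> x n" for n by (metis lim_step)
  then have "x (Suc n) \<ominus>\<^bsub>R\<^esub> x n \<in> F n" for n using x F.rcos_eq_iff by metis
  with x show ?thesis using that by blast
qed

lemma lim_carrierI:
  assumes "\<And>n. x n \<in> carrier R" and "\<And>n. x (Suc n) \<ominus>\<^bsub>R\<^esub> x n \<in> F n"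
  shows "(\<lambda>n. F n +>\<^bsub>R\<^esub> x n) \<in> carrier (lim_alg R F)"
  using assms by (auto simp: lim_alg_def quot_alg_simps[OF fil_ideal] lim_step F.rcos_eq_iff)

text \<open>The cosets of a coherent family shrink as the level grows, so a representative taken at
  a deep level is valid at all earlier ones. Computations at two levels can share one
  element.\<close>

lemma lim_carrier_le:
  assumes X: "X \<in> carrier (lim_alg R F)" and "m \<le> n" and "x \<in> X n"
  shows "x \<in> X m" and "x \<in> carrier R" and "X m = F m +>\<^bsub>R\<^esub> x"
proof -
  obtain y where y: "\<And>n. y n \<in> carrier R" "\<And>n. X n = F n +>\<^bsub>R\<^esub> y n"
    "\<And>n. y (Suc n) \<ominus>\<^bsub>R\<^esub> y n \<in> F n" using lim_carrierE[OF X] by blast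
  show x: "x \<in> carrier R" using assms(3) y(1,2) F.mem_rcos_iff by blast
  have sub: "X (Suc k) \<subseteq> X k" for k
  proof
    fix z assume "z \<in> X (Suc k)"
    then have z: "z \<in> carrier R" "z \<ominus>\<^bsub>R\<^esub> y (Suc k) \<in> F k"
      using y F.mem_rcos_iff fil_Suc by (auto simp: subset_eq)
    then have "F k +>\<^bsub>R\<^esub> z = F k +>\<^bsub>R\<^esub> y k" using y F.rcos_eq_iff by metis
    then show "z \<in> X k" using F.a_rcos_self[OF z(1)] y(2) by auto
  qed
  then have "X n \<subseteq> X m" using \<open>m \<le> n\<close> by (rule lift_Suc_antimono_le[of X])
  then show "x \<in> X m" using assms(3) by blast
  then show "X m = F m +>\<^bsub>R\<^esub> x" using x y F.mem_rcos_iff F.rcos_eq_iff by metis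
qed

lemma lim_nonempty: "X \<in> carrier (lim_alg R F) \<Longrightarrow> \<exists>x. x \<in> X n"
  by (metis lim_carrierE F.a_rcos_self)

lemma lim_simps:
  shows "zero (lim_alg R F) = F"
    and "one (lim_alg R F) = (\<lambda>n. F n +>\<^bsub>R\<^esub> \<one>\<^bsub>R\<^esub>)"
  by (auto simp: lim_alg_def quot_alg_simps[OF fil_ideal])

lemma lim_mem_closed:
  assumes X: "X \<in> carrier (lim_alg R F)" and Y: "Y \<in> carrier (lim_alg R F)"
    and x: "x \<in> X n" and y: "y \<in> Y n"
  shows "(X \<oplus>\<^bsub>lim_alg R F\<^esub> Y) n = F n +>\<^bsub>R\<^esub> (x \<oplus>\<^bsub>R\<^esub> y)"
    and "(X \<otimes>\<^bsub>lim_alg R F\<^esub> Y) n = F n +>\<^bsub>R\<^esub> (x \<otimes>\<^bsub>R\<^esub> y)"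
    and "c \<in> carrier C \<Longrightarrow> (c \<odot>\<^bsub>lim_alg R F\<^esub> X) n = F n +>\<^bsub>R\<^esub> (c \<odot>\<^bsub>R\<^esub> x)"
    and "lim_op R F P X n = F n +>\<^bsub>R\<^esub> P x"
proof -
  note x' = lim_carrier_le(2,3)[OF X order.refl x] and y' = lim_carrier_le(2,3)[OF Y order.refl y]
  show "(X \<oplus>\<^bsub>lim_alg R F\<^esub> Y) n = F n +>\<^bsub>R\<^esub> (x \<oplus>\<^bsub>R\<^esub> y)"
    "(X \<otimes>\<^bsub>lim_alg R F\<^esub> Y) n = F n +>\<^bsub>R\<^esub> (x \<otimes>\<^bsub>R\<^esub> y)"
    using x' y' by (simp_all add: lim_alg_def quot_alg_simps[OF fil_ideal])
  show "(c \<odot>\<^bsub>lim_alg R F\<^esub> X) n = F n +>\<^bsub>R\<^esub> (c \<odot>\<^bsub>R\<^esub> x)" if "c \<in> carrier C"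
    using x' that by (simp add: lim_alg_def quot_alg_smult[OF R.algebra_axioms fil_ideal])
  show "lim_op R F P X n = F n +>\<^bsub>R\<^esub> P x"
    using x' by (simp add: lim_op_def lim_op_coset)
qed

lemma lim_closed:
  shows "zero (lim_alg R F) \<in> carrier (lim_alg R F)"
    and "one (lim_alg R F) \<in> carrier (lim_alg R F)"
    and "X \<in> carrier (lim_alg R F) \<Longrightarrow> Y \<in> carrier (lim_alg R F) \<Longrightarrow>
      X \<oplus>\<^bsub>lim_alg R F\<^esub> Y \<in> carrier (lim_alg R F)"
    and "X \<in> carrier (lim_alg R F) \<Longrightarrow> Y \<in> carrier (lim_alg R F) \<Longrightarrow>
      X \<otimes>\<^bsub>lim_alg R F\<^esub> Y \<in> carrier (lim_alg R F)"
    and "c \<in> carrier C \<Longrightarrow> X \<in> carrier (lim_alg R F) \<Longrightarrow> c \<odot>\<^bsub>lim_alg R F\<^esub> X \<in> carrier (lim_alg R F)"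
    and "X \<in> carrier (lim_alg R F) \<Longrightarrow> lim_op R F P X \<in> carrier (lim_alg R F)"
proof -
  \<comment> \<open>Coherence compares neighbouring levels only, so one element representing both
    suffices. For each operation it is computed from representatives of the operands at the deeper
    of the two levels.\<close>
  have I: "Z \<in> carrier (lim_alg R F)"
    if "\<And>n. \<exists>x\<in>carrier R. Z n = F n +>\<^bsub>R\<^esub> x \<and> Z (Suc n) = F (Suc n) +>\<^bsub>R\<^esub> x" for Z
  proof -
    have "Z n \<in> carrier (quot_alg R (F n)) \<and> coset_map R (F n) (\<lambda>x. x) (Z (Suc n)) = Z n" for n
      using that[of n] by (auto simp: quot_alg_simps[OF fil_ideal] lim_step)
    then show ?thesis by (simp add: lim_alg_def)
  qed
  note le = lim_carrier_le and n = lim_nonempty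
  show "zero (lim_alg R F) \<in> carrier (lim_alg R F)"
    by (rule I) (auto simp: lim_simps intro!: bexI[of _ "\<zero>\<^bsub>R\<^esub>"] F.rcos_zero[symmetric])
  show "one (lim_alg R F) \<in> carrier (lim_alg R F)"
    by (rule I) (auto simp: lim_simps)
  show "X \<oplus>\<^bsub>lim_alg R F\<^esub> Y \<in> carrier (lim_alg R F)" "X \<otimes>\<^bsub>lim_alg R F\<^esub> Y \<in> carrier (lim_alg R F)"
    if XY: "X \<in> carrier (lim_alg R F)" "Y \<in> carrier (lim_alg R F)"
  proof (rule_tac [!] I)
    fix k
    obtain x y where "x \<in> X (Suc k)" "y \<in> Y (Suc k)" using n XY by meson
    moreover from this have "x \<in> X k" "y \<in> Y k" "x \<in> carrier R" "y \<in> carrier R"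
      using le XY by (meson le_SucI order.refl)+
    ultimately show "\<exists>x\<in>carrier R. (X \<oplus>\<^bsub>lim_alg R F\<^esub> Y) k = F k +>\<^bsub>R\<^esub> x \<and>
        (X \<oplus>\<^bsub>lim_alg R F\<^esub> Y) (Suc k) = F (Suc k) +>\<^bsub>R\<^esub> x"
      "\<exists>x\<in>carrier R. (X \<otimes>\<^bsub>lim_alg R F\<^esub> Y) k = F k +>\<^bsub>R\<^esub> x \<and>
        (X \<otimes>\<^bsub>lim_alg R F\<^esub> Y) (Suc k) = F (Suc k) +>\<^bsub>R\<^esub> x"
      using lim_mem_closed[OF XY] by (meson R.M.a_closed R.m_closed)+
  qed
  show "lim_op R F P X \<in> carrier (lim_alg R F)" if X: "X \<in> carrier (lim_alg R F)"
  proof (rule I)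
    fix k
    obtain x where "x \<in> X (Suc k)" using n X by meson
    moreover from this have "x \<in> X k" "x \<in> carrier R" using le X by (meson le_SucI order.refl)+
    ultimately show "\<exists>x\<in>carrier R. lim_op R F P X k = F k +>\<^bsub>R\<^esub> x \<and>
        lim_op R F P X (Suc k) = F (Suc k) +>\<^bsub>R\<^esub> x"
      using lim_mem_closed(4)[OF X X] baxterD(3) by meson
  qed
  show "c \<odot>\<^bsub>lim_alg R F\<^esub> X \<in> carrier (lim_alg R F)"
    if c: "c \<in> carrier C" and X: "X \<in> carrier (lim_alg R F)"
  proof (rule I)
    fix k
    obtain x where "x \<in> X (Suc k)" using n X by meson
    moreover from this have "x \<in> X k" "x \<in> carrier R" using le X by (meson le_SucI order.refl)+
    ultimately show "\<exists>x\<in>carrier R. (c \<odot>\<^bsub>lim_alg R F\<^esub> X) k = F k +>\<^bsub>R\<^esub> x \<and>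
        (c \<odot>\<^bsub>lim_alg R F\<^esub> X) (Suc k) = F (Suc k) +>\<^bsub>R\<^esub> x"
      using lim_mem_closed(3)[OF X X _ _ c] R.smult_closed[OF c] by meson
  qed
qed

lemma quot_baxter: "baxter_algebra C l (quot_alg R (F n)) (coset_map R (F n) P)"
proof (rule baxter_algebraI)
  show "algebra C (quot_alg R (F n))" by (rule quot_alg_algebra[OF R.algebra_axioms fil_ideal])
qed (auto simp: quot_alg_simps[OF fil_ideal] lim_op_coset quot_alg_smult[OF R.algebra_axioms fil_ideal] baxterD)

lemma lim_component:
  "zero (lim_alg R F) n = zero (quot_alg R (F n))"
  "one (lim_alg R F) n = one (quot_alg R (F n))"
  "(X \<oplus>\<^bsub>lim_alg R F\<^esub> Y) n = X n \<oplus>\<^bsub>quot_alg R (F n)\<^esub> Y n"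
  "(X \<otimes>\<^bsub>lim_alg R F\<^esub> Y) n = X n \<otimes>\<^bsub>quot_alg R (F n)\<^esub> Y n"
  "(c \<odot>\<^bsub>lim_alg R F\<^esub> X) n = c \<odot>\<^bsub>quot_alg R (F n)\<^esub> X n"
  "lim_op R F P X n = coset_map R (F n) P (X n)"
  "X \<in> carrier (lim_alg R F) \<Longrightarrow> X n \<in> carrier (quot_alg R (F n))"
  by (auto simp: lim_alg_def lim_op_def)

text \<open>The projections to the quotients are jointly injective, and each quotient is a Baxter
  algebra.\<close>

lemma lim_baxter: "baxter_algebra C l (lim_alg R F) (lim_op R F P)"
  by (rule baxter_family[where f = "\<lambda>n X. X n", OF quot_baxter])
     (simp_all add: fun_eq_iff lim_closed lim_component)

lemma lim_map_closed: "x \<in> carrier R \<Longrightarrow> lim_map R F x \<in> carrier (lim_alg R F)"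
  unfolding lim_map_def by (rule lim_carrierI) (auto simp: R.M.r_neg R.M.minus_eq)

lemma lim_map_apply: "lim_map R F x n = F n +>\<^bsub>R\<^esub> x"
  by (simp add: lim_map_def)

lemma lim_map_hom: "baxter_hom C l R P (lim_alg R F) (lim_op R F P) (lim_map R F)"
  unfolding baxter_hom_def
  by (intro conjI ballI ring_hom_memI baxter lim_baxter)
     (simp_all add: fun_eq_iff lim_map_closed lim_component lim_map_apply lim_op_coset
      quot_alg_simps[OF fil_ideal] quot_alg_smult[OF R.algebra_axioms fil_ideal])

text \<open>Separation makes the kernel trivial. For surjectivity only Cauchy sequences whose
  \<open>n\<close>-th step lies in \<open>F n\<close> need a limit, as every coherent family has
  representatives of that kind.\<close>

lemma lim_map_iso:
  assumes sep: "\<And>x. x \<in> carrier R \<Longrightarrow> (\<And>n. x \<in> F n) \<Longrightarrow> x = \<zero>\<^bsub>R\<^esub>"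
    and lim: "\<And>x. (\<And>n. x n \<in> carrier R) \<Longrightarrow> (\<And>n. x (Suc n) \<ominus>\<^bsub>R\<^esub> x n \<in> F n) \<Longrightarrow>
      \<exists>y\<in>carrier R. \<forall>n. y \<ominus>\<^bsub>R\<^esub> x n \<in> F n"
  shows "baxter_iso C l R P (lim_alg R F) (lim_op R F P) (lim_map R F)"
  unfolding baxter_iso_def bij_betw_def
proof (intro conjI lim_map_hom inj_onI equalityI subsetI)
  fix x y assume x: "x \<in> carrier R" and y: "y \<in> carrier R" and eq: "lim_map R F x = lim_map R F y"
  have "x \<ominus>\<^bsub>R\<^esub> y \<in> F n" for n
    using F.rcos_eq_iff[OF x y] fun_cong[OF eq] by (simp add: lim_map_def)
  then have "x \<ominus>\<^bsub>R\<^esub> y = \<zero>\<^bsub>R\<^esub>" using sep[of "x \<ominus>\<^bsub>R\<^esub> y"] x y by blast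
  then show "x = y" using x y by simp
next
  fix X assume "X \<in> lim_map R F ` carrier R"
  then show "X \<in> carrier (lim_alg R F)"
    using lim_map_hom by (auto simp: baxter_hom_def ring_hom_closed)
next
  fix X assume "X \<in> carrier (lim_alg R F)"
  then obtain x where x: "\<And>n. x n \<in> carrier R" "\<And>n. X n = F n +>\<^bsub>R\<^esub> x n"
    "\<And>n. x (Suc n) \<ominus>\<^bsub>R\<^esub> x n \<in> F n" using lim_carrierE by blast
  then obtain y where y: "y \<in> carrier R" "\<And>n. y \<ominus>\<^bsub>R\<^esub> x n \<in> F n" using lim by meson
  then have "X n = lim_map R F y n" for n
    using x(1)[of n] x(2)[of n] F.rcos_eq_iff[of y "x n" n] by (simp add: lim_map_apply)
  then have "X = lim_map R F y" by (rule ext)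
  then show "X \<in> lim_map R F ` carrier R" using y by blast
qed

lemma complete_filteredI:
  assumes "baxter_proper R P"
    and "\<And>x. x \<in> carrier R \<Longrightarrow> (\<And>n. x \<in> F n) \<Longrightarrow> x = \<zero>\<^bsub>R\<^esub>"
    and "\<And>x. (\<And>n. x n \<in> carrier R) \<Longrightarrow> (\<And>n. x (Suc n) \<ominus>\<^bsub>R\<^esub> x n \<in> F n) \<Longrightarrow>
      \<exists>y\<in>carrier R. \<forall>n. y \<ominus>\<^bsub>R\<^esub> x n \<in> F n"
  shows "complete_filtered_baxter C l R P F"
  unfolding complete_filtered_baxter_def
proof (intro conjI allI fil_0 fil_baxter_ideal fil_Suc fil_op lim_map_iso)
qed (use assms in blast)+

lemma lim_minus_mem_fil:
  assumes X: "X \<in> carrier (lim_alg R F)" and Y: "Y \<in> carrier (lim_alg R F)"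
  shows "X \<ominus>\<^bsub>lim_alg R F\<^esub> Y \<in> lim_fil R F k \<longleftrightarrow> X k = Y k"
proof -
  interpret L: algebra C "lim_alg R F" using lim_baxter by (rule baxter_algebraD)
  obtain x y where x: "x \<in> X k" and y: "y \<in> Y k" using lim_nonempty X Y by meson
  note x' = lim_carrier_le(2,3)[OF X order.refl x] and y' = lim_carrier_le(2,3)[OF Y order.refl y]
  \<comment> \<open>Formulas on representatives are available for scalar multiplication but not for
    negation in the limit, so the inverse of \<open>Y\<close> is taken as its multiple by minus
    one.\<close>
  define Z where "Z = (\<ominus>\<^bsub>C\<^esub> \<one>\<^bsub>C\<^esub>) \<odot>\<^bsub>lim_alg R F\<^esub> Y"
  have Z: "Z \<in> carrier (lim_alg R F)" "\<ominus>\<^bsub>lim_alg R F\<^esub> Y = Z" using Y by (auto simp: Z_def L.smult_neg_one)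
  have Zk: "Z k = F k +>\<^bsub>R\<^esub> (\<ominus>\<^bsub>R\<^esub> y)"
    using lim_mem_closed(3)[OF Y Y y y, of "\<ominus>\<^bsub>C\<^esub> \<one>\<^bsub>C\<^esub>"] y' by (simp add: Z_def R.smult_neg_one)
  then have "\<ominus>\<^bsub>R\<^esub> y \<in> Z k" using F.a_rcos_self y' by simp
  then have "(X \<ominus>\<^bsub>lim_alg R F\<^esub> Y) k = F k +>\<^bsub>R\<^esub> (x \<ominus>\<^bsub>R\<^esub> y)"
    using lim_mem_closed(1)[OF X Z(1) x] by (simp add: L.M.minus_eq Z(2) R.M.minus_eq)
  moreover have "X \<ominus>\<^bsub>lim_alg R F\<^esub> Y \<in> carrier (lim_alg R F)" using X Y by simp
  ultimately show ?thesis
    using x' y' by (simp add: lim_fil_def quot_alg_simps[OF fil_ideal] F.rcos_eq_self_iff F.rcos_eq_iff)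
qed

text \<open>The limit with the kernels of its projections meets the locale assumptions again, so the
  criteria for properness and completeness apply to it too.\<close>

lemma lim_filtered: "filtered_baxter C l (lim_alg R F) (lim_op R F P) (lim_fil R F)"
proof -
  interpret L: algebra C "lim_alg R F" using lim_baxter by (rule baxter_algebraD)
  note q = quot_alg_simps[OF fil_ideal]
  show ?thesis
  proof (rule filtered_baxter.intro)
    have "X 0 = F 0" if X: "X \<in> carrier (lim_alg R F)" for X
    proof -
      obtain x where "x \<in> X 0" using lim_nonempty X by meson
      with lim_carrier_le(2,3)[OF X order.refl this] show ?thesis
        by (simp add: F.rcos_eq_self_iff, simp add: fil_0)
    qed
    then show "lim_fil R F 0 = carrier (lim_alg R F)" by (auto simp: lim_fil_def q)
    show "ideal (lim_fil R F n) (lim_alg R F)" for n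
    proof (rule L.idealI')
      fix X Y assume X: "X \<in> lim_fil R F n" and Y: "Y \<in> lim_fil R F n"
      then have X': "X \<in> carrier (lim_alg R F)" "X n = F n" and Y': "Y \<in> carrier (lim_alg R F)" "Y n = F n"
        by (auto simp: lim_fil_def q)
      then have "(X \<oplus>\<^bsub>lim_alg R F\<^esub> Y) n = F n"
        using lim_mem_closed(1)[OF X'(1) Y'(1), of "\<zero>\<^bsub>R\<^esub>" n "\<zero>\<^bsub>R\<^esub>"] by (simp add: F.rcos_zero)
      then show "X \<oplus>\<^bsub>lim_alg R F\<^esub> Y \<in> lim_fil R F n"
        using X' Y' by (simp add: lim_fil_def q)
    next
      fix X Y assume X: "X \<in> lim_fil R F n" and Y: "Y \<in> carrier (lim_alg R F)"
      then have X': "X \<in> carrier (lim_alg R F)" "X n = F n" by (auto simp: lim_fil_def q)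
      obtain y where y: "y \<in> Y n" using lim_nonempty Y by meson
      then have "y \<in> carrier R" using lim_carrier_le Y by blast
      then have "(Y \<otimes>\<^bsub>lim_alg R F\<^esub> X) n = F n"
        using lim_mem_closed(2)[OF Y X'(1) y, of "\<zero>\<^bsub>R\<^esub>"] X' by (simp add: F.rcos_zero)
      then show "Y \<otimes>\<^bsub>lim_alg R F\<^esub> X \<in> lim_fil R F n"
        using X' Y by (simp add: lim_fil_def q)
    next
      show "\<zero>\<^bsub>lim_alg R F\<^esub> \<in> lim_fil R F n"
        using lim_closed(1) by (simp add: lim_fil_def lim_simps(1) q)
    qed (auto simp: lim_fil_def)
    show "lim_fil R F (Suc n) \<subseteq> lim_fil R F n" for n
    proof
      fix X assume "X \<in> lim_fil R F (Suc n)"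
      then have X: "X \<in> carrier (lim_alg R F)" "X (Suc n) = F (Suc n)" by (auto simp: lim_fil_def q)
      have "X n = F n +>\<^bsub>R\<^esub> \<zero>\<^bsub>R\<^esub>" by (rule lim_carrier_le(3)[of _ _ "Suc n"]) (use X in auto)
      then show "X \<in> lim_fil R F n" using X by (simp add: lim_fil_def q F.rcos_zero)
    qed
    show "lim_op R F P ` lim_fil R F n \<subseteq> lim_fil R F (Suc n)" for n
    proof clarify
      fix X assume "X \<in> lim_fil R F n"
      then have X: "X \<in> carrier (lim_alg R F)" "X n = F n" by (auto simp: lim_fil_def q)
      \<comment> \<open>To gain a level, the representative is taken one level deeper: it already
        lies in \<open>F n\<close>, hence \<open>P\<close> sends it into
        \<open>F (Suc n)\<close>.\<close>
      then obtain x where x: "x \<in> X (Suc n)" using lim_nonempty by meson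
      then have "x \<in> F n" using lim_carrier_le(1)[OF X(1), of n "Suc n"] X by simp
      then have "P x \<in> F (Suc n)" using fil_op by blast
      then have "lim_op R F P X (Suc n) = F (Suc n)"
        using lim_mem_closed(4)[OF X(1) X(1) x x] F.rcos_eq_self_iff by auto
      then show "lim_op R F P X \<in> lim_fil R F (Suc n)"
        using X by (simp add: lim_fil_def q lim_closed)
    qed
  qed (rule lim_baxter)
qed

lemma lim_complete_filtered:
  assumes "\<one>\<^bsub>R\<^esub> \<notin> F 1"
  shows "complete_filtered_baxter C l (lim_alg R F) (lim_op R F P) (lim_fil R F)"
proof -
  note q = quot_alg_simps[OF fil_ideal]
  note L = lim_filtered
  show ?thesis
  proof (rule filtered_baxter.complete_filteredI[OF L])
    show "baxter_proper (lim_alg R F) (lim_op R F P)"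
      by (rule filtered_baxter.proper[OF L]) (use assms in \<open>auto simp: lim_fil_def q lim_simps(2) F.rcos_eq_self_iff\<close>)
    show "X = \<zero>\<^bsub>lim_alg R F\<^esub>" if "\<And>n. X \<in> lim_fil R F n" for X
      using that by (auto simp: lim_simps(1) lim_fil_def q)
    fix X assume X: "\<And>n. X n \<in> carrier (lim_alg R F)"
      and "\<And>n. X (Suc n) \<ominus>\<^bsub>lim_alg R F\<^esub> X n \<in> lim_fil R F n"
    then have eq: "X (Suc n) n = X n n" for n by (simp add: lim_minus_mem_fil)
    \<comment> \<open>The limit is the diagonal. Passing from \<open>X n\<close> to
      \<open>X (Suc n)\<close> does not change level \<open>n\<close>, which is also what makes the
      diagonal coherent.\<close>
    define Y where "Y n = X n n" for n
    have "Y n \<in> carrier (quot_alg R (F n))" for n using X by (simp add: Y_def lim_component)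
    moreover have "coset_map R (F n) (\<lambda>x. x) (Y (Suc n)) = Y n" for n
      using X[of "Suc n"] eq[of n] by (simp add: lim_alg_def Y_def)
    ultimately have Y: "Y \<in> carrier (lim_alg R F)" by (simp add: lim_alg_def)
    then show "\<exists>Y\<in>carrier (lim_alg R F). \<forall>n. Y \<ominus>\<^bsub>lim_alg R F\<^esub> X n \<in> lim_fil R F n"
      using X by (intro bexI[of _ Y]) (simp_all add: lim_minus_mem_fil, simp add: Y_def)
  qed
qed

end

text \<open>Each term is closed under \<open>P\<close>, so it contains the generators of the next
  term and hence the next term itself.\<close>

lemma baxter_fil_filtered:
  assumes "baxter_algebra C l R P"
  shows "filtered_baxter C l R P (baxter_fil R P)"
proof -
  note D = baxter_algebraD[OF assms]
  interpret algebra C R by (rule D(1))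
  have carrier: "baxter_ideal R P (carrier R)"
    using D(3) by (auto simp: baxter_ideal_def intro!: idealI')
  have gen: "baxter_ideal R P (gen_baxter_ideal R P U)" if "U \<subseteq> carrier R" for U
    unfolding baxter_ideal_def
  proof
    let ?S = "{I. baxter_ideal R P I \<and> U \<subseteq> I}"
    have i: "ideal I R" if "I \<in> ?S" for I using that by (simp add: baxter_ideal_def)
    \<comment> \<open>An intersection over no ideals would be the whole type; the carrier keeps the
      family inhabited.\<close>
    have "?S \<noteq> {}" using carrier that by blast
    then show "ideal (gen_baxter_ideal R P U) R"
      unfolding gen_baxter_ideal_def using i_Intersect[of ?S] i by auto
    show "P ` gen_baxter_ideal R P U \<subseteq> gen_baxter_ideal R P U"
      by (auto simp: gen_baxter_ideal_def baxter_ideal_def)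
  qed
  have I: "baxter_ideal R P (baxter_fil R P n)" for n
  proof (induction n)
    case (Suc n)
    have "baxter_fil R P n \<subseteq> carrier R"
      using Suc by (auto simp: baxter_ideal_def dest: ideal.Icarr)
    then show ?case using gen D(3) by (simp add: image_subset_iff subset_eq)
  qed (use carrier in simp)
  have op: "P ` baxter_fil R P n \<subseteq> baxter_fil R P (Suc n)" for n
    by (auto simp: gen_baxter_ideal_def)
  show ?thesis
  proof (rule filtered_baxter.intro)
    show "baxter_fil R P (Suc n) \<subseteq> baxter_fil R P n" for n
      using I[of n] by (auto simp: gen_baxter_ideal_def baxter_ideal_def)
  qed (use I op assms in \<open>auto simp: baxter_ideal_def simp del: baxter_fil.simps(2)\<close>)
qed

section \<open>Mixable shuffles\<close>

lemma shuffle_perms_last: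
  assumes s: "\<sigma> \<in> shuffle_perms m n" and "m + n \<ge> 1"
  shows "\<sigma> (m + n) = m + n \<and> n \<ge> 1 \<or> \<sigma> (m + n) = m \<and> m \<ge> 1"
proof -
  have p: "\<sigma> permutes {1..m+n}" and m1: "strict_mono_on {1..m} (inv_into UNIV \<sigma>)"
    and m2: "strict_mono_on {m+1..m+n} (inv_into UNIV \<sigma>)" using s by (auto simp: shuffle_perms_def)
  define v where "v = \<sigma> (m + n)"
  have v: "v \<in> {1..m+n}" using permutes_in_image[OF p, of "m+n"] assms(2) by (simp add: v_def)
  have iv: "inv_into UNIV \<sigma> v = m + n" by (simp add: v_def permutes_inverses(2)[OF p])
  have le: "inv_into UNIV \<sigma> w \<le> m + n" if "w \<in> {1..m+n}" for w
    using permutes_in_image[OF permutes_inv[OF p], of w] that by simp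
  show ?thesis
  proof (cases "v \<le> m")
    case True
    \<comment> \<open>\<open>v\<close> occupies the last position, and a larger value of the same
      block would have to stand to its right.\<close>
    have "\<not> v < m"
    proof
      assume "v < m"
      then show False using strict_mono_onD[OF m1, of v m] le[of m] v iv by simp
    qed
    then show ?thesis using True v by (simp add: v_def)
  next
    case False
    have "\<not> v < m + n"
    proof
      assume "v < m + n"
      then show False using strict_mono_onD[OF m2, of v "m+n"] le[of "m+n"] v iv False by simp
    qed
    then show ?thesis using False v by (simp add: v_def)
  qed
qed

text \<open>A letter appended to the right word carries the largest label of all. No value has to be
  renamed, and the same function describes both shuffles.\<close>

lemma shuffle_perms_Suc_right:
  "\<sigma> \<in> shuffle_perms m n \<longleftrightarrow> \<sigma> \<in> shuffle_perms m (Suc n) \<and> \<sigma> (Suc (m + n)) = Suc (m + n)"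
proof
  assume s: "\<sigma> \<in> shuffle_perms m n"
  then have p: "\<sigma> permutes {1..m+n}" and m1: "strict_mono_on {1..m} (inv_into UNIV \<sigma>)"
    and m2: "strict_mono_on {m+1..m+n} (inv_into UNIV \<sigma>)" by (auto simp: shuffle_perms_def)
  have fix1: "\<sigma> (Suc (m + n)) = Suc (m + n)" using permutes_not_in[OF p] by simp
  have fix2: "inv_into UNIV \<sigma> (Suc (m + n)) = Suc (m + n)" using permutes_not_in[OF permutes_inv[OF p]] by simp
  have "\<sigma> permutes {1..m+Suc n}" by (rule permutes_subset[OF p]) auto
  moreover have "strict_mono_on {m+1..m+Suc n} (inv_into UNIV \<sigma>)"
  proof (rule strict_mono_onI)
    fix a b assume a: "a \<in> {m+1..m+Suc n}" and b: "b \<in> {m+1..m+Suc n}" and ab: "a < b"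
    show "inv_into UNIV \<sigma> a < inv_into UNIV \<sigma> b"
    proof (cases "b = Suc (m + n)")
      case True
      then have "a \<in> {1..m+n}" using a ab by auto
      then have "inv_into UNIV \<sigma> a \<in> {1..m+n}" using permutes_in_image[OF permutes_inv[OF p]] by blast
      then show ?thesis using True fix2 by simp
    next
      case False
      then show ?thesis using strict_mono_onD[OF m2, of a b] a b ab by auto
    qed
  qed
  ultimately show "\<sigma> \<in> shuffle_perms m (Suc n) \<and> \<sigma> (Suc (m + n)) = Suc (m + n)"
    using m1 fix1 by (simp add: shuffle_perms_def)
next
  assume "\<sigma> \<in> shuffle_perms m (Suc n) \<and> \<sigma> (Suc (m + n)) = Suc (m + n)"
  then have p: "\<sigma> permutes {1..m+Suc n}" and m1: "strict_mono_on {1..m} (inv_into UNIV \<sigma>)"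
    and m2: "strict_mono_on {m+1..m+Suc n} (inv_into UNIV \<sigma>)" and l: "\<sigma> (Suc (m + n)) = Suc (m + n)"
    by (auto simp: shuffle_perms_def)
  have "\<sigma> permutes {1..m+n}"
    by (rule permutes_superset[OF p]) (use l in \<open>auto simp: le_Suc_eq\<close>)
  moreover have "strict_mono_on {m+1..m+n} (inv_into UNIV \<sigma>)"
    using m2 by (simp add: strict_mono_on_def)
  ultimately show "\<sigma> \<in> shuffle_perms m n" using m1 by (simp add: shuffle_perms_def)
qed

text \<open>Relabelling the values after the insertion of a new last letter into the left word.\<close>

definition left_cycle :: "nat \<Rightarrow> nat \<Rightarrow> nat \<Rightarrow> nat" where
  "left_cycle m n v = (if v = Suc (m + n) then Suc m else if m < v \<and> v \<le> m + n then Suc v else v)"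

definition left_cycle_inv :: "nat \<Rightarrow> nat \<Rightarrow> nat \<Rightarrow> nat" where
  "left_cycle_inv m n v =
    (if v = Suc m then Suc (m + n) else if Suc m < v \<and> v \<le> Suc (m + n) then v - 1 else v)"

lemma left_cycle_inverse:
  "left_cycle m n (left_cycle_inv m n v) = v" "left_cycle_inv m n (left_cycle m n v) = v"
  by (auto simp: left_cycle_def left_cycle_inv_def)

lemma left_cycle_permutes: "left_cycle m n permutes {1..Suc (m + n)}"
proof (rule bij_imp_permutes)
  show "bij_betw (left_cycle m n) {1..Suc (m + n)} {1..Suc (m + n)}"
    by (rule bij_betw_byWitness[where f' = "left_cycle_inv m n"])
       (auto simp: left_cycle_inverse, auto simp: left_cycle_def left_cycle_inv_def split: if_splits)
qed (auto simp: left_cycle_def)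

lemma inv_left_cycle: "inv_into UNIV (left_cycle m n) = left_cycle_inv m n"
  by (rule inv_equality) (auto simp: left_cycle_inverse)

text \<open>A letter appended to the left word gets the label \<open>Suc m\<close>, which pushes up
  the labels of the right word. Composing with the cycle on the left renames values only; positions,
  and hence the order of the old letters, stay.\<close>

lemma shuffle_perms_Suc_left:
  "\<sigma> \<in> shuffle_perms m n \<longleftrightarrow>
    left_cycle m n \<circ> \<sigma> \<in> shuffle_perms (Suc m) n \<and> \<sigma> (Suc (m + n)) = Suc (m + n)"
proof
  assume s: "\<sigma> \<in> shuffle_perms m n"
  then have p: "\<sigma> permutes {1..m+n}" and m1: "strict_mono_on {1..m} (inv_into UNIV \<sigma>)"
    and m2: "strict_mono_on {m+1..m+n} (inv_into UNIV \<sigma>)" by (auto simp: shuffle_perms_def)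
  have fix1: "\<sigma> (Suc (m + n)) = Suc (m + n)" using permutes_not_in[OF p] by simp
  have fix2: "inv_into UNIV \<sigma> (Suc (m + n)) = Suc (m + n)" using permutes_not_in[OF permutes_inv[OF p]] by simp
  have p': "\<sigma> permutes {1..Suc (m+n)}" by (rule permutes_subset[OF p]) auto
  have inv: "inv_into UNIV (left_cycle m n \<circ> \<sigma>) = inv_into UNIV \<sigma> \<circ> left_cycle_inv m n"
    using o_inv_distrib[of "left_cycle m n" \<sigma>] permutes_bij[OF p] permutes_bij[OF left_cycle_permutes]
    by (simp add: inv_left_cycle)
  have "left_cycle m n \<circ> \<sigma> permutes {1..Suc m + n}"
    using permutes_compose[OF p' left_cycle_permutes] by simp
  moreover have "strict_mono_on {1..Suc m} (inv_into UNIV (left_cycle m n \<circ> \<sigma>))"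
    unfolding inv
  proof (rule strict_mono_onI)
    fix a b assume a: "a \<in> {1..Suc m}" and b: "b \<in> {1..Suc m}" and ab: "a < b"
    show "(inv_into UNIV \<sigma> \<circ> left_cycle_inv m n) a < (inv_into UNIV \<sigma> \<circ> left_cycle_inv m n) b"
    proof (cases "b = Suc m")
      case True
      then have "a \<in> {1..m+n}" using a ab by auto
      then have "inv_into UNIV \<sigma> a \<in> {1..m+n}" using permutes_in_image[OF permutes_inv[OF p]] by blast
      then show ?thesis using True fix2 ab by (simp add: left_cycle_inv_def)
    next
      case False
      then show ?thesis using strict_mono_onD[OF m1, of a b] a b ab by (auto simp: left_cycle_inv_def)
    qed
  qed
  moreover have "strict_mono_on {Suc m+1..Suc m+n} (inv_into UNIV (left_cycle m n \<circ> \<sigma>))"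
    unfolding inv
  proof (rule strict_mono_onI)
    fix a b assume "a \<in> {Suc m+1..Suc m+n}" "b \<in> {Suc m+1..Suc m+n}" "a < b"
    then show "(inv_into UNIV \<sigma> \<circ> left_cycle_inv m n) a < (inv_into UNIV \<sigma> \<circ> left_cycle_inv m n) b"
      using strict_mono_onD[OF m2, of "a - 1" "b - 1"] by (auto simp: left_cycle_inv_def)
  qed
  ultimately show "left_cycle m n \<circ> \<sigma> \<in> shuffle_perms (Suc m) n \<and> \<sigma> (Suc (m + n)) = Suc (m + n)"
    using fix1 by (simp add: shuffle_perms_def)
next
  let ?t = "left_cycle m n \<circ> \<sigma>"
  assume "?t \<in> shuffle_perms (Suc m) n \<and> \<sigma> (Suc (m + n)) = Suc (m + n)"
  then have p: "?t permutes {1..Suc m+n}" and m1: "strict_mono_on {1..Suc m} (inv_into UNIV ?t)"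
    and m2: "strict_mono_on {Suc m+1..Suc m+n} (inv_into UNIV ?t)" and l: "\<sigma> (Suc (m + n)) = Suc (m + n)"
    by (auto simp: shuffle_perms_def)
  have s: "\<sigma> = left_cycle_inv m n \<circ> ?t" by (simp add: fun_eq_iff left_cycle_inverse)
  have pi: "left_cycle_inv m n permutes {1..Suc (m + n)}"
    using permutes_inv[OF left_cycle_permutes] by (simp add: inv_left_cycle)
  have p1: "\<sigma> permutes {1..Suc (m + n)}"
    by (subst s) (use permutes_compose[OF p[simplified] pi[simplified]] in simp)
  have p2: "\<sigma> permutes {1..m + n}"
    by (rule permutes_superset[OF p1]) (use l in \<open>auto simp: le_Suc_eq\<close>)
  have inv: "inv_into UNIV ?t = inv_into UNIV \<sigma> \<circ> left_cycle_inv m n"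
    using o_inv_distrib[of "left_cycle m n" \<sigma>] permutes_bij[OF p2] permutes_bij[OF left_cycle_permutes]
    by (simp add: inv_left_cycle)
  have e1: "inv_into UNIV \<sigma> a = inv_into UNIV ?t a" if "a \<le> m" for a using that by (simp add: inv left_cycle_inv_def)
  have e2: "inv_into UNIV \<sigma> a = inv_into UNIV ?t (Suc a)" if "m < a" "a \<le> m + n" for a
    using that by (simp add: inv left_cycle_inv_def)
  have "strict_mono_on {1..m} (inv_into UNIV \<sigma>)"
  proof (rule strict_mono_onI)
    fix a b assume "a \<in> {1..m}" "b \<in> {1..m}" "a < b"
    then show "inv_into UNIV \<sigma> a < inv_into UNIV \<sigma> b" using strict_mono_onD[OF m1, of a b] by (simp add: e1)
  qed
  moreover have "strict_mono_on {m+1..m+n} (inv_into UNIV \<sigma>)"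
  proof (rule strict_mono_onI)
    fix a b assume "a \<in> {m+1..m+n}" "b \<in> {m+1..m+n}" "a < b"
    then show "inv_into UNIV \<sigma> a < inv_into UNIV \<sigma> b" using strict_mono_onD[OF m2, of "Suc a" "Suc b"] by (simp add: e2)
  qed
  ultimately show "\<sigma> \<in> shuffle_perms m n" using p2 by (simp add: shuffle_perms_def)
qed

lemma shuffle_perms_Suc_leftE:
  assumes t: "\<tau> \<in> shuffle_perms (Suc m) n" and l: "\<tau> (Suc (m + n)) = Suc m"
  obtains \<sigma> where "\<sigma> \<in> shuffle_perms m n" and "\<tau> = left_cycle m n \<circ> \<sigma>"
proof
  show e: "\<tau> = left_cycle m n \<circ> (left_cycle_inv m n \<circ> \<tau>)" by (simp add: fun_eq_iff left_cycle_inverse)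
  show "left_cycle_inv m n \<circ> \<tau> \<in> shuffle_perms m n"
    using t l e by (subst shuffle_perms_Suc_left) (simp add: left_cycle_inv_def)
qed

lemma left_cycle_last:
  "\<sigma> \<in> shuffle_perms m n \<Longrightarrow> (left_cycle m n \<circ> \<sigma>) (Suc (m + n)) = Suc m"
  by (subst (asm) shuffle_perms_Suc_left) (simp add: left_cycle_def)

lemma shuffle_perms_range:
  "\<sigma> \<in> shuffle_perms m n \<Longrightarrow> 1 \<le> k \<Longrightarrow> k \<le> m + n \<Longrightarrow> 1 \<le> \<sigma> k \<and> \<sigma> k \<le> m + n"
  using permutes_in_image[of \<sigma> "{1..m+n}" k] by (simp add: shuffle_perms_def)

text \<open>The only possible new pair is the final one. It is admissible exactly when the letter
  before the end comes from the left word, and then this is the last letter of that word.\<close>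

lemma admissible_Suc_right:
  assumes "\<sigma> \<in> shuffle_perms (Suc m) n"
  shows "admissible_pairs (Suc m) (Suc n) \<sigma> = admissible_pairs (Suc m) n \<sigma> \<union>
    (if \<sigma> (Suc (m + n)) = Suc m then {(Suc (m + n), Suc (Suc (m + n)))} else {})"
proof -
  have "\<sigma> (Suc (Suc (m + n))) = Suc (Suc (m + n))"
    using assms by (subst (asm) shuffle_perms_Suc_right) simp
  moreover have "\<sigma> (Suc (m + n)) \<le> Suc m \<longleftrightarrow> \<sigma> (Suc (m + n)) = Suc m"
    using shuffle_perms_last[OF assms] by auto
  ultimately show ?thesis by (auto simp: admissible_pairs_def less_Suc_eq)
qed

text \<open>A pair has its letter of the left word first, so such a letter placed at the very end
  cannot complete one.\<close>

lemma admissible_Suc_left: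
  assumes s: "\<sigma> \<in> shuffle_perms m n"
  shows "admissible_pairs (Suc m) n (left_cycle m n \<circ> \<sigma>) = admissible_pairs m n \<sigma>"
proof -
  let ?t = "left_cycle m n \<circ> \<sigma>"
  have last: "?t (Suc (m + n)) = Suc m" using left_cycle_last[OF s] .
  have 1: "?t k \<le> Suc m \<longleftrightarrow> \<sigma> k \<le> m" if "1 \<le> k" "k \<le> m + n" for k
    using shuffle_perms_range[OF s that] by (auto simp: left_cycle_def)
  have "1 \<le> k \<and> k < Suc m + n \<and> ?t k \<le> Suc m \<and> Suc m < ?t (k + 1) \<longleftrightarrow>
    1 \<le> k \<and> k < m + n \<and> \<sigma> k \<le> m \<and> m < \<sigma> (k + 1)" for k
  proof (cases "1 \<le> k \<and> k < m + n")
    case True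
    then show ?thesis using 1[of k] 1[of "k + 1"] by auto
  next
    case False
    then show ?thesis using last by (cases "k = m + n") auto
  qed
  then show ?thesis unfolding admissible_pairs_def by auto
qed

lemma admissible_pairs_less: "(k, j) \<in> admissible_pairs m n \<sigma> \<Longrightarrow> 1 \<le> k \<and> k < m + n \<and> j = Suc k"
  by (auto simp: admissible_pairs_def)

abbreviation insert_left :: "nat \<Rightarrow> nat \<Rightarrow> (nat \<Rightarrow> nat) \<times> (nat \<times> nat) set \<Rightarrow> _" where
  "insert_left m n p \<equiv> (left_cycle m n \<circ> fst p, snd p)"

abbreviation insert_both :: "nat \<Rightarrow> nat \<Rightarrow> (nat \<Rightarrow> nat) \<times> (nat \<times> nat) set \<Rightarrow> _" where
  "insert_both m n p \<equiv>
    (left_cycle m n \<circ> fst p, insert (Suc (m + n), Suc (Suc (m + n))) (snd p))"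

text \<open>The three parts are distinguished by the last position: it holds the last letter of the right
  word, that of the left word, or the product of both.\<close>

lemma mixable_shuffles_Suc:
  "mixable_shuffles (Suc m) (Suc n) = mixable_shuffles (Suc m) n \<union>
    insert_left m (Suc n) ` mixable_shuffles m (Suc n) \<union> insert_both m n ` mixable_shuffles m n"
    (is "?L = ?A \<union> ?B \<union> ?D")
proof (intro equalityI subsetI)
  fix p assume p: "p \<in> ?L"
  obtain \<sigma> T where p_eq: "p = (\<sigma>, T)" by (cases p)
  have s: "\<sigma> \<in> shuffle_perms (Suc m) (Suc n)" and T: "T \<subseteq> admissible_pairs (Suc m) (Suc n) \<sigma>"
    using p by (auto simp: mixable_shuffles_def p_eq)
  consider "\<sigma> (Suc (Suc (m + n))) = Suc (Suc (m + n))" | "\<sigma> (Suc (Suc (m + n))) = Suc m"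
    using shuffle_perms_last[OF s] by auto
  then show "p \<in> ?A \<union> ?B \<union> ?D"
  proof cases
    case 1
    then have s': "\<sigma> \<in> shuffle_perms (Suc m) n"
      using s by (subst shuffle_perms_Suc_right) simp
    note adm = admissible_Suc_right[OF s']
    show ?thesis
    proof (cases "(Suc (m + n), Suc (Suc (m + n))) \<in> T")
      case False
      then have "T \<subseteq> admissible_pairs (Suc m) n \<sigma>" using T adm by (auto split: if_splits)
      then show ?thesis using s' by (simp add: p_eq mixable_shuffles_def)
    next
      case True
      \<comment> \<open>A contracted final pair consists of the last letters of both words, so both
        can be removed at once.\<close>
      then have "\<sigma> (Suc (m + n)) \<le> Suc m" using T by (auto simp: admissible_pairs_def)
      then have "\<sigma> (Suc (m + n)) = Suc m" using shuffle_perms_last[OF s'] by auto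
      then obtain \<rho> where r: "\<rho> \<in> shuffle_perms m n" "\<sigma> = left_cycle m n \<circ> \<rho>"
        using shuffle_perms_Suc_leftE[OF s'] by blast
      let ?T = "T - {(Suc (m + n), Suc (Suc (m + n)))}"
      have "?T \<subseteq> admissible_pairs m n \<rho>"
        using T adm admissible_Suc_left[OF r(1)] by (auto simp: r(2) split: if_splits)
      then have "(\<rho>, ?T) \<in> mixable_shuffles m n" using r by (simp add: mixable_shuffles_def)
      moreover have "p = insert_both m n (\<rho>, ?T)" using True r by (auto simp: p_eq)
      ultimately show ?thesis by blast
    qed
  next
    case 2
    then obtain \<rho> where r: "\<rho> \<in> shuffle_perms m (Suc n)" "\<sigma> = left_cycle m (Suc n) \<circ> \<rho>"
      using shuffle_perms_Suc_leftE[OF s] by auto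
    then have "(\<rho>, T) \<in> mixable_shuffles m (Suc n)"
      using T admissible_Suc_left[OF r(1)] by (simp add: mixable_shuffles_def)
    moreover have "p = insert_left m (Suc n) (\<rho>, T)" using r by (simp add: p_eq)
    ultimately show ?thesis by blast
  qed
next
  fix p assume "p \<in> ?A \<union> ?B \<union> ?D"
  then consider "p \<in> ?A" | "p \<in> ?B" | "p \<in> ?D" by blast
  then show "p \<in> ?L"
  proof cases
    case 1
    then show ?thesis
      using admissible_Suc_right shuffle_perms_Suc_right[of _ "Suc m" n]
      by (fastforce simp: mixable_shuffles_def)
  next
    case 2
    then obtain \<rho> T where r: "\<rho> \<in> shuffle_perms m (Suc n)" "T \<subseteq> admissible_pairs m (Suc n) \<rho>"
      "p = (left_cycle m (Suc n) \<circ> \<rho>, T)" by (auto simp: mixable_shuffles_def)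
    then show ?thesis
      using admissible_Suc_left[OF r(1)] shuffle_perms_Suc_left[of \<rho> m "Suc n"]
      by (simp add: mixable_shuffles_def)
  next
    case 3
    then obtain \<rho> T where r: "\<rho> \<in> shuffle_perms m n" "T \<subseteq> admissible_pairs m n \<rho>"
      "p = (left_cycle m n \<circ> \<rho>, insert (Suc (m + n), Suc (Suc (m + n))) T)"
      by (auto simp: mixable_shuffles_def)
    have t: "left_cycle m n \<circ> \<rho> \<in> shuffle_perms (Suc m) n" using shuffle_perms_Suc_left r(1) by blast
    then have "left_cycle m n \<circ> \<rho> \<in> shuffle_perms (Suc m) (Suc n)"
      by (subst (asm) shuffle_perms_Suc_right) simp
    then show ?thesis
      using r admissible_Suc_left[OF r(1)] admissible_Suc_right[OF t] left_cycle_last[OF r(1)]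
      by (auto simp: mixable_shuffles_def)
  qed
qed

lemma finite_mixable_shuffles: "finite (mixable_shuffles m n)"
proof (rule finite_subset)
  show "mixable_shuffles m n \<subseteq> {\<sigma>. \<sigma> permutes {1..m+n}} \<times> Pow ({..m+n} \<times> {..m+n})"
    by (force simp: mixable_shuffles_def shuffle_perms_def admissible_pairs_def)
qed (simp add: finite_permutations)

text \<open>With one word empty the order is forced, and a pair would need a letter of each
  word.\<close>

lemma mixable_shuffles_0:
  "mixable_shuffles 0 n = {(id, {})}" "mixable_shuffles m 0 = {(id, {})}"
proof -
  have id: "id \<in> shuffle_perms m n" if "m = 0 \<or> n = 0" for m n
    using that by (auto simp: shuffle_perms_def permutes_id strict_mono_on_def)
  have "\<sigma> = id" if "\<sigma> \<in> shuffle_perms 0 n" for \<sigma>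
    using that
  proof (induction n)
    case 0
    then show ?case by (simp add: shuffle_perms_def)
  next
    case (Suc n)
    then show ?case using shuffle_perms_last[OF Suc.prems] shuffle_perms_Suc_right[of \<sigma> 0 n] by simp
  qed
  then have 1: "shuffle_perms 0 n = {id}" using id[of 0 n] by blast
  have "\<sigma> = id" if "\<sigma> \<in> shuffle_perms m 0" for \<sigma>
    using that
  proof (induction m arbitrary: \<sigma>)
    case 0
    then show ?case by (simp add: shuffle_perms_def)
  next
    case (Suc m)
    have "\<sigma> (Suc (m + 0)) = Suc m" using shuffle_perms_last[OF Suc.prems] by auto
    then obtain \<rho> where r: "\<rho> \<in> shuffle_perms m 0" "\<sigma> = left_cycle m 0 \<circ> \<rho>"
      using shuffle_perms_Suc_leftE[OF Suc.prems] by blast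
    then show ?case using Suc.IH[OF r(1)] by (simp add: r(2) fun_eq_iff left_cycle_def)
  qed
  then have 2: "shuffle_perms m 0 = {id}" using id[of m 0] by blast
  have "admissible_pairs 0 n id = {}" "admissible_pairs m 0 id = {}"
    by (auto simp: admissible_pairs_def)
  then show "mixable_shuffles 0 n = {(id, {})}" "mixable_shuffles m 0 = {(id, {})}"
    by (auto simp: mixable_shuffles_def 1 2)
qed

text \<open>No pair of \<open>T\<close> begins at the last position or right after it. So a letter
  appended later is not contracted by the old \<open>T\<close>, and inserting the new final pair
  raises the cardinality by exactly one.\<close>

lemma mixable_shuffle_snd:
  assumes "p \<in> mixable_shuffles m n"
  shows "finite (snd p)" and "(Suc (m + n), j) \<notin> snd p" and "(m + n, j) \<notin> snd p"
proof -
  have s: "snd p \<subseteq> admissible_pairs m n (fst p)" using assms by (auto simp: mixable_shuffles_def)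
  have "admissible_pairs m n (fst p) \<subseteq> {..m+n} \<times> {..m+n}" by (auto simp: admissible_pairs_def)
  then show "finite (snd p)" using s by (meson finite_SigmaI finite_atMost finite_subset subset_trans)
  show "(Suc (m + n), j) \<notin> snd p" "(m + n, j) \<notin> snd p"
    using s by (auto dest!: subsetD admissible_pairs_less)
qed

context abelian_monoid
begin

text \<open>The value in the last position separates the second part from the other two, and
  membership of the final pair separates those. The insertions are injective because the cycle and
  the fresh pair can be removed again.\<close>

lemma finsum_mixable_Suc:
  assumes g: "\<And>p. p \<in> mixable_shuffles (Suc m) (Suc n) \<Longrightarrow> g p \<in> carrier G"
  shows "finsum G g (mixable_shuffles (Suc m) (Suc n)) =
    finsum G g (mixable_shuffles (Suc m) n) \<oplus>
    finsum G (\<lambda>p. g (insert_left m (Suc n) p)) (mixable_shuffles m (Suc n)) \<oplus>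
    finsum G (\<lambda>p. g (insert_both m n p)) (mixable_shuffles m n)"
proof -
  let ?A = "mixable_shuffles (Suc m) n" and ?B = "insert_left m (Suc n) ` mixable_shuffles m (Suc n)"
    and ?D = "insert_both m n ` mixable_shuffles m n"
  have inj_c: "left_cycle m n \<circ> \<sigma> = left_cycle m n \<circ> \<tau> \<Longrightarrow> \<sigma> = \<tau>" for m n \<sigma> \<tau>
    by (auto simp: fun_eq_iff) (metis left_cycle_inverse(2))
  have iB: "inj_on (insert_left m (Suc n)) (mixable_shuffles m (Suc n))"
    by (auto intro!: inj_onI dest!: inj_c prod_eqI)
  have iD: "inj_on (insert_both m n) (mixable_shuffles m n)"
  proof (rule inj_onI)
    fix p q assume p: "p \<in> mixable_shuffles m n" and q: "q \<in> mixable_shuffles m n"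
      and e: "insert_both m n p = insert_both m n q"
    have "snd p = snd q"
      using e mixable_shuffle_snd(2)[OF p] mixable_shuffle_snd(2)[OF q] by (metis insert_ident prod.inject)
    then show "p = q" using e by (auto dest!: inj_c prod_eqI)
  qed
  have A: "fst p (Suc (Suc (m + n))) = Suc (Suc (m + n)) \<and> (Suc (m + n), Suc (Suc (m + n))) \<notin> snd p"
    if "p \<in> ?A" for p
    using that mixable_shuffle_snd(3)[OF that] shuffle_perms_Suc_right[of "fst p" "Suc m" n]
    by (auto simp: mixable_shuffles_def)
  have B: "fst p (Suc (Suc (m + n))) = Suc m" if "p \<in> ?B" for p
    using that left_cycle_last[of _ m "Suc n"] by (auto simp: mixable_shuffles_def)
  have D: "fst p (Suc (Suc (m + n))) = Suc (Suc (m + n)) \<and> (Suc (m + n), Suc (Suc (m + n))) \<in> snd p"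
    if pD: "p \<in> ?D" for p
  proof -
    obtain q where q: "q \<in> mixable_shuffles m n" "p = insert_both m n q" using pD by blast
    then have "fst q \<in> shuffle_perms m n" by (auto simp: mixable_shuffles_def)
    then have "left_cycle m n \<circ> fst q \<in> shuffle_perms (Suc m) n"
      using shuffle_perms_Suc_left[of "fst q" m n] by simp
    then show ?thesis using shuffle_perms_Suc_right[of "left_cycle m n \<circ> fst q" "Suc m" n] q(2) by simp
  qed
  have "False" if "p \<in> ?A" "p \<in> ?B" for p using A[OF that(1)] B[OF that(2)] by simp
  moreover have "False" if "p \<in> ?A" "p \<in> ?D" for p using A[OF that(1)] D[OF that(2)] by blast
  moreover have "False" if "p \<in> ?B" "p \<in> ?D" for p using B[OF that(1)] D[OF that(2)] by simp
  ultimately have disj: "?A \<inter> ?B = {}" "(?A \<union> ?B) \<inter> ?D = {}" by blast+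
  have gc: "g \<in> ?A \<rightarrow> carrier G" "g \<in> ?B \<rightarrow> carrier G" "g \<in> ?D \<rightarrow> carrier G"
    using g mixable_shuffles_Suc[of m n] by blast+
  have "finsum G g (mixable_shuffles (Suc m) (Suc n)) = finsum G g (?A \<union> ?B) \<oplus> finsum G g ?D"
    unfolding mixable_shuffles_Suc
    by (rule finsum_Un_disjoint) (use disj gc in \<open>auto simp: finite_mixable_shuffles\<close>)
  also have "finsum G g (?A \<union> ?B) = finsum G g ?A \<oplus> finsum G g ?B"
    by (rule finsum_Un_disjoint) (use disj gc in \<open>auto simp: finite_mixable_shuffles\<close>)
  finally show ?thesis using finsum_reindex[OF gc(2) iB] finsum_reindex[OF gc(3) iD] by (simp only:)
qed

end

section \<open>Words obtained by contracting a shuffle\<close>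

lemma contract_word_cong:
  assumes "\<And>k. 1 \<le> k \<Longrightarrow> k \<le> N \<Longrightarrow> z k = z' k"
    and "\<And>k. k < N \<Longrightarrow> (k, Suc k) \<in> T \<longleftrightarrow> (k, Suc k) \<in> T'"
  shows "contract_word A z T N = contract_word A z' T' N"
  using assms by (induction N) (auto simp: Let_def)

lemma contract_word_empty: "contract_word A z {} N = map z [1..<Suc N]"
  by (induction N) auto

lemma shuffle_word_Nil: "shuffle_word A [] y id {} = y" "shuffle_word A x [] id {} = x"
  by (rule nth_equalityI; simp add: shuffle_word_def contract_word_empty del: upt_Suc)+

text \<open>The earlier positions hold labels up to \<open>length x + length y\<close> and never
  reach the new letter. As no pair starts at the last old position, the new letter stands alone at
  the end.\<close>

lemma shuffle_word_right:
  assumes "p \<in> mixable_shuffles (length x) (length y)"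
  shows "shuffle_word A x (y @ [b]) (fst p) (snd p) = shuffle_word A x y (fst p) (snd p) @ [b]"
proof -
  let ?N = "length x + length y"
  have s: "fst p \<in> shuffle_perms (length x) (length y)" using assms by (auto simp: mixable_shuffles_def)
  have l: "fst p (Suc ?N) = Suc ?N" using s by (subst (asm) shuffle_perms_Suc_right) simp
  have "contract_word A (\<lambda>k. (x @ y @ [b]) ! (fst p k - 1)) (snd p) ?N =
    contract_word A (\<lambda>k. (x @ y) ! (fst p k - 1)) (snd p) ?N"
  proof (rule contract_word_cong)
    fix k assume "1 \<le> k" "k \<le> ?N"
    then have "fst p k - 1 < length (x @ y)" using shuffle_perms_range[OF s] by force
    then show "(x @ y @ [b]) ! (fst p k - 1) = (x @ y) ! (fst p k - 1)"
      using nth_append[of "x @ y" "[b]" "fst p k - 1"] by simp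
  qed simp
  then show ?thesis
    using mixable_shuffle_snd(3)[OF assms] l nth_append[of "x @ y" "[b]" ?N]
    by (simp add: shuffle_word_def Let_def)
qed

text \<open>Renaming the values and inserting \<open>a\<close> into the list between
  \<open>x\<close> and \<open>y\<close> are index shifts that cancel, so all earlier positions show
  the same letters.\<close>

lemma shuffle_word_left:
  assumes "p \<in> mixable_shuffles (length x) (length y)"
  shows "shuffle_word A (x @ [a]) y (left_cycle (length x) (length y) \<circ> fst p) (snd p) =
    shuffle_word A x y (fst p) (snd p) @ [a]"
proof -
  let ?N = "length x + length y" and ?s = "left_cycle (length x) (length y) \<circ> fst p"
  have s: "fst p \<in> shuffle_perms (length x) (length y)" using assms by (auto simp: mixable_shuffles_def)
  have l: "?s (Suc ?N) = Suc (length x)" by (rule left_cycle_last[OF s])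
  have "contract_word A (\<lambda>k. (x @ a # y) ! (?s k - 1)) (snd p) ?N =
    contract_word A (\<lambda>k. (x @ y) ! (fst p k - 1)) (snd p) ?N"
  proof (rule contract_word_cong)
    fix k assume "1 \<le> k" "k \<le> ?N"
    then have v: "1 \<le> fst p k" "fst p k \<le> ?N" using shuffle_perms_range[OF s] by auto
    show "(x @ a # y) ! (?s k - 1) = (x @ y) ! (fst p k - 1)"
    proof (cases "fst p k \<le> length x")
      case True
      then have "fst p k - 1 < length x" using v by linarith
      then show ?thesis using v True by (simp add: left_cycle_def nth_append)
    next
      case False
      then have "?s k - 1 = Suc (length x + (fst p k - 1 - length x))" using v by (simp add: left_cycle_def)
      moreover have "\<not> fst p k - 1 < length x" using False by linarith
      ultimately show ?thesis by (simp add: nth_append)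
    qed
  qed simp
  then show ?thesis
    using mixable_shuffle_snd(3)[OF assms] l by (simp add: shuffle_word_def Let_def)
qed

text \<open>The product arises in two moves: \<open>a\<close> is placed as by a left insertion, then
  the additional pair contracts \<open>b\<close> into it instead of starting a new letter.\<close>

lemma shuffle_word_both:
  assumes p: "p \<in> mixable_shuffles (length x) (length y)"
  shows "shuffle_word A (x @ [a]) (y @ [b]) (fst (insert_both (length x) (length y) p))
      (snd (insert_both (length x) (length y) p)) =
    shuffle_word A x y (fst p) (snd p) @ [a \<otimes>\<^bsub>A\<^esub> b]"
proof -
  let ?N = "length x + length y" and ?s = "left_cycle (length x) (length y) \<circ> fst p"
  let ?z = "\<lambda>k. (x @ a # y @ [b]) ! (?s k - 1)"
  have s: "fst p \<in> shuffle_perms (length x) (length y)" using p by (auto simp: mixable_shuffles_def)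
  have q: "(?s, snd p) \<in> mixable_shuffles (length (x @ [a])) (length y)"
    using p shuffle_perms_Suc_left[of "fst p"] admissible_Suc_left[OF s]
    by (auto simp: mixable_shuffles_def)
  have l: "?s (Suc (Suc ?N)) = Suc (Suc ?N)"
    using q shuffle_perms_Suc_right[of ?s "Suc (length x)" "length y"] by (simp add: mixable_shuffles_def)
  have "contract_word A ?z (insert (Suc ?N, Suc (Suc ?N)) (snd p)) (Suc ?N) =
    contract_word A ?z (snd p) (Suc ?N)"
    by (rule contract_word_cong) auto
  also have "\<dots> = shuffle_word A x y (fst p) (snd p) @ [a]"
    using shuffle_word_right[OF q, of A b] shuffle_word_left[OF p, of A a] mixable_shuffle_snd(3)[OF q]
    by (simp add: shuffle_word_def Let_def)
  finally show ?thesis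
    using l nth_append[of "x @ a # y" "[b]" "Suc ?N"] by (simp add: shuffle_word_def Let_def)
qed

text \<open>Contracted letters are products of letters. The induction removes the last position, in
  line with the three parts of the recursion.\<close>

lemma shuffle_word_closed:
  assumes "monoid A" and "p \<in> mixable_shuffles (length x) (length y)"
    and "set x \<subseteq> carrier A" and "set y \<subseteq> carrier A"
  shows "set (shuffle_word A x y (fst p) (snd p)) \<subseteq> carrier A"
  using assms(2-)
proof (induction "length x + length y" arbitrary: x y p rule: less_induct)
  case less
  show ?case
  proof (cases "x = [] \<or> y = []")
    case True
    then have "p = (id, {})" using less.prems(1) by (auto simp: mixable_shuffles_0)
    then show ?thesis using True less.prems by (auto simp: shuffle_word_Nil)
  next
    case False
    then obtain x' a y' b where xy: "x = x' @ [a]" "y = y' @ [b]" by (metis rev_exhaust)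
    have ab: "a \<otimes>\<^bsub>A\<^esub> b \<in> carrier A" using less.prems xy assms(1) by (simp add: monoid.m_closed)
    consider "p \<in> mixable_shuffles (length x) (length y')"
      | q where "q \<in> mixable_shuffles (length x') (length y)" "p = insert_left (length x') (length y) q"
      | q where "q \<in> mixable_shuffles (length x') (length y')" "p = insert_both (length x') (length y') q"
      using less.prems(1) mixable_shuffles_Suc[of "length x'" "length y'"] unfolding xy by auto
    then show ?thesis
    proof cases
      case 1
      then show ?thesis using less.hyps[of x y' p] less.prems shuffle_word_right[OF 1, of A b] xy by simp
    next
      case 2
      then show ?thesis using less.hyps[of x' y q] less.prems shuffle_word_left[OF 2(1), of A a] xy by simp
    next
      case 3
      then show ?thesis
        using less.hyps[of x' y' q] less.prems shuffle_word_both[OF 3(1), of A a b] xy ab by simp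
    qed
  qed
qed

section \<open>Free modules\<close>

definition linear_map ::
  "('c, 'k) ring_scheme \<Rightarrow> ('c, 'r, 'x) module_scheme \<Rightarrow> ('c, 's, 'y) module_scheme \<Rightarrow> ('r \<Rightarrow> 's) \<Rightarrow> bool" where
  "linear_map C M N L \<longleftrightarrow> L \<in> carrier M \<rightarrow> carrier N \<and>
     (\<forall>x\<in>carrier M. \<forall>y\<in>carrier M. L (x \<oplus>\<^bsub>M\<^esub> y) = L x \<oplus>\<^bsub>N\<^esub> L y) \<and>
     (\<forall>c\<in>carrier C. \<forall>x\<in>carrier M. L (c \<odot>\<^bsub>M\<^esub> x) = c \<odot>\<^bsub>N\<^esub> L x)"

lemma linear_mapI:
  assumes "\<And>x. x \<in> carrier M \<Longrightarrow> L x \<in> carrier N"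
    and "\<And>x y. x \<in> carrier M \<Longrightarrow> y \<in> carrier M \<Longrightarrow> L (x \<oplus>\<^bsub>M\<^esub> y) = L x \<oplus>\<^bsub>N\<^esub> L y"
    and "\<And>c x. c \<in> carrier C \<Longrightarrow> x \<in> carrier M \<Longrightarrow> L (c \<odot>\<^bsub>M\<^esub> x) = c \<odot>\<^bsub>N\<^esub> L x"
  shows "linear_map C M N L"
  using assms by (auto simp: linear_map_def)

lemma linear_mapD:
  assumes "linear_map C M N L"
  shows "x \<in> carrier M \<Longrightarrow> L x \<in> carrier N"
    and "x \<in> carrier M \<Longrightarrow> y \<in> carrier M \<Longrightarrow> L (x \<oplus>\<^bsub>M\<^esub> y) = L x \<oplus>\<^bsub>N\<^esub> L y"
    and "c \<in> carrier C \<Longrightarrow> x \<in> carrier M \<Longrightarrow> L (c \<odot>\<^bsub>M\<^esub> x) = c \<odot>\<^bsub>N\<^esub> L x"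
  using assms by (auto simp: linear_map_def)

lemma linear_map_comp:
  assumes "linear_map C M N L" and "linear_map C N K L'"
  shows "linear_map C M K (\<lambda>x. L' (L x))"
  using assms by (auto simp: linear_map_def Pi_iff)

lemma linear_map_zero:
  assumes L: "linear_map C M N L" and "module C M" and "module C N"
  shows "L \<zero>\<^bsub>M\<^esub> = \<zero>\<^bsub>N\<^esub>"
proof -
  interpret M: module C M by fact
  interpret N: module C N by fact
  have "L (\<zero>\<^bsub>C\<^esub> \<odot>\<^bsub>M\<^esub> \<zero>\<^bsub>M\<^esub>) = \<zero>\<^bsub>C\<^esub> \<odot>\<^bsub>N\<^esub> L \<zero>\<^bsub>M\<^esub>" by (rule linear_mapD[OF L]) auto
  then show ?thesis using linear_mapD(1)[OF L] by simp
qed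

lemma linear_map_minus:
  assumes L: "linear_map C M N L" and "module C M" and "module C N"
    and x: "x \<in> carrier M" "y \<in> carrier M"
  shows "L (x \<ominus>\<^bsub>M\<^esub> y) = L x \<ominus>\<^bsub>N\<^esub> L y"
proof -
  interpret M: module C M by fact
  interpret N: module C N by fact
  have "L (\<ominus>\<^bsub>M\<^esub> y) = L ((\<ominus>\<^bsub>C\<^esub> \<one>\<^bsub>C\<^esub>) \<odot>\<^bsub>M\<^esub> y)" using x by (simp add: M.smult_l_minus)
  also have "\<dots> = \<ominus>\<^bsub>N\<^esub> L y" using x linear_mapD[OF L] by (simp add: N.smult_l_minus)
  finally show ?thesis using x linear_mapD[OF L] by (simp add: M.M.minus_eq N.M.minus_eq)
qed

lemma linear_map_finsum:
  assumes L: "linear_map C M N L" and M: "module C M" and N: "module C N"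
    and "finite S" and "f \<in> S \<rightarrow> carrier M"
  shows "L (finsum M f S) = finsum N (\<lambda>i. L (f i)) S"
proof -
  interpret M: module C M by fact
  interpret N: module C N by fact
  from assms(4,5) show ?thesis
    by (induction S)
       (auto simp: linear_map_zero[OF L M N] linear_mapD[OF L] Pi_iff M.M.finsum_insert N.M.finsum_insert)
qed

context abelian_monoid
begin

lemma finsum_Times:
  assumes "finite S" and "finite T" and "\<And>s t. s \<in> S \<Longrightarrow> t \<in> T \<Longrightarrow> f (s, t) \<in> carrier G"
  shows "finsum G f (S \<times> T) = (\<Oplus>s\<in>S. \<Oplus>t\<in>T. f (s, t))"
  using assms(1,3)
proof (induction S)
  case (insert s S)
  have inj: "inj_on (\<lambda>t. (s, t)) T" by (rule inj_onI) simp
  have "finsum G f (insert s S \<times> T) = finsum G f ((\<lambda>t. (s, t)) ` T \<union> S \<times> T)"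
    by (rule arg_cong[where f = "finsum G f"]) auto
  also have "\<dots> = finsum G f ((\<lambda>t. (s, t)) ` T) \<oplus> finsum G f (S \<times> T)"
    by (rule finsum_Un_disjoint) (use insert assms(2) in auto)
  also have "finsum G f ((\<lambda>t. (s, t)) ` T) = (\<Oplus>t\<in>T. f (s, t))"
    by (rule finsum_reindex[OF _ inj]) (use insert in auto)
  finally show ?case using insert by (simp add: Pi_iff)
qed simp

end

text \<open>The multiplicative fields of \<open>M\<close> are left open, so that words of one
  length, whose module carries a product, and words of all positive lengths are instances
  alike.\<close>

locale free_module = C: cring C for C :: "('c, 'k) ring_scheme" (structure) +
  fixes B :: "'w set" and M :: "('c, 'w \<Rightarrow> 'c, 'x) module_scheme"
  assumes carrier_eq: "carrier M = {f. (\<forall>w. f w \<in> carrier C) \<and> finite {w. f w \<noteq> \<zero>} \<and>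
      (\<forall>w. f w \<noteq> \<zero> \<longrightarrow> w \<in> B)}"
    and zero_eq: "zero M = (\<lambda>w. \<zero>)"
    and add_eq: "add M = (\<lambda>f g w. f w \<oplus> g w)"
    and smult_eq: "smult M = (\<lambda>c f w. c \<otimes> f w)"
begin

lemma free_module_module: "module C M"
proof (rule moduleI)
  have add: "x \<oplus>\<^bsub>M\<^esub> y \<in> carrier M" if "x \<in> carrier M" "y \<in> carrier M" for x y
  proof -
    have "finite ({w. x w \<noteq> \<zero>} \<union> {w. y w \<noteq> \<zero>})" using that by (auto simp: carrier_eq)
    moreover have "{w. x w \<oplus> y w \<noteq> \<zero>} \<subseteq> {w. x w \<noteq> \<zero>} \<union> {w. y w \<noteq> \<zero>}" by auto
    ultimately have "finite {w. x w \<oplus> y w \<noteq> \<zero>}" by (rule rev_finite_subset)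
    then show ?thesis using that by (auto simp: carrier_eq add_eq) (metis C.l_zero C.zero_closed)
  qed
  show "abelian_group M"
  proof (rule abelian_groupI)
    fix x assume x: "x \<in> carrier M"
    then have "(\<lambda>w. \<ominus> x w) \<in> carrier M"
      by (auto simp: carrier_eq elim!: rev_finite_subset)
    moreover have "(\<lambda>w. \<ominus> x w) \<oplus>\<^bsub>M\<^esub> x = \<zero>\<^bsub>M\<^esub>"
      using x by (auto simp: carrier_eq add_eq zero_eq C.l_neg)
    ultimately show "\<exists>y\<in>carrier M. y \<oplus>\<^bsub>M\<^esub> x = \<zero>\<^bsub>M\<^esub>" by blast
  qed (auto intro: add, auto simp: carrier_eq add_eq zero_eq C.a_ac)
  fix c x assume cx: "c \<in> carrier C" "x \<in> carrier M"
  have nz: "x w \<noteq> \<zero>" if "c \<otimes> x w \<noteq> \<zero>" for w using that cx by auto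
  show "c \<odot>\<^bsub>M\<^esub> x \<in> carrier M"
    using cx nz by (auto simp: carrier_eq smult_eq elim!: rev_finite_subset)
qed (auto simp: carrier_eq add_eq smult_eq C.l_distr C.r_distr C.m_assoc intro: C.is_cring)

sublocale M: module C M by (rule free_module_module)

lemma single_closed: "w \<in> B \<Longrightarrow> single C w \<in> carrier M"
  by (auto simp: carrier_eq single_def intro!: finite_subset[of _ "{w}"])

text \<open>Induction on the finite support, splitting off the term of one word at a time.\<close>

lemma free_induct [consumes 1, case_names zero step]:
  assumes "x \<in> carrier M" and "P \<zero>\<^bsub>M\<^esub>"
    and step: "\<And>c w f. c \<in> carrier C \<Longrightarrow> w \<in> B \<Longrightarrow> f \<in> carrier M \<Longrightarrow> P f \<Longrightarrow>
      P (c \<odot>\<^bsub>M\<^esub> single C w \<oplus>\<^bsub>M\<^esub> f)"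
  shows "P x"
proof -
  have "P x" if "finite S" "x \<in> carrier M" "{w. x w \<noteq> \<zero>} = S" for S x
    using that
  proof (induction S arbitrary: x)
    case empty
    then have "x = \<zero>\<^bsub>M\<^esub>" by (auto simp: zero_eq)
    then show ?case using assms(2) by simp
  next
    case (insert w S)
    define f where "f = x(w := \<zero>)"
    have sf: "{v. f v \<noteq> \<zero>} = S" using insert by (auto simp: f_def)
    then have f: "f \<in> carrier M" using insert by (auto simp: carrier_eq f_def)
    have xw: "x w \<in> carrier C" "w \<in> B" using insert by (auto simp: carrier_eq)
    have "x = x w \<odot>\<^bsub>M\<^esub> single C w \<oplus>\<^bsub>M\<^esub> f"
      using insert(4) xw f by (auto simp: add_eq smult_eq single_def f_def fun_eq_iff carrier_eq)
    then show ?case using step[OF xw f insert.IH[OF f sf]] by simp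
  qed
  then show ?thesis using assms(1) by (auto simp: carrier_eq)
qed

text \<open>Linear maps are equal if they agree on the basis. Multilinear identities follow by
  applying this to one argument after another.\<close>

lemma linear_map_eqI:
  assumes "linear_map C M N L" and "linear_map C M N L'" and "module C N"
    and "\<And>w. w \<in> B \<Longrightarrow> L (single C w) = L' (single C w)" and "x \<in> carrier M"
  shows "L x = L' x"
  using assms(5)
proof (induction rule: free_induct)
  case zero
  then show ?case using linear_map_zero[OF _ free_module_module assms(3)] assms by metis
next
  case (step c w f)
  then show ?case
    using linear_mapD[OF assms(1)] linear_mapD[OF assms(2)] assms(4) single_closed by simp
qed

end

definition free_ext ::
  "('c, 'k) ring_scheme \<Rightarrow> ('c, 's, 'y) module_scheme \<Rightarrow> ('w \<Rightarrow> 's) \<Rightarrow> ('w \<Rightarrow> 'c) \<Rightarrow> 's" where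
  "free_ext C N h f = (\<Oplus>\<^bsub>N\<^esub>w\<in>{w. f w \<noteq> \<zero>\<^bsub>C\<^esub>}. f w \<odot>\<^bsub>N\<^esub> h w)"

context free_module
begin

text \<open>The supports of \<open>f\<close>, \<open>g\<close> and their sum may differ; summing
  over a common larger set makes the three sums comparable.\<close>

lemma free_ext_superset:
  assumes "module C N" and "h \<in> B \<rightarrow> carrier N" and f: "f \<in> carrier M" and "finite S"
    and "{w. f w \<noteq> \<zero>} \<subseteq> S" and "S \<subseteq> B"
  shows "free_ext C N h f = (\<Oplus>\<^bsub>N\<^esub>w\<in>S. f w \<odot>\<^bsub>N\<^esub> h w)"
proof -
  interpret N: module C N by fact
  have fC: "f w \<in> carrier C" for w using f by (simp add: carrier_eq)
  have hS: "w \<in> S \<Longrightarrow> h w \<in> carrier N" for w using assms by auto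
  show ?thesis
    unfolding free_ext_def
    by (rule N.M.add.finprod_mono_neutral_cong_left) (use assms(4,5) fC hS in auto)
qed

lemma free_ext_linear:
  assumes N: "module C N" and h: "h \<in> B \<rightarrow> carrier N"
  shows "linear_map C M N (free_ext C N h)"
proof (rule linear_mapI)
  interpret N: module C N by fact
  have fC: "f w \<in> carrier C" "f w \<noteq> \<zero> \<Longrightarrow> w \<in> B" "finite {w. f w \<noteq> \<zero>}" if "f \<in> carrier M" for f w
    using that by (auto simp: carrier_eq)
  show "free_ext C N h f \<in> carrier N" if "f \<in> carrier M" for f
    unfolding free_ext_def using fC[OF that] h by (intro N.M.finsum_closed) auto
  fix f g assume f: "f \<in> carrier M" and g: "g \<in> carrier M"
  let ?S = "{w. f w \<noteq> \<zero>} \<union> {w. g w \<noteq> \<zero>}"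
  have S: "finite ?S" "?S \<subseteq> B" using fC[OF f] fC[OF g] by auto
  have "free_ext C N h (f \<oplus>\<^bsub>M\<^esub> g) = (\<Oplus>\<^bsub>N\<^esub>w\<in>?S. (f w \<oplus> g w) \<odot>\<^bsub>N\<^esub> h w)"
    by (subst free_ext_superset[OF N h _ S(1) _ S(2)]) (use f g M.M.a_closed[OF f g] in \<open>auto simp: add_eq\<close>)
  also have "\<dots> = (\<Oplus>\<^bsub>N\<^esub>w\<in>?S. f w \<odot>\<^bsub>N\<^esub> h w \<oplus>\<^bsub>N\<^esub> g w \<odot>\<^bsub>N\<^esub> h w)"
    by (rule N.M.finsum_cong') (use S(2) fC[OF f] fC[OF g] h in \<open>auto simp: N.smult_l_distr subset_eq Pi_iff\<close>)
  also have "\<dots> = (\<Oplus>\<^bsub>N\<^esub>w\<in>?S. f w \<odot>\<^bsub>N\<^esub> h w) \<oplus>\<^bsub>N\<^esub> (\<Oplus>\<^bsub>N\<^esub>w\<in>?S. g w \<odot>\<^bsub>N\<^esub> h w)"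
    by (rule N.M.finsum_addf) (use S(2) fC[OF f] fC[OF g] h in \<open>auto simp: subset_eq Pi_iff\<close>)
  also have "\<dots> = free_ext C N h f \<oplus>\<^bsub>N\<^esub> free_ext C N h g"
    using free_ext_superset[OF N h f S(1) _ S(2)] free_ext_superset[OF N h g S(1) _ S(2)] by simp
  finally show "free_ext C N h (f \<oplus>\<^bsub>M\<^esub> g) = free_ext C N h f \<oplus>\<^bsub>N\<^esub> free_ext C N h g" .
next
  interpret N: module C N by fact
  fix c f assume c: "c \<in> carrier C" and f: "f \<in> carrier M"
  let ?S = "{w. f w \<noteq> \<zero>}"
  have S: "finite ?S" "?S \<subseteq> B" "f w \<in> carrier C" for w using f by (auto simp: carrier_eq)
  have "free_ext C N h (c \<odot>\<^bsub>M\<^esub> f) = (\<Oplus>\<^bsub>N\<^esub>w\<in>?S. (c \<otimes> f w) \<odot>\<^bsub>N\<^esub> h w)"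
    by (subst free_ext_superset[OF N h _ S(1) _ S(2)]) (use f c M.smult_closed[OF c f] in \<open>auto simp: smult_eq\<close>)
  also have "\<dots> = (\<Oplus>\<^bsub>N\<^esub>w\<in>?S. c \<odot>\<^bsub>N\<^esub> (f w \<odot>\<^bsub>N\<^esub> h w))"
    by (rule N.M.finsum_cong') (use S c h in \<open>auto simp: N.smult_assoc1 subset_eq Pi_iff\<close>)
  also have "\<dots> = c \<odot>\<^bsub>N\<^esub> free_ext C N h f"
    unfolding free_ext_def
    by (rule N.finsum_smult_ldistr[symmetric]) (use S c h in auto)
  finally show "free_ext C N h (c \<odot>\<^bsub>M\<^esub> f) = c \<odot>\<^bsub>N\<^esub> free_ext C N h f" .
qed

lemma free_ext_single:
  assumes "module C N" and h: "h \<in> B \<rightarrow> carrier N" and w: "w \<in> B"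
  shows "free_ext C N h (single C w) = h w"
proof -
  interpret N: module C N by fact
  have "free_ext C N h (single C w) = (\<Oplus>\<^bsub>N\<^esub>v\<in>{w}. single C w v \<odot>\<^bsub>N\<^esub> h v)"
    by (rule free_ext_superset[OF assms(1,2) single_closed[OF w]]) (use w in \<open>auto simp: single_def\<close>)
  also have "\<dots> = h w" using h w by (auto simp: single_def Pi_iff N.M.finsum_insert)
  finally show ?thesis .
qed

lemma finsum_apply:
  assumes "finite I" and "\<And>i. i \<in> I \<Longrightarrow> F i \<in> carrier M"
  shows "(\<Oplus>\<^bsub>M\<^esub>i\<in>I. F i) v = (\<Oplus>i\<in>I. F i v)"
  using assms
proof (induction I)
  case empty
  then show ?case by (simp add: zero_eq)
next
  case (insert i I)
  then have "\<And>j. j \<in> insert i I \<Longrightarrow> F j v \<in> carrier C" by (simp add: carrier_eq)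
  then show ?case using insert by (simp add: add_eq Pi_iff)
qed

end

text \<open>\<open>lin_ext\<close> collects the coefficients of all words sent to \<open>v\<close>.
  Evaluating the universal extension at \<open>v\<close> gives the same sum, since
  \<open>single C (h w) v\<close> selects exactly the fibre over \<open>v\<close>.\<close>

lemma lin_ext_eq_free_ext:
  assumes M: "free_module C B M" and N: "free_module C B' N" and h: "h \<in> B \<rightarrow> B'"
    and f: "f \<in> carrier M"
  shows "lin_ext C h f = free_ext C N (\<lambda>w. single C (h w)) f"
proof
  fix v
  interpret M: free_module C B M by fact
  interpret N: free_module C B' N by fact
  have S: "finite {w. f w \<noteq> \<zero>\<^bsub>C\<^esub>}" "\<And>w. f w \<in> carrier C" "\<And>w. f w \<noteq> \<zero>\<^bsub>C\<^esub> \<Longrightarrow> w \<in> B"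
    using f by (auto simp: M.carrier_eq)
  have "free_ext C N (\<lambda>w. single C (h w)) f v = (\<Oplus>\<^bsub>C\<^esub>w\<in>{w. f w \<noteq> \<zero>\<^bsub>C\<^esub>}. (f w \<odot>\<^bsub>N\<^esub> single C (h w)) v)"
    unfolding free_ext_def by (rule N.finsum_apply) (use S h in \<open>auto intro!: N.M.smult_closed N.single_closed\<close>)
  also have "\<dots> = (\<Oplus>\<^bsub>C\<^esub>w\<in>{w. f w \<noteq> \<zero>\<^bsub>C\<^esub> \<and> h w = v}. f w)"
    by (rule M.C.add.finprod_mono_neutral_cong_right)
       (use S in \<open>auto simp: N.smult_eq single_def\<close>)
  finally show "lin_ext C h f v = free_ext C N (\<lambda>w. single C (h w)) f v" by (simp add: lin_ext_def)
qed

lemma lin_ext_linear: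
  assumes M: "free_module C B M" and N: "free_module C B' N" and h: "h \<in> B \<rightarrow> B'"
  shows "linear_map C M N (lin_ext C h)"
    and "w \<in> B \<Longrightarrow> lin_ext C h (single C w) = single C (h w)"
proof -
  interpret M: free_module C B M by fact
  interpret N: free_module C B' N by fact
  have h': "(\<lambda>w. single C (h w)) \<in> B \<rightarrow> carrier N" using h N.single_closed by auto
  note L = linear_mapD[OF M.free_ext_linear[OF N.free_module_module h']]
  show "linear_map C M N (lin_ext C h)"
    by (rule linear_mapI) (simp_all add: lin_ext_eq_free_ext[OF M N h] L)
  show "w \<in> B \<Longrightarrow> lin_ext C h (single C w) = single C (h w)"
    by (simp add: lin_ext_eq_free_ext[OF M N h] M.single_closed M.free_ext_single[OF N.free_module_module h'])
qed

text \<open>The sum over pairs is an iterated sum, which exhibits the bilinear extension as a linear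
  extension whose prescribed values are themselves linear extensions.\<close>

lemma bilin_ext_eq_free_ext:
  assumes M: "free_module C B M" and N: "free_module C B' N"
    and b: "\<And>w u. w \<in> B \<Longrightarrow> u \<in> B \<Longrightarrow> b w u \<in> carrier N"
    and f: "f \<in> carrier M" and g: "g \<in> carrier M"
  shows "bilin_ext C b f g = free_ext C N (\<lambda>w. free_ext C N (b w) g) f"
proof
  fix v
  interpret M: free_module C B M by fact
  interpret N: free_module C B' N by fact
  let ?S = "{w. f w \<noteq> \<zero>\<^bsub>C\<^esub>}" and ?T = "{w. g w \<noteq> \<zero>\<^bsub>C\<^esub>}"
  have S: "finite ?S" "\<And>w. f w \<in> carrier C" "\<And>w. f w \<noteq> \<zero>\<^bsub>C\<^esub> \<Longrightarrow> w \<in> B"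
    using f by (auto simp: M.carrier_eq)
  have T: "finite ?T" "\<And>w. g w \<in> carrier C" "\<And>w. g w \<noteq> \<zero>\<^bsub>C\<^esub> \<Longrightarrow> w \<in> B"
    using g by (auto simp: M.carrier_eq)
  have bC: "b w u x \<in> carrier C" if "w \<in> B" "u \<in> B" for w u x using b[OF that] by (simp add: N.carrier_eq)
  have e: "free_ext C N (b w) g v = (\<Oplus>\<^bsub>C\<^esub>u\<in>?T. g u \<otimes>\<^bsub>C\<^esub> b w u v)" if "w \<in> B" for w
  proof -
    have "free_ext C N (b w) g v = (\<Oplus>\<^bsub>C\<^esub>u\<in>?T. (g u \<odot>\<^bsub>N\<^esub> b w u) v)"
      unfolding free_ext_def by (rule N.finsum_apply) (use T b that in \<open>auto intro!: N.M.smult_closed\<close>)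
    then show ?thesis by (simp add: N.smult_eq)
  qed
  have c: "free_ext C N (b w) g \<in> carrier N" if "w \<in> B" for w
    using linear_mapD(1)[OF M.free_ext_linear[OF N.free_module_module, of "b w"] g] b that by auto
  have "free_ext C N (\<lambda>w. free_ext C N (b w) g) f v =
    (\<Oplus>\<^bsub>C\<^esub>w\<in>?S. (f w \<odot>\<^bsub>N\<^esub> free_ext C N (b w) g) v)"
    unfolding free_ext_def[of C N _ f]
    by (rule N.finsum_apply) (use S c in \<open>auto intro!: N.M.smult_closed\<close>)
  also have "\<dots> = (\<Oplus>\<^bsub>C\<^esub>w\<in>?S. \<Oplus>\<^bsub>C\<^esub>u\<in>?T. f w \<otimes>\<^bsub>C\<^esub> g u \<otimes>\<^bsub>C\<^esub> b w u v)"
  proof (rule M.C.add.finprod_cong')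
    fix w assume w: "w \<in> ?S"
    have "(f w \<odot>\<^bsub>N\<^esub> free_ext C N (b w) g) v = f w \<otimes>\<^bsub>C\<^esub> (\<Oplus>\<^bsub>C\<^esub>u\<in>?T. g u \<otimes>\<^bsub>C\<^esub> b w u v)"
      using w S e by (simp add: N.smult_eq)
    also have "\<dots> = (\<Oplus>\<^bsub>C\<^esub>u\<in>?T. f w \<otimes>\<^bsub>C\<^esub> (g u \<otimes>\<^bsub>C\<^esub> b w u v))"
      by (rule M.C.finsum_rdistr) (use w S T bC in auto)
    also have "\<dots> = (\<Oplus>\<^bsub>C\<^esub>u\<in>?T. f w \<otimes>\<^bsub>C\<^esub> g u \<otimes>\<^bsub>C\<^esub> b w u v)"
      by (rule M.C.add.finprod_cong') (use w S T bC in \<open>auto simp: M.C.m_assoc\<close>)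
    finally show "(f w \<odot>\<^bsub>N\<^esub> free_ext C N (b w) g) v = (\<Oplus>\<^bsub>C\<^esub>u\<in>?T. f w \<otimes>\<^bsub>C\<^esub> g u \<otimes>\<^bsub>C\<^esub> b w u v)" .
  qed (use S T bC in auto)
  also have "\<dots> = (\<Oplus>\<^bsub>C\<^esub>p\<in>?S \<times> ?T. f (fst p) \<otimes>\<^bsub>C\<^esub> g (snd p) \<otimes>\<^bsub>C\<^esub> b (fst p) (snd p) v)"
    by (subst M.C.finsum_Times) (use S T bC in auto)
  finally show "bilin_ext C b f g v = free_ext C N (\<lambda>w. free_ext C N (b w) g) f v"
    by (simp add: bilin_ext_def)
qed

lemma bilin_ext_linear:
  assumes M: "free_module C B M" and N: "free_module C B' N"
    and b: "\<And>w u. w \<in> B \<Longrightarrow> u \<in> B \<Longrightarrow> b w u \<in> carrier N"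
  shows "g \<in> carrier M \<Longrightarrow> linear_map C M N (\<lambda>f. bilin_ext C b f g)"
    and "f \<in> carrier M \<Longrightarrow> linear_map C M N (\<lambda>g. bilin_ext C b f g)"
    and "w \<in> B \<Longrightarrow> u \<in> B \<Longrightarrow> bilin_ext C b (single C w) (single C u) = b w u"
proof -
  interpret M: free_module C B M by fact
  interpret N: free_module C B' N by fact
  have e: "bilin_ext C b f g = free_ext C N (\<lambda>w. free_ext C N (b w) g) f"
    if "f \<in> carrier M" "g \<in> carrier M" for f g
    by (rule bilin_ext_eq_free_ext[OF M N]) (use b that in auto)
  note Nm = N.free_module_module
  have b': "b w \<in> B \<rightarrow> carrier N" if "w \<in> B" for w using b that by auto
  note Lw = linear_mapD[OF M.free_ext_linear[OF Nm b']]
  show "linear_map C M N (\<lambda>f. bilin_ext C b f g)" if g: "g \<in> carrier M" for g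
  proof -
    have "(\<lambda>w. free_ext C N (b w) g) \<in> B \<rightarrow> carrier N" using Lw(1) g by auto
    note L = linear_mapD[OF M.free_ext_linear[OF Nm this]]
    show ?thesis by (rule linear_mapI) (use g in \<open>simp_all add: e L\<close>)
  qed
  show s: "bilin_ext C b (single C w) (single C u) = b w u" if "w \<in> B" "u \<in> B" for w u
  proof -
    have "(\<lambda>w. free_ext C N (b w) (single C u)) \<in> B \<rightarrow> carrier N"
      using Lw(1) M.single_closed that by auto
    then show ?thesis
      using that by (simp add: e M.single_closed M.free_ext_single[OF Nm] b')
  qed
  \<comment> \<open>The argument \<open>g\<close> enters through the prescribed values, not through
    the coefficients, so linearity in it is not an instance of the extension property; it is checked
    termwise over the support of \<open>f\<close>.\<close>
  show "linear_map C M N (\<lambda>g. bilin_ext C b f g)" if f: "f \<in> carrier M" for f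
  proof (rule linear_mapI)
    have S: "f w \<in> carrier C" "f w \<noteq> \<zero>\<^bsub>C\<^esub> \<Longrightarrow> w \<in> B" "finite {w. f w \<noteq> \<zero>\<^bsub>C\<^esub>}" for w
      using f by (auto simp: M.carrier_eq)
    show "bilin_ext C b f g \<in> carrier N" if g: "g \<in> carrier M" for g
      unfolding e[OF f g] free_ext_def[of C N _ f]
      by (rule N.M.finsum_closed) (use S Lw(1) g in auto)
    show "bilin_ext C b f (g \<oplus>\<^bsub>M\<^esub> g') = bilin_ext C b f g \<oplus>\<^bsub>N\<^esub> bilin_ext C b f g'"
      if g: "g \<in> carrier M" "g' \<in> carrier M" for g g'
    proof -
      have "bilin_ext C b f (g \<oplus>\<^bsub>M\<^esub> g') = (\<Oplus>\<^bsub>N\<^esub>w\<in>{w. f w \<noteq> \<zero>\<^bsub>C\<^esub>}.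
        f w \<odot>\<^bsub>N\<^esub> free_ext C N (b w) g \<oplus>\<^bsub>N\<^esub> f w \<odot>\<^bsub>N\<^esub> free_ext C N (b w) g')"
        unfolding e[OF f M.M.a_closed[OF g]] free_ext_def[of C N _ f]
        by (rule N.M.finsum_cong') (use S Lw g in \<open>auto simp: N.M.smult_r_distr\<close>)
      also have "\<dots> = bilin_ext C b f g \<oplus>\<^bsub>N\<^esub> bilin_ext C b f g'"
        unfolding e[OF f g(1)] e[OF f g(2)] free_ext_def[of C N _ f]
        by (rule N.M.finsum_addf) (use S Lw g in auto)
      finally show ?thesis .
    qed
    show "bilin_ext C b f (c \<odot>\<^bsub>M\<^esub> g) = c \<odot>\<^bsub>N\<^esub> bilin_ext C b f g"
      if c: "c \<in> carrier C" and g: "g \<in> carrier M" for c g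
    proof -
      have "bilin_ext C b f (c \<odot>\<^bsub>M\<^esub> g) = (\<Oplus>\<^bsub>N\<^esub>w\<in>{w. f w \<noteq> \<zero>\<^bsub>C\<^esub>}.
        c \<odot>\<^bsub>N\<^esub> (f w \<odot>\<^bsub>N\<^esub> free_ext C N (b w) g))"
        unfolding e[OF f M.M.smult_closed[OF c g]] free_ext_def[of C N _ f]
        by (rule N.M.finsum_cong')
           (use S Lw g c in \<open>auto simp: N.M.smult_assoc1[symmetric] M.C.m_comm\<close>)
      also have "\<dots> = c \<odot>\<^bsub>N\<^esub> bilin_ext C b f g"
        unfolding e[OF f g] free_ext_def[of C N _ f]
        by (rule N.M.finsum_smult_ldistr[symmetric]) (use S Lw g c in auto)
      finally show ?thesis .
    qed
  qed
qed

section \<open>Tensor powers\<close>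

abbreviation words :: "('a, 'm) ring_scheme \<Rightarrow> nat \<Rightarrow> 'a list set" where
  "words A n \<equiv> {w. length w = n \<and> set w \<subseteq> carrier A}"

locale tensor_base = A: algebra C A
  for C :: "('c, 'k) ring_scheme" and A :: "('c, 'a, 'm) module_scheme"
begin

lemma map2_closed:
  "set u \<subseteq> carrier A \<Longrightarrow> set v \<subseteq> carrier A \<Longrightarrow> set (map2 (mult A) u v) \<subseteq> carrier A"
  by (induction u v rule: list_induct2') auto

lemma map2_words: "u \<in> words A n \<Longrightarrow> v \<in> words A n \<Longrightarrow> map2 (mult A) u v \<in> words A n"
  using map2_closed[of u v] by simp

lemma word_free: "free_module C (words A n) (word_alg C A n)"
  by unfold_locales (auto simp: word_alg_def)

sublocale W: free_module C "words A n" "word_alg C A n" for n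
  by (rule word_free)

lemmas word_module = W.free_module_module

lemma word_mult:
  "f \<otimes>\<^bsub>word_alg C A n\<^esub> g = bilin_ext C (\<lambda>u v. single C (map2 (mult A) u v)) f g"
  by (simp add: word_alg_def)

lemma word_mult_linear:
  shows "g \<in> carrier (word_alg C A n) \<Longrightarrow>
      linear_map C (word_alg C A n) (word_alg C A n) (\<lambda>f. f \<otimes>\<^bsub>word_alg C A n\<^esub> g)"
    and "f \<in> carrier (word_alg C A n) \<Longrightarrow>
      linear_map C (word_alg C A n) (word_alg C A n) (\<lambda>g. f \<otimes>\<^bsub>word_alg C A n\<^esub> g)"
    and "u \<in> words A n \<Longrightarrow> v \<in> words A n \<Longrightarrow>
      single C u \<otimes>\<^bsub>word_alg C A n\<^esub> single C v = single C (map2 (mult A) u v)"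
  unfolding word_mult
proof -
  have b: "single C (map2 (mult A) u v) \<in> carrier (word_alg C A n)"
    if "u \<in> words A n" "v \<in> words A n" for u v
    using map2_words[OF that] by (rule W.single_closed)
  show "linear_map C (word_alg C A n) (word_alg C A n)
      (\<lambda>f. bilin_ext C (\<lambda>u v. single C (map2 (mult A) u v)) f g)" if "g \<in> carrier (word_alg C A n)"
    by (rule bilin_ext_linear(1)[OF word_free word_free b that])
  show "linear_map C (word_alg C A n) (word_alg C A n)
      (\<lambda>g. bilin_ext C (\<lambda>u v. single C (map2 (mult A) u v)) f g)" if "f \<in> carrier (word_alg C A n)"
    by (rule bilin_ext_linear(2)[OF word_free word_free b that])
  show "bilin_ext C (\<lambda>u v. single C (map2 (mult A) u v)) (single C u) (single C v) =
      single C (map2 (mult A) u v)" if "u \<in> words A n" "v \<in> words A n"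
    by (rule bilin_ext_linear(3)[OF word_free word_free b that])
qed

lemma map2_assoc:
  assumes "u \<in> words A n" "v \<in> words A n" "w \<in> words A n"
  shows "map2 (mult A) (map2 (mult A) u v) w = map2 (mult A) u (map2 (mult A) v w)"
  using assms by (intro nth_equalityI) (auto simp: A.m_assoc subset_eq)

lemma map2_comm:
  assumes "u \<in> words A n" "v \<in> words A n"
  shows "map2 (mult A) u v = map2 (mult A) v u"
  using assms by (intro nth_equalityI) (auto simp: A.m_comm subset_eq)

lemma map2_one: "u \<in> words A n \<Longrightarrow> map2 (mult A) u (replicate n \<one>\<^bsub>A\<^esub>) = u"
  by (intro nth_equalityI) (auto simp: subset_eq)

lemma replicate_words: "replicate n \<one>\<^bsub>A\<^esub> \<in> words A n"
  by auto

lemma word_one: "\<one>\<^bsub>word_alg C A n\<^esub> = single C (replicate n \<one>\<^bsub>A\<^esub>)"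
  by (simp add: word_alg_def)

lemma word_m_closed:
  "f \<in> carrier (word_alg C A n) \<Longrightarrow> g \<in> carrier (word_alg C A n) \<Longrightarrow>
    f \<otimes>\<^bsub>word_alg C A n\<^esub> g \<in> carrier (word_alg C A n)"
  using linear_mapD(1)[OF word_mult_linear(1)] by blast

text \<open>Both sides are linear in each argument, so each argument is replaced in turn by a word,
  where the identity is associativity letter by letter.\<close>

lemma word_m_assoc:
  assumes f: "f \<in> carrier (word_alg C A n)" and g: "g \<in> carrier (word_alg C A n)"
    and h: "h \<in> carrier (word_alg C A n)"
  shows "f \<otimes>\<^bsub>word_alg C A n\<^esub> g \<otimes>\<^bsub>word_alg C A n\<^esub> h = f \<otimes>\<^bsub>word_alg C A n\<^esub> (g \<otimes>\<^bsub>word_alg C A n\<^esub> h)"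
proof (rule W.linear_map_eqI[OF _ _ word_module _ f])
  show "linear_map C (word_alg C A n) (word_alg C A n) (\<lambda>f. f \<otimes>\<^bsub>word_alg C A n\<^esub> g \<otimes>\<^bsub>word_alg C A n\<^esub> h)"
    by (rule linear_map_comp[OF word_mult_linear(1)[OF g] word_mult_linear(1)[OF h]])
  show "linear_map C (word_alg C A n) (word_alg C A n) (\<lambda>f. f \<otimes>\<^bsub>word_alg C A n\<^esub> (g \<otimes>\<^bsub>word_alg C A n\<^esub> h))"
    by (rule word_mult_linear(1)[OF word_m_closed[OF g h]])
  fix u assume u: "u \<in> words A n"
  note su = W.single_closed[OF u]
  show "single C u \<otimes>\<^bsub>word_alg C A n\<^esub> g \<otimes>\<^bsub>word_alg C A n\<^esub> h = single C u \<otimes>\<^bsub>word_alg C A n\<^esub> (g \<otimes>\<^bsub>word_alg C A n\<^esub> h)"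
  proof (rule W.linear_map_eqI[OF _ _ word_module _ g])
    show "linear_map C (word_alg C A n) (word_alg C A n)
        (\<lambda>g. single C u \<otimes>\<^bsub>word_alg C A n\<^esub> g \<otimes>\<^bsub>word_alg C A n\<^esub> h)"
      by (rule linear_map_comp[OF word_mult_linear(2)[OF su] word_mult_linear(1)[OF h]])
    show "linear_map C (word_alg C A n) (word_alg C A n)
        (\<lambda>g. single C u \<otimes>\<^bsub>word_alg C A n\<^esub> (g \<otimes>\<^bsub>word_alg C A n\<^esub> h))"
      by (rule linear_map_comp[OF word_mult_linear(1)[OF h] word_mult_linear(2)[OF su]])
    fix v assume v: "v \<in> words A n"
    note sv = W.single_closed[OF v]
    show "single C u \<otimes>\<^bsub>word_alg C A n\<^esub> single C v \<otimes>\<^bsub>word_alg C A n\<^esub> h =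
      single C u \<otimes>\<^bsub>word_alg C A n\<^esub> (single C v \<otimes>\<^bsub>word_alg C A n\<^esub> h)"
    proof (rule W.linear_map_eqI[OF _ _ word_module _ h])
      show "linear_map C (word_alg C A n) (word_alg C A n)
          (\<lambda>h. single C u \<otimes>\<^bsub>word_alg C A n\<^esub> single C v \<otimes>\<^bsub>word_alg C A n\<^esub> h)"
        by (rule word_mult_linear(2)[OF word_m_closed[OF su sv]])
      show "linear_map C (word_alg C A n) (word_alg C A n)
          (\<lambda>h. single C u \<otimes>\<^bsub>word_alg C A n\<^esub> (single C v \<otimes>\<^bsub>word_alg C A n\<^esub> h))"
        by (rule linear_map_comp[OF word_mult_linear(2)[OF sv] word_mult_linear(2)[OF su]])
      fix w assume w: "w \<in> words A n"
      show "single C u \<otimes>\<^bsub>word_alg C A n\<^esub> single C v \<otimes>\<^bsub>word_alg C A n\<^esub> single C w =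
        single C u \<otimes>\<^bsub>word_alg C A n\<^esub> (single C v \<otimes>\<^bsub>word_alg C A n\<^esub> single C w)"
        using map2_assoc[OF u v w] map2_words[OF u v] map2_words[OF v w]
        by (simp only: word_mult_linear(3) u v w)
    qed
  qed
qed

lemma word_m_comm:
  assumes f: "f \<in> carrier (word_alg C A n)" and g: "g \<in> carrier (word_alg C A n)"
  shows "f \<otimes>\<^bsub>word_alg C A n\<^esub> g = g \<otimes>\<^bsub>word_alg C A n\<^esub> f"
proof (rule W.linear_map_eqI[OF word_mult_linear(1)[OF g] word_mult_linear(2)[OF g] word_module _ f])
  fix u assume u: "u \<in> words A n"
  note su = W.single_closed[OF u]
  show "single C u \<otimes>\<^bsub>word_alg C A n\<^esub> g = g \<otimes>\<^bsub>word_alg C A n\<^esub> single C u"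
    by (rule W.linear_map_eqI[OF word_mult_linear(2)[OF su] word_mult_linear(1)[OF su] word_module _ g])
       (simp only: word_mult_linear(3) u map2_comm[OF u])
qed

lemma word_algebra: "algebra C (word_alg C A n)"
proof (rule algebraI)
  note l1 = linear_mapD[OF word_mult_linear(1)] and l2 = linear_mapD[OF word_mult_linear(2)]
  show "cring (word_alg C A n)"
  proof (rule cringI)
    show "abelian_group (word_alg C A n)" by (rule W.M.M.abelian_group_axioms)
    show "comm_monoid (word_alg C A n)"
    proof (rule comm_monoidI)
      show "\<one>\<^bsub>word_alg C A n\<^esub> \<in> carrier (word_alg C A n)"
        unfolding word_one by (rule W.single_closed[OF replicate_words])
      fix f assume f: "f \<in> carrier (word_alg C A n)"
      have "f \<otimes>\<^bsub>word_alg C A n\<^esub> \<one>\<^bsub>word_alg C A n\<^esub> = f"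
        unfolding word_one
      proof (rule W.linear_map_eqI[OF word_mult_linear(1)[OF W.single_closed[OF replicate_words]] _ word_module _ f])
        show "linear_map C (word_alg C A n) (word_alg C A n) (\<lambda>f. f)" by (rule linear_mapI) auto
      qed (use replicate_words in \<open>simp only: word_mult_linear(3) map2_one\<close>)
      then show "\<one>\<^bsub>word_alg C A n\<^esub> \<otimes>\<^bsub>word_alg C A n\<^esub> f = f"
        using word_m_comm[OF f] \<open>\<one>\<^bsub>word_alg C A n\<^esub> \<in> carrier (word_alg C A n)\<close> by simp
    qed (auto intro: word_m_closed word_m_assoc word_m_comm)
  qed (use l1 in auto)
  show "cring C" by (rule A.R_cring)
qed (use linear_mapD[OF word_mult_linear(1)] in
    \<open>auto simp: W.M.smult_l_distr W.M.smult_r_distr W.M.smult_assoc1\<close>)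

sublocale WA: algebra C "word_alg C A n" for n
  by (rule word_algebra)

section \<open>The submodule of multilinear relations\<close>

lemma tensor_ker_submodule: "submodule (tensor_ker C A n) C (word_alg C A n)"
proof -
  let ?S = "{N. submodule N C (word_alg C A n) \<and> multilinear_rels C A n \<subseteq> N}"
  have rels: "multilinear_rels C A n \<subseteq> carrier (word_alg C A n)"
    unfolding multilinear_rels_def
    by (auto intro!: W.single_closed W.M.M.minus_closed W.M.M.a_closed W.M.smult_closed)
  then have c: "carrier (word_alg C A n) \<in> ?S" using W.M.carrier_is_submodule by blast
  have sub: "submodule N C (word_alg C A n)" if "N \<in> ?S" for N using that by blast
  note E = W.M.submoduleE[OF sub]
  show ?thesis
    unfolding tensor_ker_def
  proof (rule W.M.submoduleI)
    show "\<Inter>?S \<subseteq> carrier (word_alg C A n)" using c by blast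
    show "\<zero>\<^bsub>word_alg C A n\<^esub> \<in> \<Inter>?S"
    proof
      fix N assume "N \<in> ?S"
      from subgroup.one_closed[OF submodule.axioms(1)[OF sub[OF this]]]
      show "\<zero>\<^bsub>word_alg C A n\<^esub> \<in> N" by simp
    qed
    show "\<ominus>\<^bsub>word_alg C A n\<^esub> x \<in> \<Inter>?S" if "x \<in> \<Inter>?S" for x
      using that E(3) by (intro InterI) blast
    show "x \<oplus>\<^bsub>word_alg C A n\<^esub> y \<in> \<Inter>?S" if "x \<in> \<Inter>?S" "y \<in> \<Inter>?S" for x y
      using that E(5) by (intro InterI) blast
    show "k \<odot>\<^bsub>word_alg C A n\<^esub> x \<in> \<Inter>?S" if "k \<in> carrier C" "x \<in> \<Inter>?S" for k x
      using that E(4) by (intro InterI) blast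
  qed
qed

lemma tensor_ker_closed:
  shows "tensor_ker C A n \<subseteq> carrier (word_alg C A n)"
    and "\<zero>\<^bsub>word_alg C A n\<^esub> \<in> tensor_ker C A n"
    and "x \<in> tensor_ker C A n \<Longrightarrow> y \<in> tensor_ker C A n \<Longrightarrow> x \<oplus>\<^bsub>word_alg C A n\<^esub> y \<in> tensor_ker C A n"
    and "c \<in> carrier C \<Longrightarrow> x \<in> tensor_ker C A n \<Longrightarrow> c \<odot>\<^bsub>word_alg C A n\<^esub> x \<in> tensor_ker C A n"
  using W.M.submoduleE[OF tensor_ker_submodule]
    subgroup.one_closed[OF submodule.axioms(1)[OF tensor_ker_submodule]] by auto

text \<open>Multilinearity up to \<open>K\<close>. With \<open>K\<close> zero this is a multilinear
  map in the usual sense; with \<open>K\<close> the relations of another tensor power it is what a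
  map between tensor powers requires.\<close>

definition multilinear_mod ::
  "nat \<Rightarrow> ('c, 's, 'y) module_scheme \<Rightarrow> 's set \<Rightarrow> ('a list \<Rightarrow> 's) \<Rightarrow> bool" where
  "multilinear_mod n N K \<phi> \<longleftrightarrow> (\<forall>u v. set u \<subseteq> carrier A \<and> set v \<subseteq> carrier A \<and> length u + 1 + length v = n \<longrightarrow>
     (\<forall>a\<in>carrier A. \<forall>b\<in>carrier A. \<phi> (u @ [a \<oplus>\<^bsub>A\<^esub> b] @ v) \<ominus>\<^bsub>N\<^esub> (\<phi> (u @ [a] @ v) \<oplus>\<^bsub>N\<^esub> \<phi> (u @ [b] @ v)) \<in> K) \<and>
     (\<forall>c\<in>carrier C. \<forall>a\<in>carrier A. \<phi> (u @ [c \<odot>\<^bsub>A\<^esub> a] @ v) \<ominus>\<^bsub>N\<^esub> c \<odot>\<^bsub>N\<^esub> \<phi> (u @ [a] @ v) \<in> K))"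

text \<open>The universal property of the tensor power: the preimage of \<open>K\<close> is a
  submodule containing the generating relations.\<close>

lemma tensor_ker_image:
  assumes L: "linear_map C (word_alg C A n) N L" and N: "module C N" and K: "submodule K C N"
    and ml: "multilinear_mod n N K (\<lambda>w. L (single C w))" and x: "x \<in> tensor_ker C A n"
  shows "L x \<in> K"
proof -
  interpret N: module C N by (rule N)
  note KE = N.submoduleE[OF K]
  let ?N = "{x \<in> carrier (word_alg C A n). L x \<in> K}"
  have K0: "\<zero>\<^bsub>N\<^esub> \<in> K" using subgroup.one_closed[OF submodule.axioms(1)[OF K]] by simp
  have Lm: "L (\<ominus>\<^bsub>word_alg C A n\<^esub> x) = \<ominus>\<^bsub>N\<^esub> L x" if "x \<in> carrier (word_alg C A n)" for x
    using linear_map_minus[OF L word_module N, of "\<zero>\<^bsub>word_alg C A n\<^esub>" x] that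
      linear_map_zero[OF L word_module N] linear_mapD(1)[OF L that]
    by (simp add: W.M.M.minus_eq N.M.minus_eq)
  have "submodule ?N C (word_alg C A n)"
    by (rule W.M.submoduleI)
       (use KE K0 linear_mapD[OF L] Lm in \<open>auto simp: linear_map_zero[OF L word_module N]\<close>)
  moreover have "multilinear_rels C A n \<subseteq> ?N"
  proof
    fix r assume "r \<in> multilinear_rels C A n"
    then consider u a b v where "r = single C (u @ [a \<oplus>\<^bsub>A\<^esub> b] @ v) \<ominus>\<^bsub>word_alg C A n\<^esub>
        (single C (u @ [a] @ v) \<oplus>\<^bsub>word_alg C A n\<^esub> single C (u @ [b] @ v))"
        "set u \<subseteq> carrier A" "a \<in> carrier A" "b \<in> carrier A" "set v \<subseteq> carrier A" "length u + 1 + length v = n"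
      | u c a v where "r = single C (u @ [c \<odot>\<^bsub>A\<^esub> a] @ v) \<ominus>\<^bsub>word_alg C A n\<^esub>
        (c \<odot>\<^bsub>word_alg C A n\<^esub> single C (u @ [a] @ v))"
        "set u \<subseteq> carrier A" "c \<in> carrier C" "a \<in> carrier A" "set v \<subseteq> carrier A" "length u + 1 + length v = n"
      unfolding multilinear_rels_def by blast
    then show "r \<in> ?N"
    proof cases
      case 1
      then have w: "u @ [a \<oplus>\<^bsub>A\<^esub> b] @ v \<in> words A n" "u @ [a] @ v \<in> words A n" "u @ [b] @ v \<in> words A n"
        by auto
      note s = W.single_closed[OF w(1)] W.single_closed[OF w(2)] W.single_closed[OF w(3)]
      have "L r = L (single C (u @ [a \<oplus>\<^bsub>A\<^esub> b] @ v)) \<ominus>\<^bsub>N\<^esub>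
          (L (single C (u @ [a] @ v)) \<oplus>\<^bsub>N\<^esub> L (single C (u @ [b] @ v)))"
        unfolding 1(1) linear_map_minus[OF L word_module N s(1) W.M.M.a_closed[OF s(2,3)]]
          linear_mapD(2)[OF L s(2,3)] ..
      also have "\<dots> \<in> K" using ml 1(2-) unfolding multilinear_mod_def by blast
      finally have "L r \<in> K" .
      moreover have "r \<in> carrier (word_alg C A n)"
        unfolding 1(1) by (rule W.M.M.minus_closed[OF s(1) W.M.M.a_closed[OF s(2,3)]])
      ultimately show ?thesis by simp
    next
      case 2
      then have w: "u @ [c \<odot>\<^bsub>A\<^esub> a] @ v \<in> words A n" "u @ [a] @ v \<in> words A n" by auto
      note s = W.single_closed[OF w(1)] W.single_closed[OF w(2)]
      have "L r = L (single C (u @ [c \<odot>\<^bsub>A\<^esub> a] @ v)) \<ominus>\<^bsub>N\<^esub> c \<odot>\<^bsub>N\<^esub> L (single C (u @ [a] @ v))"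
        unfolding 2(1) linear_map_minus[OF L word_module N s(1) W.M.smult_closed[OF 2(3) s(2)]]
          linear_mapD(3)[OF L 2(3) s(2)] ..
      also have "\<dots> \<in> K" using ml 2(2-) unfolding multilinear_mod_def by blast
      finally have "L r \<in> K" .
      moreover have "r \<in> carrier (word_alg C A n)"
        unfolding 2(1) by (rule W.M.M.minus_closed[OF s(1) W.M.smult_closed[OF 2(3) s(2)]])
      ultimately show ?thesis by simp
    qed
  qed
  ultimately show ?thesis using x unfolding tensor_ker_def by blast
qed

lemma rels_mem_ker: "r \<in> multilinear_rels C A n \<Longrightarrow> r \<in> tensor_ker C A n"
  by (auto simp: tensor_ker_def)

text \<open>A word map with this property depends on each letter of its argument through one letter of its
  value, and linearly so.\<close>

definition letterwise_linear :: "nat \<Rightarrow> nat \<Rightarrow> ('a list \<Rightarrow> 'a list) \<Rightarrow> bool" where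
  "letterwise_linear n n' h \<longleftrightarrow> h \<in> words A n \<rightarrow> words A n' \<and>
    (\<forall>u v. set u \<subseteq> carrier A \<and> set v \<subseteq> carrier A \<and> length u + 1 + length v = n \<longrightarrow>
      (\<exists>u' v' g. set u' \<subseteq> carrier A \<and> set v' \<subseteq> carrier A \<and> length u' + 1 + length v' = n' \<and>
        linear_map C A A g \<and> (\<forall>a\<in>carrier A. h (u @ [a] @ v) = u' @ [g a] @ v')))"

text \<open>Varying one letter of the argument varies one letter of the value linearly, so a
  generating relation goes to a generating relation.\<close>

lemma lin_ext_tensor_ker:
  assumes h: "letterwise_linear n n' h" and x: "x \<in> tensor_ker C A n"
  shows "lin_ext C h x \<in> tensor_ker C A n'"
proof (rule tensor_ker_image[where L = "lin_ext C h", OF _ word_module tensor_ker_submodule _ x])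
  have hw: "h \<in> words A n \<rightarrow> words A n'" using h by (simp add: letterwise_linear_def)
  note L = lin_ext_linear[OF word_free word_free hw]
  show "linear_map C (word_alg C A n) (word_alg C A n') (lin_ext C h)" by (rule L)
  show "multilinear_mod n (word_alg C A n') (tensor_ker C A n') (\<lambda>w. lin_ext C h (single C w))"
    unfolding multilinear_mod_def
  proof (intro allI impI)
    fix u v assume uv: "set u \<subseteq> carrier A \<and> set v \<subseteq> carrier A \<and> length u + 1 + length v = n"
    then obtain u' v' g where g: "set u' \<subseteq> carrier A" "set v' \<subseteq> carrier A" "length u' + 1 + length v' = n'"
      "linear_map C A A g" "\<forall>a\<in>carrier A. h (u @ [a] @ v) = u' @ [g a] @ v'"
      using h uv unfolding letterwise_linear_def by blast
    note gD = linear_mapD[OF g(4)]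
    have L': "lin_ext C h (single C (u @ [a] @ v)) = single C (u' @ [g a] @ v')" if "a \<in> carrier A" for a
      using L(2)[of "u @ [a] @ v"] uv that g(5) by auto
    show "(\<forall>a\<in>carrier A. \<forall>b\<in>carrier A.
         lin_ext C h (single C (u @ [a \<oplus>\<^bsub>A\<^esub> b] @ v)) \<ominus>\<^bsub>word_alg C A n'\<^esub>
         (lin_ext C h (single C (u @ [a] @ v)) \<oplus>\<^bsub>word_alg C A n'\<^esub> lin_ext C h (single C (u @ [b] @ v)))
         \<in> tensor_ker C A n') \<and>
      (\<forall>c\<in>carrier C. \<forall>a\<in>carrier A. lin_ext C h (single C (u @ [c \<odot>\<^bsub>A\<^esub> a] @ v)) \<ominus>\<^bsub>word_alg C A n'\<^esub>
         c \<odot>\<^bsub>word_alg C A n'\<^esub> lin_ext C h (single C (u @ [a] @ v)) \<in> tensor_ker C A n')"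
    proof (intro conjI ballI; rule rels_mem_ker)
      fix a b assume "a \<in> carrier A" "b \<in> carrier A"
      then show "lin_ext C h (single C (u @ [a \<oplus>\<^bsub>A\<^esub> b] @ v)) \<ominus>\<^bsub>word_alg C A n'\<^esub>
         (lin_ext C h (single C (u @ [a] @ v)) \<oplus>\<^bsub>word_alg C A n'\<^esub> lin_ext C h (single C (u @ [b] @ v)))
         \<in> multilinear_rels C A n'"
        unfolding multilinear_rels_def L'[OF \<open>a \<in> carrier A\<close>] L'[OF \<open>b \<in> carrier A\<close>]
          L'[OF A.M.a_closed[OF \<open>a \<in> carrier A\<close> \<open>b \<in> carrier A\<close>]] gD(2)[OF \<open>a \<in> carrier A\<close> \<open>b \<in> carrier A\<close>]
        using g(1-3) gD(1) by blast
    next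
      fix c a assume ca: "c \<in> carrier C" "a \<in> carrier A"
      then show "lin_ext C h (single C (u @ [c \<odot>\<^bsub>A\<^esub> a] @ v)) \<ominus>\<^bsub>word_alg C A n'\<^esub>
         c \<odot>\<^bsub>word_alg C A n'\<^esub> lin_ext C h (single C (u @ [a] @ v)) \<in> multilinear_rels C A n'"
        unfolding multilinear_rels_def L'[OF ca(2)] L'[OF A.smult_closed[OF ca]] gD(3)[OF ca]
        using g(1-3) gD(1) by blast
    qed
  qed
qed

lemma mult_single_tensor_ker:
  assumes w: "w \<in> words A n" and x: "x \<in> tensor_ker C A n"
  shows "x \<otimes>\<^bsub>word_alg C A n\<^esub> single C w \<in> tensor_ker C A n"
proof -
  let ?h = "\<lambda>u. map2 (mult A) u w"
  have h: "?h \<in> words A n \<rightarrow> words A n" using map2_words[OF _ w] by blast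
  have "letterwise_linear n n ?h"
    unfolding letterwise_linear_def
  proof (intro conjI h allI impI)
    fix u v assume uv: "set u \<subseteq> carrier A \<and> set v \<subseteq> carrier A \<and> length u + 1 + length v = n"
    \<comment> \<open>\<open>w\<close> is cut at the place of the varying letter; \<open>c\<close>
      is the factor which that letter meets, and the other letters contribute constant
      products.\<close>
    define w1 c w2 where "w1 = take (length u) w" and "c = w ! length u" and "w2 = drop (Suc (length u)) w"
    have wc: "w = w1 @ [c] @ w2"
      using uv w by (simp add: w1_def c_def w2_def id_take_nth_drop[symmetric])
    have l: "length w1 = length u" "length w2 = length v" using uv w by (auto simp: w1_def w2_def)
    have c: "set w1 \<subseteq> carrier A" "set w2 \<subseteq> carrier A" "c \<in> carrier A" using w by (auto simp: wc)
    have "linear_map C A A (\<lambda>a. a \<otimes>\<^bsub>A\<^esub> c)"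
      by (rule linear_mapI) (use c in \<open>auto simp: A.l_distr A.smult_assoc2\<close>)
    moreover have "?h (u @ [a] @ v) = ?h u @ [a \<otimes>\<^bsub>A\<^esub> c] @ map2 (mult A) v w2" if "a \<in> carrier A" for a
      using zip_append2[of u w1 "c # w2"] l by (simp add: wc)
    moreover have "set (?h u) \<subseteq> carrier A" using uv w by (intro map2_closed) auto
    moreover have "set (map2 (mult A) v w2) \<subseteq> carrier A" using uv c by (intro map2_closed) auto
    moreover have "?h u = map2 (mult A) u w1" using zip_append2[of u w1 "c # w2"] l by (simp add: wc)
    ultimately show "\<exists>u' v' g. set u' \<subseteq> carrier A \<and> set v' \<subseteq> carrier A \<and> length u' + 1 + length v' = n \<and>
        linear_map C A A g \<and> (\<forall>a\<in>carrier A. ?h (u @ [a] @ v) = u' @ [g a] @ v')"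
      using uv l by (intro exI[of _ "?h u"] exI[of _ "map2 (mult A) v w2"] exI[of _ "\<lambda>a. a \<otimes>\<^bsub>A\<^esub> c"]) simp
  qed
  then have "lin_ext C ?h x \<in> tensor_ker C A n" using x by (rule lin_ext_tensor_ker)
  moreover have "x \<otimes>\<^bsub>word_alg C A n\<^esub> single C w = lin_ext C ?h x"
  proof (rule W.linear_map_eqI[OF word_mult_linear(1)[OF W.single_closed[OF w]]
        lin_ext_linear(1)[OF word_free word_free h] word_module])
    show "x \<in> carrier (word_alg C A n)" using x tensor_ker_closed(1) by blast
  qed (use w in \<open>simp only: word_mult_linear(3) lin_ext_linear(2)[OF word_free word_free h]\<close>)
  ultimately show ?thesis by simp
qed

text \<open>Multiplication by one word preserves the relations, and a general multiplier is a
  combination of words.\<close>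

lemma tensor_ker_ideal: "ideal (tensor_ker C A n) (word_alg C A n)"
proof (rule WA.idealI')
  fix x y assume x: "x \<in> tensor_ker C A n" and y: "y \<in> carrier (word_alg C A n)"
  have xc: "x \<in> carrier (word_alg C A n)" using x tensor_ker_closed(1) by blast
  show "y \<otimes>\<^bsub>word_alg C A n\<^esub> x \<in> tensor_ker C A n"
    using y
  proof (induction rule: W.free_induct)
    case zero
    then show ?case using xc tensor_ker_closed by simp
  next
    case (step c w f)
    have s: "single C w \<in> carrier (word_alg C A n)" using step by (intro W.single_closed)
    have "single C w \<otimes>\<^bsub>word_alg C A n\<^esub> x \<in> tensor_ker C A n"
      using mult_single_tensor_ker[OF step(2) x] WA.m_comm[OF s xc] by simp
    then have "c \<odot>\<^bsub>word_alg C A n\<^esub> (single C w \<otimes>\<^bsub>word_alg C A n\<^esub> x) \<oplus>\<^bsub>word_alg C A n\<^esub>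
      f \<otimes>\<^bsub>word_alg C A n\<^esub> x \<in> tensor_ker C A n"
      using step tensor_ker_closed by blast
    then show ?case using step s xc by (simp add: WA.l_distr WA.smult_assoc2)
  qed
qed (use tensor_ker_closed in auto)

sublocale K: ideal "tensor_ker C A n" "word_alg C A n" for n
  by (rule tensor_ker_ideal)

lemma tensor_pow_algebra: "algebra C (tensor_pow C A n)"
  unfolding tensor_pow_def by (rule quot_alg_algebra[OF word_algebra tensor_ker_ideal])

abbreviation tcoset :: "nat \<Rightarrow> ('a list \<Rightarrow> 'c) \<Rightarrow> ('a list \<Rightarrow> 'c) set" where
  "tcoset n x \<equiv> tensor_ker C A n +>\<^bsub>word_alg C A n\<^esub> x"

lemma tensor_pow_simps:
  shows "carrier (tensor_pow C A n) = tcoset n ` carrier (word_alg C A n)"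
    and "zero (tensor_pow C A n) = tensor_ker C A n"
    and "one (tensor_pow C A n) = tcoset n \<one>\<^bsub>word_alg C A n\<^esub>"
    and "x \<in> carrier (word_alg C A n) \<Longrightarrow> y \<in> carrier (word_alg C A n) \<Longrightarrow>
      tcoset n x \<oplus>\<^bsub>tensor_pow C A n\<^esub> tcoset n y = tcoset n (x \<oplus>\<^bsub>word_alg C A n\<^esub> y)"
    and "x \<in> carrier (word_alg C A n) \<Longrightarrow> y \<in> carrier (word_alg C A n) \<Longrightarrow>
      tcoset n x \<otimes>\<^bsub>tensor_pow C A n\<^esub> tcoset n y = tcoset n (x \<otimes>\<^bsub>word_alg C A n\<^esub> y)"
    and "c \<in> carrier C \<Longrightarrow> x \<in> carrier (word_alg C A n) \<Longrightarrow>
      c \<odot>\<^bsub>tensor_pow C A n\<^esub> tcoset n x = tcoset n (c \<odot>\<^bsub>word_alg C A n\<^esub> x)"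
  unfolding tensor_pow_def
  using quot_alg_simps[OF tensor_ker_ideal] quot_alg_smult[OF word_algebra tensor_ker_ideal] by auto

lemma tensor_map_coset:
  assumes h: "letterwise_linear n n' h" and x: "x \<in> carrier (word_alg C A n)"
  shows "tensor_map C A n' h (tcoset n x) = tcoset n' (lin_ext C h x)"
proof -
  have hw: "h \<in> words A n \<rightarrow> words A n'" using h by (simp add: letterwise_linear_def)
  note L = linear_mapD[OF lin_ext_linear(1)[OF word_free word_free hw]]
  show ?thesis
    unfolding tensor_map_def
    by (rule coset_map_coset[OF tensor_ker_ideal tensor_ker_ideal x])
       (use L lin_ext_tensor_ker[OF h] in auto)
qed

end

section \<open>The direct limit of the tensor powers\<close>

context tensor_base
begin

abbreviation pad :: "nat \<Rightarrow> 'a list \<Rightarrow> 'a list" where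
  "pad d w \<equiv> w @ replicate d \<one>\<^bsub>A\<^esub>"

lemma pad_letterwise: "letterwise_linear n (n + d) (pad d)"
  unfolding letterwise_linear_def
proof (intro conjI allI impI)
  fix u v assume "set u \<subseteq> carrier A \<and> set v \<subseteq> carrier A \<and> length u + 1 + length v = n"
  moreover have "linear_map C A A (\<lambda>a. a)" by (rule linear_mapI) auto
  ultimately show "\<exists>u' v' g. set u' \<subseteq> carrier A \<and> set v' \<subseteq> carrier A \<and> length u' + 1 + length v' = n + d \<and>
      linear_map C A A g \<and> (\<forall>a\<in>carrier A. pad d (u @ [a] @ v) = u' @ [g a] @ v')"
    by (intro exI[of _ u] exI[of _ "pad d v"] exI[of _ "\<lambda>a. a"]) auto
qed auto

lemma pad_words: "pad d \<in> words A n \<rightarrow> words A (n + d)"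
  using pad_letterwise by (simp add: letterwise_linear_def)

lemma pad_linear:
  shows "linear_map C (word_alg C A n) (word_alg C A (n + d)) (lin_ext C (pad d))"
    and "w \<in> words A n \<Longrightarrow> lin_ext C (pad d) (single C w) = single C (pad d w)"
  using lin_ext_linear[OF word_free word_free pad_words] by auto

lemma lin_ext_ident:
  assumes "\<And>w. w \<in> words A n \<Longrightarrow> h w = w" and "x \<in> carrier (word_alg C A n)"
  shows "lin_ext C h x = x"
proof -
  have h: "h \<in> words A n \<rightarrow> words A n" using assms(1) by auto
  show ?thesis
  proof (rule W.linear_map_eqI[OF lin_ext_linear(1)[OF word_free word_free h] _ word_module _ assms(2)])
    show "linear_map C (word_alg C A n) (word_alg C A n) (\<lambda>x. x)" by (rule linear_mapI) auto
    show "lin_ext C h (single C w) = single C w" if "w \<in> words A n" for w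
      using lin_ext_linear(2)[OF word_free word_free h that] assms(1)[OF that] by simp
  qed
qed

lemma lin_ext_lin_ext:
  assumes h: "h \<in> words A n \<rightarrow> words A n'" and h': "h' \<in> words A n' \<rightarrow> words A n''"
    and x: "x \<in> carrier (word_alg C A n)"
  shows "lin_ext C h' (lin_ext C h x) = lin_ext C (\<lambda>w. h' (h w)) x"
proof -
  have hh: "(\<lambda>w. h' (h w)) \<in> words A n \<rightarrow> words A n''" using h h' by blast
  note L = lin_ext_linear[OF word_free word_free h] and L' = lin_ext_linear[OF word_free word_free h']
  note L'' = lin_ext_linear[OF word_free word_free hh]
  show ?thesis
  proof (rule W.linear_map_eqI[OF linear_map_comp[OF L(1) L'(1)] L''(1) word_module _ x])
    show "lin_ext C h' (lin_ext C h (single C w)) = lin_ext C (\<lambda>w. h' (h w)) (single C w)"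
      if w: "w \<in> words A n" for w
    proof -
      have "h w \<in> words A n'" using h w by blast
      then show ?thesis using L(2)[OF w] L'(2) L''(2)[OF w] by simp
    qed
  qed
qed

lemma pad_pad:
  "x \<in> carrier (word_alg C A n) \<Longrightarrow>
    lin_ext C (pad e) (lin_ext C (pad d) x) = lin_ext C (pad (d + e)) x"
  by (subst lin_ext_lin_ext[OF pad_words pad_words]) (simp_all add: replicate_add)

lemma pad_closed:
  "x \<in> carrier (word_alg C A n) \<Longrightarrow> lin_ext C (pad d) x \<in> carrier (word_alg C A (n + d))"
  by (rule linear_mapD(1)[OF pad_linear(1)])

lemma pad_mult:
  assumes x: "x \<in> carrier (word_alg C A n)" and y: "y \<in> carrier (word_alg C A n)"
  shows "lin_ext C (pad d) (x \<otimes>\<^bsub>word_alg C A n\<^esub> y) =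
    lin_ext C (pad d) x \<otimes>\<^bsub>word_alg C A (n + d)\<^esub> lin_ext C (pad d) y"
proof (rule W.linear_map_eqI[OF linear_map_comp[OF word_mult_linear(1)[OF y] pad_linear(1)]
      linear_map_comp[OF pad_linear(1) word_mult_linear(1)[OF pad_closed[OF y]]] word_module _ x])
  fix u assume u: "u \<in> words A n"
  note su = W.single_closed[OF u]
  show "lin_ext C (pad d) (single C u \<otimes>\<^bsub>word_alg C A n\<^esub> y) =
    lin_ext C (pad d) (single C u) \<otimes>\<^bsub>word_alg C A (n + d)\<^esub> lin_ext C (pad d) y"
  proof (rule W.linear_map_eqI[OF linear_map_comp[OF word_mult_linear(2)[OF su] pad_linear(1)]
        linear_map_comp[OF pad_linear(1) word_mult_linear(2)[OF pad_closed[OF su]]] word_module _ y])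
    fix v assume v: "v \<in> words A n"
    have pu: "pad d u \<in> words A (n + d)" and pv: "pad d v \<in> words A (n + d)" using u v by auto
    have "map2 (mult A) (pad d u) (pad d v) = pad d (map2 (mult A) u v)"
      using u v by (simp add: zip_replicate map_replicate)
    then show "lin_ext C (pad d) (single C u \<otimes>\<^bsub>word_alg C A n\<^esub> single C v) =
        lin_ext C (pad d) (single C u) \<otimes>\<^bsub>word_alg C A (n + d)\<^esub> lin_ext C (pad d) (single C v)"
      using pad_linear(2)[OF map2_words[OF u v]]
      by (simp only: word_mult_linear(3)[OF u v] pad_linear(2)[OF u] pad_linear(2)[OF v]
          word_mult_linear(3)[OF pu pv])
  qed
qed

lemma pad_one: "lin_ext C (pad d) \<one>\<^bsub>word_alg C A n\<^esub> = \<one>\<^bsub>word_alg C A (n + d)\<^esub>"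
  unfolding word_one using pad_linear(2)[OF replicate_words[of n]] by (simp add: replicate_add)

text \<open>Multiplying the last two letters retracts the padding.\<close>

definition merge_last :: "'a list \<Rightarrow> 'a list" where
  "merge_last w = butlast (butlast w) @ [last (butlast w) \<otimes>\<^bsub>A\<^esub> last w]"

lemma merge_last_snoc: "merge_last (w @ [a, b]) = w @ [a \<otimes>\<^bsub>A\<^esub> b]"
  by (simp add: merge_last_def butlast_append)

lemma merge_last_words: "merge_last \<in> words A (Suc (Suc n)) \<rightarrow> words A (Suc n)"
proof
  fix w assume w: "w \<in> words A (Suc (Suc n))"
  then obtain a b w' where "w = w' @ [a, b]"
    by (auto simp: length_Suc_conv_rev)
  then show "merge_last w \<in> words A (Suc n)" using w by (auto simp: merge_last_snoc)
qed

lemma merge_last_letterwise: "letterwise_linear (Suc (Suc n)) (Suc n) merge_last"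
  unfolding letterwise_linear_def
proof (intro conjI merge_last_words allI impI)
  fix u v assume uv: "set u \<subseteq> carrier A \<and> set v \<subseteq> carrier A \<and> length u + 1 + length v = Suc (Suc n)"
  let ?goal = "\<exists>u' v' g. set u' \<subseteq> carrier A \<and> set v' \<subseteq> carrier A \<and> length u' + 1 + length v' = Suc n \<and>
      linear_map C A A g \<and> (\<forall>a\<in>carrier A. merge_last (u @ [a] @ v) = u' @ [g a] @ v')"
  \<comment> \<open>The merged letters are the last two, so the varying letter becomes the right
    factor, the left factor, or stays untouched.\<close>
  consider "v = []" | q where "v = [q]" | v' p q where "v = v' @ [p, q]"
    by (metis append_Cons append_Nil append_assoc rev_exhaust)
  then show ?goal
  proof cases
    case 1
    then obtain u' p where u: "u = u' @ [p]" using uv by (cases u rule: rev_cases) auto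
    have "linear_map C A A (\<lambda>a. p \<otimes>\<^bsub>A\<^esub> a)"
      by (rule linear_mapI) (use uv u in \<open>auto simp: A.r_distr A.smult_assoc2'\<close>)
    then show ?thesis using uv u 1
      by (intro exI[of _ u'] exI[of _ "[]"] exI[of _ "\<lambda>a. p \<otimes>\<^bsub>A\<^esub> a"]) (auto simp: merge_last_snoc)
  next
    case 2
    have "linear_map C A A (\<lambda>a. a \<otimes>\<^bsub>A\<^esub> q)"
      by (rule linear_mapI) (use uv 2 in \<open>auto simp: A.l_distr A.smult_assoc2\<close>)
    then show ?thesis using uv 2
      by (intro exI[of _ u] exI[of _ "[]"] exI[of _ "\<lambda>a. a \<otimes>\<^bsub>A\<^esub> q"]) (auto simp: merge_last_snoc)
  next
    case 3
    have "linear_map C A A (\<lambda>a. a)" by (rule linear_mapI) auto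
    moreover have "merge_last (u @ [a] @ v) = u @ [a] @ (v' @ [p \<otimes>\<^bsub>A\<^esub> q])" for a
      using merge_last_snoc[of "u @ [a] @ v'" p q] 3 by simp
    ultimately show ?thesis using uv 3
      by (intro exI[of _ u] exI[of _ "v' @ [p \<otimes>\<^bsub>A\<^esub> q]"] exI[of _ "\<lambda>a. a"]) auto
  qed
qed

text \<open>Multiplying the last letter by an appended one gives it back, so each transition map has
  a left inverse that respects the relations; \<open>1 \<le> n\<close> provides the letter to merge
  with. Hence the tensor powers embed in their direct limit, which later allows entries of sequences
  to detect relations.\<close>

lemma pad_tensor_ker_iff:
  assumes x: "x \<in> carrier (word_alg C A n)" and "1 \<le> n"
  shows "lin_ext C (pad d) x \<in> tensor_ker C A (n + d) \<longleftrightarrow> x \<in> tensor_ker C A n"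
proof
  show "lin_ext C (pad d) x \<in> tensor_ker C A (n + d)" if "x \<in> tensor_ker C A n"
    by (rule lin_ext_tensor_ker[OF pad_letterwise that])
  show "x \<in> tensor_ker C A n" if "lin_ext C (pad d) x \<in> tensor_ker C A (n + d)"
    using that
  proof (induction d)
    case 0
    then show ?case using lin_ext_ident[of n "pad 0" x] x by simp
  next
    case (Suc d)
    obtain k where k: "n + d = Suc k" using \<open>1 \<le> n\<close> by (cases "n + d") auto
    have "lin_ext C merge_last (lin_ext C (pad (Suc d)) x) \<in> tensor_ker C A (n + d)"
      using lin_ext_tensor_ker[OF merge_last_letterwise] Suc.prems k by simp
    moreover have "lin_ext C merge_last (lin_ext C (pad (Suc d)) x) = lin_ext C (pad d) x"
    proof -
      have "lin_ext C (pad (Suc d)) x = lin_ext C (pad 1) (lin_ext C (pad d) x)"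
        using pad_pad[OF x, of 1 d] by simp
      moreover have y: "lin_ext C (pad d) x \<in> carrier (word_alg C A (Suc k))" using pad_closed[OF x] k by metis
      moreover have p: "pad 1 \<in> words A (Suc k) \<rightarrow> words A (Suc (Suc k))" by auto
      moreover have "lin_ext C (\<lambda>w. merge_last (pad 1 w)) (lin_ext C (pad d) x) = lin_ext C (pad d) x"
      proof (rule lin_ext_ident[OF _ y])
        fix w assume w: "w \<in> words A (Suc k)"
        then obtain w' a where "w = w' @ [a]" by (cases w rule: rev_cases) auto
        then show "merge_last (pad 1 w) = w" using merge_last_snoc[of w' a "\<one>\<^bsub>A\<^esub>"] w by simp
      qed
      ultimately show ?thesis using lin_ext_lin_ext[OF p merge_last_words y] by (simp only:)
    qed
    ultimately show ?case using Suc.IH by simp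
  qed
qed

section \<open>Classes of the direct limit and their representatives\<close>

lemma tensor_lift_coset:
  "x \<in> carrier (word_alg C A n) \<Longrightarrow>
    tensor_lift C A n d (tcoset n x) = tcoset (n + d) (lin_ext C (pad d) x)"
proof (induction d)
  case 0
  then show ?case using lin_ext_ident[of n "pad 0" x] by simp
next
  case (Suc d)
  show ?case
    using Suc tensor_map_coset[OF pad_letterwise[of "n + d" 1] pad_closed[OF Suc.prems, of d]]
      pad_pad[OF Suc.prems, of 1 d]
    by simp
qed

lemma tensor_lift_add: "tensor_lift C A m (d + e) X = tensor_lift C A (m + d) e (tensor_lift C A m d X)"
  by (induction e) (auto simp: add.assoc)

abbreviation dirlim_dom :: "(nat \<times> ('a list \<Rightarrow> 'c) set) set" where
  "dirlim_dom \<equiv> SIGMA n:{1..}. carrier (tensor_pow C A n)"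

lemma dirlim_equiv: "equiv dirlim_dom (dirlim_rel C A)"
proof (rule equivI)
  show "dirlim_rel C A \<subseteq> dirlim_dom \<times> dirlim_dom" by (auto simp: dirlim_rel_def)
  show "refl_on dirlim_dom (dirlim_rel C A)" by (auto simp: refl_on_def dirlim_rel_def)
  show "sym (dirlim_rel C A)" by (rule symI) (auto simp: dirlim_rel_def)
  show "trans (dirlim_rel C A)"
  proof (rule transI)
    fix p q r assume "(p, q) \<in> dirlim_rel C A" and "(q, r) \<in> dirlim_rel C A"
    then obtain m X n Y i Z k k' where pqr: "p = (m, X)" "q = (n, Y)" "r = (i, Z)"
      and 1: "1 \<le> m" "1 \<le> n" "1 \<le> i" "X \<in> carrier (tensor_pow C A m)" "Y \<in> carrier (tensor_pow C A n)"
        "Z \<in> carrier (tensor_pow C A i)"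
      and k: "m \<le> k" "n \<le> k" "tensor_lift C A m (k - m) X = tensor_lift C A n (k - n) Y"
      and k': "n \<le> k'" "i \<le> k'" "tensor_lift C A n (k' - n) Y = tensor_lift C A i (k' - i) Z"
      unfolding dirlim_rel_def by auto
    \<comment> \<open>Both equalities are lifted to a common level, where they can be
      chained.\<close>
    let ?K = "max k k'"
    have s: "tensor_lift C A j (?K - j) U = tensor_lift C A h (?K - h) (tensor_lift C A j (h - j) U)"
      if "j \<le> h" "h \<le> ?K" for j h U
    proof -
      have "?K - j = (h - j) + (?K - h)" "j + (h - j) = h" using that by auto
      then show ?thesis using tensor_lift_add[of j "h - j" "?K - h" U] by simp
    qed
    have "tensor_lift C A m (?K - m) X = tensor_lift C A k (?K - k) (tensor_lift C A m (k - m) X)"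
      by (rule s) (use k in auto)
    also have "\<dots> = tensor_lift C A k (?K - k) (tensor_lift C A n (k - n) Y)" by (simp only: k)
    also have "\<dots> = tensor_lift C A n (?K - n) Y" by (rule s[symmetric]) (use k in auto)
    also have "\<dots> = tensor_lift C A k' (?K - k') (tensor_lift C A n (k' - n) Y)"
      by (rule s) (use k' in auto)
    also have "\<dots> = tensor_lift C A k' (?K - k') (tensor_lift C A i (k' - i) Z)" by (simp only: k')
    also have "\<dots> = tensor_lift C A i (?K - i) Z" by (rule s[symmetric]) (use k' in auto)
    finally show "(p, r) \<in> dirlim_rel C A"
      using 1 k k' unfolding dirlim_rel_def pqr by (auto intro!: exI[of _ ?K])
  qed
qed

text \<open>The canonical map from a tensor power to the limit, already composed with the quotient
  map from combinations of words, so that calculations in the limit rarely mention cosets.\<close>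

definition iota :: "nat \<Rightarrow> ('a list \<Rightarrow> 'c) \<Rightarrow> (nat \<times> ('a list \<Rightarrow> 'c) set) set" where
  "iota n x = dirlim_class C A n (tcoset n x)"

lemma tcoset_carrier: "x \<in> carrier (word_alg C A n) \<Longrightarrow> tcoset n x \<in> carrier (tensor_pow C A n)"
  by (simp add: tensor_pow_simps)

lemma dirlim_class_eq_iff:
  assumes "1 \<le> m" "1 \<le> n" "x \<in> carrier (word_alg C A m)" "y \<in> carrier (word_alg C A n)"
  shows "iota m x = iota n y \<longleftrightarrow> (\<exists>k. m \<le> k \<and> n \<le> k \<and>
    tcoset k (lin_ext C (pad (k - m)) x) = tcoset k (lin_ext C (pad (k - n)) y))"
proof -
  have "(m, tcoset m x) \<in> dirlim_dom" "(n, tcoset n y) \<in> dirlim_dom" using assms by (auto simp: tcoset_carrier)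
  then have "iota m x = iota n y \<longleftrightarrow> ((m, tcoset m x), (n, tcoset n y)) \<in> dirlim_rel C A"
    unfolding iota_def dirlim_class_def by (rule eq_equiv_class_iff[OF dirlim_equiv])
  also have "\<dots> \<longleftrightarrow> (\<exists>k. m \<le> k \<and> n \<le> k \<and>
    tcoset k (lin_ext C (pad (k - m)) x) = tcoset k (lin_ext C (pad (k - n)) y))"
    using assms by (auto simp: dirlim_rel_def tcoset_carrier tensor_lift_coset)
  finally show ?thesis .
qed

text \<open>The limit identifies elements that agree at some later level; injectivity of the
  transition maps brings this back to level \<open>n\<close>.\<close>

lemma iota_eq_iff:
  assumes n: "1 \<le> n" and x: "x \<in> carrier (word_alg C A n)" and y: "y \<in> carrier (word_alg C A n)"
  shows "iota n x = iota n y \<longleftrightarrow> tcoset n x = tcoset n y"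
proof -
  have "tcoset k (lin_ext C (pad (k - n)) x) = tcoset k (lin_ext C (pad (k - n)) y) \<longleftrightarrow> tcoset n x = tcoset n y"
    if "n \<le> k" for k
  proof -
    obtain d where k: "k = n + d" using \<open>n \<le> k\<close> le_Suc_ex by blast
    have "lin_ext C (pad d) (x \<ominus>\<^bsub>word_alg C A n\<^esub> y) =
      lin_ext C (pad d) x \<ominus>\<^bsub>word_alg C A (n + d)\<^esub> lin_ext C (pad d) y"
      by (rule linear_map_minus[OF pad_linear(1) word_module word_module x y])
    then show ?thesis
      using pad_tensor_ker_iff[of "x \<ominus>\<^bsub>word_alg C A n\<^esub> y" n d] n x y
      by (simp add: k K.rcos_eq_iff pad_closed)
  qed
  then show ?thesis using dirlim_class_eq_iff[OF n n x y] by blast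
qed

lemma iota_pad:
  assumes "1 \<le> n" and x: "x \<in> carrier (word_alg C A n)"
  shows "iota (n + d) (lin_ext C (pad d) x) = iota n x"
  using dirlim_class_eq_iff[of "n + d" n "lin_ext C (pad d) x" x] assms pad_closed[OF x]
    lin_ext_ident[of "n + d" "pad 0" "lin_ext C (pad d) x"]
  by (auto intro!: exI[of _ "n + d"])

lemma iota_carrier: "1 \<le> n \<Longrightarrow> x \<in> carrier (word_alg C A n) \<Longrightarrow> iota n x \<in> carrier (tensor_dirlim C A)"
  unfolding tensor_dirlim_def iota_def dirlim_class_def by (auto intro!: quotientI simp: tcoset_carrier)

lemma dirlim_exhaust:
  assumes "X \<in> carrier (tensor_dirlim C A)"
  obtains n x where "1 \<le> n" "x \<in> carrier (word_alg C A n)" "X = iota n x"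
  using assms by (auto simp: tensor_dirlim_def iota_def dirlim_class_def tensor_pow_simps elim!: quotientE)

lemma dirlim_exhaust_le:
  assumes "X \<in> carrier (tensor_dirlim C A)"
  obtains n where "1 \<le> n" "\<And>k. n \<le> k \<Longrightarrow> \<exists>x\<in>carrier (word_alg C A k). X = iota k x"
proof -
  obtain n x where n: "1 \<le> n" "x \<in> carrier (word_alg C A n)" "X = iota n x" using dirlim_exhaust[OF assms] .
  have "\<exists>x\<in>carrier (word_alg C A k). X = iota k x" if "n \<le> k" for k
  proof -
    obtain d where k: "k = n + d" using \<open>n \<le> k\<close> le_Suc_ex by blast
    show ?thesis using iota_pad[OF n(1,2), of d] pad_closed[OF n(2), of d] n(3) k by auto
  qed
  with n(1) show ?thesis using that by blast
qed

text \<open>The system is directed, so finitely many classes have representatives at one level, and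
  axioms of the limit become axioms of a word algebra.\<close>

lemma dirlim_exhaust3:
  assumes "X \<in> carrier (tensor_dirlim C A)" "Y \<in> carrier (tensor_dirlim C A)" "Z \<in> carrier (tensor_dirlim C A)"
  obtains n x y z where "1 \<le> n" "x \<in> carrier (word_alg C A n)" "y \<in> carrier (word_alg C A n)"
    "z \<in> carrier (word_alg C A n)" "X = iota n x" "Y = iota n y" "Z = iota n z"
proof -
  obtain a where a: "1 \<le> a" "\<And>k. a \<le> k \<Longrightarrow> \<exists>x\<in>carrier (word_alg C A k). X = iota k x"
    using dirlim_exhaust_le[OF assms(1)] by blast
  obtain b where b: "\<And>k. b \<le> k \<Longrightarrow> \<exists>x\<in>carrier (word_alg C A k). Y = iota k x"
    using dirlim_exhaust_le[OF assms(2)] by blast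
  obtain c where c: "\<And>k. c \<le> k \<Longrightarrow> \<exists>x\<in>carrier (word_alg C A k). Z = iota k x"
    using dirlim_exhaust_le[OF assms(3)] by blast
  show ?thesis
    using that[of "a + b + c"] a(1) a(2)[of "a + b + c"] b[of "a + b + c"] c[of "a + b + c"] by auto
qed

lemma mem_iotaD:
  assumes "1 \<le> n" "x \<in> carrier (word_alg C A n)" and "(m, U) \<in> iota n x"
  obtains u where "1 \<le> m" "u \<in> carrier (word_alg C A m)" "U = tcoset m u" "iota m u = iota n x"
proof -
  have r: "((n, tcoset n x), (m, U)) \<in> dirlim_rel C A" using assms(3) by (simp add: iota_def dirlim_class_def)
  then have "1 \<le> m" "U \<in> carrier (tensor_pow C A m)" by (auto simp: dirlim_rel_def)
  moreover from this obtain u where "u \<in> carrier (word_alg C A m)" "U = tcoset m u"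
    by (auto simp: tensor_pow_simps)
  moreover have "dirlim_class C A m U = iota n x"
    unfolding iota_def dirlim_class_def using equiv_class_eq[OF dirlim_equiv r] by simp
  ultimately show ?thesis using that by (simp add: iota_def)
qed

lemma iota_self: "1 \<le> n \<Longrightarrow> x \<in> carrier (word_alg C A n) \<Longrightarrow> (n, tcoset n x) \<in> iota n x"
  unfolding iota_def dirlim_class_def
  using equiv_class_self[OF dirlim_equiv, of "(n, tcoset n x)"] tcoset_carrier by auto

text \<open>\<open>dirlim_binop\<close> ranges over all representatives of both classes, each pair
  lifted to the maximum of its levels. Compatibility with padding makes every choice give the same
  class, so the union collapses.\<close>

lemma dirlim_binop_iota:
  assumes n: "1 \<le> n" and x: "x \<in> carrier (word_alg C A n)" and y: "y \<in> carrier (word_alg C A n)"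
    and wop: "\<And>k u v. u \<in> carrier (word_alg C A k) \<Longrightarrow> v \<in> carrier (word_alg C A k) \<Longrightarrow>
      wop k u v \<in> carrier (word_alg C A k) \<and> bop k (tcoset k u) (tcoset k v) = tcoset k (wop k u v)"
    and pad: "\<And>k d u v. u \<in> carrier (word_alg C A k) \<Longrightarrow> v \<in> carrier (word_alg C A k) \<Longrightarrow>
      lin_ext C (pad d) (wop k u v) = wop (k + d) (lin_ext C (pad d) u) (lin_ext C (pad d) v)"
  shows "dirlim_binop C A bop (iota n x) (iota n y) = iota n (wop n x y)"
proof -
  \<comment> \<open>Levels \<open>m\<close> and \<open>n\<close> are compared at
    \<open>m + n\<close>, where equal classes have equal cosets.\<close>
  have key: "iota m (wop m p q) = iota n (wop n x y)"
    if m: "1 \<le> m" and p: "p \<in> carrier (word_alg C A m)" "q \<in> carrier (word_alg C A m)"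
      and eq: "iota m p = iota n x" "iota m q = iota n y" for m p q
  proof -
    let ?L = "\<lambda>d. lin_ext C (pad d)"
    note c = pad_closed[OF p(1), of n] pad_closed[OF p(2), of n]
      pad_closed[OF x, of m, unfolded add.commute[of n m]] pad_closed[OF y, of m, unfolded add.commute[of n m]]
    have ip: "iota (m + n) (?L n z) = iota m z" if "z \<in> carrier (word_alg C A m)" for z
      by (rule iota_pad[OF m that])
    have ix: "iota (m + n) (?L m z) = iota n z" if "z \<in> carrier (word_alg C A n)" for z
      using iota_pad[OF n that, of m] by (simp add: add.commute)
    have "1 \<le> m + n" using m by simp
    then have "tcoset (m + n) (?L n p) = tcoset (m + n) (?L m x)" "tcoset (m + n) (?L n q) = tcoset (m + n) (?L m y)"
      using iota_eq_iff c ip ix eq p x y by metis+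
    then have "tcoset (m + n) (wop (m + n) (?L n p) (?L n q)) = tcoset (m + n) (wop (m + n) (?L m x) (?L m y))"
      using wop c by metis
    then have "iota (m + n) (?L n (wop m p q)) = iota (m + n) (?L m (wop n x y))"
      using pad[OF p, of n] pad[OF x y, of m] by (simp add: iota_def add.commute)
    then show ?thesis using ip ix wop p x y by metis
  qed
  have mem: "dirlim_class C A (max m k) (bop (max m k) (tensor_lift C A m (max m k - m) U)
      (tensor_lift C A k (max m k - k) V)) = iota n (wop n x y)"
    if U: "(m, U) \<in> iota n x" and V: "(k, V) \<in> iota n y" for m U k V
  proof -
    obtain u where u: "1 \<le> m" "u \<in> carrier (word_alg C A m)" "U = tcoset m u" "iota m u = iota n x"
      using mem_iotaD[OF n x U] .
    obtain v where v: "1 \<le> k" "v \<in> carrier (word_alg C A k)" "V = tcoset k v" "iota k v = iota n y"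
      using mem_iotaD[OF n y V] .
    define M where "M = max m k"
    have M: "m + (M - m) = M" "k + (M - k) = M" "1 \<le> M" using u(1) by (auto simp: M_def)
    note c = pad_closed[OF u(2), of "M - m", unfolded M] pad_closed[OF v(2), of "M - k", unfolded M]
    show ?thesis
      using key[OF M(3) c] iota_pad[OF u(1,2), of "M - m", unfolded M] iota_pad[OF v(1,2), of "M - k", unfolded M]
        wop[OF c] u v
      by (simp add: tensor_lift_coset M flip: M_def iota_def)
  qed
  show ?thesis
    unfolding dirlim_binop_def
  proof (intro equalityI subsetI)
    fix r assume "r \<in> iota n (wop n x y)"
    then have "r \<in> dirlim_class C A (max n n) (bop (max n n) (tensor_lift C A n (max n n - n) (tcoset n x))
      (tensor_lift C A n (max n n - n) (tcoset n y)))"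
      using mem[OF iota_self[OF n x] iota_self[OF n y]] by simp
    then show "r \<in> (\<Union>(m, x)\<in>iota n x. \<Union>(k, y)\<in>iota n y. dirlim_class C A (max m k)
       (bop (max m k) (tensor_lift C A m (max m k - m) x) (tensor_lift C A k (max m k - k) y)))"
      using iota_self[OF n x] iota_self[OF n y] by blast
  qed (use mem in auto)
qed

lemma iota_simps:
  assumes n: "1 \<le> n" and x: "x \<in> carrier (word_alg C A n)" and y: "y \<in> carrier (word_alg C A n)"
  shows "iota n x \<oplus>\<^bsub>tensor_dirlim C A\<^esub> iota n y = iota n (x \<oplus>\<^bsub>word_alg C A n\<^esub> y)"
    and "iota n x \<otimes>\<^bsub>tensor_dirlim C A\<^esub> iota n y = iota n (x \<otimes>\<^bsub>word_alg C A n\<^esub> y)"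
    and "c \<in> carrier C \<Longrightarrow> c \<odot>\<^bsub>tensor_dirlim C A\<^esub> iota n x = iota n (c \<odot>\<^bsub>word_alg C A n\<^esub> x)"
proof -
  show "iota n x \<oplus>\<^bsub>tensor_dirlim C A\<^esub> iota n y = iota n (x \<oplus>\<^bsub>word_alg C A n\<^esub> y)"
    by (simp add: tensor_dirlim_def, rule dirlim_binop_iota[OF n x y, of "\<lambda>n. add (word_alg C A n)"])
       (auto simp: tensor_pow_simps linear_mapD(2)[OF pad_linear(1)])
  show "iota n x \<otimes>\<^bsub>tensor_dirlim C A\<^esub> iota n y = iota n (x \<otimes>\<^bsub>word_alg C A n\<^esub> y)"
    by (simp add: tensor_dirlim_def, rule dirlim_binop_iota[OF n x y, of "\<lambda>n. mult (word_alg C A n)"])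
       (auto simp: tensor_pow_simps pad_mult)
  show "c \<odot>\<^bsub>tensor_dirlim C A\<^esub> iota n x = iota n (c \<odot>\<^bsub>word_alg C A n\<^esub> x)" if c: "c \<in> carrier C"
  proof -
    have "dirlim_class C A m (c \<odot>\<^bsub>tensor_pow C A m\<^esub> U) = iota n (c \<odot>\<^bsub>word_alg C A n\<^esub> x)"
      if U: "(m, U) \<in> iota n x" for m U
    proof -
      obtain u where u: "1 \<le> m" "u \<in> carrier (word_alg C A m)" "U = tcoset m u" "iota m u = iota n x"
        using mem_iotaD[OF n x U] .
      let ?L = "\<lambda>d. lin_ext C (pad d)"
      have cx: "?L m x \<in> carrier (word_alg C A (m + n))" using pad_closed[OF x, of m] by (simp add: add.commute)
      have cu: "?L n u \<in> carrier (word_alg C A (m + n))" using pad_closed[OF u(2), of n] .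
      have ix: "iota (m + n) (?L m z) = iota n z" if "z \<in> carrier (word_alg C A n)" for z
        using iota_pad[OF n that, of m] by (simp add: add.commute)
      have "tcoset (m + n) (?L n u) = tcoset (m + n) (?L m x)"
        using iota_eq_iff[OF _ cu cx] u ix[OF x] iota_pad[OF u(1,2), of n] by simp
      then have "tcoset (m + n) (c \<odot>\<^bsub>word_alg C A (m + n)\<^esub> ?L n u) = tcoset (m + n) (c \<odot>\<^bsub>word_alg C A (m + n)\<^esub> ?L m x)"
        using tensor_pow_simps(6)[OF c] cu cx by metis
      then have "iota (m + n) (?L n (c \<odot>\<^bsub>word_alg C A m\<^esub> u)) = iota (m + n) (?L m (c \<odot>\<^bsub>word_alg C A n\<^esub> x))"
        using linear_mapD(3)[OF pad_linear(1) c u(2), of n] linear_mapD(3)[OF pad_linear(1) c x, of m]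
        by (simp add: iota_def add.commute)
      then have "iota m (c \<odot>\<^bsub>word_alg C A m\<^esub> u) = iota n (c \<odot>\<^bsub>word_alg C A n\<^esub> x)"
        using ix[OF W.M.smult_closed[OF c x]] iota_pad[OF u(1) W.M.smult_closed[OF c u(2)], of n] by simp
      then show ?thesis using u c by (simp add: tensor_pow_simps(6) iota_def)
    qed
    then show ?thesis using iota_self[OF n x] by (fastforce simp: tensor_dirlim_def)
  qed
qed

lemma iota_smult:
  "1 \<le> n \<Longrightarrow> x \<in> carrier (word_alg C A n) \<Longrightarrow> c \<in> carrier C \<Longrightarrow>
    c \<odot>\<^bsub>tensor_dirlim C A\<^esub> iota n x = iota n (c \<odot>\<^bsub>word_alg C A n\<^esub> x)"
  by (rule iota_simps(3))

lemma iota_one: "1 \<le> n \<Longrightarrow> iota n \<one>\<^bsub>word_alg C A n\<^esub> = \<one>\<^bsub>tensor_dirlim C A\<^esub>"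
  using iota_pad[of 1 "\<one>\<^bsub>word_alg C A 1\<^esub>" "n - 1"] pad_one[of "n - 1" 1]
  by (simp add: tensor_dirlim_def tensor_pow_simps iota_def)

lemma iota_zero: "1 \<le> n \<Longrightarrow> iota n \<zero>\<^bsub>word_alg C A n\<^esub> = \<zero>\<^bsub>tensor_dirlim C A\<^esub>"
  using iota_pad[of 1 "\<zero>\<^bsub>word_alg C A 1\<^esub>" "n - 1"]
    linear_map_zero[OF pad_linear(1)[of 1 "n - 1"] word_module word_module] K.rcos_zero[of 1]
  by (simp add: tensor_dirlim_def tensor_pow_simps iota_def)

lemma dirlim_algebra: "algebra C (tensor_dirlim C A)"
proof (rule algebraI)
  let ?D = "tensor_dirlim C A"
  have add: "X \<oplus>\<^bsub>?D\<^esub> Y \<in> carrier ?D" and mult: "X \<otimes>\<^bsub>?D\<^esub> Y \<in> carrier ?D"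
    and "X \<oplus>\<^bsub>?D\<^esub> Y = Y \<oplus>\<^bsub>?D\<^esub> X" and "X \<otimes>\<^bsub>?D\<^esub> Y = Y \<otimes>\<^bsub>?D\<^esub> X"
    and "X \<oplus>\<^bsub>?D\<^esub> Y \<oplus>\<^bsub>?D\<^esub> Z = X \<oplus>\<^bsub>?D\<^esub> (Y \<oplus>\<^bsub>?D\<^esub> Z)"
    and "X \<otimes>\<^bsub>?D\<^esub> Y \<otimes>\<^bsub>?D\<^esub> Z = X \<otimes>\<^bsub>?D\<^esub> (Y \<otimes>\<^bsub>?D\<^esub> Z)"
    and "(X \<oplus>\<^bsub>?D\<^esub> Y) \<otimes>\<^bsub>?D\<^esub> Z = X \<otimes>\<^bsub>?D\<^esub> Z \<oplus>\<^bsub>?D\<^esub> Y \<otimes>\<^bsub>?D\<^esub> Z"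
    and "\<one>\<^bsub>?D\<^esub> \<otimes>\<^bsub>?D\<^esub> X = X" and "\<zero>\<^bsub>?D\<^esub> \<oplus>\<^bsub>?D\<^esub> X = X" and "\<exists>Y\<in>carrier ?D. Y \<oplus>\<^bsub>?D\<^esub> X = \<zero>\<^bsub>?D\<^esub>"
    if XYZ: "X \<in> carrier ?D" "Y \<in> carrier ?D" "Z \<in> carrier ?D" for X Y Z
  proof -
    obtain n x y z where n: "1 \<le> n" and c: "x \<in> carrier (word_alg C A n)" "y \<in> carrier (word_alg C A n)"
      "z \<in> carrier (word_alg C A n)" and eq: "X = iota n x" "Y = iota n y" "Z = iota n z"
      using dirlim_exhaust3[OF XYZ] .
    note s = eq c iota_simps[OF n] iota_carrier[OF n] iota_one[OF n, symmetric] iota_zero[OF n, symmetric]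
    show "X \<oplus>\<^bsub>?D\<^esub> Y \<in> carrier ?D" "X \<otimes>\<^bsub>?D\<^esub> Y \<in> carrier ?D"
      "X \<oplus>\<^bsub>?D\<^esub> Y = Y \<oplus>\<^bsub>?D\<^esub> X" "X \<otimes>\<^bsub>?D\<^esub> Y = Y \<otimes>\<^bsub>?D\<^esub> X"
      by (simp_all add: s W.M.M.a_comm WA.m_comm)
    show "X \<oplus>\<^bsub>?D\<^esub> Y \<oplus>\<^bsub>?D\<^esub> Z = X \<oplus>\<^bsub>?D\<^esub> (Y \<oplus>\<^bsub>?D\<^esub> Z)"
      "X \<otimes>\<^bsub>?D\<^esub> Y \<otimes>\<^bsub>?D\<^esub> Z = X \<otimes>\<^bsub>?D\<^esub> (Y \<otimes>\<^bsub>?D\<^esub> Z)"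
      "(X \<oplus>\<^bsub>?D\<^esub> Y) \<otimes>\<^bsub>?D\<^esub> Z = X \<otimes>\<^bsub>?D\<^esub> Z \<oplus>\<^bsub>?D\<^esub> Y \<otimes>\<^bsub>?D\<^esub> Z"
      "\<one>\<^bsub>?D\<^esub> \<otimes>\<^bsub>?D\<^esub> X = X" "\<zero>\<^bsub>?D\<^esub> \<oplus>\<^bsub>?D\<^esub> X = X"
      by (simp_all add: s W.M.M.a_assoc WA.m_assoc WA.l_distr)
    show "\<exists>Y\<in>carrier ?D. Y \<oplus>\<^bsub>?D\<^esub> X = \<zero>\<^bsub>?D\<^esub>"
      by (rule bexI[of _ "iota n (\<ominus>\<^bsub>word_alg C A n\<^esub> x)"]) (simp_all add: s W.M.M.l_neg)
  qed
  note ax = this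
  have zero: "\<zero>\<^bsub>?D\<^esub> \<in> carrier ?D" and one: "\<one>\<^bsub>?D\<^esub> \<in> carrier ?D"
    using iota_zero[of 1] iota_one[of 1] iota_carrier[of 1 "\<zero>\<^bsub>word_alg C A 1\<^esub>"]
      iota_carrier[of 1 "\<one>\<^bsub>word_alg C A 1\<^esub>"] by auto
  show "cring ?D"
    by (intro cringI abelian_groupI comm_monoidI zero one; (rule ax; assumption)?)
  have sm: "a \<odot>\<^bsub>?D\<^esub> X \<in> carrier ?D" "(a \<oplus>\<^bsub>C\<^esub> b) \<odot>\<^bsub>?D\<^esub> X = a \<odot>\<^bsub>?D\<^esub> X \<oplus>\<^bsub>?D\<^esub> b \<odot>\<^bsub>?D\<^esub> X"
    "a \<odot>\<^bsub>?D\<^esub> (X \<oplus>\<^bsub>?D\<^esub> Y) = a \<odot>\<^bsub>?D\<^esub> X \<oplus>\<^bsub>?D\<^esub> a \<odot>\<^bsub>?D\<^esub> Y"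
    "(a \<otimes>\<^bsub>C\<^esub> b) \<odot>\<^bsub>?D\<^esub> X = a \<odot>\<^bsub>?D\<^esub> (b \<odot>\<^bsub>?D\<^esub> X)" "\<one>\<^bsub>C\<^esub> \<odot>\<^bsub>?D\<^esub> X = X"
    "(a \<odot>\<^bsub>?D\<^esub> X) \<otimes>\<^bsub>?D\<^esub> Y = a \<odot>\<^bsub>?D\<^esub> (X \<otimes>\<^bsub>?D\<^esub> Y)"
    if ab: "a \<in> carrier C" "b \<in> carrier C" and X: "X \<in> carrier ?D" and Y: "Y \<in> carrier ?D" for a b X Y
  proof -
    obtain n x y z where n: "1 \<le> n" and c: "x \<in> carrier (word_alg C A n)" "y \<in> carrier (word_alg C A n)"
      "z \<in> carrier (word_alg C A n)" and eq: "X = iota n x" "Y = iota n y" "Y = iota n z"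
      using dirlim_exhaust3[OF X Y Y] .
    note s = eq(1,2) c(1,2) ab iota_simps(1,2)[OF n] iota_smult[OF n] iota_carrier[OF n]
    show "a \<odot>\<^bsub>?D\<^esub> X \<in> carrier ?D" "(a \<oplus>\<^bsub>C\<^esub> b) \<odot>\<^bsub>?D\<^esub> X = a \<odot>\<^bsub>?D\<^esub> X \<oplus>\<^bsub>?D\<^esub> b \<odot>\<^bsub>?D\<^esub> X"
      "a \<odot>\<^bsub>?D\<^esub> (X \<oplus>\<^bsub>?D\<^esub> Y) = a \<odot>\<^bsub>?D\<^esub> X \<oplus>\<^bsub>?D\<^esub> a \<odot>\<^bsub>?D\<^esub> Y"
      "(a \<otimes>\<^bsub>C\<^esub> b) \<odot>\<^bsub>?D\<^esub> X = a \<odot>\<^bsub>?D\<^esub> (b \<odot>\<^bsub>?D\<^esub> X)" "\<one>\<^bsub>C\<^esub> \<odot>\<^bsub>?D\<^esub> X = X"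
      "(a \<odot>\<^bsub>?D\<^esub> X) \<otimes>\<^bsub>?D\<^esub> Y = a \<odot>\<^bsub>?D\<^esub> (X \<otimes>\<^bsub>?D\<^esub> Y)"
      by (simp_all add: s W.M.smult_l_distr W.M.smult_r_distr W.M.smult_assoc1 WA.smult_assoc2)
  qed
  show "a \<odot>\<^bsub>?D\<^esub> X \<in> carrier ?D" if "a \<in> carrier C" "X \<in> carrier ?D" for a X
    by (rule sm) (use that in auto)
  show "(a \<oplus>\<^bsub>C\<^esub> b) \<odot>\<^bsub>?D\<^esub> X = a \<odot>\<^bsub>?D\<^esub> X \<oplus>\<^bsub>?D\<^esub> b \<odot>\<^bsub>?D\<^esub> X"
    "(a \<otimes>\<^bsub>C\<^esub> b) \<odot>\<^bsub>?D\<^esub> X = a \<odot>\<^bsub>?D\<^esub> (b \<odot>\<^bsub>?D\<^esub> X)"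
    if "a \<in> carrier C" "b \<in> carrier C" "X \<in> carrier ?D" for a b X
    by (rule sm; use that in auto)+
  show "a \<odot>\<^bsub>?D\<^esub> (X \<oplus>\<^bsub>?D\<^esub> Y) = a \<odot>\<^bsub>?D\<^esub> X \<oplus>\<^bsub>?D\<^esub> a \<odot>\<^bsub>?D\<^esub> Y"
    "(a \<odot>\<^bsub>?D\<^esub> X) \<otimes>\<^bsub>?D\<^esub> Y = a \<odot>\<^bsub>?D\<^esub> (X \<otimes>\<^bsub>?D\<^esub> Y)"
    if "a \<in> carrier C" "X \<in> carrier ?D" "Y \<in> carrier ?D" for a X Y
    by (rule sm; use that in auto)+
  show "\<one>\<^bsub>C\<^esub> \<odot>\<^bsub>?D\<^esub> X = X" if "X \<in> carrier ?D" for X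
    by (rule sm[of "\<one>\<^bsub>C\<^esub>" "\<one>\<^bsub>C\<^esub>"]) (use that in auto)
qed (rule A.R_cring)

sublocale D: algebra C "tensor_dirlim C A"
  by (rule dirlim_algebra)

lemma iota_linear: "1 \<le> n \<Longrightarrow> linear_map C (word_alg C A n) (tensor_dirlim C A) (iota n)"
  by (rule linear_mapI) (simp_all add: iota_carrier iota_simps(1) iota_smult)

lemma iota_eq_zero_iff:
  "1 \<le> n \<Longrightarrow> x \<in> carrier (word_alg C A n) \<Longrightarrow> iota n x = \<zero>\<^bsub>tensor_dirlim C A\<^esub> \<longleftrightarrow> x \<in> tensor_ker C A n"
  by (simp add: iota_zero[symmetric] iota_eq_iff K.rcos_eq_self_iff K.rcos_zero)

lemma submodule_zero:
  assumes "module C N"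
  shows "submodule {\<zero>\<^bsub>N\<^esub>} C N"
proof -
  interpret N: module C N by fact
  show ?thesis by (rule N.submoduleI) auto
qed

text \<open>An equality of zero and one in the limit would already hold in the first tensor power.
  The linear extension of \<open>hd\<close> maps that power back to \<open>A\<close>, where it
  fails. This is what makes the Baxter algebras below proper.\<close>

lemma dirlim_nontrivial:
  assumes "\<one>\<^bsub>A\<^esub> \<noteq> \<zero>\<^bsub>A\<^esub>"
  shows "\<one>\<^bsub>tensor_dirlim C A\<^esub> \<noteq> \<zero>\<^bsub>tensor_dirlim C A\<^esub>"
proof
  assume "\<one>\<^bsub>tensor_dirlim C A\<^esub> = \<zero>\<^bsub>tensor_dirlim C A\<^esub>"
  then have ker: "single C [\<one>\<^bsub>A\<^esub>] \<in> tensor_ker C A 1"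
    using iota_one[of 1] iota_eq_zero_iff[of 1 "\<one>\<^bsub>word_alg C A 1\<^esub>"] WA.one_closed[of 1] by (simp add: word_one)
  have h: "hd \<in> words A 1 \<rightarrow> carrier A" by (auto simp: length_Suc_conv)
  have e: "free_ext C A hd (single C [a]) = a" if "a \<in> carrier A" for a
    using W.free_ext_single[OF A.module h, of "[a]"] that by simp
  have "free_ext C A hd (single C [\<one>\<^bsub>A\<^esub>]) \<in> {\<zero>\<^bsub>A\<^esub>}"
    by (rule tensor_ker_image[where L = "free_ext C A hd", OF W.free_ext_linear[OF A.module h] A.module
          submodule_zero[OF A.module] _ ker])
       (auto simp: multilinear_mod_def e A.M.minus_eq A.M.r_neg)
  then show False using assms by (simp add: e)
qed

end

section \<open>The algebra of sequences\<close>

text \<open>Over the zero algebra every algebra built from \<open>A\<close> here is zero and cannot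
  be proper; \<open>nontrivial\<close> excludes that case.\<close>

locale baxter_base = tensor_base C A
  for C :: "('c, 'k) ring_scheme" and A :: "('c, 'a, 'm) module_scheme" +
  fixes l :: 'c
  assumes weight_closed: "l \<in> carrier C"
    and nontrivial: "\<one>\<^bsub>A\<^esub> \<noteq> \<zero>\<^bsub>A\<^esub>"
begin

abbreviation "Abar \<equiv> tensor_dirlim C A"
abbreviation "Seq \<equiv> seq_alg C A"
abbreviation "Q \<equiv> seq_op C l A"

lemma seq_component:
  "zero Seq i = \<zero>\<^bsub>Abar\<^esub>" "one Seq i = \<one>\<^bsub>Abar\<^esub>"
  "(s \<oplus>\<^bsub>Seq\<^esub> t) i = s i \<oplus>\<^bsub>Abar\<^esub> t i" "(s \<otimes>\<^bsub>Seq\<^esub> t) i = s i \<otimes>\<^bsub>Abar\<^esub> t i"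
  "(c \<odot>\<^bsub>Seq\<^esub> s) i = c \<odot>\<^bsub>Abar\<^esub> s i"
  by (auto simp: seq_alg_def)

lemma seq_carrier: "s \<in> carrier Seq \<longleftrightarrow> (\<forall>i. s i \<in> carrier Abar)"
  by (simp add: seq_alg_def)

lemma seq_algebra: "algebra C Seq"
  by (rule algebra_family[where f = "\<lambda>i s. s i", OF dirlim_algebra])
     (simp_all add: fun_eq_iff seq_component seq_carrier)

sublocale S: algebra C Seq
  by (rule seq_algebra)

lemma seq_minus:
  assumes "s \<in> carrier Seq" "t \<in> carrier Seq"
  shows "(s \<ominus>\<^bsub>Seq\<^esub> t) i = s i \<ominus>\<^bsub>Abar\<^esub> t i"
proof -
  have "linear_map C Seq Abar (\<lambda>s. s i)" by (rule linear_mapI) (simp_all add: seq_component seq_carrier)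
  then show ?thesis by (rule linear_map_minus[OF _ S.module D.module assms])
qed

lemma seq_op_0: "Q s 0 = \<zero>\<^bsub>Abar\<^esub>"
  using weight_closed by (simp add: seq_op_def)

text \<open>The partial sums as a recursion on the index; induction along it replaces the
  manipulation of finite sums.\<close>

lemma seq_op_Suc: "s \<in> carrier Seq \<Longrightarrow> Q s (Suc i) = Q s i \<oplus>\<^bsub>Abar\<^esub> l \<odot>\<^bsub>Abar\<^esub> s i"
  using weight_closed
  by (simp add: seq_op_def lessThan_Suc Pi_iff seq_carrier D.M.finsum_insert D.smult_r_distr D.M.a_comm)

lemma seq_op_closed: "s \<in> carrier Seq \<Longrightarrow> Q s \<in> carrier Seq"
  unfolding seq_carrier[of "Q s"]
proof
  fix i assume s: "s \<in> carrier Seq"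
  show "Q s i \<in> carrier Abar"
    by (induction i) (use s weight_closed in \<open>auto simp: seq_op_0 seq_op_Suc seq_carrier\<close>)
qed

text \<open>The Baxter identity is the discrete product rule. From \<open>i\<close> to
  \<open>Suc i\<close> the two factors grow by \<open>l\<close> times \<open>x i\<close> and
  \<open>y i\<close>, so their product grows by two mixed terms and by the term with both
  increments, which is the weight term.\<close>

lemma seq_baxter: "baxter_algebra C l Seq Q"
proof (rule baxter_algebraI[OF seq_algebra weight_closed seq_op_closed])
  have c: "s i \<in> carrier Abar" "Q s i \<in> carrier Abar" if "s \<in> carrier Seq" for s i
    using that seq_op_closed[OF that] by (auto simp: seq_carrier)
  fix x y assume x: "x \<in> carrier Seq" and y: "y \<in> carrier Seq"
  \<comment> \<open>The sum is represented by any \<open>z\<close> with the right entries, so that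
    the recursion for \<open>Q\<close> can be applied to it as a whole. The same device serves for
    products and multiples.\<close>
  have add: "Q z i = Q x i \<oplus>\<^bsub>Abar\<^esub> Q y i" if "z \<in> carrier Seq" "\<And>i. z i = x i \<oplus>\<^bsub>Abar\<^esub> y i" for z i
  proof (induction i)
    case (Suc i)
    show ?case
      using c[OF x, of i] c[OF y, of i] Suc that(2)[of i] weight_closed
      by (simp add: seq_op_Suc x y that(1) D.smult_r_distr D.M.a_ac)
  qed (simp add: seq_op_0)
  show "Q (x \<oplus>\<^bsub>Seq\<^esub> y) = Q x \<oplus>\<^bsub>Seq\<^esub> Q y"
    by (simp add: fun_eq_iff seq_component add[OF S.M.a_closed[OF x y] seq_component(3)])
  have mult: "Q x i \<otimes>\<^bsub>Abar\<^esub> Q y i = Q u i \<oplus>\<^bsub>Abar\<^esub> Q v i \<oplus>\<^bsub>Abar\<^esub> l \<odot>\<^bsub>Abar\<^esub> Q w i"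
    if uvw: "u \<in> carrier Seq" "v \<in> carrier Seq" "w \<in> carrier Seq"
      and eq: "\<And>i. u i = x i \<otimes>\<^bsub>Abar\<^esub> Q y i" "\<And>i. v i = y i \<otimes>\<^bsub>Abar\<^esub> Q x i"
        "\<And>i. w i = x i \<otimes>\<^bsub>Abar\<^esub> y i" for u v w i
  proof (induction i)
    case 0
    then show ?case using weight_closed by (simp add: seq_op_0)
  next
    case (Suc i)
    note cs = c[OF x, of i] c[OF y, of i] c(2)[OF uvw(1), of i] c(2)[OF uvw(2), of i] c(2)[OF uvw(3), of i]
    have "Q x (Suc i) \<otimes>\<^bsub>Abar\<^esub> Q y (Suc i) =
      Q x i \<otimes>\<^bsub>Abar\<^esub> Q y i \<oplus>\<^bsub>Abar\<^esub> (l \<odot>\<^bsub>Abar\<^esub> (x i \<otimes>\<^bsub>Abar\<^esub> Q y i) \<oplus>\<^bsub>Abar\<^esub>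
      l \<odot>\<^bsub>Abar\<^esub> (y i \<otimes>\<^bsub>Abar\<^esub> Q x i) \<oplus>\<^bsub>Abar\<^esub> l \<odot>\<^bsub>Abar\<^esub> (l \<odot>\<^bsub>Abar\<^esub> (x i \<otimes>\<^bsub>Abar\<^esub> y i)))"
      using cs weight_closed
      by (simp add: seq_op_Suc x y D.l_distr D.r_distr D.smult_assoc2 D.smult_assoc2' D.M.a_ac D.m_comm)
    then show ?case
      unfolding Suc.IH using cs weight_closed
      by (simp add: seq_op_Suc uvw eq[of i] D.smult_r_distr D.M.a_ac)
  qed
  show "Q x \<otimes>\<^bsub>Seq\<^esub> Q y =
      Q (x \<otimes>\<^bsub>Seq\<^esub> Q y) \<oplus>\<^bsub>Seq\<^esub> Q (y \<otimes>\<^bsub>Seq\<^esub> Q x) \<oplus>\<^bsub>Seq\<^esub> l \<odot>\<^bsub>Seq\<^esub> Q (x \<otimes>\<^bsub>Seq\<^esub> y)"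
    by (rule ext, unfold seq_component, rule mult)
       (use c[OF x] c[OF y] in \<open>auto simp: seq_carrier\<close>)
next
  fix k x assume k: "k \<in> carrier C" and x: "x \<in> carrier Seq"
  have c: "x i \<in> carrier Abar" "Q x i \<in> carrier Abar" for i
    using x seq_op_closed[OF x] by (auto simp: seq_carrier)
  have sm: "Q z i = k \<odot>\<^bsub>Abar\<^esub> Q x i" if "z \<in> carrier Seq" "\<And>i. z i = k \<odot>\<^bsub>Abar\<^esub> x i" for z i
  proof (induction i)
    case (Suc i)
    show ?case
      using c[of i] k Suc that(2)[of i] weight_closed
      by (simp add: seq_op_Suc x that(1) D.smult_r_distr D.smult_assoc1[symmetric] A.R.m_comm)
  qed (simp add: seq_op_0 k)
  show "Q (k \<odot>\<^bsub>Seq\<^esub> x) = k \<odot>\<^bsub>Seq\<^esub> Q x"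
    by (rule ext, unfold seq_component, rule sm) (use c k in \<open>auto simp: seq_carrier\<close>)
qed

text \<open>\<open>Q s i\<close> uses only entries before \<open>i\<close>, so an initial run of
  zeros grows by one place.\<close>

lemma seq_op_zero_below:
  assumes s: "s \<in> carrier Seq" and z: "\<And>i. i < k \<Longrightarrow> s i = \<zero>\<^bsub>Abar\<^esub>" and i: "i < Suc k"
  shows "Q s i = \<zero>\<^bsub>Abar\<^esub>"
  using i by (induction i) (use s z weight_closed in \<open>simp_all add: seq_op_0 seq_op_Suc\<close>)

section \<open>The Baxter filtration of the algebra of sequences\<close>

definition weighted :: "nat \<Rightarrow> (nat \<times> ('a list \<Rightarrow> 'c) set) set set" where
  "weighted n = (\<lambda>a. (l [^]\<^bsub>C\<^esub> n) \<odot>\<^bsub>Abar\<^esub> a) ` carrier Abar"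

text \<open>Each application of \<open>Q\<close> delays a sequence by one place and multiplies it by
  \<open>l\<close>; vanishing of entries alone would not see the second effect.\<close>

definition weighted_fil :: "nat \<Rightarrow> (nat \<Rightarrow> (nat \<times> ('a list \<Rightarrow> 'c) set) set) set" where
  "weighted_fil n = {s \<in> carrier Seq. (\<forall>i<n. s i = \<zero>\<^bsub>Abar\<^esub>) \<and>
     (\<forall>i. s i \<in> weighted n)}"

lemma weight_pow_closed: "l [^]\<^bsub>C\<^esub> (n::nat) \<in> carrier C"
  using weight_closed by simp

lemma weight_pow_Suc:
  "a \<in> carrier Abar \<Longrightarrow> (l [^]\<^bsub>C\<^esub> Suc n) \<odot>\<^bsub>Abar\<^esub> a = l \<odot>\<^bsub>Abar\<^esub> ((l [^]\<^bsub>C\<^esub> n) \<odot>\<^bsub>Abar\<^esub> a)"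
  using weight_closed weight_pow_closed[of n] by (simp add: D.smult_assoc1[symmetric] A.R.m_comm)

lemma weighted_zero: "\<zero>\<^bsub>Abar\<^esub> \<in> weighted n"
  unfolding weighted_def by (rule image_eqI[of _ _ "\<zero>\<^bsub>Abar\<^esub>"]) (simp_all add: weight_pow_closed)

lemma weighted_add: "x \<in> weighted n \<Longrightarrow> y \<in> weighted n \<Longrightarrow> x \<oplus>\<^bsub>Abar\<^esub> y \<in> weighted n"
  unfolding weighted_def using weight_pow_closed[of n]
  by (auto simp: D.smult_r_distr[symmetric])

lemma weighted_mult: "x \<in> weighted n \<Longrightarrow> y \<in> carrier Abar \<Longrightarrow> y \<otimes>\<^bsub>Abar\<^esub> x \<in> weighted n"
  unfolding weighted_def using weight_pow_closed[of n] by (auto simp: D.smult_assoc2')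

lemma weighted_smult: "x \<in> weighted n \<Longrightarrow> l \<odot>\<^bsub>Abar\<^esub> x \<in> weighted (Suc n)"
  unfolding weighted_def by (auto simp: weight_pow_Suc[symmetric] simp del: A.nat_pow_Suc)

lemma weighted_Suc: "weighted (Suc n) \<subseteq> weighted n"
proof
  fix x assume "x \<in> weighted (Suc n)"
  then obtain a where a: "a \<in> carrier Abar" "x = (l [^]\<^bsub>C\<^esub> Suc n) \<odot>\<^bsub>Abar\<^esub> a" by (auto simp: weighted_def)
  then have "x = (l [^]\<^bsub>C\<^esub> n) \<odot>\<^bsub>Abar\<^esub> (l \<odot>\<^bsub>Abar\<^esub> a)"
    using weight_closed weight_pow_closed[of n] by (simp add: D.smult_assoc1)
  then show "x \<in> weighted n" using a(1) weight_closed by (auto simp: weighted_def)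
qed

lemma weighted_filI:
  "s \<in> carrier Seq \<Longrightarrow> (\<And>i. i < n \<Longrightarrow> s i = \<zero>\<^bsub>Abar\<^esub>) \<Longrightarrow> (\<And>i. s i \<in> weighted n) \<Longrightarrow> s \<in> weighted_fil n"
  by (simp add: weighted_fil_def)

lemma weighted_filD:
  assumes "s \<in> weighted_fil n"
  shows "s \<in> carrier Seq" "i < n \<Longrightarrow> s i = \<zero>\<^bsub>Abar\<^esub>" "s i \<in> weighted n"
  using assms by (auto simp: weighted_fil_def)

lemma seq_op_weighted_fil:
  assumes "s \<in> weighted_fil n"
  shows "Q s \<in> weighted_fil (Suc n)"
proof (rule weighted_filI)
  note s = weighted_filD[OF assms]
  show "Q s \<in> carrier Seq" by (rule seq_op_closed[OF s(1)])
  show "Q s i = \<zero>\<^bsub>Abar\<^esub>" if "i < Suc n" for i by (rule seq_op_zero_below[OF s(1,2) that])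
  show "Q s i \<in> weighted (Suc n)" for i
    by (induction i) (simp_all add: seq_op_0 seq_op_Suc s weighted_zero weighted_add weighted_smult)
qed

lemma weighted_fil_ideal: "ideal (weighted_fil n) Seq"
proof (rule S.idealI')
  show "\<zero>\<^bsub>Seq\<^esub> \<in> weighted_fil n"
    by (rule weighted_filI) (auto simp: seq_carrier seq_component weighted_zero)
  show "x \<oplus>\<^bsub>Seq\<^esub> y \<in> weighted_fil n" if x: "x \<in> weighted_fil n" and y: "y \<in> weighted_fil n" for x y
  proof (rule weighted_filI)
    note x = weighted_filD[OF x] and y = weighted_filD[OF y]
    show "x \<oplus>\<^bsub>Seq\<^esub> y \<in> carrier Seq" by (rule S.M.a_closed[OF x(1) y(1)])
  qed (simp_all add: seq_component weighted_filD[OF x] weighted_filD[OF y] weighted_add)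
  show "y \<otimes>\<^bsub>Seq\<^esub> x \<in> weighted_fil n" if x: "x \<in> weighted_fil n" and y: "y \<in> carrier Seq" for x y
  proof (rule weighted_filI)
    have c: "y i \<in> carrier Abar" for i using y by (simp add: seq_carrier)
    show "y \<otimes>\<^bsub>Seq\<^esub> x \<in> carrier Seq" by (rule S.m_closed[OF y weighted_filD(1)[OF x]])
    show "(y \<otimes>\<^bsub>Seq\<^esub> x) i = \<zero>\<^bsub>Abar\<^esub>" if "i < n" for i
      using weighted_filD(2)[OF x that] c[of i] by (simp add: seq_component)
    show "(y \<otimes>\<^bsub>Seq\<^esub> x) i \<in> weighted n" for i
      using weighted_mult[OF weighted_filD(3)[OF x] c[of i]] by (simp add: seq_component)
  qed
qed (auto simp: weighted_fil_def)

lemma weighted_fil_Suc: "weighted_fil (Suc n) \<subseteq> weighted_fil n"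
  using weighted_Suc by (auto simp: weighted_fil_def subset_eq)

lemma weighted_fil_0: "weighted_fil 0 = carrier Seq"
  by (auto simp: weighted_fil_def weighted_def seq_carrier intro!: image_eqI)

lemma weighted_filtered: "filtered_baxter C l Seq Q weighted_fil"
  by (rule filtered_baxter.intro[OF seq_baxter weighted_fil_0 weighted_fil_ideal weighted_fil_Suc])
     (use seq_op_weighted_fil in auto)

text \<open>Differences of a sequence give its preimage under the operator, so no generation of ideals is
  involved in the filtration.\<close>

lemma baxter_fil_seq: "baxter_fil Seq Q n = weighted_fil n"
proof (induction n)
  case 0
  show ?case by (simp add: weighted_fil_0)
next
  case (Suc n)
  interpret F: filtered_baxter C l Seq Q weighted_fil by (rule weighted_filtered)
  show ?case
  proof
    show "baxter_fil Seq Q (Suc n) \<subseteq> weighted_fil (Suc n)" by (rule F.baxter_fil_subset)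
    show "weighted_fil (Suc n) \<subseteq> baxter_fil Seq Q (Suc n)"
    proof
      fix s assume s: "s \<in> weighted_fil (Suc n)"
      let ?w = "l [^]\<^bsub>C\<^esub> n"
      note w = weight_pow_closed[of n]
      \<comment> \<open>If \<open>l\<close> is a zero divisor, a cofactor of a vanishing entry need
        not vanish. Zero is chosen there on purpose, so that the differences formed below vanish as
        well.\<close>
      have "\<exists>b\<in>carrier Abar. s i = (l [^]\<^bsub>C\<^esub> Suc n) \<odot>\<^bsub>Abar\<^esub> b \<and> (i < Suc n \<longrightarrow> b = \<zero>\<^bsub>Abar\<^esub>)" for i
      proof (cases "i < Suc n")
        case True
        then have "s i = \<zero>\<^bsub>Abar\<^esub>" using weighted_filD(2)[OF s] by blast
        then show ?thesis using weight_pow_closed[of "Suc n"]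
          by (intro bexI[of _ "\<zero>\<^bsub>Abar\<^esub>"]) (simp_all del: A.nat_pow_Suc)
      next
        case False
        have "s i \<in> weighted (Suc n)" using s by (rule weighted_filD)
        then show ?thesis using False unfolding weighted_def by blast
      qed
      then obtain a where a: "\<And>i. a i \<in> carrier Abar" "\<And>i. s i = (l [^]\<^bsub>C\<^esub> Suc n) \<odot>\<^bsub>Abar\<^esub> a i"
        "\<And>i. i < Suc n \<Longrightarrow> a i = \<zero>\<^bsub>Abar\<^esub>" by metis
      \<comment> \<open>One factor \<open>l\<close> is left for \<open>Q\<close>, whose partial sums
        then telescope back to \<open>s\<close>. For \<open>i < n\<close> both \<open>a i\<close>
        and \<open>a (Suc i)\<close> vanish, because \<open>a\<close> has one more initial zero than
        \<open>r\<close> needs.\<close>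
      define r where "r i = ?w \<odot>\<^bsub>Abar\<^esub> (a (Suc i) \<ominus>\<^bsub>Abar\<^esub> a i)" for i
      have rc: "r \<in> carrier Seq" using a(1) w by (simp add: seq_carrier r_def)
      have r: "r \<in> weighted_fil n"
      proof (rule weighted_filI[OF rc])
        show "r i = \<zero>\<^bsub>Abar\<^esub>" if "i < n" for i
          using that a w by (simp add: r_def D.M.minus_eq)
        show "r i \<in> weighted n" for i using a(1) by (simp add: r_def weighted_def)
      qed
      have "Q r i = s i" for i
      proof (induction i)
        case 0
        show ?case using weighted_filD(2)[OF s, of 0] by (simp add: seq_op_0)
      next
        case (Suc i)
        have "l \<odot>\<^bsub>Abar\<^esub> r i = (l [^]\<^bsub>C\<^esub> Suc n) \<odot>\<^bsub>Abar\<^esub> (a (Suc i) \<ominus>\<^bsub>Abar\<^esub> a i)"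
          unfolding r_def by (rule weight_pow_Suc[symmetric]) (use a(1) in simp)
        then have "Q r (Suc i) = (l [^]\<^bsub>C\<^esub> Suc n) \<odot>\<^bsub>Abar\<^esub> (a i \<oplus>\<^bsub>Abar\<^esub> (a (Suc i) \<ominus>\<^bsub>Abar\<^esub> a i))"
          using Suc a(1) weight_pow_closed[of "Suc n"]
          by (simp add: seq_op_Suc[OF rc] D.smult_r_distr a(2) del: A.nat_pow_Suc)
        also have "a i \<oplus>\<^bsub>Abar\<^esub> (a (Suc i) \<ominus>\<^bsub>Abar\<^esub> a i) = a (Suc i)"
          using a(1) by (simp add: D.M.minus_eq D.M.a_comm[of "a (Suc i)"] D.M.r_neg2)
        finally show ?case by (simp only: a(2))
      qed
      then have "s = Q r" by auto
      then show "s \<in> baxter_fil Seq Q (Suc n)"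
        using r Suc.IH by (auto simp: gen_baxter_ideal_def)
    qed
  qed
qed

lemma weighted_fil_minusI:
  assumes "s \<in> carrier Seq" "t \<in> carrier Seq"
    and "\<And>i. i < n \<Longrightarrow> s i = t i" and "\<And>i. s i \<ominus>\<^bsub>Abar\<^esub> t i \<in> weighted n"
  shows "s \<ominus>\<^bsub>Seq\<^esub> t \<in> weighted_fil n"
proof (rule weighted_filI)
  have c: "s i \<in> carrier Abar" "t i \<in> carrier Abar" for i using assms(1,2) by (auto simp: seq_carrier)
  show "s \<ominus>\<^bsub>Seq\<^esub> t \<in> carrier Seq" using assms(1,2) by simp
  show "(s \<ominus>\<^bsub>Seq\<^esub> t) i = \<zero>\<^bsub>Abar\<^esub>" if "i < n" for i
    using that c[of i] by (simp add: seq_minus[OF assms(1,2)] assms(3))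
  show "(s \<ominus>\<^bsub>Seq\<^esub> t) i \<in> weighted n" for i
    using assms(4)[of i] by (simp only: seq_minus[OF assms(1,2), of i])
qed

theorem seq_complete: "baxter_complete C l Seq Q"
proof -
  interpret F: filtered_baxter C l Seq Q weighted_fil by (rule weighted_filtered)
  have "\<one>\<^bsub>Seq\<^esub> \<notin> weighted_fil 1"
    using weighted_filD(2)[of "\<one>\<^bsub>Seq\<^esub>" 1 0] dirlim_nontrivial[OF nontrivial]
    by (metis seq_component(2) zero_less_one)
  then have proper: "baxter_proper Seq Q" by (rule F.proper)
  have "baxter_iso C l Seq Q (lim_alg Seq weighted_fil) (lim_op Seq weighted_fil Q) (lim_map Seq weighted_fil)"
  proof (rule F.lim_map_iso)
    fix s assume s: "\<And>n. s \<in> weighted_fil n"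
    have "s i = \<zero>\<^bsub>Abar\<^esub>" for i by (rule weighted_filD(2)[OF s, of i "Suc i"]) simp
    then show "s = \<zero>\<^bsub>Seq\<^esub>" by (simp add: fun_eq_iff seq_component(1))
  next
    fix x assume x: "\<And>n. x n \<in> carrier Seq" and d: "\<And>n. x (Suc n) \<ominus>\<^bsub>Seq\<^esub> x n \<in> weighted_fil n"
    have c: "x n i \<in> carrier Abar" for n i using x by (simp add: seq_carrier)
    have z: "x n i \<ominus>\<^bsub>Abar\<^esub> x n i \<in> weighted m" for n m i
      using c weighted_zero by (simp add: D.M.minus_eq D.M.r_neg)
    \<comment> \<open>The steps from \<open>n\<close> on are all multiples of \<open>l^n\<close> and
      telescope, so the bound does not depend on \<open>k\<close>.\<close>
    have step: "x (n + k) i \<ominus>\<^bsub>Abar\<^esub> x n i \<in> weighted n" for n k i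
    proof (induction k)
      case 0
      show ?case using z by simp
    next
      case (Suc k)
      have "x (Suc (n + k)) \<ominus>\<^bsub>Seq\<^esub> x (n + k) \<in> weighted_fil n"
        using d[of "n + k"] F.fil_antimono[of n "n + k"] by auto
      then have "x (Suc (n + k)) i \<ominus>\<^bsub>Abar\<^esub> x (n + k) i \<in> weighted n"
        using weighted_filD(3)[of _ n i] seq_minus[OF x x] by metis
      then have "(x (Suc (n + k)) i \<ominus>\<^bsub>Abar\<^esub> x (n + k) i) \<oplus>\<^bsub>Abar\<^esub> (x (n + k) i \<ominus>\<^bsub>Abar\<^esub> x n i) \<in> weighted n"
        using Suc by (rule weighted_add)
      then show ?case using c[of "Suc (n + k)" i] c[of "n + k" i] c[of n i]
        by (simp add: D.M.minus_eq D.M.a_assoc D.M.r_neg1)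
    qed
    have stable: "x (n + k) i = x n i" if "i < n" for n k i
    proof (induction k)
      case (Suc k)
      have "(x (Suc (n + k)) \<ominus>\<^bsub>Seq\<^esub> x (n + k)) i = \<zero>\<^bsub>Abar\<^esub>"
        by (rule weighted_filD(2)[OF d]) (use that in simp)
      then have "x (Suc (n + k)) i \<ominus>\<^bsub>Abar\<^esub> x (n + k) i = \<zero>\<^bsub>Abar\<^esub>" by (simp add: seq_minus[OF x x])
      then have "x (Suc (n + k)) i = x (n + k) i"
        using c[of "Suc (n + k)" i] c[of "n + k" i] by simp
      then show ?case using Suc by simp
    qed simp
    \<comment> \<open>Entry \<open>i\<close> stops changing at \<open>x (Suc i)\<close>. For
      \<open>i \<ge> n\<close> this is a later term than \<open>x n\<close>, which gives
      divisibility of the difference by \<open>l^n\<close> although the entries may differ.\<close>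
    define y where "y i = x (Suc i) i" for i
    have y: "y \<in> carrier Seq" using c by (simp add: seq_carrier y_def)
    have "y \<ominus>\<^bsub>Seq\<^esub> x n \<in> weighted_fil n" for n
    proof (rule weighted_fil_minusI[OF y x])
      have eq: "y i = x n i" if "i < n" for i
      proof -
        obtain k where "n = Suc i + k" using \<open>i < n\<close> less_iff_Suc_add by auto
        then show ?thesis using stable[of i "Suc i" k] by (simp add: y_def)
      qed
      then show "y i = x n i" if "i < n" for i using that .
      show "y i \<ominus>\<^bsub>Abar\<^esub> x n i \<in> weighted n" for i
      proof (cases "i < n")
        case True
        then show ?thesis using eq z by simp
      next
        case False
        then obtain k where "Suc i = n + k" by (metis le_Suc_ex le_SucI linorder_not_less)
        then show ?thesis using step[of n k i] by (simp add: y_def)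
      qed
    qed
    then show "\<exists>y\<in>carrier Seq. \<forall>n. y \<ominus>\<^bsub>Seq\<^esub> x n \<in> weighted_fil n" using y by blast
  qed
  moreover have "baxter_fil Seq Q = weighted_fil" using baxter_fil_seq by (rule ext)
  ultimately show ?thesis using proper by (simp add: baxter_complete_def)
qed

end

section \<open>Sums over decreasing times and shuffles\<close>

context tensor_base
begin

lemma iota_single_closed: "w \<in> words A n \<Longrightarrow> 1 \<le> n \<Longrightarrow> iota n (single C w) \<in> carrier (tensor_dirlim C A)"
  by (rule iota_carrier[OF _ W.single_closed])

text \<open>The generating relations become equalities in the limit.\<close>

lemma iota_multilinear:
  assumes uv: "set u \<subseteq> carrier A" "set v \<subseteq> carrier A" "length u + 1 + length v = n" and a: "a \<in> carrier A"
  shows "b \<in> carrier A \<Longrightarrow> iota n (single C (u @ [a \<oplus>\<^bsub>A\<^esub> b] @ v)) =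
      iota n (single C (u @ [a] @ v)) \<oplus>\<^bsub>tensor_dirlim C A\<^esub> iota n (single C (u @ [b] @ v))"
    and "c \<in> carrier C \<Longrightarrow> iota n (single C (u @ [c \<odot>\<^bsub>A\<^esub> a] @ v)) =
      c \<odot>\<^bsub>tensor_dirlim C A\<^esub> iota n (single C (u @ [a] @ v))"
proof -
  have n: "1 \<le> n" using uv by simp
  have s: "single C (u @ [a] @ v) \<in> carrier (word_alg C A n)" if "a \<in> carrier A" for a
    by (rule W.single_closed) (use uv that in auto)
  have eq: "iota n x = iota n y"
    if "x \<in> carrier (word_alg C A n)" "y \<in> carrier (word_alg C A n)"
      "x \<ominus>\<^bsub>word_alg C A n\<^esub> y \<in> multilinear_rels C A n" for x y
    using iota_eq_iff[OF n that(1,2)] K.rcos_eq_iff[OF that(1,2)] rels_mem_ker[OF that(3)] by simp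
  show "iota n (single C (u @ [a \<oplus>\<^bsub>A\<^esub> b] @ v)) =
      iota n (single C (u @ [a] @ v)) \<oplus>\<^bsub>tensor_dirlim C A\<^esub> iota n (single C (u @ [b] @ v))"
    if b: "b \<in> carrier A"
  proof -
    have "single C (u @ [a \<oplus>\<^bsub>A\<^esub> b] @ v) \<ominus>\<^bsub>word_alg C A n\<^esub>
       (single C (u @ [a] @ v) \<oplus>\<^bsub>word_alg C A n\<^esub> single C (u @ [b] @ v)) \<in> multilinear_rels C A n"
      unfolding multilinear_rels_def using uv a b by blast
    from eq[OF s[OF A.M.a_closed[OF a b]] W.M.M.a_closed[OF s[OF a] s[OF b]] this]
    show ?thesis using iota_simps(1)[OF n s[OF a] s[OF b]] by simp
  qed
  show "iota n (single C (u @ [c \<odot>\<^bsub>A\<^esub> a] @ v)) =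
      c \<odot>\<^bsub>tensor_dirlim C A\<^esub> iota n (single C (u @ [a] @ v))" if c: "c \<in> carrier C"
  proof -
    have "single C (u @ [c \<odot>\<^bsub>A\<^esub> a] @ v) \<ominus>\<^bsub>word_alg C A n\<^esub>
       (c \<odot>\<^bsub>word_alg C A n\<^esub> single C (u @ [a] @ v)) \<in> multilinear_rels C A n"
      unfolding multilinear_rels_def using uv a c by blast
    from eq[OF s[OF A.smult_closed[OF c a]] W.M.smult_closed[OF c s[OF a]] this]
    show ?thesis using iota_smult[OF n s[OF a] c] by simp
  qed
qed

end

context baxter_base
begin

definition tgen :: "nat \<Rightarrow> 'a \<Rightarrow> (nat \<times> ('a list \<Rightarrow> 'c) set) set" where
  "tgen t a = iota (Suc t) (single C (replicate t \<one>\<^bsub>A\<^esub> @ [a]))"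

lemma std_gen_eq: "std_gen C A a = (\<lambda>t. tgen t a)"
  by (simp add: std_gen_def tgen_def iota_def pure_tensor_def)

lemma tgen_closed [simp]: "a \<in> carrier A \<Longrightarrow> tgen t a \<in> carrier Abar"
  unfolding tgen_def by (rule iota_single_closed) auto

lemma tgen_linear:
  shows "a \<in> carrier A \<Longrightarrow> b \<in> carrier A \<Longrightarrow> tgen t (a \<oplus>\<^bsub>A\<^esub> b) = tgen t a \<oplus>\<^bsub>Abar\<^esub> tgen t b"
    and "a \<in> carrier A \<Longrightarrow> c \<in> carrier C \<Longrightarrow> tgen t (c \<odot>\<^bsub>A\<^esub> a) = c \<odot>\<^bsub>Abar\<^esub> tgen t a"
proof -
  have u: "set (replicate t \<one>\<^bsub>A\<^esub>) \<subseteq> carrier A" "length (replicate t \<one>\<^bsub>A\<^esub>) + 1 + length [] = Suc t" by auto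
  show "a \<in> carrier A \<Longrightarrow> b \<in> carrier A \<Longrightarrow> tgen t (a \<oplus>\<^bsub>A\<^esub> b) = tgen t a \<oplus>\<^bsub>Abar\<^esub> tgen t b"
    "a \<in> carrier A \<Longrightarrow> c \<in> carrier C \<Longrightarrow> tgen t (c \<odot>\<^bsub>A\<^esub> a) = c \<odot>\<^bsub>Abar\<^esub> tgen t a"
    using iota_multilinear[OF u(1) _ u(2), of a] by (simp_all add: tgen_def)
qed

lemma tgen_one: "tgen t \<one>\<^bsub>A\<^esub> = \<one>\<^bsub>Abar\<^esub>"
  using iota_one[of "Suc t"] by (simp add: tgen_def word_one replicate_append_same)

lemma iota_single_mult:
  assumes "u \<in> words A n" "v \<in> words A n" "1 \<le> n"
  shows "iota n (single C u) \<otimes>\<^bsub>Abar\<^esub> iota n (single C v) = iota n (single C (map2 (mult A) u v))"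
  using iota_simps(2)[OF assms(3) W.single_closed[OF assms(1)] W.single_closed[OF assms(2)]]
    word_mult_linear(3)[OF assms(1,2)] by simp

lemma map2_ones: "set v \<subseteq> carrier A \<Longrightarrow> length v = n \<Longrightarrow> map2 (mult A) (replicate n \<one>\<^bsub>A\<^esub>) v = v"
  by (induction v arbitrary: n) auto

text \<open>Two letters at the same time share one tensor slot, where they multiply in
  \<open>A\<close>. This is how a contracted pair of a mixable shuffle appears in sequences.\<close>

lemma tgen_mult:
  assumes "a \<in> carrier A" "b \<in> carrier A"
  shows "tgen t (a \<otimes>\<^bsub>A\<^esub> b) = tgen t a \<otimes>\<^bsub>Abar\<^esub> tgen t b"
  unfolding tgen_def
  by (subst iota_single_mult) (use assms in \<open>auto simp: zip_append map2_ones\<close>)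

text \<open>The sum over all subsequences of the times, taken in order, of the products of generators at
  these times, one factor of the weight for each letter.\<close>

primrec chain_sum :: "nat list \<Rightarrow> 'a list \<Rightarrow> (nat \<times> ('a list \<Rightarrow> 'c) set) set" where
  "chain_sum [] w = (if w = [] then \<one>\<^bsub>Abar\<^esub> else \<zero>\<^bsub>Abar\<^esub>)"
| "chain_sum (t # ts) w = (case w of [] \<Rightarrow> \<one>\<^bsub>Abar\<^esub>
     | a # v \<Rightarrow> chain_sum ts w \<oplus>\<^bsub>Abar\<^esub> l \<odot>\<^bsub>Abar\<^esub> (tgen t a \<otimes>\<^bsub>Abar\<^esub> chain_sum ts v))"

lemma chain_sum_Nil: "chain_sum ts [] = \<one>\<^bsub>Abar\<^esub>"
  by (cases ts) auto

lemma chain_sum_closed [simp]: "set w \<subseteq> carrier A \<Longrightarrow> chain_sum ts w \<in> carrier Abar"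
  by (induction ts arbitrary: w) (auto split: list.split simp: weight_closed)

lemma chain_sum_snoc:
  assumes "set w \<subseteq> carrier A" "a \<in> carrier A"
  shows "chain_sum (ts @ [t]) (w @ [a]) =
    chain_sum ts (w @ [a]) \<oplus>\<^bsub>Abar\<^esub> l \<odot>\<^bsub>Abar\<^esub> (tgen t a \<otimes>\<^bsub>Abar\<^esub> chain_sum ts w)"
  using assms
proof (induction ts arbitrary: w)
  case Nil
  then show ?case by (cases w) (auto simp: weight_closed)
next
  case (Cons s ts)
  show ?case
  proof (cases w)
    case Nil
    then show ?thesis using Cons.IH[of "[]"] Cons.prems
      by (simp add: chain_sum_Nil weight_closed D.M.a_ac)
  next
    case (Cons b v)
    then show ?thesis using Cons.IH[of w] Cons.IH[of v] Cons.prems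
      by (simp add: weight_closed D.M.a_ac D.r_distr D.smult_r_distr D.smult_assoc2' D.m_lcomm)
  qed
qed

text \<open>The linear extension of \<open>\<phi>\<close> evaluated at the mixable shuffle product
  of \<open>x\<close> and \<open>y\<close>. An arbitrary \<open>\<phi>\<close> is allowed because
  the recursion replaces it by \<open>\<lambda>w. \<phi> (w @ [b])\<close> and the like.\<close>

definition shuffle_sum :: "('a list \<Rightarrow> (nat \<times> ('a list \<Rightarrow> 'c) set) set) \<Rightarrow> 'a list \<Rightarrow> 'a list \<Rightarrow>
    (nat \<times> ('a list \<Rightarrow> 'c) set) set" where
  "shuffle_sum \<phi> x y = (\<Oplus>\<^bsub>Abar\<^esub>p\<in>mixable_shuffles (length x) (length y).
     (l [^]\<^bsub>C\<^esub> card (snd p)) \<odot>\<^bsub>Abar\<^esub> \<phi> (shuffle_word A x y (fst p) (snd p)))"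

lemma shuffle_sum_Nil:
  assumes "\<And>w. set w \<subseteq> carrier A \<Longrightarrow> \<phi> w \<in> carrier Abar" "set x \<subseteq> carrier A"
  shows "shuffle_sum \<phi> [] x = \<phi> x" "shuffle_sum \<phi> x [] = \<phi> x"
  using assms by (auto simp: shuffle_sum_def mixable_shuffles_0 shuffle_word_Nil D.M.finsum_insert)

lemma shuffle_sum_summand:
  assumes "\<And>w. set w \<subseteq> carrier A \<Longrightarrow> \<phi> w \<in> carrier Abar" "set x \<subseteq> carrier A" "set y \<subseteq> carrier A"
    and "p \<in> mixable_shuffles (length x) (length y)"
  shows "\<phi> (shuffle_word A x y (fst p) (snd p)) \<in> carrier Abar"
  by (rule assms(1)[OF shuffle_word_closed[OF A.is_monoid assms(4,2,3)]])

lemma shuffle_sum_add: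
  assumes f: "\<And>w. set w \<subseteq> carrier A \<Longrightarrow> f w \<in> carrier Abar" and g: "\<And>w. set w \<subseteq> carrier A \<Longrightarrow> g w \<in> carrier Abar"
    and xy: "set x \<subseteq> carrier A" "set y \<subseteq> carrier A"
    and eq: "\<And>w. set w \<subseteq> carrier A \<Longrightarrow> \<phi> w = f w \<oplus>\<^bsub>Abar\<^esub> g w"
  shows "shuffle_sum \<phi> x y = shuffle_sum f x y \<oplus>\<^bsub>Abar\<^esub> shuffle_sum g x y"
proof -
  have F: "f (shuffle_word A x y (fst p) (snd p)) \<in> carrier Abar"
    and G: "g (shuffle_word A x y (fst p) (snd p)) \<in> carrier Abar"
    if "p \<in> mixable_shuffles (length x) (length y)" for p
    using shuffle_sum_summand[of f x y p] shuffle_sum_summand[of g x y p] f g xy that by blast+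
  have "shuffle_sum \<phi> x y = (\<Oplus>\<^bsub>Abar\<^esub>p\<in>mixable_shuffles (length x) (length y).
     (l [^]\<^bsub>C\<^esub> card (snd p)) \<odot>\<^bsub>Abar\<^esub> f (shuffle_word A x y (fst p) (snd p)) \<oplus>\<^bsub>Abar\<^esub>
     (l [^]\<^bsub>C\<^esub> card (snd p)) \<odot>\<^bsub>Abar\<^esub> g (shuffle_word A x y (fst p) (snd p)))"
    unfolding shuffle_sum_def
  proof (rule D.M.finsum_cong')
    fix p assume p: "p \<in> mixable_shuffles (length x) (length y)"
    show "(l [^]\<^bsub>C\<^esub> card (snd p)) \<odot>\<^bsub>Abar\<^esub> \<phi> (shuffle_word A x y (fst p) (snd p)) =
      (l [^]\<^bsub>C\<^esub> card (snd p)) \<odot>\<^bsub>Abar\<^esub> f (shuffle_word A x y (fst p) (snd p)) \<oplus>\<^bsub>Abar\<^esub>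
      (l [^]\<^bsub>C\<^esub> card (snd p)) \<odot>\<^bsub>Abar\<^esub> g (shuffle_word A x y (fst p) (snd p))"
      unfolding eq[OF shuffle_word_closed[OF A.is_monoid p xy]]
      by (rule D.smult_r_distr[OF weight_pow_closed F[OF p] G[OF p]])
  qed (use F G weight_pow_closed in auto)
  also have "\<dots> = shuffle_sum f x y \<oplus>\<^bsub>Abar\<^esub> shuffle_sum g x y"
    unfolding shuffle_sum_def by (rule D.M.finsum_addf) (use F G weight_pow_closed in auto)
  finally show ?thesis .
qed

lemma shuffle_sum_smult:
  assumes f: "\<And>w. set w \<subseteq> carrier A \<Longrightarrow> f w \<in> carrier Abar" and c: "c \<in> carrier Abar" and k: "k \<in> carrier C"
    and xy: "set x \<subseteq> carrier A" "set y \<subseteq> carrier A"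
  shows "shuffle_sum (\<lambda>w. k \<odot>\<^bsub>Abar\<^esub> (c \<otimes>\<^bsub>Abar\<^esub> f w)) x y = k \<odot>\<^bsub>Abar\<^esub> (c \<otimes>\<^bsub>Abar\<^esub> shuffle_sum f x y)"
proof -
  have F: "f (shuffle_word A x y (fst p) (snd p)) \<in> carrier Abar"
    if "p \<in> mixable_shuffles (length x) (length y)" for p
    using shuffle_sum_summand[of f x y p] f xy that by blast
  have L: "linear_map C Abar Abar (\<lambda>z. k \<odot>\<^bsub>Abar\<^esub> (c \<otimes>\<^bsub>Abar\<^esub> z))"
    by (rule linear_mapI)
       (use k c in \<open>simp_all add: D.r_distr D.smult_r_distr D.smult_assoc2' D.smult_assoc1[symmetric] A.R.m_comm\<close>)
  have "k \<odot>\<^bsub>Abar\<^esub> (c \<otimes>\<^bsub>Abar\<^esub> shuffle_sum f x y) = (\<Oplus>\<^bsub>Abar\<^esub>p\<in>mixable_shuffles (length x) (length y).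
     k \<odot>\<^bsub>Abar\<^esub> (c \<otimes>\<^bsub>Abar\<^esub> ((l [^]\<^bsub>C\<^esub> card (snd p)) \<odot>\<^bsub>Abar\<^esub> f (shuffle_word A x y (fst p) (snd p)))))"
    unfolding shuffle_sum_def
    by (rule linear_map_finsum[OF L D.module D.module finite_mixable_shuffles]) (use F weight_pow_closed in auto)
  also have "\<dots> = shuffle_sum (\<lambda>w. k \<odot>\<^bsub>Abar\<^esub> (c \<otimes>\<^bsub>Abar\<^esub> f w)) x y"
    unfolding shuffle_sum_def
    by (rule D.M.finsum_cong')
       (use F weight_pow_closed k c linear_mapD(3)[OF L weight_pow_closed] in auto)
  finally show ?thesis ..
qed

text \<open>The recursion of the quasi-shuffle product: the result ends in \<open>b\<close>, in
  \<open>a\<close> or in their product, the last case with one additional factor of the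
  weight.\<close>

lemma shuffle_sum_snoc:
  assumes phi: "\<And>w. set w \<subseteq> carrier A \<Longrightarrow> \<phi> w \<in> carrier Abar"
    and x: "set x \<subseteq> carrier A" and y: "set y \<subseteq> carrier A" and a: "a \<in> carrier A" and b: "b \<in> carrier A"
  shows "shuffle_sum \<phi> (x @ [a]) (y @ [b]) =
    shuffle_sum (\<lambda>w. \<phi> (w @ [b])) (x @ [a]) y \<oplus>\<^bsub>Abar\<^esub> shuffle_sum (\<lambda>w. \<phi> (w @ [a])) x (y @ [b]) \<oplus>\<^bsub>Abar\<^esub>
    l \<odot>\<^bsub>Abar\<^esub> shuffle_sum (\<lambda>w. \<phi> (w @ [a \<otimes>\<^bsub>A\<^esub> b])) x y"
proof -
  let ?g = "\<lambda>p. (l [^]\<^bsub>C\<^esub> card (snd p)) \<odot>\<^bsub>Abar\<^esub> \<phi> (shuffle_word A (x @ [a]) (y @ [b]) (fst p) (snd p))"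
  let ?m = "length x" and ?n = "length y"
  have xa: "set (x @ [a]) \<subseteq> carrier A" and yb: "set (y @ [b]) \<subseteq> carrier A" using x y a b by auto
  have ab: "a \<otimes>\<^bsub>A\<^esub> b \<in> carrier A" using a b by simp
  have g: "?g p \<in> carrier Abar" if "p \<in> mixable_shuffles (Suc ?m) (Suc ?n)" for p
    using shuffle_sum_summand[of \<phi> "x @ [a]" "y @ [b]" p] phi xa yb that weight_pow_closed by auto
  have 1: "finsum Abar ?g (mixable_shuffles (Suc ?m) ?n) = shuffle_sum (\<lambda>w. \<phi> (w @ [b])) (x @ [a]) y"
    unfolding shuffle_sum_def
  proof (rule D.M.finsum_cong')
    show "mixable_shuffles (Suc ?m) ?n = mixable_shuffles (length (x @ [a])) ?n" by simp
    fix p assume p: "p \<in> mixable_shuffles (length (x @ [a])) ?n"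
    show "?g p = (l [^]\<^bsub>C\<^esub> card (snd p)) \<odot>\<^bsub>Abar\<^esub> \<phi> (shuffle_word A (x @ [a]) y (fst p) (snd p) @ [b])"
      unfolding shuffle_word_right[OF p] ..
  next
    show "(\<lambda>p. (l [^]\<^bsub>C\<^esub> card (snd p)) \<odot>\<^bsub>Abar\<^esub> \<phi> (shuffle_word A (x @ [a]) y (fst p) (snd p) @ [b]))
      \<in> mixable_shuffles (length (x @ [a])) ?n \<rightarrow> carrier Abar"
      using weight_pow_closed shuffle_sum_summand[where \<phi> = "\<lambda>w. \<phi> (w @ [b])", OF _ xa y] phi b by auto
  qed
  have 2: "(\<Oplus>\<^bsub>Abar\<^esub>p\<in>mixable_shuffles ?m (Suc ?n). ?g (insert_left ?m (Suc ?n) p)) =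
    shuffle_sum (\<lambda>w. \<phi> (w @ [a])) x (y @ [b])"
    unfolding shuffle_sum_def
  proof (rule D.M.finsum_cong')
    show "mixable_shuffles ?m (Suc ?n) = mixable_shuffles ?m (length (y @ [b]))" by simp
    fix p assume p: "p \<in> mixable_shuffles ?m (length (y @ [b]))"
    show "?g (insert_left ?m (Suc ?n) p) =
      (l [^]\<^bsub>C\<^esub> card (snd p)) \<odot>\<^bsub>Abar\<^esub> \<phi> (shuffle_word A x (y @ [b]) (fst p) (snd p) @ [a])"
      using shuffle_word_left[OF p, of A a] by simp
  next
    show "(\<lambda>p. (l [^]\<^bsub>C\<^esub> card (snd p)) \<odot>\<^bsub>Abar\<^esub> \<phi> (shuffle_word A x (y @ [b]) (fst p) (snd p) @ [a]))
      \<in> mixable_shuffles ?m (length (y @ [b])) \<rightarrow> carrier Abar"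
      using weight_pow_closed shuffle_sum_summand[where \<phi> = "\<lambda>w. \<phi> (w @ [a])", OF _ x yb] phi a by auto
  qed
  have F: "\<phi> (shuffle_word A x y (fst p) (snd p) @ [a \<otimes>\<^bsub>A\<^esub> b]) \<in> carrier Abar"
    if "p \<in> mixable_shuffles ?m ?n" for p
    using shuffle_sum_summand[where \<phi> = "\<lambda>w. \<phi> (w @ [a \<otimes>\<^bsub>A\<^esub> b])", OF _ x y that] phi ab by auto
  have 3: "(\<Oplus>\<^bsub>Abar\<^esub>p\<in>mixable_shuffles ?m ?n. ?g (insert_both ?m ?n p)) =
    l \<odot>\<^bsub>Abar\<^esub> shuffle_sum (\<lambda>w. \<phi> (w @ [a \<otimes>\<^bsub>A\<^esub> b])) x y"
  proof -
    have "l \<odot>\<^bsub>Abar\<^esub> shuffle_sum (\<lambda>w. \<phi> (w @ [a \<otimes>\<^bsub>A\<^esub> b])) x y = (\<Oplus>\<^bsub>Abar\<^esub>p\<in>mixable_shuffles ?m ?n.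
      l \<odot>\<^bsub>Abar\<^esub> ((l [^]\<^bsub>C\<^esub> card (snd p)) \<odot>\<^bsub>Abar\<^esub> \<phi> (shuffle_word A x y (fst p) (snd p) @ [a \<otimes>\<^bsub>A\<^esub> b])))"
      unfolding shuffle_sum_def
      by (rule D.finsum_smult_ldistr[OF finite_mixable_shuffles weight_closed]) (use F weight_pow_closed in auto)
    also have "\<dots> = (\<Oplus>\<^bsub>Abar\<^esub>p\<in>mixable_shuffles ?m ?n. ?g (insert_both ?m ?n p))"
    proof (rule D.M.finsum_cong'[symmetric])
      fix p assume p: "p \<in> mixable_shuffles ?m ?n"
      \<comment> \<open>The final pair is new to \<open>T\<close>, which accounts for the extra
        factor \<open>l\<close>.\<close>
      have "card (snd (insert_both ?m ?n p)) = Suc (card (snd p))"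
        using mixable_shuffle_snd(1,2)[OF p] by simp
      then show "?g (insert_both ?m ?n p) = l \<odot>\<^bsub>Abar\<^esub> ((l [^]\<^bsub>C\<^esub> card (snd p)) \<odot>\<^bsub>Abar\<^esub>
          \<phi> (shuffle_word A x y (fst p) (snd p) @ [a \<otimes>\<^bsub>A\<^esub> b]))"
        unfolding shuffle_word_both[OF p] using weight_pow_Suc[OF F[OF p]] by (simp only:)
    qed (use F weight_pow_closed weight_closed in auto)
    finally show ?thesis ..
  qed
  have "shuffle_sum \<phi> (x @ [a]) (y @ [b]) = finsum Abar ?g (mixable_shuffles (Suc ?m) (Suc ?n))"
    by (simp add: shuffle_sum_def)
  also have "\<dots> = finsum Abar ?g (mixable_shuffles (Suc ?m) ?n) \<oplus>\<^bsub>Abar\<^esub>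
    (\<Oplus>\<^bsub>Abar\<^esub>p\<in>mixable_shuffles ?m (Suc ?n). ?g (insert_left ?m (Suc ?n) p)) \<oplus>\<^bsub>Abar\<^esub>
    (\<Oplus>\<^bsub>Abar\<^esub>p\<in>mixable_shuffles ?m ?n. ?g (insert_both ?m ?n p))"
    by (rule D.M.finsum_mixable_Suc) (rule g)
  finally show ?thesis unfolding 1 2 3 .
qed

lemma shuffle_sum_closed:
  assumes "\<And>w. set w \<subseteq> carrier A \<Longrightarrow> \<phi> w \<in> carrier Abar" "set x \<subseteq> carrier A" "set y \<subseteq> carrier A"
  shows "shuffle_sum \<phi> x y \<in> carrier Abar"
  unfolding shuffle_sum_def
  by (rule D.M.finsum_closed)
     (use shuffle_sum_summand[of \<phi> x y] assms weight_pow_closed in auto)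

text \<open>Sums over chains of times multiply like quasi-symmetric functions: two chains are merged
  in order, and letters at coinciding times are contracted. There the weights of the two separate
  letters equal the weight of one letter times that of the contraction. The induction removes the
  last time of the list, to match the recursion of shuffles.\<close>

lemma shuffle_sum_chain_sum:
  assumes "set x \<subseteq> carrier A" "set y \<subseteq> carrier A"
  shows "shuffle_sum (chain_sum ts) x y = chain_sum ts x \<otimes>\<^bsub>Abar\<^esub> chain_sum ts y"
  using assms
proof (induction ts arbitrary: x y rule: rev_induct)
  case Nil
  show ?case
  proof (cases "x = [] \<or> y = []")
    case True
    then show ?thesis using Nil shuffle_sum_Nil[of "chain_sum []"] by (auto simp: chain_sum_Nil simp del: chain_sum.simps)
  next
    case False
    then obtain x' a y' b where xy: "x = x' @ [a]" "y = y' @ [b]" by (metis rev_exhaust)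
    have z: "shuffle_sum (\<lambda>w. \<zero>\<^bsub>Abar\<^esub>) u v = \<zero>\<^bsub>Abar\<^esub>" for u v
      unfolding shuffle_sum_def using weight_pow_closed
      by (intro D.M.add.finprod_one_eqI) simp
    \<comment> \<open>Without times only the empty word has a nonzero value, and every shuffle of
      nonempty words ends in a letter.\<close>
    have "shuffle_sum (chain_sum []) (x' @ [a]) (y' @ [b]) = \<zero>\<^bsub>Abar\<^esub>"
      using shuffle_sum_snoc[of "chain_sum []" x' y' a b, OF chain_sum_closed] Nil weight_closed
      by (simp add: xy z)
    moreover have "chain_sum [] (x' @ [a]) = \<zero>\<^bsub>Abar\<^esub>" by simp
    ultimately show ?thesis using Nil(2) by (simp only: xy D.l_null chain_sum_closed)
  qed
next
  case (snoc t ts)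
  show ?case
  proof (cases "x = [] \<or> y = []")
    case True
    then show ?thesis using snoc.prems shuffle_sum_Nil[of "chain_sum (ts @ [t])"] by (auto simp: chain_sum_Nil)
  next
    case False
    then obtain x' a y' b where xy: "x = x' @ [a]" "y = y' @ [b]" by (metis rev_exhaust)
    have c: "set x' \<subseteq> carrier A" "set y' \<subseteq> carrier A" "a \<in> carrier A" "b \<in> carrier A"
      "a \<otimes>\<^bsub>A\<^esub> b \<in> carrier A" using snoc.prems by (auto simp: xy)
    let ?H = "chain_sum ts"
    have s: "shuffle_sum (\<lambda>w. chain_sum (ts @ [t]) (w @ [d])) u v =
      shuffle_sum (\<lambda>w. ?H (w @ [d])) u v \<oplus>\<^bsub>Abar\<^esub> l \<odot>\<^bsub>Abar\<^esub> (tgen t d \<otimes>\<^bsub>Abar\<^esub> (?H u \<otimes>\<^bsub>Abar\<^esub> ?H v))"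
      if d: "d \<in> carrier A" and uv: "set u \<subseteq> carrier A" "set v \<subseteq> carrier A" for d u v
    proof -
      have "shuffle_sum (\<lambda>w. chain_sum (ts @ [t]) (w @ [d])) u v =
        shuffle_sum (\<lambda>w. ?H (w @ [d])) u v \<oplus>\<^bsub>Abar\<^esub>
        shuffle_sum (\<lambda>w. l \<odot>\<^bsub>Abar\<^esub> (tgen t d \<otimes>\<^bsub>Abar\<^esub> ?H w)) u v"
        by (rule shuffle_sum_add) (use d uv weight_closed chain_sum_snoc in auto)
      also have "shuffle_sum (\<lambda>w. l \<odot>\<^bsub>Abar\<^esub> (tgen t d \<otimes>\<^bsub>Abar\<^esub> ?H w)) u v =
        l \<odot>\<^bsub>Abar\<^esub> (tgen t d \<otimes>\<^bsub>Abar\<^esub> shuffle_sum ?H u v)"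
        by (rule shuffle_sum_smult) (use d uv weight_closed in auto)
      finally show ?thesis using snoc.IH[OF uv] by simp
    qed
    have xa: "set (x' @ [a]) \<subseteq> carrier A" and yb: "set (y' @ [b]) \<subseteq> carrier A" using c by auto
    define U V W X Y where "U = shuffle_sum (\<lambda>w. ?H (w @ [b])) (x' @ [a]) y'"
      and "V = shuffle_sum (\<lambda>w. ?H (w @ [a])) x' (y' @ [b])"
      and "W = shuffle_sum (\<lambda>w. ?H (w @ [a \<otimes>\<^bsub>A\<^esub> b])) x' y'"
      and "X = ?H (x' @ [a])" and "Y = ?H (y' @ [b])"
    have UVW: "U \<in> carrier Abar" "V \<in> carrier Abar" "W \<in> carrier Abar" "X \<in> carrier Abar" "Y \<in> carrier Abar"
      unfolding U_def V_def W_def X_def Y_def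
      using c by (auto intro!: shuffle_sum_closed)
    have XY: "X \<otimes>\<^bsub>Abar\<^esub> Y = U \<oplus>\<^bsub>Abar\<^esub> V \<oplus>\<^bsub>Abar\<^esub> l \<odot>\<^bsub>Abar\<^esub> W"
      unfolding U_def V_def W_def X_def Y_def
      using shuffle_sum_snoc[of ?H x' y' a b] snoc.IH[OF xa yb] c by simp
    have "shuffle_sum (chain_sum (ts @ [t])) x y =
      (U \<oplus>\<^bsub>Abar\<^esub> l \<odot>\<^bsub>Abar\<^esub> (tgen t b \<otimes>\<^bsub>Abar\<^esub> (X \<otimes>\<^bsub>Abar\<^esub> ?H y'))) \<oplus>\<^bsub>Abar\<^esub>
      (V \<oplus>\<^bsub>Abar\<^esub> l \<odot>\<^bsub>Abar\<^esub> (tgen t a \<otimes>\<^bsub>Abar\<^esub> (?H x' \<otimes>\<^bsub>Abar\<^esub> Y))) \<oplus>\<^bsub>Abar\<^esub>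
      l \<odot>\<^bsub>Abar\<^esub> (W \<oplus>\<^bsub>Abar\<^esub> l \<odot>\<^bsub>Abar\<^esub> (tgen t (a \<otimes>\<^bsub>A\<^esub> b) \<otimes>\<^bsub>Abar\<^esub> (?H x' \<otimes>\<^bsub>Abar\<^esub> ?H y')))"
      unfolding xy U_def V_def W_def X_def Y_def
      using shuffle_sum_snoc[of "chain_sum (ts @ [t])" x' y' a b] c
        s[OF c(4) xa c(2)] s[OF c(3) c(1) yb] s[OF c(5) c(1,2)] by (simp del: append_Cons)
    \<comment> \<open>The terms that do not use time \<open>t\<close> recombine by
      \<open>XY\<close>; the others are the three ways in which at least one of the two factors ends
      at \<open>t\<close>.\<close>
    also have "\<dots> = X \<otimes>\<^bsub>Abar\<^esub> Y \<oplus>\<^bsub>Abar\<^esub> (l \<odot>\<^bsub>Abar\<^esub> (tgen t b \<otimes>\<^bsub>Abar\<^esub> (X \<otimes>\<^bsub>Abar\<^esub> ?H y')) \<oplus>\<^bsub>Abar\<^esub>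
      l \<odot>\<^bsub>Abar\<^esub> (tgen t a \<otimes>\<^bsub>Abar\<^esub> (?H x' \<otimes>\<^bsub>Abar\<^esub> Y)) \<oplus>\<^bsub>Abar\<^esub>
      l \<odot>\<^bsub>Abar\<^esub> (l \<odot>\<^bsub>Abar\<^esub> (tgen t a \<otimes>\<^bsub>Abar\<^esub> tgen t b \<otimes>\<^bsub>Abar\<^esub> (?H x' \<otimes>\<^bsub>Abar\<^esub> ?H y'))))"
      unfolding XY using UVW c weight_closed by (simp add: tgen_mult D.smult_r_distr D.M.a_ac)
    also have "\<dots> = (X \<oplus>\<^bsub>Abar\<^esub> l \<odot>\<^bsub>Abar\<^esub> (tgen t a \<otimes>\<^bsub>Abar\<^esub> ?H x')) \<otimes>\<^bsub>Abar\<^esub>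
      (Y \<oplus>\<^bsub>Abar\<^esub> l \<odot>\<^bsub>Abar\<^esub> (tgen t b \<otimes>\<^bsub>Abar\<^esub> ?H y'))"
      using UVW c weight_closed
      by (simp add: D.l_distr D.r_distr D.smult_assoc2 D.smult_assoc2' D.smult_r_distr D.m_ac D.M.a_ac)
    also have "\<dots> = chain_sum (ts @ [t]) x \<otimes>\<^bsub>Abar\<^esub> chain_sum (ts @ [t]) y"
      using chain_sum_snoc[of x' a ts t] chain_sum_snoc[of y' b ts t] c by (simp add: xy X_def Y_def)
    finally show ?thesis .
  qed
qed

lemma chain_sum_multilinear:
  assumes "set u \<subseteq> carrier A" "set v \<subseteq> carrier A" "a \<in> carrier A"
  shows "b \<in> carrier A \<Longrightarrow> chain_sum ts (u @ [a \<oplus>\<^bsub>A\<^esub> b] @ v) =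
      chain_sum ts (u @ [a] @ v) \<oplus>\<^bsub>Abar\<^esub> chain_sum ts (u @ [b] @ v)"
    and "c \<in> carrier C \<Longrightarrow> chain_sum ts (u @ [c \<odot>\<^bsub>A\<^esub> a] @ v) = c \<odot>\<^bsub>Abar\<^esub> chain_sum ts (u @ [a] @ v)"
proof -
  show "chain_sum ts (u @ [a \<oplus>\<^bsub>A\<^esub> b] @ v) = chain_sum ts (u @ [a] @ v) \<oplus>\<^bsub>Abar\<^esub> chain_sum ts (u @ [b] @ v)"
    if "b \<in> carrier A"
    using assms that
  proof (induction ts arbitrary: u)
    case (Cons t ts)
    show ?case
    proof (cases u)
      case Nil
      then show ?thesis using Cons.IH[of "[]"] Cons.prems weight_closed
        by (simp add: tgen_linear D.l_distr D.smult_r_distr D.M.a_ac)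
    next
      case (Cons d w)
      then show ?thesis using Cons.IH[of u] Cons.IH[of w] Cons.prems weight_closed
        by (simp add: D.r_distr D.smult_r_distr D.M.a_ac)
    qed
  qed simp
  show "chain_sum ts (u @ [c \<odot>\<^bsub>A\<^esub> a] @ v) = c \<odot>\<^bsub>Abar\<^esub> chain_sum ts (u @ [a] @ v)" if "c \<in> carrier C"
    using assms that
  proof (induction ts arbitrary: u)
    case (Cons t ts)
    show ?case
    proof (cases u)
      case Nil
      then show ?thesis using Cons.IH[of "[]"] Cons.prems weight_closed
        by (simp add: tgen_linear D.smult_r_distr D.smult_assoc2 D.smult_assoc1[symmetric] A.R.m_comm)
    next
      case (Cons d w)
      then show ?thesis using Cons.IH[of u] Cons.IH[of w] Cons.prems weight_closed
        by (simp add: D.smult_r_distr D.smult_assoc2' D.smult_assoc1[symmetric] A.R.m_comm)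
    qed
  qed simp
qed

end

section \<open>Evaluation of words\<close>

context baxter_base
begin

abbreviation times_below :: "nat \<Rightarrow> nat list" where
  "times_below i \<equiv> rev [0..<i]"

text \<open>Entry \<open>i\<close> of the image of a word: the head stands at time \<open>i\<close>
  and carries no weight, the tail stands at strictly earlier times. The value at the empty word is a
  default, as tensors in \<open>Sh\<close> have at least one factor.\<close>

definition psi :: "nat \<Rightarrow> 'a list \<Rightarrow> (nat \<times> ('a list \<Rightarrow> 'c) set) set" where
  "psi i w = (case w of [] \<Rightarrow> \<zero>\<^bsub>Abar\<^esub> | a # v \<Rightarrow> tgen i a \<otimes>\<^bsub>Abar\<^esub> chain_sum (times_below i) v)"

lemma psi_Cons: "psi i (a # v) = tgen i a \<otimes>\<^bsub>Abar\<^esub> chain_sum (times_below i) v"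
  by (simp add: psi_def)

lemma psi_closed [simp]: "set w \<subseteq> carrier A \<Longrightarrow> psi i w \<in> carrier Abar"
  by (auto simp: psi_def split: list.split)

lemma psi_multilinear:
  assumes "set u \<subseteq> carrier A" "set v \<subseteq> carrier A" "a \<in> carrier A"
  shows "b \<in> carrier A \<Longrightarrow> psi i (u @ [a \<oplus>\<^bsub>A\<^esub> b] @ v) = psi i (u @ [a] @ v) \<oplus>\<^bsub>Abar\<^esub> psi i (u @ [b] @ v)"
    and "c \<in> carrier C \<Longrightarrow> psi i (u @ [c \<odot>\<^bsub>A\<^esub> a] @ v) = c \<odot>\<^bsub>Abar\<^esub> psi i (u @ [a] @ v)"
proof -
  show "psi i (u @ [a \<oplus>\<^bsub>A\<^esub> b] @ v) = psi i (u @ [a] @ v) \<oplus>\<^bsub>Abar\<^esub> psi i (u @ [b] @ v)" if "b \<in> carrier A"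
  proof (cases u)
    case Nil
    then show ?thesis using assms that by (simp add: psi_Cons tgen_linear D.l_distr)
  next
    case (Cons d u')
    then show ?thesis using assms that chain_sum_multilinear(1)[of u' v a b] by (simp add: psi_Cons D.r_distr)
  qed
  show "psi i (u @ [c \<odot>\<^bsub>A\<^esub> a] @ v) = c \<odot>\<^bsub>Abar\<^esub> psi i (u @ [a] @ v)" if "c \<in> carrier C"
  proof (cases u)
    case Nil
    then show ?thesis using assms that by (simp add: psi_Cons tgen_linear D.smult_assoc2)
  next
    case (Cons d u')
    then show ?thesis using assms that chain_sum_multilinear(2)[of u' v a c] by (simp add: psi_Cons D.smult_assoc2')
  qed
qed

text \<open>Letters occupy distinct places in the list of times, so a nonzero term needs at least as
  many times as letters.\<close>

lemma chain_sum_long: "set w \<subseteq> carrier A \<Longrightarrow> length ts < length w \<Longrightarrow> chain_sum ts w = \<zero>\<^bsub>Abar\<^esub>"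
proof (induction ts arbitrary: w)
  case (Cons t ts)
  then obtain a v where w: "w = a # v" by (cases w) auto
  then show ?case using Cons.IH[of w] Cons.IH[of v] Cons.prems weight_closed by simp
qed auto

lemma psi_long: "set w \<subseteq> carrier A \<Longrightarrow> Suc i < length w \<Longrightarrow> psi i w = \<zero>\<^bsub>Abar\<^esub>"
  by (cases w) (auto simp: psi_Cons chain_sum_long)

text \<open>A word of maximal length uses every time once, in descending order.\<close>

lemma psi_top: "set w \<subseteq> carrier A \<Longrightarrow> length w = Suc i \<Longrightarrow>
    psi i w = (l [^]\<^bsub>C\<^esub> i) \<odot>\<^bsub>Abar\<^esub> iota (Suc i) (single C (rev w))"
proof (induction i arbitrary: w)
  case 0
  then obtain a where "w = [a]" by (auto simp: length_Suc_conv)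
  then show ?case using 0 tgen_closed[of a 0] iota_single_closed[of "[a]" "Suc 0"] by (simp add: psi_Cons) (simp add: tgen_def)
next
  case (Suc i)
  then obtain a b v where w: "w = a # b # v" by (auto simp: length_Suc_conv)
  then have c: "a \<in> carrier A" "b \<in> carrier A" "set v \<subseteq> carrier A" "length v = i" using Suc.prems by auto
  let ?z = "iota (Suc i) (single C (rev (b # v)))"
  have bv: "rev (b # v) \<in> words A (Suc i)" using c by auto
  then have z: "?z \<in> carrier Abar" by (rule iota_single_closed) simp
  \<comment> \<open>The tail fills one tensor slot fewer than the whole word. A final one makes room
    for the head, whose time belongs to the last slot.\<close>
  have pad: "?z = iota (Suc (Suc i)) (single C (rev (b # v) @ [\<one>\<^bsub>A\<^esub>]))"
    using iota_pad[OF _ W.single_closed[OF bv], of 1] pad_linear(2)[OF bv, of 1] by simp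
  \<comment> \<open>If \<open>b\<close> skipped time \<open>i\<close>, only \<open>i\<close> times
    would remain for \<open>Suc i\<close> letters.\<close>
  have "chain_sum (times_below i) (b # v) = \<zero>\<^bsub>Abar\<^esub>"
    using c by (intro chain_sum_long) auto
  then have "chain_sum (times_below (Suc i)) (b # v) = l \<odot>\<^bsub>Abar\<^esub> psi i (b # v)"
    using c weight_closed by (simp add: psi_Cons)
  also have "\<dots> = (l [^]\<^bsub>C\<^esub> Suc i) \<odot>\<^bsub>Abar\<^esub> ?z"
    using Suc.IH[of "b # v"] c weight_pow_Suc[OF z, of i] by simp
  finally have "psi (Suc i) w = tgen (Suc i) a \<otimes>\<^bsub>Abar\<^esub> ((l [^]\<^bsub>C\<^esub> Suc i) \<odot>\<^bsub>Abar\<^esub> ?z)"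
    by (simp only: w psi_Cons)
  also have "\<dots> = (l [^]\<^bsub>C\<^esub> Suc i) \<odot>\<^bsub>Abar\<^esub> (tgen (Suc i) a \<otimes>\<^bsub>Abar\<^esub> ?z)"
    by (rule D.smult_assoc2'[OF weight_pow_closed tgen_closed[OF c(1)] z])
  also have "tgen (Suc i) a \<otimes>\<^bsub>Abar\<^esub> ?z = iota (Suc (Suc i)) (single C (rev w))"
  proof -
    have "map2 (mult A) (replicate (Suc i) \<one>\<^bsub>A\<^esub> @ [a]) (rev (b # v) @ [\<one>\<^bsub>A\<^esub>]) = rev w"
      using map2_ones[of "rev (b # v)" "Suc i"] bv c w by (simp del: replicate_Suc rev.simps) simp
    moreover have "replicate (Suc i) \<one>\<^bsub>A\<^esub> @ [a] \<in> words A (Suc (Suc i))"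
      "rev (b # v) @ [\<one>\<^bsub>A\<^esub>] \<in> words A (Suc (Suc i))" using c by auto
    ultimately show ?thesis unfolding pad tgen_def by (subst iota_single_mult) simp_all
  qed
  finally show ?case .
qed

definition nonempty_words :: "'a list set" where
  "nonempty_words = {w. w \<noteq> [] \<and> set w \<subseteq> carrier A}"

text \<open>Only the module structure matters, so the multiplicative fields are dummies.\<close>

definition nword_mod :: "('c, 'a list \<Rightarrow> 'c) module" where
  "nword_mod = \<lparr>carrier = {f. (\<forall>w. f w \<in> carrier C) \<and> finite {w. f w \<noteq> \<zero>\<^bsub>C\<^esub>} \<and>
        (\<forall>w. f w \<noteq> \<zero>\<^bsub>C\<^esub> \<longrightarrow> w \<in> nonempty_words)},
     mult = (\<lambda>f g. f), one = (\<lambda>w. \<zero>\<^bsub>C\<^esub>), zero = (\<lambda>w. \<zero>\<^bsub>C\<^esub>),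
     add = (\<lambda>f g w. f w \<oplus>\<^bsub>C\<^esub> g w), smult = (\<lambda>c f w. c \<otimes>\<^bsub>C\<^esub> f w)\<rparr>"

lemma nword_free: "free_module C nonempty_words nword_mod"
  by unfold_locales (auto simp: nword_mod_def)

sublocale N: free_module C nonempty_words nword_mod
  by (rule nword_free)

lemmas nword_module = N.free_module_module

lemma words_nonempty: "words A (Suc n) \<subseteq> nonempty_words"
  by (auto simp: nonempty_words_def)

lemma word_alg_nword: "x \<in> carrier (word_alg C A (Suc n)) \<Longrightarrow> x \<in> carrier nword_mod"
  by (auto simp: W.carrier_eq N.carrier_eq nonempty_words_def)

lemma word_alg_nword_linear: "linear_map C (word_alg C A (Suc n)) nword_mod (\<lambda>x. x)"
  by (rule linear_mapI) (auto simp: word_alg_nword, simp_all add: W.add_eq N.add_eq W.smult_eq N.smult_eq)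

definition Psi :: "('a list \<Rightarrow> 'c) \<Rightarrow> nat \<Rightarrow> (nat \<times> ('a list \<Rightarrow> 'c) set) set" where
  "Psi F = (\<lambda>i. free_ext C Abar (psi i) F)"

lemma psi_nonempty: "psi i \<in> nonempty_words \<rightarrow> carrier Abar"
  by (auto simp: nonempty_words_def)

lemma Psi_component_linear: "linear_map C nword_mod Abar (\<lambda>F. Psi F i)"
  unfolding Psi_def by (rule N.free_ext_linear[OF D.module psi_nonempty])

lemma Psi_linear: "linear_map C nword_mod Seq Psi"
  using linear_mapD[OF Psi_component_linear]
  by (intro linear_mapI) (simp_all add: seq_carrier fun_eq_iff seq_component)

lemma Psi_single: "w \<in> nonempty_words \<Longrightarrow> Psi (single C w) i = psi i w"
  unfolding Psi_def by (rule N.free_ext_single[OF D.module psi_nonempty])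

text \<open>\<open>psi i\<close> is multilinear in the letters, so the evaluation factors through
  tensors.\<close>

lemma Psi_tensor_ker:
  assumes x: "x \<in> tensor_ker C A (Suc n)"
  shows "Psi x i = \<zero>\<^bsub>Abar\<^esub>"
proof -
  have L: "linear_map C (word_alg C A (Suc n)) Abar (\<lambda>x. Psi x i)"
    by (rule linear_map_comp[OF word_alg_nword_linear Psi_component_linear])
  have s: "Psi (single C (u @ [a] @ v)) i = psi i (u @ [a] @ v)"
    if "set u \<subseteq> carrier A" "set v \<subseteq> carrier A" "a \<in> carrier A" for u v a
    by (rule Psi_single) (use that in \<open>auto simp: nonempty_words_def\<close>)
  have "multilinear_mod (Suc n) Abar {\<zero>\<^bsub>Abar\<^esub>} (\<lambda>w. Psi (single C w) i)"
    unfolding multilinear_mod_def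
    using weight_closed by (auto simp: s[simplified] psi_multilinear[simplified] D.M.minus_eq D.M.r_neg)
  from tensor_ker_image[where L = "\<lambda>x. Psi x i", OF L D.module submodule_zero[OF D.module] this x]
  show ?thesis by simp
qed

section \<open>Parts of a combination of words of given length\<close>

lemma word_part_linear: "linear_map C nword_mod (word_alg C A (Suc k)) (word_part C (Suc k))"
proof (rule linear_mapI)
  fix F assume F: "F \<in> carrier nword_mod"
  then have "finite {w. F w \<noteq> \<zero>\<^bsub>C\<^esub>}" by (simp add: N.carrier_eq)
  then have "finite {w. word_part C (Suc k) F w \<noteq> \<zero>\<^bsub>C\<^esub>}"
    by (rule rev_finite_subset) (auto simp: word_part_def)
  then show "word_part C (Suc k) F \<in> carrier (word_alg C A (Suc k))"
    using F by (auto simp: N.carrier_eq W.carrier_eq word_part_def nonempty_words_def)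
qed (auto simp: word_part_def N.add_eq N.smult_eq W.add_eq W.smult_eq)

lemma word_part_word_alg:
  assumes "x \<in> carrier (word_alg C A n)"
  shows "word_part C k x = (if k = n then x else (\<lambda>w. \<zero>\<^bsub>C\<^esub>))"
proof -
  have "x w = \<zero>\<^bsub>C\<^esub>" if "length w \<noteq> n" for w using assms that by (auto simp: W.carrier_eq)
  then show ?thesis by (auto simp: word_part_def fun_eq_iff)
qed

definition word_low :: "nat \<Rightarrow> ('a list \<Rightarrow> 'c) \<Rightarrow> 'a list \<Rightarrow> 'c" where
  "word_low k F = (\<lambda>w. if length w \<le> k then F w else \<zero>\<^bsub>C\<^esub>)"

lemma word_low_linear: "linear_map C nword_mod nword_mod (word_low k)"
proof (rule linear_mapI)
  fix F assume F: "F \<in> carrier nword_mod"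
  then have "finite {w. F w \<noteq> \<zero>\<^bsub>C\<^esub>}" by (simp add: N.carrier_eq)
  then have "finite {w. word_low k F w \<noteq> \<zero>\<^bsub>C\<^esub>}"
    by (rule rev_finite_subset) (auto simp: word_low_def)
  then show "word_low k F \<in> carrier nword_mod"
    using F by (auto simp: N.carrier_eq word_low_def)
qed (auto simp: word_low_def N.add_eq N.smult_eq)

lemma word_low_0: "F \<in> carrier nword_mod \<Longrightarrow> word_low 0 F = \<zero>\<^bsub>nword_mod\<^esub>"
  by (auto simp: word_low_def N.carrier_eq N.zero_eq nonempty_words_def fun_eq_iff)

lemma word_low_Suc:
  "F \<in> carrier nword_mod \<Longrightarrow> word_low (Suc k) F = word_low k F \<oplus>\<^bsub>nword_mod\<^esub> word_part C (Suc k) F"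
  by (auto simp: word_low_def word_part_def N.add_eq N.carrier_eq fun_eq_iff le_Suc_eq)

text \<open>The support is finite, so the lengths that occur are bounded.\<close>

lemma word_low_eventually:
  assumes "F \<in> carrier nword_mod"
  obtains k where "word_low k F = F" and "\<And>j. j \<ge> k \<Longrightarrow> word_part C (Suc j) F = (\<lambda>w. \<zero>\<^bsub>C\<^esub>)"
proof -
  have "finite (length ` {w. F w \<noteq> \<zero>\<^bsub>C\<^esub>})" using assms by (simp add: N.carrier_eq)
  then obtain k where "\<And>w. F w \<noteq> \<zero>\<^bsub>C\<^esub> \<Longrightarrow> length w \<le> k"
    by (auto simp: finite_nat_set_iff_bounded_le)
  then have k: "F w = \<zero>\<^bsub>C\<^esub>" if "length w > k" for w using that linorder_not_le by blast
  show ?thesis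
  proof
    show "word_low k F = F" using k by (auto simp: word_low_def fun_eq_iff)
    show "word_part C (Suc j) F = (\<lambda>w. \<zero>\<^bsub>C\<^esub>)" if "j \<ge> k" for j
      using k that by (auto simp: word_part_def fun_eq_iff)
  qed
qed

text \<open>Words with more than \<open>Suc i\<close> letters do not fit into the times up to
  \<open>i\<close>.\<close>

lemma Psi_low:
  assumes F: "F \<in> carrier nword_mod"
  shows "Psi F i = Psi (word_low (Suc i) F) i"
proof (rule N.linear_map_eqI[OF Psi_component_linear
      linear_map_comp[OF word_low_linear Psi_component_linear] D.module _ F])
  fix w assume w: "w \<in> nonempty_words"
  show "Psi (single C w) i = Psi (word_low (Suc i) (single C w)) i"
  proof (cases "length w \<le> Suc i")
    case True
    then have "word_low (Suc i) (single C w) = single C w" by (auto simp: word_low_def single_def fun_eq_iff)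
    then show ?thesis by simp
  next
    case False
    then have "word_low (Suc i) (single C w) = \<zero>\<^bsub>nword_mod\<^esub>"
      by (auto simp: word_low_def single_def fun_eq_iff N.zero_eq)
    then show ?thesis
      using False w linear_map_zero[OF Psi_component_linear nword_module D.module]
      by (simp add: Psi_single psi_long nonempty_words_def)
  qed
qed

lemma Psi_low_zero:
  assumes F: "F \<in> carrier nword_mod" and "\<And>j. j < k \<Longrightarrow> word_part C (Suc j) F \<in> tensor_ker C A (Suc j)"
  shows "Psi (word_low k F) i = \<zero>\<^bsub>Abar\<^esub>"
  using assms(2)
proof (induction k)
  case 0
  show ?case
    unfolding word_low_0[OF F] by (rule linear_map_zero[OF Psi_component_linear nword_module D.module])
next
  case (Suc k)
  have "Psi (word_low (Suc k) F) i = Psi (word_low k F) i \<oplus>\<^bsub>Abar\<^esub> Psi (word_part C (Suc k) F) i"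
    unfolding word_low_Suc[OF F]
    by (rule linear_mapD(2)[OF Psi_component_linear])
       (use linear_mapD(1)[OF word_low_linear F] word_alg_nword[OF linear_mapD(1)[OF word_part_linear F]] in auto)
  then show ?case using Suc Psi_tensor_ker[of "word_part C (Suc k) F" k i] by simp
qed

lemma rev_letterwise: "letterwise_linear n n rev"
  unfolding letterwise_linear_def
proof (intro conjI allI impI)
  fix u v assume "set u \<subseteq> carrier A \<and> set v \<subseteq> carrier A \<and> length u + 1 + length v = n"
  moreover have "linear_map C A A (\<lambda>a. a)" by (rule linear_mapI) auto
  ultimately show "\<exists>u' v' g. set u' \<subseteq> carrier A \<and> set v' \<subseteq> carrier A \<and> length u' + 1 + length v' = n \<and>
      linear_map C A A g \<and> (\<forall>a\<in>carrier A. rev (u @ [a] @ v) = u' @ [g a] @ v')"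
    by (intro exI[of _ "rev v"] exI[of _ "rev u"] exI[of _ "\<lambda>a. a"]) auto
qed auto

text \<open>The head of a word stands at the latest time and thus in the last tensor slot, which
  reverses the order of the letters.\<close>

lemma Psi_top:
  assumes G: "G \<in> carrier (word_alg C A (Suc i))"
  shows "Psi G i = (l [^]\<^bsub>C\<^esub> i) \<odot>\<^bsub>Abar\<^esub> iota (Suc i) (lin_ext C rev G)"
proof -
  have rw: "rev \<in> words A (Suc i) \<rightarrow> words A (Suc i)" by auto
  note R = lin_ext_linear[OF word_free word_free rw]
  have sm: "linear_map C Abar Abar (\<lambda>z. (l [^]\<^bsub>C\<^esub> i) \<odot>\<^bsub>Abar\<^esub> z)"
    by (rule linear_mapI)
       (use weight_pow_closed[of i] in \<open>simp_all add: D.smult_r_distr D.smult_assoc1[symmetric] A.R.m_comm\<close>)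
  show ?thesis
  proof (rule W.linear_map_eqI[OF linear_map_comp[OF word_alg_nword_linear Psi_component_linear]
        linear_map_comp[OF linear_map_comp[OF R(1) iota_linear] sm] D.module _ G])
    fix w assume w: "w \<in> words A (Suc i)"
    then have "w \<in> nonempty_words" using words_nonempty by blast
    then show "Psi (single C w) i = (l [^]\<^bsub>C\<^esub> i) \<odot>\<^bsub>Abar\<^esub> iota (Suc i) (lin_ext C rev (single C w))"
      using w psi_top[of w i] by (simp add: Psi_single R(2))
  qed simp
qed

end

locale baxter_regular = baxter_base C A l
  for C :: "('c, 'k) ring_scheme" and A :: "('c, 'a, 'm) module_scheme" and l :: 'c +
  assumes weight_regular: "x \<in> carrier (tensor_dirlim C A) \<Longrightarrow>
    l \<odot>\<^bsub>tensor_dirlim C A\<^esub> x = \<zero>\<^bsub>tensor_dirlim C A\<^esub> \<Longrightarrow> x = \<zero>\<^bsub>tensor_dirlim C A\<^esub>"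
begin

lemma weight_pow_regular:
  "x \<in> carrier Abar \<Longrightarrow> (l [^]\<^bsub>C\<^esub> (n::nat)) \<odot>\<^bsub>Abar\<^esub> x = \<zero>\<^bsub>Abar\<^esub> \<Longrightarrow> x = \<zero>\<^bsub>Abar\<^esub>"
proof (induction n)
  case (Suc n)
  then have "l \<odot>\<^bsub>Abar\<^esub> ((l [^]\<^bsub>C\<^esub> n) \<odot>\<^bsub>Abar\<^esub> x) = \<zero>\<^bsub>Abar\<^esub>" using weight_pow_Suc[OF Suc.prems(1), of n] by simp
  from weight_regular[OF D.smult_closed[OF weight_pow_closed Suc.prems(1)] this]
  show ?case by (rule Suc.IH[OF Suc.prems(1)])
qed simp

text \<open>A triangular system: in entry \<open>j\<close> longer words vanish, shorter ones vanish
  by induction, and what remains is \<open>l^j\<close> times the reversed part of length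
  \<open>Suc j\<close>. Regularity removes the power, and the embedding into the limit turns a zero
  value into membership in the relations.\<close>

lemma Psi_zero_below:
  assumes F: "F \<in> carrier nword_mod" and z: "\<And>i. i < k \<Longrightarrow> Psi F i = \<zero>\<^bsub>Abar\<^esub>" and j: "j < k"
  shows "word_part C (Suc j) F \<in> tensor_ker C A (Suc j)"
  using j
proof (induction j rule: less_induct)
  case (less j)
  let ?G = "word_part C (Suc j) F"
  have G: "?G \<in> carrier (word_alg C A (Suc j))" by (rule linear_mapD(1)[OF word_part_linear F])
  have "\<zero>\<^bsub>Abar\<^esub> = Psi (word_low (Suc j) F) j" using z[OF less.prems] Psi_low[OF F, of j] by simp
  also have "\<dots> = Psi (word_low j F) j \<oplus>\<^bsub>Abar\<^esub> Psi ?G j"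
    unfolding word_low_Suc[OF F]
    by (rule linear_mapD(2)[OF Psi_component_linear])
       (use linear_mapD(1)[OF word_low_linear F] word_alg_nword[OF G] in auto)
  also have "Psi (word_low j F) j = \<zero>\<^bsub>Abar\<^esub>"
    by (rule Psi_low_zero[OF F]) (use less in auto)
  finally have "(l [^]\<^bsub>C\<^esub> j) \<odot>\<^bsub>Abar\<^esub> iota (Suc j) (lin_ext C rev ?G) = \<zero>\<^bsub>Abar\<^esub>"
    using linear_mapD(1)[OF Psi_component_linear word_alg_nword[OF G], of j] Psi_top[OF G] by simp
  have rw: "rev \<in> words A (Suc j) \<rightarrow> words A (Suc j)" by auto
  have rG: "lin_ext C rev ?G \<in> carrier (word_alg C A (Suc j))"
    by (rule linear_mapD(1)[OF lin_ext_linear(1)[OF word_free word_free rw] G])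
  have "iota (Suc j) (lin_ext C rev ?G) = \<zero>\<^bsub>Abar\<^esub>"
    by (rule weight_pow_regular) (fact | rule iota_carrier[OF _ rG]; simp)+
  then have "lin_ext C rev ?G \<in> tensor_ker C A (Suc j)" using iota_eq_zero_iff[OF _ rG] by simp
  \<comment> \<open>Reversal preserves the relations, so applying it a second time returns to
    \<open>?G\<close>.\<close>
  then have "lin_ext C rev (lin_ext C rev ?G) \<in> tensor_ker C A (Suc j)" by (rule lin_ext_tensor_ker[OF rev_letterwise])
  moreover have "lin_ext C rev (lin_ext C rev ?G) = ?G"
    using lin_ext_lin_ext[OF rw rw G] lin_ext_ident[OF _ G, of "\<lambda>w. rev (rev w)"] by simp
  ultimately show ?case by simp
qed

lemma Psi_zero_below_iff:
  assumes F: "F \<in> carrier nword_mod"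
  shows "(\<forall>i<k. Psi F i = \<zero>\<^bsub>Abar\<^esub>) \<longleftrightarrow> (\<forall>j<k. word_part C (Suc j) F \<in> tensor_ker C A (Suc j))"
proof
  show "\<forall>j<k. word_part C (Suc j) F \<in> tensor_ker C A (Suc j)" if "\<forall>i<k. Psi F i = \<zero>\<^bsub>Abar\<^esub>"
    using Psi_zero_below[OF F, of k] that by blast
  show "\<forall>i<k. Psi F i = \<zero>\<^bsub>Abar\<^esub>" if "\<forall>j<k. word_part C (Suc j) F \<in> tensor_ker C A (Suc j)"
    using that by (auto simp: Psi_low[OF F] intro!: Psi_low_zero[OF F])
qed

lemma Psi_eq_zero_iff:
  assumes "F \<in> carrier nword_mod"
  shows "Psi F = \<zero>\<^bsub>Seq\<^esub> \<longleftrightarrow> (\<forall>j. word_part C (Suc j) F \<in> tensor_ker C A (Suc j))"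
proof -
  have "Psi F = \<zero>\<^bsub>Seq\<^esub> \<longleftrightarrow> (\<forall>i. Psi F i = \<zero>\<^bsub>Abar\<^esub>)" by (simp add: fun_eq_iff seq_component(1))
  also have "\<dots> \<longleftrightarrow> (\<forall>k. \<forall>i<k. Psi F i = \<zero>\<^bsub>Abar\<^esub>)" by blast
  also have "\<dots> \<longleftrightarrow> (\<forall>j. word_part C (Suc j) F \<in> tensor_ker C A (Suc j))"
    unfolding Psi_zero_below_iff[OF assms] by blast
  finally show ?thesis .
qed

end

context baxter_base
begin

section \<open>The shuffle product and the operator on combinations of words\<close>

abbreviation shuffle_mult :: "('a list \<Rightarrow> 'c) \<Rightarrow> ('a list \<Rightarrow> 'c) \<Rightarrow> 'a list \<Rightarrow> 'c" where
  "shuffle_mult \<equiv> bilin_ext C (mixed_shuffle C l A)"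

lemma mixed_shuffle_eq:
  assumes "u \<in> nonempty_words" "v \<in> nonempty_words"
  shows "mixed_shuffle C l A u v = (\<Oplus>\<^bsub>nword_mod\<^esub>p\<in>mixable_shuffles (length (tl u)) (length (tl v)).
      (l [^]\<^bsub>C\<^esub> card (snd p)) \<odot>\<^bsub>nword_mod\<^esub>
      single C ((hd u \<otimes>\<^bsub>A\<^esub> hd v) # shuffle_word A (tl u) (tl v) (fst p) (snd p)))" (is "_ = ?S")
    and "p \<in> mixable_shuffles (length (tl u)) (length (tl v)) \<Longrightarrow>
      (hd u \<otimes>\<^bsub>A\<^esub> hd v) # shuffle_word A (tl u) (tl v) (fst p) (snd p) \<in> nonempty_words"
proof -
  obtain a x b y where uv: "u = a # x" "v = b # y" using assms by (auto simp: nonempty_words_def neq_Nil_conv)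
  then have c: "a \<in> carrier A" "set x \<subseteq> carrier A" "b \<in> carrier A" "set y \<subseteq> carrier A"
    using assms by (auto simp: nonempty_words_def)
  show w: "(hd u \<otimes>\<^bsub>A\<^esub> hd v) # shuffle_word A (tl u) (tl v) (fst p) (snd p) \<in> nonempty_words"
    if "p \<in> mixable_shuffles (length (tl u)) (length (tl v))" for p
    using shuffle_word_closed[OF A.is_monoid, of p x y] that c uv by (auto simp: nonempty_words_def)
  show "mixed_shuffle C l A u v = ?S"
  proof
    fix z
    have "?S z = (\<Oplus>\<^bsub>C\<^esub>p\<in>mixable_shuffles (length (tl u)) (length (tl v)).
      ((l [^]\<^bsub>C\<^esub> card (snd p)) \<odot>\<^bsub>nword_mod\<^esub>
      single C ((hd u \<otimes>\<^bsub>A\<^esub> hd v) # shuffle_word A (tl u) (tl v) (fst p) (snd p))) z)"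
      by (rule N.finsum_apply[OF finite_mixable_shuffles])
         (use w weight_pow_closed in \<open>auto intro!: N.M.smult_closed N.single_closed\<close>)
    then show "mixed_shuffle C l A u v z = ?S z" by (simp add: mixed_shuffle_def N.smult_eq)
  qed
qed

lemma mixed_shuffle_closed:
  "u \<in> nonempty_words \<Longrightarrow> v \<in> nonempty_words \<Longrightarrow> mixed_shuffle C l A u v \<in> carrier nword_mod"
  unfolding mixed_shuffle_eq(1)
  by (rule N.M.finsum_closed)
     (use mixed_shuffle_eq(2) weight_pow_closed in \<open>auto intro!: N.M.smult_closed N.single_closed\<close>)

lemma shuffle_mult_linear:
  shows "G \<in> carrier nword_mod \<Longrightarrow> linear_map C nword_mod nword_mod (\<lambda>F. shuffle_mult F G)"
    and "F \<in> carrier nword_mod \<Longrightarrow> linear_map C nword_mod nword_mod (\<lambda>G. shuffle_mult F G)"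
    and "u \<in> nonempty_words \<Longrightarrow> v \<in> nonempty_words \<Longrightarrow>
      shuffle_mult (single C u) (single C v) = mixed_shuffle C l A u v"
proof -
  note b = bilin_ext_linear[OF nword_free nword_free, of "mixed_shuffle C l A", OF mixed_shuffle_closed]
  show "linear_map C nword_mod nword_mod (\<lambda>F. shuffle_mult F G)" if "G \<in> carrier nword_mod" for G
    by (rule b(1)) (use that in auto)
  show "linear_map C nword_mod nword_mod (\<lambda>G. shuffle_mult F G)" if "F \<in> carrier nword_mod" for F
    by (rule b(2)) (use that in auto)
  show "shuffle_mult (single C u) (single C v) = mixed_shuffle C l A u v"
    if "u \<in> nonempty_words" "v \<in> nonempty_words" for u v
    by (rule b(3)) (use that in auto)
qed

text \<open>The heads meet at time \<open>i\<close> and multiply there, while the tails multiply as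
  sums over the earlier times.\<close>

lemma Psi_mixed_shuffle:
  assumes u: "u \<in> nonempty_words" and v: "v \<in> nonempty_words"
  shows "Psi (mixed_shuffle C l A u v) i = psi i u \<otimes>\<^bsub>Abar\<^esub> psi i v"
proof -
  obtain a x b y where uv: "u = a # x" "v = b # y" using u v by (auto simp: nonempty_words_def neq_Nil_conv)
  then have c: "a \<in> carrier A" "set x \<subseteq> carrier A" "b \<in> carrier A" "set y \<subseteq> carrier A"
    using u v by (auto simp: nonempty_words_def)
  let ?H = "chain_sum (times_below i)" and ?t = "tgen i (a \<otimes>\<^bsub>A\<^esub> b)"
  let ?w = "\<lambda>p. shuffle_word A x y (fst p) (snd p)"
  have H: "?H (?w p) \<in> carrier Abar" if "p \<in> mixable_shuffles (length x) (length y)" for p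
    using shuffle_word_closed[OF A.is_monoid that c(2,4)] by simp
  have t: "?t \<in> carrier Abar" using c by simp
  have w: "(a \<otimes>\<^bsub>A\<^esub> b) # ?w p \<in> nonempty_words" if "p \<in> mixable_shuffles (length x) (length y)" for p
    using mixed_shuffle_eq(2)[OF u v, of p] that by (simp add: uv)
  have "Psi (mixed_shuffle C l A u v) i = (\<Oplus>\<^bsub>Abar\<^esub>p\<in>mixable_shuffles (length x) (length y).
      Psi ((l [^]\<^bsub>C\<^esub> card (snd p)) \<odot>\<^bsub>nword_mod\<^esub> single C ((a \<otimes>\<^bsub>A\<^esub> b) # ?w p)) i)"
    unfolding uv mixed_shuffle_eq(1)[OF u v, unfolded uv list.sel]
    by (rule linear_map_finsum[where L = "\<lambda>F. Psi F i", OF Psi_component_linear nword_module D.module finite_mixable_shuffles])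
       (use w weight_pow_closed in \<open>auto intro!: N.M.smult_closed N.single_closed\<close>)
  also have "\<dots> = (\<Oplus>\<^bsub>Abar\<^esub>p\<in>mixable_shuffles (length x) (length y).
      ?t \<otimes>\<^bsub>Abar\<^esub> ((l [^]\<^bsub>C\<^esub> card (snd p)) \<odot>\<^bsub>Abar\<^esub> ?H (?w p)))"
  proof (rule D.M.finsum_cong')
    fix p assume p: "p \<in> mixable_shuffles (length x) (length y)"
    show "Psi ((l [^]\<^bsub>C\<^esub> card (snd p)) \<odot>\<^bsub>nword_mod\<^esub> single C ((a \<otimes>\<^bsub>A\<^esub> b) # ?w p)) i =
      ?t \<otimes>\<^bsub>Abar\<^esub> ((l [^]\<^bsub>C\<^esub> card (snd p)) \<odot>\<^bsub>Abar\<^esub> ?H (?w p))"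
      unfolding linear_mapD(3)[OF Psi_component_linear weight_pow_closed N.single_closed[OF w[OF p]]]
        Psi_single[OF w[OF p]] psi_Cons D.smult_assoc2'[OF weight_pow_closed t H[OF p]] ..
  qed (use H t weight_pow_closed in auto)
  also have "\<dots> = ?t \<otimes>\<^bsub>Abar\<^esub> shuffle_sum ?H x y"
    unfolding shuffle_sum_def
    by (rule D.finsum_rdistr[symmetric]) (use H t weight_pow_closed finite_mixable_shuffles in auto)
  also have "\<dots> = psi i u \<otimes>\<^bsub>Abar\<^esub> psi i v"
    using c by (simp add: uv psi_Cons shuffle_sum_chain_sum tgen_mult D.m_ac)
  finally show ?thesis .
qed

text \<open>Bilinearity extends the formula from words to combinations. This takes place before the
  passage to tensors, so nothing has to be shown independent of representatives yet.\<close>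

lemma Psi_mult:
  assumes F: "F \<in> carrier nword_mod" and G: "G \<in> carrier nword_mod"
  shows "Psi (shuffle_mult F G) = Psi F \<otimes>\<^bsub>Seq\<^esub> Psi G"
proof
  fix i
  have ml: "linear_map C Abar Abar (\<lambda>z. z \<otimes>\<^bsub>Abar\<^esub> c)" "linear_map C Abar Abar (\<lambda>z. c \<otimes>\<^bsub>Abar\<^esub> z)"
    if "c \<in> carrier Abar" for c
    using that by (auto intro!: linear_mapI simp: D.l_distr D.r_distr D.smult_assoc2 D.smult_assoc2')
  have PF: "Psi F i \<in> carrier Abar" if "F \<in> carrier nword_mod" for F
    by (rule linear_mapD(1)[OF Psi_component_linear that])
  have "Psi (shuffle_mult F G) i = Psi F i \<otimes>\<^bsub>Abar\<^esub> Psi G i"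
  proof (rule N.linear_map_eqI[OF linear_map_comp[OF shuffle_mult_linear(1)[OF G] Psi_component_linear]
        linear_map_comp[OF Psi_component_linear ml(1)[OF PF[OF G]]] D.module _ F])
    fix u assume u: "u \<in> nonempty_words"
    note su = N.single_closed[OF u]
    show "Psi (shuffle_mult (single C u) G) i = Psi (single C u) i \<otimes>\<^bsub>Abar\<^esub> Psi G i"
    proof (rule N.linear_map_eqI[OF linear_map_comp[OF shuffle_mult_linear(2)[OF su] Psi_component_linear]
          linear_map_comp[OF Psi_component_linear ml(2)[OF PF[OF su]]] D.module _ G])
      fix v assume v: "v \<in> nonempty_words"
      show "Psi (shuffle_mult (single C u) (single C v)) i = Psi (single C u) i \<otimes>\<^bsub>Abar\<^esub> Psi (single C v) i"
        unfolding shuffle_mult_linear(3)[OF u v] Psi_mixed_shuffle[OF u v] Psi_single[OF u] Psi_single[OF v] ..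
    qed
  qed
  then show "Psi (shuffle_mult F G) i = (Psi F \<otimes>\<^bsub>Seq\<^esub> Psi G) i" by (simp only: seq_component(4))
qed

abbreviation cons_one :: "'a list \<Rightarrow> 'a list" where
  "cons_one \<equiv> (\<lambda>w. \<one>\<^bsub>A\<^esub> # w)"

lemma cons_one_linear:
  shows "linear_map C nword_mod nword_mod (lin_ext C cons_one)"
    and "w \<in> nonempty_words \<Longrightarrow> lin_ext C cons_one (single C w) = single C (\<one>\<^bsub>A\<^esub> # w)"
  by (rule lin_ext_linear[OF nword_free nword_free]; auto simp: nonempty_words_def)+

lemma seq_op_linear: "linear_map C Seq Seq Q"
  using baxter_algebraD(3-5)[OF seq_baxter] by (intro linear_mapI) auto

lemma Psi_op:
  assumes F: "F \<in> carrier nword_mod"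
  shows "Psi (lin_ext C cons_one F) = Q (Psi F)"
proof (rule N.linear_map_eqI[OF linear_map_comp[OF cons_one_linear(1) Psi_linear]
      linear_map_comp[OF Psi_linear seq_op_linear] S.module _ F])
  fix w assume w: "w \<in> nonempty_words"
  then obtain a v where av: "w = a # v" "a \<in> carrier A" "set v \<subseteq> carrier A"
    by (auto simp: nonempty_words_def neq_Nil_conv)
  then have w1: "\<one>\<^bsub>A\<^esub> # w \<in> nonempty_words" by (simp add: nonempty_words_def)
  have Pw: "Psi (single C w) \<in> carrier Seq" by (rule linear_mapD(1)[OF Psi_linear N.single_closed[OF w]])
  have "Q (Psi (single C w)) i = chain_sum (times_below i) w" for i
  proof (induction i)
    case 0
    then show ?case by (simp add: seq_op_0 av)
  next
    case (Suc i)
    then have "Q (Psi (single C w)) (Suc i) = chain_sum (times_below i) w \<oplus>\<^bsub>Abar\<^esub> l \<odot>\<^bsub>Abar\<^esub> psi i w"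
      unfolding seq_op_Suc[OF Pw, of i] Psi_single[OF w, of i] by (simp only:)
    then show ?case by (simp add: av psi_Cons)
  qed
  moreover have "Psi (single C (\<one>\<^bsub>A\<^esub> # w)) i = chain_sum (times_below i) w" for i
    unfolding Psi_single[OF w1] psi_Cons tgen_one using av by (simp del: chain_sum.simps)
  ultimately have "Psi (single C (\<one>\<^bsub>A\<^esub> # w)) i = Q (Psi (single C w)) i" for i by simp
  then have "Psi (single C (\<one>\<^bsub>A\<^esub> # w)) = Q (Psi (single C w))" by (rule ext)
  then show "Psi (lin_ext C cons_one (single C w)) = Q (Psi (single C w))"
    unfolding cons_one_linear(2)[OF w] .
qed

end

section \<open>The shuffle algebra\<close>

lemma subring_of_algebraI:
  assumes "algebra C R" and "S \<subseteq> carrier R" and "\<one>\<^bsub>R\<^esub> \<in> S"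
    and "\<And>x y. x \<in> S \<Longrightarrow> y \<in> S \<Longrightarrow> x \<oplus>\<^bsub>R\<^esub> y \<in> S"
    and "\<And>x y. x \<in> S \<Longrightarrow> y \<in> S \<Longrightarrow> x \<otimes>\<^bsub>R\<^esub> y \<in> S"
    and "\<And>c x. c \<in> carrier C \<Longrightarrow> x \<in> S \<Longrightarrow> c \<odot>\<^bsub>R\<^esub> x \<in> S"
  shows "subring S R"
proof -
  interpret algebra C R by fact
  show ?thesis
  proof (rule ring.subringI)
    show "ring R" using M_cring by (rule cring.axioms)
    show "\<ominus>\<^bsub>R\<^esub> x \<in> S" if "x \<in> S" for x
      using assms(6)[of "\<ominus>\<^bsub>C\<^esub> \<one>\<^bsub>C\<^esub>" x] assms(2) that by (auto simp: smult_neg_one)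
  qed (use assms in auto)
qed

context baxter_regular
begin

abbreviation "ShA \<equiv> Sh C l A"
abbreviation "P \<equiv> Sh_op C A"
abbreviation "Std \<equiv> std_alg C l A"

lemma Sh_carrier:
  "f \<in> carrier ShA \<longleftrightarrow> (\<forall>k. f k \<in> carrier (tensor_pow C A (Suc k))) \<and> finite {k. f k \<noteq> tensor_ker C A (Suc k)}"
  by (simp add: Sh_def tensor_pow_simps)

text \<open>The projection from combinations of words to the direct sum of tensor powers. The
  operations of \<open>Sh\<close> are computed on representatives under this map.\<close>

definition cls :: "('a list \<Rightarrow> 'c) \<Rightarrow> nat \<Rightarrow> ('a list \<Rightarrow> 'c) set" where
  "cls F k = tcoset (Suc k) (word_part C (Suc k) F)"

lemma tcoset_linear: "linear_map C (word_alg C A n) (tensor_pow C A n) (\<lambda>x. tcoset n x)"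
  by (rule linear_mapI) (simp_all add: tensor_pow_simps)

lemma cls_component_linear: "linear_map C nword_mod (tensor_pow C A (Suc k)) (\<lambda>F. cls F k)"
  unfolding cls_def by (rule linear_map_comp[OF word_part_linear tcoset_linear])

lemma tcoset_zero: "tcoset n (\<lambda>w. \<zero>\<^bsub>C\<^esub>) = tensor_ker C A n"
  using K.rcos_zero[of n] by (simp add: W.zero_eq)

lemma word_part_closed: "F \<in> carrier nword_mod \<Longrightarrow> word_part C (Suc k) F \<in> carrier (word_alg C A (Suc k))"
  by (rule linear_mapD(1)[OF word_part_linear])

lemma cls_eq_ker_iff:
  "F \<in> carrier nword_mod \<Longrightarrow> cls F k = tensor_ker C A (Suc k) \<longleftrightarrow> word_part C (Suc k) F \<in> tensor_ker C A (Suc k)"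
  unfolding cls_def by (rule K.rcos_eq_self_iff[OF word_part_closed])

lemma cls_closed:
  assumes F: "F \<in> carrier nword_mod"
  shows "cls F \<in> carrier ShA"
  unfolding Sh_carrier
proof
  show "\<forall>k. cls F k \<in> carrier (tensor_pow C A (Suc k))"
    using linear_mapD(1)[OF cls_component_linear F] by blast
  obtain n where "\<And>j. j \<ge> n \<Longrightarrow> word_part C (Suc j) F = (\<lambda>w. \<zero>\<^bsub>C\<^esub>)" using word_low_eventually[OF F] by blast
  then have "{k. cls F k \<noteq> tensor_ker C A (Suc k)} \<subseteq> {..<n}"
    by (auto simp: cls_def tcoset_zero not_le[symmetric])
  then show "finite {k. cls F k \<noteq> tensor_ker C A (Suc k)}" by (rule finite_subset) simp
qed

lemma cls_surj:
  assumes f: "f \<in> carrier ShA"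
  obtains F where "F \<in> carrier nword_mod" and "f = cls F"
proof -
  \<comment> \<open>Zero components get the zero representative; otherwise the representatives glued
    together could have infinite support.\<close>
  have "\<exists>x\<in>carrier (word_alg C A (Suc k)). f k = tcoset (Suc k) x \<and>
      (f k = tensor_ker C A (Suc k) \<longrightarrow> x = (\<lambda>w. \<zero>\<^bsub>C\<^esub>))" for k
  proof (cases "f k = tensor_ker C A (Suc k)")
    case True
    then show ?thesis using W.M.M.zero_closed[of "Suc k"] tcoset_zero[of "Suc k"] by (auto simp: W.zero_eq)
  next
    case False
    then show ?thesis using f by (auto simp: Sh_carrier tensor_pow_simps)
  qed
  then obtain x where x: "\<And>k. x k \<in> carrier (word_alg C A (Suc k))" "\<And>k. f k = tcoset (Suc k) (x k)"
    "\<And>k. f k = tensor_ker C A (Suc k) \<Longrightarrow> x k = (\<lambda>w. \<zero>\<^bsub>C\<^esub>)" by metis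
  have xC: "x k w \<in> carrier C" "finite {w. x k w \<noteq> \<zero>\<^bsub>C\<^esub>}"
    "x k w \<noteq> \<zero>\<^bsub>C\<^esub> \<Longrightarrow> length w = Suc k \<and> set w \<subseteq> carrier A" for k w
    using x(1)[of k] by (auto simp: W.carrier_eq)
  \<comment> \<open>The length of a word selects the component it belongs to; the offset by one is
    that between the index of a component and its number of factors.\<close>
  define F where "F w = (if w = [] then \<zero>\<^bsub>C\<^esub> else x (length w - 1) w)" for w
  have "{w. F w \<noteq> \<zero>\<^bsub>C\<^esub>} \<subseteq> (\<Union>k\<in>{k. f k \<noteq> tensor_ker C A (Suc k)}. {w. x k w \<noteq> \<zero>\<^bsub>C\<^esub>})"
  proof
    fix w assume "w \<in> {w. F w \<noteq> \<zero>\<^bsub>C\<^esub>}"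
    then have "x (length w - 1) w \<noteq> \<zero>\<^bsub>C\<^esub>" by (auto simp: F_def split: if_splits)
    then show "w \<in> (\<Union>k\<in>{k. f k \<noteq> tensor_ker C A (Suc k)}. {w. x k w \<noteq> \<zero>\<^bsub>C\<^esub>})"
      by (intro UN_I[of "length w - 1"]) (use x(3)[of "length w - 1"] in auto)
  qed
  moreover have "finite (\<Union>k\<in>{k. f k \<noteq> tensor_ker C A (Suc k)}. {w. x k w \<noteq> \<zero>\<^bsub>C\<^esub>})"
    using f xC(2) by (auto simp: Sh_carrier)
  ultimately have fin: "finite {w. F w \<noteq> \<zero>\<^bsub>C\<^esub>}" by (rule finite_subset)
  have "F w \<in> carrier C" for w by (simp add: F_def xC(1))
  moreover have "w \<in> nonempty_words" if "F w \<noteq> \<zero>\<^bsub>C\<^esub>" for w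
    using that xC(3)[of "length w - 1" w] by (auto simp: F_def nonempty_words_def split: if_splits)
  ultimately have F: "F \<in> carrier nword_mod" using fin by (simp add: N.carrier_eq)
  have "word_part C (Suc k) F w = x k w" for k w
  proof (cases "length w = Suc k")
    case True
    then show ?thesis by (auto simp: word_part_def F_def)
  next
    case False
    then have "x k w = \<zero>\<^bsub>C\<^esub>" using xC(3)[of k w] by blast
    then show ?thesis using False by (simp add: word_part_def)
  qed
  then have wp: "word_part C (Suc k) F = x k" for k by (rule ext)
  have "f = cls F" by (rule ext) (simp only: cls_def x(2) wp)
  with F show ?thesis using that by blast
qed

lemma tensor_pow_module: "module C (tensor_pow C A n)"
  by (rule algebra.module[OF tensor_pow_algebra])

lemma cls_minus:
  assumes "F \<in> carrier nword_mod" "G \<in> carrier nword_mod"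
  shows "cls F k = cls G k \<longleftrightarrow> word_part C (Suc k) (F \<ominus>\<^bsub>nword_mod\<^esub> G) \<in> tensor_ker C A (Suc k)"
  unfolding cls_def K.rcos_eq_iff[OF word_part_closed[OF assms(1)] word_part_closed[OF assms(2)]]
    linear_map_minus[OF word_part_linear nword_module word_module assms] ..

text \<open>By regularity the relations are the whole kernel of \<open>Psi\<close>, so an equality
  in \<open>Sh\<close> can be tested on sequences. The laws of the shuffle product are obtained in
  this way.\<close>

lemma cls_eq_iff:
  assumes F: "F \<in> carrier nword_mod" and G: "G \<in> carrier nword_mod"
  shows "cls F = cls G \<longleftrightarrow> Psi F = Psi G"
proof -
  have FG: "F \<ominus>\<^bsub>nword_mod\<^esub> G \<in> carrier nword_mod" using F G by simp
  have c: "Psi F \<in> carrier Seq" "Psi G \<in> carrier Seq" using linear_mapD(1)[OF Psi_linear] F G by auto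
  have "cls F = cls G \<longleftrightarrow> Psi (F \<ominus>\<^bsub>nword_mod\<^esub> G) = \<zero>\<^bsub>Seq\<^esub>"
    unfolding Psi_eq_zero_iff[OF FG] fun_eq_iff[of "cls F"] cls_minus[OF F G] ..
  also have "\<dots> \<longleftrightarrow> Psi F = Psi G"
    unfolding linear_map_minus[OF Psi_linear nword_module S.module F G] using c by simp
  finally show ?thesis .
qed

lemma Sh_component:
  "(f \<oplus>\<^bsub>ShA\<^esub> g) k = f k \<oplus>\<^bsub>tensor_pow C A (Suc k)\<^esub> g k"
  "(c \<odot>\<^bsub>ShA\<^esub> f) k = c \<odot>\<^bsub>tensor_pow C A (Suc k)\<^esub> f k"
  "\<zero>\<^bsub>ShA\<^esub> k = tensor_ker C A (Suc k)"
  by (simp_all add: Sh_def tensor_pow_simps)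

lemma cls_add:
  assumes F: "F \<in> carrier nword_mod" and G: "G \<in> carrier nword_mod"
  shows "cls F \<oplus>\<^bsub>ShA\<^esub> cls G = cls (F \<oplus>\<^bsub>nword_mod\<^esub> G)"
proof
  fix k show "(cls F \<oplus>\<^bsub>ShA\<^esub> cls G) k = cls (F \<oplus>\<^bsub>nword_mod\<^esub> G) k"
    unfolding Sh_component(1) linear_mapD(2)[OF cls_component_linear F G] ..
qed

lemma cls_smult:
  assumes c: "c \<in> carrier C" and F: "F \<in> carrier nword_mod"
  shows "c \<odot>\<^bsub>ShA\<^esub> cls F = cls (c \<odot>\<^bsub>nword_mod\<^esub> F)"
proof
  fix k show "(c \<odot>\<^bsub>ShA\<^esub> cls F) k = cls (c \<odot>\<^bsub>nword_mod\<^esub> F) k"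
    unfolding Sh_component(2) linear_mapD(3)[OF cls_component_linear c F] ..
qed

lemma cls_zero: "\<zero>\<^bsub>ShA\<^esub> = cls \<zero>\<^bsub>nword_mod\<^esub>"
proof
  fix k show "\<zero>\<^bsub>ShA\<^esub> k = cls \<zero>\<^bsub>nword_mod\<^esub> k"
    using linear_map_zero[OF cls_component_linear nword_module tensor_pow_module, of k]
    by (simp add: Sh_component(3) tensor_pow_simps(2))
qed

lemma single_letter: "a \<in> carrier A \<Longrightarrow> [a] \<in> nonempty_words"
  by (simp add: nonempty_words_def)

lemma cls_incl:
  assumes "a \<in> carrier A"
  shows "Sh_incl C A a = cls (single C [a])"
proof
  fix k
  have "single C [a] \<in> carrier (word_alg C A 1)" by (rule W.single_closed) (use assms in simp)
  then show "Sh_incl C A a k = cls (single C [a]) k"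
    using word_part_word_alg[of "single C [a]" 1 "Suc k"]
    by (auto simp: Sh_incl_def cls_def pure_tensor_def tensor_pow_simps tcoset_zero)
qed

lemma cls_one: "\<one>\<^bsub>ShA\<^esub> = cls (single C [\<one>\<^bsub>A\<^esub>])"
proof -
  have "\<one>\<^bsub>ShA\<^esub> = Sh_incl C A \<one>\<^bsub>A\<^esub>"
    by (auto simp: Sh_def Sh_incl_def fun_eq_iff tensor_pow_simps pure_tensor_def word_one)
  then show ?thesis by (simp add: cls_incl)
qed

lemma cons_one_letterwise: "letterwise_linear n (Suc n) cons_one"
  unfolding letterwise_linear_def
proof (intro conjI allI impI)
  fix u v assume "set u \<subseteq> carrier A \<and> set v \<subseteq> carrier A \<and> length u + 1 + length v = n"
  moreover have "linear_map C A A (\<lambda>a. a)" by (rule linear_mapI) auto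
  ultimately show "\<exists>u' v' g. set u' \<subseteq> carrier A \<and> set v' \<subseteq> carrier A \<and> length u' + 1 + length v' = Suc n \<and>
      linear_map C A A g \<and> (\<forall>a\<in>carrier A. \<one>\<^bsub>A\<^esub> # u @ [a] @ v = u' @ [g a] @ v')"
    by (intro exI[of _ "\<one>\<^bsub>A\<^esub> # u"] exI[of _ v] exI[of _ "\<lambda>a. a"]) auto
qed auto

lemma word_part_cons_one:
  assumes F: "F \<in> carrier nword_mod"
  shows "word_part C (Suc (Suc k)) (lin_ext C cons_one F) = lin_ext C cons_one (word_part C (Suc k) F)"
    and "word_part C (Suc 0) (lin_ext C cons_one F) = (\<lambda>w. \<zero>\<^bsub>C\<^esub>)"
proof -
  have c: "cons_one \<in> words A (Suc k) \<rightarrow> words A (Suc (Suc k))" for k by auto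
  note L = lin_ext_linear[OF word_free word_free c]
  have lw: "word_part C n (single C w) = (if length w = n then single C w else (\<lambda>w. \<zero>\<^bsub>C\<^esub>))" for n and w :: "'a list"
    by (auto simp: word_part_def single_def fun_eq_iff)
  show "word_part C (Suc (Suc k)) (lin_ext C cons_one F) = lin_ext C cons_one (word_part C (Suc k) F)"
  proof (rule N.linear_map_eqI[OF linear_map_comp[OF cons_one_linear(1) word_part_linear]
        linear_map_comp[OF word_part_linear L(1)] word_module _ F])
    fix w assume w: "w \<in> nonempty_words"
    show "word_part C (Suc (Suc k)) (lin_ext C cons_one (single C w)) =
        lin_ext C cons_one (word_part C (Suc k) (single C w))"
    proof (cases "length w = Suc k")
      case True
      then have "w \<in> words A (Suc k)" using w by (simp add: nonempty_words_def)
      then show ?thesis using True by (simp add: cons_one_linear(2)[OF w] L(2) lw)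
    next
      case False
      then show ?thesis
        using linear_map_zero[OF L(1)[of k] word_module word_module]
        by (simp add: cons_one_linear(2)[OF w] lw W.zero_eq)
    qed
  qed
  show "word_part C (Suc 0) (lin_ext C cons_one F) = (\<lambda>w. \<zero>\<^bsub>C\<^esub>)"
  proof (rule N.linear_map_eqI[OF linear_map_comp[OF cons_one_linear(1) word_part_linear] _ word_module _ F])
    show "linear_map C nword_mod (word_alg C A (Suc 0)) (\<lambda>F w. \<zero>\<^bsub>C\<^esub>)"
      by (rule linear_mapI) (auto simp: W.carrier_eq W.add_eq W.smult_eq)
    show "word_part C (Suc 0) (lin_ext C cons_one (single C w)) = (\<lambda>w. \<zero>\<^bsub>C\<^esub>)" if "w \<in> nonempty_words" for w
      using that unfolding cons_one_linear(2)[OF that] lw by (simp add: nonempty_words_def)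
  qed
qed

lemma cls_op:
  assumes F: "F \<in> carrier nword_mod"
  shows "P (cls F) = cls (lin_ext C cons_one F)"
proof
  fix k
  show "P (cls F) k = cls (lin_ext C cons_one F) k"
  proof (cases k)
    case 0
    then show ?thesis
      by (simp add: Sh_op_def cls_def word_part_cons_one(2)[OF F] tcoset_zero tensor_pow_simps)
  next
    case (Suc j)
    then show ?thesis
      by (simp add: Sh_op_def cls_def word_part_cons_one(1)[OF F]
          tensor_map_coset[OF cons_one_letterwise word_part_closed[OF F]])
  qed
qed

text \<open>The product of \<open>Sh\<close> is a finite sum over the nonzero components. A linear
  map that kills the parts which are relations is the sum of its values on just these components, so
  the two can be compared.\<close>

lemma linear_map_decompose:
  assumes L: "linear_map C nword_mod M L" and M: "module C M" and F: "F \<in> carrier nword_mod"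
    and z: "\<And>m. word_part C (Suc m) F \<in> tensor_ker C A (Suc m) \<Longrightarrow> L (word_part C (Suc m) F) = \<zero>\<^bsub>M\<^esub>"
  shows "L F = (\<Oplus>\<^bsub>M\<^esub>m\<in>{m. cls F m \<noteq> tensor_ker C A (Suc m)}. L (word_part C (Suc m) F))"
proof -
  interpret M: module C M by (rule M)
  obtain k where k: "word_low k F = F" "\<And>j. j \<ge> k \<Longrightarrow> word_part C (Suc j) F = (\<lambda>w. \<zero>\<^bsub>C\<^esub>)"
    using word_low_eventually[OF F] by blast
  have p: "word_part C (Suc m) F \<in> carrier nword_mod" for m by (rule word_alg_nword[OF word_part_closed[OF F]])
  then have c: "L (word_part C (Suc m) F) \<in> carrier M" for m by (rule linear_mapD(1)[OF L])
  have "L (word_low n F) = (\<Oplus>\<^bsub>M\<^esub>m\<in>{..<n}. L (word_part C (Suc m) F))" for n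
  proof (induction n)
    case 0
    then show ?case by (simp add: word_low_0[OF F] linear_map_zero[OF L nword_module M])
  next
    case (Suc n)
    have "L (word_low (Suc n) F) = L (word_low n F) \<oplus>\<^bsub>M\<^esub> L (word_part C (Suc n) F)"
      unfolding word_low_Suc[OF F] by (rule linear_mapD(2)[OF L linear_mapD(1)[OF word_low_linear F] p])
    then show ?case
      using Suc c by (simp add: lessThan_Suc M.M.finsum_insert M.M.a_comm)
  qed
  from this[of k] have "L F = (\<Oplus>\<^bsub>M\<^esub>m\<in>{..<k}. L (word_part C (Suc m) F))" by (simp add: k(1))
  also have "\<dots> = (\<Oplus>\<^bsub>M\<^esub>m\<in>{m. cls F m \<noteq> tensor_ker C A (Suc m)}. L (word_part C (Suc m) F))"
  proof (rule M.M.add.finprod_mono_neutral_cong_right)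
    show "{m. cls F m \<noteq> tensor_ker C A (Suc m)} \<subseteq> {..<k}"
      using k(2) by (auto simp: cls_def tcoset_zero not_le[symmetric])
    show "L (word_part C (Suc i) F) = \<zero>\<^bsub>M\<^esub>" if "i \<in> {..<k} - {m. cls F m \<noteq> tensor_ker C A (Suc m)}" for i
      using that z[of i] by (simp add: cls_eq_ker_iff[OF F])
  qed (use c in auto)
  finally show ?thesis .
qed

text \<open>Independence of representatives is not checked against the shuffle formula. Factors with
  the same images under \<open>Psi\<close> have products with the same image, since
  \<open>Psi\<close> is multiplicative, and equal images mean equal classes.\<close>

lemma cls_mult:
  assumes F: "F \<in> carrier nword_mod" and G: "G \<in> carrier nword_mod"
  shows "cls F \<otimes>\<^bsub>ShA\<^esub> cls G = cls (shuffle_mult F G)"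
proof
  fix k
  let ?T = "tensor_pow C A (Suc k)"
  let ?D = "\<lambda>x y. cls (shuffle_mult x y) k"
  let ?F = "\<lambda>m. word_part C (Suc m) F" and ?G = "\<lambda>n. word_part C (Suc n) G"
  let ?S = "{m. cls F m \<noteq> tensor_ker C A (Suc m)}" and ?R = "{n. cls G n \<noteq> tensor_ker C A (Suc n)}"
  note sm = shuffle_mult_linear
  have mc: "shuffle_mult x y \<in> carrier nword_mod" if "x \<in> carrier nword_mod" "y \<in> carrier nword_mod" for x y
    by (rule linear_mapD(1)[OF sm(1)[OF that(2)] that(1)])
  have D_cong: "?D x y = ?D x' y'"
    if "x \<in> carrier nword_mod" "y \<in> carrier nword_mod" "x' \<in> carrier nword_mod" "y' \<in> carrier nword_mod"
      "Psi x = Psi x'" "Psi y = Psi y'" for x y x' y'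
  proof -
    have "cls (shuffle_mult x y) = cls (shuffle_mult x' y')"
      unfolding cls_eq_iff[OF mc[OF that(1,2)] mc[OF that(3,4)]]
      using that by (simp only: Psi_mult)
    then show ?thesis by simp
  qed
  have Fm: "?F m \<in> carrier nword_mod" and Gn: "?G m \<in> carrier nword_mod" for m
    using word_alg_nword word_part_closed F G by blast+
  have L1: "linear_map C nword_mod ?T (\<lambda>x. ?D x y)" if "y \<in> carrier nword_mod" for y
    by (rule linear_map_comp[OF sm(1)[OF that] cls_component_linear])
  have L2: "linear_map C nword_mod ?T (\<lambda>y. ?D x y)" if "x \<in> carrier nword_mod" for x
    by (rule linear_map_comp[OF sm(2)[OF that] cls_component_linear])
  interpret T: module C ?T by (rule tensor_pow_module)
  \<comment> \<open>\<open>Psi\<close> cannot tell a relation from zero, so by \<open>D_cong\<close>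
    a relation may be replaced by zero in either factor.\<close>
  have Psi0: "Psi x = Psi \<zero>\<^bsub>nword_mod\<^esub>" if "x \<in> tensor_ker C A (Suc m)" for x m
    using Psi_tensor_ker[OF that] linear_map_zero[OF Psi_linear nword_module S.module]
    by (auto simp: fun_eq_iff seq_component(1))
  have Dc: "?D x y \<in> carrier ?T" if "x \<in> carrier nword_mod" "y \<in> carrier nword_mod" for x y
    by (rule linear_mapD(1)[OF L1[OF that(2)] that(1)])
  \<comment> \<open>All pairs of elements of the two cosets give one and the same coset, so the
    nested union in the definition of the product is that coset.\<close>
  have U: "(\<Union>x\<in>cls F m. \<Union>y\<in>cls G n. tcoset (Suc k) (word_part C (Suc k) (shuffle_mult x y))) = ?D (?F m) (?G n)"
    for m n
  proof -
    have rep: "x \<in> carrier nword_mod \<and> Psi x = Psi (word_part C (Suc m) H)"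
      if "H \<in> carrier nword_mod" "x \<in> cls H m" for H x m
    proof -
      note p = word_part_closed[OF that(1), of m]
      have x: "x \<in> carrier (word_alg C A (Suc m))" "x \<ominus>\<^bsub>word_alg C A (Suc m)\<^esub> word_part C (Suc m) H \<in> tensor_ker C A (Suc m)"
        using that(2) K.mem_rcos_iff[OF p] by (auto simp: cls_def)
      have "Psi x i \<ominus>\<^bsub>Abar\<^esub> Psi (word_part C (Suc m) H) i = \<zero>\<^bsub>Abar\<^esub>" for i
        using Psi_tensor_ker[OF x(2), of i]
          linear_map_minus[OF linear_map_comp[OF word_alg_nword_linear Psi_component_linear[of i]]
            word_module D.module x(1) p] by simp
      then have "Psi x i = Psi (word_part C (Suc m) H) i" for i
        using linear_mapD(1)[OF Psi_component_linear] word_alg_nword[OF x(1)] word_alg_nword[OF p] by simp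
      then show ?thesis using word_alg_nword[OF x(1)] by auto
    qed
    have self: "word_part C (Suc m) H \<in> cls H m" if "H \<in> carrier nword_mod" for H m
      unfolding cls_def by (rule K.a_rcos_self[OF word_part_closed[OF that]])
    have "tcoset (Suc k) (word_part C (Suc k) (shuffle_mult x y)) = ?D (?F m) (?G n)"
      if "x \<in> cls F m" "y \<in> cls G n" for x y
      unfolding cls_def[symmetric]
      using rep[OF F that(1)] rep[OF G that(2)] Fm Gn by (intro D_cong) auto
    then show ?thesis using self[OF F, of m] self[OF G, of n] by blast
  qed
  have "(cls F \<otimes>\<^bsub>ShA\<^esub> cls G) k = (\<Oplus>\<^bsub>?T\<^esub>p\<in>?S \<times> ?R. ?D (?F (fst p)) (?G (snd p)))"
    by (simp add: Sh_def tensor_pow_simps(2) U)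
  also have "\<dots> = (\<Oplus>\<^bsub>?T\<^esub>m\<in>?S. \<Oplus>\<^bsub>?T\<^esub>n\<in>?R. ?D (?F m) (?G n))"
    by (subst T.M.finsum_Times) (use cls_closed F G Dc Fm Gn in \<open>auto simp: Sh_carrier\<close>)
  also have "\<dots> = (\<Oplus>\<^bsub>?T\<^esub>m\<in>?S. ?D (?F m) G)"
  proof (rule T.M.finsum_cong')
    fix m
    show "(\<Oplus>\<^bsub>?T\<^esub>n\<in>?R. ?D (?F m) (?G n)) = ?D (?F m) G"
    proof (rule linear_map_decompose[where L = "\<lambda>y. ?D (?F m) y", OF L2[OF Fm] tensor_pow_module G, symmetric])
      fix n assume "?G n \<in> tensor_ker C A (Suc n)"
      then have "?D (?F m) (?G n) = ?D (?F m) \<zero>\<^bsub>nword_mod\<^esub>"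
        using Psi0 Fm Gn by (intro D_cong) auto
      then show "?D (?F m) (?G n) = \<zero>\<^bsub>?T\<^esub>"
        using linear_map_zero[OF L2[OF Fm] nword_module tensor_pow_module] by simp
    qed
  qed (use Dc Fm G in auto)
  also have "\<dots> = ?D F G"
  proof (rule linear_map_decompose[where L = "\<lambda>x. ?D x G", OF L1[OF G] tensor_pow_module F, symmetric])
    fix m assume "?F m \<in> tensor_ker C A (Suc m)"
    then have "?D (?F m) G = ?D \<zero>\<^bsub>nword_mod\<^esub> G" using Psi0 Fm G by (intro D_cong) auto
    then show "?D (?F m) G = \<zero>\<^bsub>?T\<^esub>"
      using linear_map_zero[OF L1[OF G] nword_module tensor_pow_module] by simp
  qed
  finally show "(cls F \<otimes>\<^bsub>ShA\<^esub> cls G) k = cls (shuffle_mult F G) k" .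
qed

text \<open>The choice of the combination of words does not affect the value, because equal classes
  have equal images under \<open>Psi\<close>.\<close>

definition Phi0 :: "(nat \<Rightarrow> ('a list \<Rightarrow> 'c) set) \<Rightarrow> nat \<Rightarrow> (nat \<times> ('a list \<Rightarrow> 'c) set) set" where
  "Phi0 f = Psi (SOME F. F \<in> carrier nword_mod \<and> f = cls F)"

lemma Phi0_cls:
  assumes "F \<in> carrier nword_mod"
  shows "Phi0 (cls F) = Psi F"
proof -
  define G where "G = (SOME G. G \<in> carrier nword_mod \<and> cls F = cls G)"
  have "G \<in> carrier nword_mod \<and> cls F = cls G"
    unfolding G_def by (rule someI[of _ F]) (use assms in simp)
  then have "Psi G = Psi F" using cls_eq_iff[OF assms, of G] by auto
  then show ?thesis by (simp add: Phi0_def G_def)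
qed

lemma shuffle_mult_closed:
  "F \<in> carrier nword_mod \<Longrightarrow> G \<in> carrier nword_mod \<Longrightarrow> shuffle_mult F G \<in> carrier nword_mod"
  by (rule linear_mapD(1)[OF shuffle_mult_linear(1)])

lemma cons_one_closed: "F \<in> carrier nword_mod \<Longrightarrow> lin_ext C cons_one F \<in> carrier nword_mod"
  by (rule linear_mapD(1)[OF cons_one_linear(1)])

lemma Psi_gen: "a \<in> carrier A \<Longrightarrow> Psi (single C [a]) = std_gen C A a"
  by (rule ext) (simp add: Psi_single single_letter psi_Cons chain_sum_Nil std_gen_eq)

lemma Psi_one: "Psi (single C [\<one>\<^bsub>A\<^esub>]) = \<one>\<^bsub>Seq\<^esub>"
  by (rule ext) (simp add: Psi_gen std_gen_eq tgen_one seq_component(2))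

section \<open>Transfer of the structure of sequences to the shuffle algebra\<close>

lemma Phi0_simps:
  assumes f: "f \<in> carrier ShA" and g: "g \<in> carrier ShA"
  shows "Phi0 f \<in> carrier Seq"
    and "f \<oplus>\<^bsub>ShA\<^esub> g \<in> carrier ShA" "Phi0 (f \<oplus>\<^bsub>ShA\<^esub> g) = Phi0 f \<oplus>\<^bsub>Seq\<^esub> Phi0 g"
    and "f \<otimes>\<^bsub>ShA\<^esub> g \<in> carrier ShA" "Phi0 (f \<otimes>\<^bsub>ShA\<^esub> g) = Phi0 f \<otimes>\<^bsub>Seq\<^esub> Phi0 g"
    and "c \<in> carrier C \<Longrightarrow> c \<odot>\<^bsub>ShA\<^esub> f \<in> carrier ShA"
    and "c \<in> carrier C \<Longrightarrow> Phi0 (c \<odot>\<^bsub>ShA\<^esub> f) = c \<odot>\<^bsub>Seq\<^esub> Phi0 f"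
    and "P f \<in> carrier ShA" "Phi0 (P f) = Q (Phi0 f)"
    and "Phi0 f = Phi0 g \<Longrightarrow> f = g"
proof -
  obtain F where F: "F \<in> carrier nword_mod" "f = cls F" using cls_surj[OF f] .
  obtain G where G: "G \<in> carrier nword_mod" "g = cls G" using cls_surj[OF g] .
  note L = linear_mapD[OF Psi_linear]
  show "Phi0 f \<in> carrier Seq" by (simp add: F Phi0_cls L)
  show "f \<oplus>\<^bsub>ShA\<^esub> g \<in> carrier ShA" "Phi0 (f \<oplus>\<^bsub>ShA\<^esub> g) = Phi0 f \<oplus>\<^bsub>Seq\<^esub> Phi0 g"
    by (simp_all add: F G cls_add cls_closed Phi0_cls L)
  show "f \<otimes>\<^bsub>ShA\<^esub> g \<in> carrier ShA" "Phi0 (f \<otimes>\<^bsub>ShA\<^esub> g) = Phi0 f \<otimes>\<^bsub>Seq\<^esub> Phi0 g"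
    by (simp_all add: F G cls_mult cls_closed Phi0_cls shuffle_mult_closed Psi_mult)
  show "c \<odot>\<^bsub>ShA\<^esub> f \<in> carrier ShA" "Phi0 (c \<odot>\<^bsub>ShA\<^esub> f) = c \<odot>\<^bsub>Seq\<^esub> Phi0 f" if "c \<in> carrier C"
    using that by (simp_all add: F cls_smult cls_closed Phi0_cls L)
  show "P f \<in> carrier ShA" "Phi0 (P f) = Q (Phi0 f)"
    by (simp_all add: F cls_op cls_closed Phi0_cls cons_one_closed Psi_op)
  show "f = g" if "Phi0 f = Phi0 g" using that by (simp add: F G Phi0_cls cls_eq_iff)
qed

lemma Phi0_consts:
  "\<zero>\<^bsub>ShA\<^esub> \<in> carrier ShA" "Phi0 \<zero>\<^bsub>ShA\<^esub> = \<zero>\<^bsub>Seq\<^esub>" "\<one>\<^bsub>ShA\<^esub> \<in> carrier ShA" "Phi0 \<one>\<^bsub>ShA\<^esub> = \<one>\<^bsub>Seq\<^esub>"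
  using N.single_closed[OF single_letter[of "\<one>\<^bsub>A\<^esub>"]] linear_map_zero[OF Psi_linear nword_module S.module]
  by (simp_all add: cls_zero cls_one cls_closed Phi0_cls Psi_one)

text \<open>\<open>Phi0\<close> is injective and respects all operations, so the shuffle algebra
  inherits every law from the sequences, including associativity of the mixable shuffle
  product.\<close>

lemma Sh_baxter: "baxter_algebra C l ShA P"
proof (rule baxter_family[where S = "\<lambda>i::unit. Seq" and Q = "\<lambda>i. Q" and f = "\<lambda>i. Phi0"])
  show "baxter_algebra C l Seq Q" by (rule seq_baxter)
  show "f = g" if "f \<in> carrier ShA" "g \<in> carrier ShA" "\<And>i::unit. Phi0 f = Phi0 g" for f g
    using Phi0_simps(10) that by blast
qed (simp_all add: Phi0_simps Phi0_consts)

text \<open>A tensor is its first letter times the operator applied to the rest. So the letters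
  generate everything, both in the shuffle algebra and in the image of \<open>Psi\<close>.\<close>

lemma single_Cons:
  assumes a: "a \<in> carrier A" and w: "w \<in> nonempty_words"
  shows "a # w \<in> nonempty_words"
    and "Psi (single C (a # w)) = std_gen C A a \<otimes>\<^bsub>Seq\<^esub> Q (Psi (single C w))"
    and "cls (single C (a # w)) = Sh_incl C A a \<otimes>\<^bsub>ShA\<^esub> P (cls (single C w))"
proof -
  show aw: "a # w \<in> nonempty_words" using a w by (simp add: nonempty_words_def)
  have w1: "\<one>\<^bsub>A\<^esub> # w \<in> nonempty_words" using w by (simp add: nonempty_words_def)
  note s = N.single_closed[OF w] N.single_closed[OF aw] N.single_closed[OF single_letter[OF a]]
  have ws: "set w \<subseteq> carrier A" using w by (simp add: nonempty_words_def)
  show e: "Psi (single C (a # w)) = std_gen C A a \<otimes>\<^bsub>Seq\<^esub> Q (Psi (single C w))"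
  proof
    fix i
    have "Q (Psi (single C w)) i = chain_sum (times_below i) w"
      unfolding Psi_op[OF s(1), symmetric] cons_one_linear(2)[OF w] Psi_single[OF w1] psi_Cons tgen_one
      using ws by simp
    then show "Psi (single C (a # w)) i = (std_gen C A a \<otimes>\<^bsub>Seq\<^esub> Q (Psi (single C w))) i"
      unfolding seq_component(4) Psi_single[OF aw, of i] psi_Cons std_gen_eq by simp
  qed
  have "Psi (single C (a # w)) = Psi (shuffle_mult (single C [a]) (lin_ext C cons_one (single C w)))"
    unfolding e Psi_mult[OF s(3) cons_one_closed[OF s(1)]] Psi_gen[OF a] Psi_op[OF s(1)] ..
  then show "cls (single C (a # w)) = Sh_incl C A a \<otimes>\<^bsub>ShA\<^esub> P (cls (single C w))"
    unfolding cls_incl[OF a] cls_op[OF s(1)] cls_mult[OF s(3) cons_one_closed[OF s(1)]]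
      cls_eq_iff[OF s(2) shuffle_mult_closed[OF s(3) cons_one_closed[OF s(1)]]] .
qed

lemma nonempty_induct [consumes 1, case_names single Cons]:
  assumes "w \<in> nonempty_words" and "\<And>a. a \<in> carrier A \<Longrightarrow> R [a]"
    and "\<And>a w. a \<in> carrier A \<Longrightarrow> w \<in> nonempty_words \<Longrightarrow> R w \<Longrightarrow> R (a # w)"
  shows "R w"
proof -
  have "w \<noteq> [] \<Longrightarrow> set w \<subseteq> carrier A \<Longrightarrow> R w"
  proof (induction w)
    case (Cons a w)
    then show ?case using assms(2,3) by (cases "w = []") (auto simp: nonempty_words_def)
  qed simp
  then show ?thesis using assms(1) by (simp add: nonempty_words_def)
qed

text \<open>The image of \<open>Psi\<close> is closed under all operations, and conversely each word
  is reached from the generators by \<open>single_Cons\<close>.\<close>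

lemma Std_carrier: "carrier Std = Psi ` carrier nword_mod"
proof
  let ?I = "Psi ` carrier nword_mod"
  note L = linear_mapD[OF Psi_linear]
  have sc: "single C w \<in> carrier nword_mod" if "w \<in> nonempty_words" for w by (rule N.single_closed[OF that])
  have "subring ?I Seq"
  proof (rule subring_of_algebraI[OF seq_algebra])
    show "?I \<subseteq> carrier Seq" using L(1) by auto
    show "\<one>\<^bsub>Seq\<^esub> \<in> ?I" using Psi_one sc[OF single_letter] by (metis A.one_closed image_eqI)
    show "x \<oplus>\<^bsub>Seq\<^esub> y \<in> ?I" if "x \<in> ?I" "y \<in> ?I" for x y
      using that by (auto simp: L(2)[symmetric])
    show "x \<otimes>\<^bsub>Seq\<^esub> y \<in> ?I" if "x \<in> ?I" "y \<in> ?I" for x y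
      using that by (auto simp: Psi_mult[symmetric] shuffle_mult_closed)
    show "c \<odot>\<^bsub>Seq\<^esub> x \<in> ?I" if "c \<in> carrier C" "x \<in> ?I" for c x
      using that by (auto simp: L(3)[symmetric])
  qed
  moreover have "Q ` ?I \<subseteq> ?I" by (auto simp: Psi_op[symmetric] cons_one_closed)
  moreover have "c \<odot>\<^bsub>Seq\<^esub> x \<in> ?I" if "c \<in> carrier C" "x \<in> ?I" for c x
    using that by (auto simp: L(3)[symmetric])
  ultimately have "baxter_subalgebra C Seq Q ?I" by (simp add: baxter_subalgebra_def)
  moreover have "std_gen C A ` carrier A \<subseteq> ?I"
    using Psi_gen[symmetric] sc[OF single_letter] by blast
  ultimately show "carrier Std \<subseteq> ?I"
    unfolding std_alg_def gen_baxter_subalgebra_def by auto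
  show "?I \<subseteq> carrier Std"
  proof -
    have "Psi F \<in> S" if S: "baxter_subalgebra C Seq Q S" "std_gen C A ` carrier A \<subseteq> S"
      and F: "F \<in> carrier nword_mod" for S F
    proof -
      have sr: "subring S Seq" and sm: "\<And>c x. c \<in> carrier C \<Longrightarrow> x \<in> S \<Longrightarrow> c \<odot>\<^bsub>Seq\<^esub> x \<in> S"
        and SQ: "\<And>x. x \<in> S \<Longrightarrow> Q x \<in> S"
        using S(1) by (auto simp: baxter_subalgebra_def)
      note S' = subringE[OF sr]
      have w: "Psi (single C w) \<in> S" if "w \<in> nonempty_words" for w
        using that
      proof (induction rule: nonempty_induct)
        case (single a)
        then show ?case using S(2) by (auto simp: Psi_gen)
      next
        case (Cons a w)
        then show ?case unfolding single_Cons(2)[OF Cons(1,2)] using S(2) S'(6) SQ by blast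
      qed
      show ?thesis
        using F
      proof (induction rule: N.free_induct)
        case zero
        then show ?case using linear_map_zero[OF Psi_linear nword_module S.module] S'(2) by simp
      next
        case (step c w F)
        then show ?case using w sm S'(7) by (simp add: L sc)
      qed
    qed
    then show ?thesis unfolding std_alg_def gen_baxter_subalgebra_def by auto
  qed
qed

lemma Std_component:
  "mult Std = mult Seq" "one Std = one Seq" "zero Std = zero Seq" "add Std = add Seq" "smult Std = smult Seq"
  by (simp_all add: std_alg_def)

lemma Std_subset: "carrier Std \<subseteq> carrier Seq"
  using linear_mapD(1)[OF Psi_linear] by (auto simp: Std_carrier)

lemma Phi0_Std: "Phi0 ` carrier ShA = carrier Std"
proof
  show "Phi0 ` carrier ShA \<subseteq> carrier Std"
    by (auto simp: Std_carrier Phi0_cls elim!: cls_surj)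
  show "carrier Std \<subseteq> Phi0 ` carrier ShA"
    unfolding Std_carrier using Phi0_cls cls_closed by (metis image_eqI image_subsetI)
qed

text \<open>The elements of the standard algebra are the images under \<open>Phi0\<close>, so
  closure is read off from the shuffle algebra and the laws hold because they hold for all
  sequences.\<close>

lemma Std_baxter: "baxter_algebra C l Std Q"
  by (rule baxter_family[where S = "\<lambda>i::unit. Seq" and Q = "\<lambda>i. Q" and f = "\<lambda>i x. x"])
     (use seq_baxter Std_subset Phi0_Std[symmetric] Phi0_simps Phi0_consts in
       \<open>auto simp: Std_component Phi0_simps(3,5,7,9)[symmetric] Phi0_consts(2,4)[symmetric]\<close>)

end

section \<open>Completion of the shuffle algebra\<close>

context baxter_regular
begin

lemma Phi0_linear: "linear_map C ShA Seq Phi0"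
  by (rule linear_mapI) (simp_all add: Phi0_simps)

sublocale Sh: algebra C ShA
  by (rule baxter_algebraD(1)[OF Sh_baxter])

sublocale Std: algebra C Std
  by (rule baxter_algebraD(1)[OF Std_baxter])

lemma Phi0_hom: "baxter_hom C l ShA P Std Q (restrict Phi0 (carrier ShA))"
  unfolding baxter_hom_def
  by (intro conjI Sh_baxter Std_baxter ring_hom_memI ballI)
     (use Phi0_Std in \<open>auto simp: Phi0_simps Phi0_consts Std_component\<close>)

text \<open>The values on letters fix those on words by peeling off the first letter, and those on
  words fix the rest by linearity.\<close>

lemma baxter_hom_unique:
  assumes h: "baxter_hom C l ShA P Std Q h"
    and gen: "\<And>a. a \<in> carrier A \<Longrightarrow> h (Sh_incl C A a) = std_gen C A a"
    and F: "F \<in> carrier nword_mod"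
  shows "h (cls F) = Psi F"
proof -
  have hom: "h \<in> ring_hom ShA Std" and sm: "\<And>c x. c \<in> carrier C \<Longrightarrow> x \<in> carrier ShA \<Longrightarrow>
      h (c \<odot>\<^bsub>ShA\<^esub> x) = c \<odot>\<^bsub>Std\<^esub> h x" and op: "\<And>x. x \<in> carrier ShA \<Longrightarrow> h (P x) = Q (h x)"
    using h by (auto simp: baxter_hom_def)
  have sc: "single C w \<in> carrier nword_mod" if "w \<in> nonempty_words" for w by (rule N.single_closed[OF that])
  have w: "h (cls (single C w)) = Psi (single C w)" if "w \<in> nonempty_words" for w
    using that
  proof (induction rule: nonempty_induct)
    case (single a)
    then show ?case using gen by (simp add: cls_incl[symmetric] Psi_gen)
  next
    case (Cons a w)
    have c: "cls (single C w) \<in> carrier ShA" "Sh_incl C A a \<in> carrier ShA"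
      using Cons by (simp_all add: cls_incl cls_closed sc single_letter)
    have "h (cls (single C (a # w))) = h (Sh_incl C A a) \<otimes>\<^bsub>Std\<^esub> h (P (cls (single C w)))"
      unfolding single_Cons(3)[OF Cons(1,2)]
      by (rule ring_hom_mult[OF hom c(2)]) (rule Phi0_simps(8)[OF c(1) c(1)])
    then show ?case
      unfolding single_Cons(2)[OF Cons(1,2)] using Cons gen op c by (simp add: Std_component)
  qed
  show ?thesis
    using F
  proof (induction rule: N.free_induct)
    case zero
    have "h \<zero>\<^bsub>ShA\<^esub> = \<zero>\<^bsub>Std\<^esub>"
      by (rule ring_hom_zero[OF hom]) (use Sh.ring_axioms Std.ring_axioms in auto)
    then show ?case
      using linear_map_zero[OF Psi_linear nword_module S.module] by (simp add: cls_zero Std_component)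
  next
    case (step c w F)
    note s = sc[OF step(2)] N.M.smult_closed[OF step(1) sc[OF step(2)]]
    have "h (cls (c \<odot>\<^bsub>nword_mod\<^esub> single C w \<oplus>\<^bsub>nword_mod\<^esub> F)) =
      h (c \<odot>\<^bsub>ShA\<^esub> cls (single C w)) \<oplus>\<^bsub>Std\<^esub> h (cls F)"
      unfolding cls_add[OF s(2) step(3), symmetric] cls_smult[OF step(1) s(1)]
      by (rule ring_hom_add[OF hom cls_closed[OF s(2)] cls_closed[OF step(3)]])
    also have "\<dots> = c \<odot>\<^bsub>Seq\<^esub> Psi (single C w) \<oplus>\<^bsub>Seq\<^esub> Psi F"
      using step w sm cls_closed[OF s(1)] by (simp add: Std_component)
    also have "\<dots> = Psi (c \<odot>\<^bsub>nword_mod\<^esub> single C w \<oplus>\<^bsub>nword_mod\<^esub> F)"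
      unfolding linear_mapD(2)[OF Psi_linear s(2) step(3)] linear_mapD(3)[OF Psi_linear step(1) s(1)] ..
    finally show ?case .
  qed
qed

text \<open>\<open>Phi\<close> is a definite description among extensional functions, so the value
  outside the carrier has to be fixed too; hence the restriction.\<close>

lemma Phi_eq: "Phi C l A = restrict Phi0 (carrier ShA)"
  unfolding Phi_def
proof (rule the_equality, intro conjI ballI)
  show "restrict Phi0 (carrier ShA) \<in> extensional (carrier ShA)" by simp
  show "baxter_hom C l ShA P Std Q (restrict Phi0 (carrier ShA))" by (rule Phi0_hom)
  show "restrict Phi0 (carrier ShA) (Sh_incl C A a) = std_gen C A a" if "a \<in> carrier A" for a
    using that N.single_closed[OF single_letter[OF that]]
    by (simp add: cls_incl cls_closed Phi0_cls Psi_gen)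
  fix h assume h: "h \<in> extensional (carrier ShA) \<and> baxter_hom C l ShA P Std Q h \<and>
      (\<forall>a\<in>carrier A. h (Sh_incl C A a) = std_gen C A a)"
  show "h = restrict Phi0 (carrier ShA)"
  proof (rule extensionalityI[of _ "carrier ShA"])
    fix x assume x: "x \<in> carrier ShA"
    obtain F where F: "F \<in> carrier nword_mod" "x = cls F" using cls_surj[OF x] .
    then show "h x = restrict Phi0 (carrier ShA) x"
      using baxter_hom_unique[of h F] h x by (simp add: Phi0_cls)
  qed (use h in auto)
qed

lemma Phi_iso: "baxter_iso C l ShA P Std Q (Phi C l A)"
  unfolding baxter_iso_def Phi_eq bij_betw_def
  using Phi0_hom Phi0_Std Phi0_simps(10) by (auto intro!: inj_onI)

text \<open>Vanishing of the first \<open>k\<close> entries means that all parts of length at most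
  \<open>k\<close> are relations, so these are the sums of tensors with more than \<open>k\<close>
  factors. The form chosen makes the ideal property and the comparison with sequences
  immediate.\<close>

definition Sh_fil :: "nat \<Rightarrow> (nat \<Rightarrow> ('a list \<Rightarrow> 'c) set) set" where
  "Sh_fil k = {f \<in> carrier ShA. \<forall>i<k. Phi0 f i = \<zero>\<^bsub>Abar\<^esub>}"

lemma Sh_filtered: "filtered_baxter C l ShA P Sh_fil"
proof (rule filtered_baxter.intro[OF Sh_baxter])
  show "Sh_fil 0 = carrier ShA" by (simp add: Sh_fil_def)
  show "ideal (Sh_fil k) ShA" for k
  proof (rule Sh.idealI')
    show "x \<oplus>\<^bsub>ShA\<^esub> y \<in> Sh_fil k" if "x \<in> Sh_fil k" "y \<in> Sh_fil k" for x y
      using that by (simp add: Sh_fil_def Phi0_simps(3) seq_component(3))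
    show "y \<otimes>\<^bsub>ShA\<^esub> x \<in> Sh_fil k" if "x \<in> Sh_fil k" "y \<in> carrier ShA" for x y
    proof -
      have "Phi0 y i \<in> carrier Abar" for i using Phi0_simps(1)[OF that(2) that(2)] by (simp add: seq_carrier)
      then show ?thesis using that by (simp add: Sh_fil_def Phi0_simps(5) seq_component(4))
    qed
  qed (auto simp: Sh_fil_def Phi0_consts seq_component(1))
  show "Sh_fil (Suc k) \<subseteq> Sh_fil k" for k by (auto simp: Sh_fil_def)
  show "P ` Sh_fil k \<subseteq> Sh_fil (Suc k)" for k
  proof
    fix y assume "y \<in> P ` Sh_fil k"
    then obtain x where x: "x \<in> carrier ShA" "\<And>i. i < k \<Longrightarrow> Phi0 x i = \<zero>\<^bsub>Abar\<^esub>" "y = P x"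
      by (auto simp: Sh_fil_def)
    then show "y \<in> Sh_fil (Suc k)"
      using seq_op_zero_below[OF Phi0_simps(1)[OF x(1) x(1)] x(2)]
      by (simp add: Sh_fil_def Phi0_simps(8,9)[OF x(1) x(1)])
  qed
qed

definition word_high :: "nat \<Rightarrow> ('a list \<Rightarrow> 'c) \<Rightarrow> 'a list \<Rightarrow> 'c" where
  "word_high k F = (\<lambda>w. if length w \<le> k then \<zero>\<^bsub>C\<^esub> else F w)"

lemma word_high_linear: "linear_map C nword_mod nword_mod (word_high k)"
proof (rule linear_mapI)
  fix F assume F: "F \<in> carrier nword_mod"
  then have "finite {w. F w \<noteq> \<zero>\<^bsub>C\<^esub>}" by (simp add: N.carrier_eq)
  then have "finite {w. word_high k F w \<noteq> \<zero>\<^bsub>C\<^esub>}"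
    by (rule rev_finite_subset) (auto simp: word_high_def)
  then show "word_high k F \<in> carrier nword_mod"
    using F by (auto simp: N.carrier_eq word_high_def)
qed (auto simp: word_high_def N.add_eq N.smult_eq)

lemma word_low_high:
  "F \<in> carrier nword_mod \<Longrightarrow> F = word_low k F \<oplus>\<^bsub>nword_mod\<^esub> word_high k F"
  by (auto simp: word_low_def word_high_def N.add_eq N.carrier_eq fun_eq_iff)

text \<open>One inclusion is minimality. For the other the short words drop out, and each longer
  word is a letter times the operator applied to a word of the previous term.\<close>

lemma baxter_fil_Sh: "baxter_fil ShA P k = Sh_fil k"
proof (induction k)
  case 0
  show ?case by (simp add: Sh_fil_def)
next
  case (Suc k)
  interpret B: filtered_baxter C l ShA P "baxter_fil ShA P"
    by (rule baxter_fil_filtered[OF Sh_baxter])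
  note sub = ideal.axioms(1)[OF B.fil_ideal[of "Suc k"]]
  show ?case
  proof
    show "baxter_fil ShA P (Suc k) \<subseteq> Sh_fil (Suc k)" by (rule filtered_baxter.baxter_fil_subset[OF Sh_filtered])
    show "Sh_fil (Suc k) \<subseteq> baxter_fil ShA P (Suc k)"
    proof
      fix f assume f: "f \<in> Sh_fil (Suc k)"
      then obtain F where F: "F \<in> carrier nword_mod" "f = cls F"
        using cls_surj[of f] unfolding Sh_fil_def by blast
      then have z: "\<forall>i<Suc k. Psi F i = \<zero>\<^bsub>Abar\<^esub>" using f by (simp add: Sh_fil_def Phi0_cls)
      note c = linear_mapD(1)[OF word_low_linear F(1), of "Suc k"] linear_mapD(1)[OF word_high_linear F(1), of "Suc k"]
      \<comment> \<open>The vanishing entries make every part of length at most \<open>Suc k\<close>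
        a relation. This portion is then zero in all entries and may be dropped.\<close>
      have low: "Psi (word_low (Suc k) F) i = \<zero>\<^bsub>Abar\<^esub>" for i
        by (rule Psi_low_zero[OF F(1)]) (use z Psi_zero_below_iff[OF F(1)] in blast)
      have "Psi F i = Psi (word_high (Suc k) F) i" for i
      proof -
        have "Psi F i = Psi (word_low (Suc k) F \<oplus>\<^bsub>nword_mod\<^esub> word_high (Suc k) F) i"
          using word_low_high[OF F(1), of "Suc k"] by simp
        also have "\<dots> = Psi (word_low (Suc k) F) i \<oplus>\<^bsub>Abar\<^esub> Psi (word_high (Suc k) F) i"
          by (rule linear_mapD(2)[OF Psi_component_linear c])
        finally show ?thesis using low linear_mapD(1)[OF Psi_component_linear c(2)] by simp
      qed
      then have "f = cls (word_high (Suc k) F)" unfolding F(2) cls_eq_iff[OF F(1) c(2)] by (rule ext)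
      moreover have "cls (word_high (Suc k) F) \<in> baxter_fil ShA P (Suc k)"
        using F(1)
      proof (induction rule: N.free_induct)
        case zero
        then show ?case
          using linear_map_zero[OF word_high_linear nword_module nword_module] additive_subgroup.zero_closed[OF sub] by (simp add: cls_zero)
      next
        case (step a w G)
        have sw: "single C w \<in> carrier nword_mod" by (rule N.single_closed[OF step(2)])
        have w: "cls (word_high (Suc k) (single C w)) \<in> baxter_fil ShA P (Suc k)"
        proof (cases "length w \<le> Suc k")
          case True
          then have "word_high (Suc k) (single C w) = \<zero>\<^bsub>nword_mod\<^esub>"
            by (auto simp: word_high_def single_def N.zero_eq fun_eq_iff)
          then show ?thesis using additive_subgroup.zero_closed[OF sub] by (simp add: cls_zero)
        next
          case False
          then have e: "word_high (Suc k) (single C w) = single C w"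
            by (auto simp: word_high_def single_def fun_eq_iff)
          \<comment> \<open>\<open>w\<close> has more than \<open>Suc k\<close> letters, so its tail
            still has more than \<open>k\<close> of them and lies in the previous term.\<close>
          obtain b v where w: "w = b # v" using step(2) by (cases w) (auto simp: nonempty_words_def)
          moreover have "v \<noteq> []" using False w by auto
          ultimately have bv: "w = b # v" "b \<in> carrier A" "v \<in> nonempty_words" "k < length v" "set v \<subseteq> carrier A"
            using False step(2) by (auto simp: nonempty_words_def)
          have sv: "single C v \<in> carrier nword_mod" by (rule N.single_closed[OF bv(3)])
          have "psi i v = \<zero>\<^bsub>Abar\<^esub>" if "i < k" for i by (rule psi_long[OF bv(5)]) (use that bv(4) in simp)
          then have "cls (single C v) \<in> Sh_fil k"
            using sv bv(3) by (simp add: Sh_fil_def cls_closed Phi0_cls Psi_single)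
          then have "P (cls (single C v)) \<in> baxter_fil ShA P (Suc k)" using Suc.IH B.fil_op[of k] by blast
          then show ?thesis
            unfolding e unfolding bv(1) single_Cons(3)[OF bv(2,3)]
            by (rule ideal.I_l_closed[OF B.fil_ideal])
               (simp add: cls_incl[OF bv(2)] cls_closed N.single_closed single_letter bv(2))
        qed
        have h: "word_high (Suc k) (single C w) \<in> carrier nword_mod" "word_high (Suc k) G \<in> carrier nword_mod"
          using linear_mapD(1)[OF word_high_linear] sw step(3) by auto
        have "cls (word_high (Suc k) (a \<odot>\<^bsub>nword_mod\<^esub> single C w \<oplus>\<^bsub>nword_mod\<^esub> G)) =
          a \<odot>\<^bsub>ShA\<^esub> cls (word_high (Suc k) (single C w)) \<oplus>\<^bsub>ShA\<^esub> cls (word_high (Suc k) G)"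
          unfolding linear_mapD(2)[OF word_high_linear N.M.smult_closed[OF step(1) sw] step(3)]
            linear_mapD(3)[OF word_high_linear step(1) sw] cls_smult[OF step(1) h(1)]
            cls_add[OF N.M.smult_closed[OF step(1) h(1)] h(2)] ..
        also have "\<dots> \<in> baxter_fil ShA P (Suc k)"
          by (rule additive_subgroup.a_closed[OF sub Sh.ideal_smult_closed[OF B.fil_ideal step(1) w] step(4)])
        finally show ?case .
      qed
      ultimately show "f \<in> baxter_fil ShA P (Suc k)" by simp
    qed
  qed
qed

section \<open>Subalgebras of sequences filtered by vanishing entries\<close>

lemma seq_fil_mem: "s \<in> seq_fil C A k \<longleftrightarrow> s \<in> carrier Seq \<and> (\<forall>i<k. s i = \<zero>\<^bsub>Abar\<^esub>)"
  by (auto simp: seq_fil_def)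

text \<open>Negation is defined by a description relative to the carrier, so it is not automatically
  unchanged when the carrier shrinks. The inclusion is linear, and linear maps preserve
  differences.\<close>

lemma sub_seq_minus:
  assumes S: "baxter_subalgebra C Seq Q S" and "s \<in> S" "t \<in> S"
  shows "s \<ominus>\<^bsub>Seq\<lparr>carrier := S\<rparr>\<^esub> t = s \<ominus>\<^bsub>Seq\<^esub> t"
proof -
  have sub: "S \<subseteq> carrier Seq" using S subringE(1) by (auto simp: baxter_subalgebra_def)
  have "linear_map C (Seq\<lparr>carrier := S\<rparr>) Seq (\<lambda>x. x)" by (rule linear_mapI) (use sub in auto)
  moreover have "module C (Seq\<lparr>carrier := S\<rparr>)"
    by (rule algebra.module[OF baxter_algebraD(1)[OF baxter_subalgebra_baxter[OF seq_baxter S]]])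
  ultimately show ?thesis
    using linear_map_minus[of C "Seq\<lparr>carrier := S\<rparr>" Seq "\<lambda>x. x" s t] S.module assms(2,3) by simp
qed

lemma sub_seq_minus_fil_iff:
  assumes S: "baxter_subalgebra C Seq Q S" and s: "s \<in> S" and t: "t \<in> S"
  shows "s \<ominus>\<^bsub>Seq\<lparr>carrier := S\<rparr>\<^esub> t \<in> S \<inter> seq_fil C A k \<longleftrightarrow> (\<forall>i<k. s i = t i)"
proof -
  have sub: "S \<subseteq> carrier Seq" using S subringE(1) by (auto simp: baxter_subalgebra_def)
  interpret R: algebra C "Seq\<lparr>carrier := S\<rparr>"
    by (rule baxter_algebraD(1)[OF baxter_subalgebra_baxter[OF seq_baxter S]])
  have st: "s \<in> carrier Seq" "t \<in> carrier Seq" using s t sub by auto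
  have c: "s i \<in> carrier Abar" "t i \<in> carrier Abar" for i using st by (auto simp: seq_carrier)
  have "s \<ominus>\<^bsub>Seq\<lparr>carrier := S\<rparr>\<^esub> t \<in> S" using R.M.minus_closed[of s t] s t by simp
  moreover have "(s \<ominus>\<^bsub>Seq\<^esub> t) i = \<zero>\<^bsub>Abar\<^esub> \<longleftrightarrow> s i = t i" for i
    unfolding seq_minus[OF st, of i] using c[of i] by simp
  ultimately show ?thesis
    unfolding sub_seq_minus[OF S s t] using sub by (auto simp: seq_fil_mem)
qed

text \<open>Applied to the full algebra of sequences, to the standard algebra and to its
  closure.\<close>

lemma sub_seq_filtered:
  assumes S: "baxter_subalgebra C Seq Q S"
  shows "filtered_baxter C l (Seq\<lparr>carrier := S\<rparr>) Q (\<lambda>k. S \<inter> seq_fil C A k)"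
proof (rule filtered_baxter.intro[OF baxter_subalgebra_baxter[OF seq_baxter S]])
  have sub: "S \<subseteq> carrier Seq" and SQ: "Q ` S \<subseteq> S" using S subringE(1) by (auto simp: baxter_subalgebra_def)
  interpret R: algebra C "Seq\<lparr>carrier := S\<rparr>"
    by (rule baxter_algebraD(1)[OF baxter_subalgebra_baxter[OF seq_baxter S]])
  show "S \<inter> seq_fil C A 0 = carrier (Seq\<lparr>carrier := S\<rparr>)" using sub by (auto simp: seq_fil_mem)
  show "ideal (S \<inter> seq_fil C A k) (Seq\<lparr>carrier := S\<rparr>)" for k
  proof (rule R.idealI')
    show "\<zero>\<^bsub>Seq\<lparr>carrier := S\<rparr>\<^esub> \<in> S \<inter> seq_fil C A k"
      using R.M.zero_closed sub by (auto simp: seq_fil_mem seq_component(1))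
    show "x \<oplus>\<^bsub>Seq\<lparr>carrier := S\<rparr>\<^esub> y \<in> S \<inter> seq_fil C A k" if "x \<in> S \<inter> seq_fil C A k" "y \<in> S \<inter> seq_fil C A k" for x y
      using R.M.a_closed[of x y] that sub by (auto simp: seq_fil_mem seq_component(3))
    show "y \<otimes>\<^bsub>Seq\<lparr>carrier := S\<rparr>\<^esub> x \<in> S \<inter> seq_fil C A k"
      if "x \<in> S \<inter> seq_fil C A k" "y \<in> carrier (Seq\<lparr>carrier := S\<rparr>)" for x y
    proof -
      have y: "y i \<in> carrier Abar" for i using that sub by (auto simp: seq_carrier)
      have "y \<otimes>\<^bsub>Seq\<^esub> x \<in> S" using R.m_closed[of y x] that by simp
      moreover have "(y \<otimes>\<^bsub>Seq\<^esub> x) i = \<zero>\<^bsub>Abar\<^esub>" if "i < k" for i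
        unfolding seq_component(4) using \<open>x \<in> S \<inter> seq_fil C A k\<close> that y[of i] by (simp add: seq_fil_mem)
      ultimately show ?thesis using sub by (auto simp: seq_fil_mem)
    qed
  qed auto
  show "S \<inter> seq_fil C A (Suc k) \<subseteq> S \<inter> seq_fil C A k" for k by (auto simp: seq_fil_mem)
  show "Q ` (S \<inter> seq_fil C A k) \<subseteq> S \<inter> seq_fil C A (Suc k)" for k
  proof
    fix y assume "y \<in> Q ` (S \<inter> seq_fil C A k)"
    then obtain x where x: "x \<in> S" "x \<in> carrier Seq" "\<And>i. i < k \<Longrightarrow> x i = \<zero>\<^bsub>Abar\<^esub>" "y = Q x"
      by (auto simp: seq_fil_mem)
    then show "y \<in> S \<inter> seq_fil C A (Suc k)"
      using SQ seq_op_zero_below[OF x(2,3)] seq_op_closed[OF x(2)] by (auto simp: seq_fil_mem)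
  qed
qed

lemma Seq_self: "baxter_subalgebra C Seq Q (carrier Seq)"
  using S.carrier_is_subring seq_op_closed by (auto simp: baxter_subalgebra_def)

lemma Std_sub: "baxter_subalgebra C Seq Q (carrier Std)"
proof -
  have "subring (carrier Std) Seq"
    by (rule subring_of_algebraI[OF seq_algebra Std_subset])
       (use Std.one_closed Std.M.a_closed Std.m_closed Std.smult_closed in \<open>simp_all add: Std_component\<close>)
  then show ?thesis
    using Std.smult_closed baxter_algebraD(3)[OF Std_baxter] by (auto simp: baxter_subalgebra_def Std_component)
qed

text \<open>The topological closure of the standard algebra, for the topology of agreement on
  initial segments. It describes the completion without cosets.\<close>

definition std_closure :: "(nat \<Rightarrow> (nat \<times> ('a list \<Rightarrow> 'c) set) set) set" where
  "std_closure = {s \<in> carrier Seq. \<forall>k. \<exists>r\<in>carrier Std. \<forall>i<k. s i = r i}"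

lemma std_closureD:
  assumes "x \<in> std_closure"
  shows "x \<in> carrier Seq" and "\<exists>r\<in>carrier Std. \<forall>i<k. x i = r i"
  using assms unfolding std_closure_def by blast+

text \<open>Continuity of the operator, with a gain of one place since only earlier entries are
  summed.\<close>

lemma seq_op_cong_below:
  assumes "s \<in> carrier Seq" "t \<in> carrier Seq" "\<And>i. i < k \<Longrightarrow> s i = t i" "i \<le> k"
  shows "Q s i = Q t i"
  using assms(4)
proof (induction i)
  case (Suc i)
  then show ?case using assms(3)[of i] by (simp add: seq_op_Suc[OF assms(1), of i] seq_op_Suc[OF assms(2), of i])
qed (simp add: seq_op_0)

text \<open>Every operation is continuous, so the results of approximants approximate the
  result.\<close>

lemma std_closure_sub: "baxter_subalgebra C Seq Q std_closure"
proof -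
  note S' = Std_sub[unfolded baxter_subalgebra_def]
  note sr = subringE[OF conjunct1[OF S']]
  have sm: "c \<odot>\<^bsub>Seq\<^esub> x \<in> std_closure" if c: "c \<in> carrier C" and x: "x \<in> std_closure" for c x
    unfolding std_closure_def
  proof (intro CollectI conjI allI)
    show "c \<odot>\<^bsub>Seq\<^esub> x \<in> carrier Seq" using c x by (simp add: std_closure_def)
    fix k
    obtain r where r: "r \<in> carrier Std" "\<forall>i<k. x i = r i" using std_closureD(2)[OF x] by blast
    have "c \<odot>\<^bsub>Seq\<^esub> r \<in> carrier Std" using Std.smult_closed[OF c r(1)] by (simp add: Std_component)
    moreover have "\<forall>i<k. (c \<odot>\<^bsub>Seq\<^esub> x) i = (c \<odot>\<^bsub>Seq\<^esub> r) i" unfolding seq_component(5) using r(2) by simp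
    ultimately show "\<exists>r\<in>carrier Std. \<forall>i<k. (c \<odot>\<^bsub>Seq\<^esub> x) i = r i" by blast
  qed
  have "subring std_closure Seq"
  proof (rule subring_of_algebraI[OF seq_algebra])
    show "std_closure \<subseteq> carrier Seq" by (auto simp: std_closure_def)
    show "\<one>\<^bsub>Seq\<^esub> \<in> std_closure" using sr(3) S.one_closed unfolding std_closure_def by blast
    fix x y assume x: "x \<in> std_closure" and y: "y \<in> std_closure"
    have xy: "\<exists>r\<in>carrier Std. \<exists>t\<in>carrier Std. \<forall>i<k. x i = r i \<and> y i = t i" for k
    proof -
      obtain r where "r \<in> carrier Std" "\<forall>i<k. x i = r i" using std_closureD(2)[OF x] by blast
      moreover obtain t where "t \<in> carrier Std" "\<forall>i<k. y i = t i" using std_closureD(2)[OF y] by blast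
      ultimately show ?thesis by (intro bexI[of _ r] bexI[of _ t]) simp_all
    qed
    note c = std_closureD(1)[OF x] std_closureD(1)[OF y]
    show "x \<oplus>\<^bsub>Seq\<^esub> y \<in> std_closure"
      unfolding std_closure_def
    proof (intro CollectI conjI allI)
      fix k
      obtain r t where r: "r \<in> carrier Std" "t \<in> carrier Std" "\<forall>i<k. x i = r i \<and> y i = t i" using xy by blast
      have "\<forall>i<k. (x \<oplus>\<^bsub>Seq\<^esub> y) i = (r \<oplus>\<^bsub>Seq\<^esub> t) i" unfolding seq_component(3) using r(3) by simp
      then show "\<exists>r\<in>carrier Std. \<forall>i<k. (x \<oplus>\<^bsub>Seq\<^esub> y) i = r i" using sr(7)[OF r(1,2)] by blast
    qed (use c in simp)
    show "x \<otimes>\<^bsub>Seq\<^esub> y \<in> std_closure"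
      unfolding std_closure_def
    proof (intro CollectI conjI allI)
      fix k
      obtain r t where r: "r \<in> carrier Std" "t \<in> carrier Std" "\<forall>i<k. x i = r i \<and> y i = t i" using xy by blast
      have "\<forall>i<k. (x \<otimes>\<^bsub>Seq\<^esub> y) i = (r \<otimes>\<^bsub>Seq\<^esub> t) i" unfolding seq_component(4) using r(3) by simp
      then show "\<exists>r\<in>carrier Std. \<forall>i<k. (x \<otimes>\<^bsub>Seq\<^esub> y) i = r i" using sr(6)[OF r(1,2)] by blast
    qed (use c in simp)
  qed (rule sm)
  moreover have "Q x \<in> std_closure" if x: "x \<in> std_closure" for x
    unfolding std_closure_def
  proof (intro CollectI conjI allI)
    have c: "x \<in> carrier Seq" using x by (simp add: std_closure_def)
    then show "Q x \<in> carrier Seq" by (rule seq_op_closed)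
    fix k
    obtain r where r: "r \<in> carrier Std" "\<And>i. i < k \<Longrightarrow> x i = r i" using std_closureD(2)[OF x, of k] by blast
    then have rc: "r \<in> carrier Seq" using Std_subset by blast
    have "\<forall>i<k. Q x i = Q r i" using seq_op_cong_below[OF c rc r(2)] by simp
    then show "\<exists>r\<in>carrier Std. \<forall>i<k. Q x i = r i" using baxter_algebraD(3)[OF Std_baxter r(1)] by blast
  qed
  ultimately show ?thesis using sm by (auto simp: baxter_subalgebra_def)
qed

lemma std_alg_eq: "Std = Seq\<lparr>carrier := carrier Std\<rparr>"
  by (simp add: std_alg_def)

text \<open>A coherent family over the standard algebra amounts to elements of it that agree on
  longer and longer initial segments. A sequence corresponds to such a family exactly when these
  elements approximate it.\<close>

lemma std_completion_carrier: "carrier (std_completion C l A) = std_closure"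
proof -
  let ?F = "\<lambda>k. carrier Std \<inter> seq_fil C A k"
  have F: "?F = std_fil C l A" by (simp add: fun_eq_iff std_fil_def)
  interpret R: filtered_baxter C l Std Q ?F
    using sub_seq_filtered[OF Std_sub] by (simp flip: std_alg_eq)
  have "filtered_baxter C l (Seq\<lparr>carrier := carrier Seq\<rparr>) Q (\<lambda>k. carrier Seq \<inter> seq_fil C A k)"
    by (rule sub_seq_filtered[OF Seq_self])
  moreover have "(\<lambda>k. carrier Seq \<inter> seq_fil C A k) = seq_fil C A" by (auto simp: fun_eq_iff seq_fil_mem)
  ultimately have "filtered_baxter C l Seq Q (seq_fil C A)" by simp
  then interpret G: filtered_baxter C l Seq Q "seq_fil C A" .
  \<comment> \<open>The map between the quotients sends the coset of \<open>r\<close> in the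
    standard algebra to its coset in all sequences, so coherent families can be handled by
    representatives.\<close>
  have e: "coset_map Seq (seq_fil C A k) (\<lambda>x. x) (?F k +>\<^bsub>Std\<^esub> r) = seq_fil C A k +>\<^bsub>Seq\<^esub> r"
    if "r \<in> carrier Std" for r k
    by (rule coset_map_coset[OF R.fil_ideal G.fil_ideal that]) (use Std_subset in \<open>auto simp: Std_component\<close>)
  have eq: "seq_fil C A k +>\<^bsub>Seq\<^esub> s = seq_fil C A k +>\<^bsub>Seq\<^esub> r \<longleftrightarrow> (\<forall>i<k. s i = r i)"
    if "s \<in> carrier Seq" "r \<in> carrier Seq" for s r k
    unfolding G.F.rcos_eq_iff[OF that] using sub_seq_minus_fil_iff[OF Seq_self that, of k] G.F.a_Hcarr by auto
  let ?i = "\<lambda>X k. coset_map Seq (seq_fil C A k) (\<lambda>x. x) (X k)"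
  have mem: "s \<in> carrier (std_completion C l A) \<longleftrightarrow>
      s \<in> carrier Seq \<and> (\<exists>X\<in>carrier (lim_alg Std ?F). lim_map Seq (seq_fil C A) s = ?i X)" for s
    unfolding F std_completion_def by (simp add: image_iff)
  have "s \<in> carrier (std_completion C l A) \<longleftrightarrow> s \<in> std_closure" if s: "s \<in> carrier Seq" for s
  proof
    assume "s \<in> carrier (std_completion C l A)"
    then have "\<exists>X\<in>carrier (lim_alg Std ?F). lim_map Seq (seq_fil C A) s = ?i X" unfolding mem by (rule conjunct2)
    then obtain X where X: "X \<in> carrier (lim_alg Std ?F)" "lim_map Seq (seq_fil C A) s = ?i X" by (rule bexE)
    obtain r where r: "\<And>n. r n \<in> carrier Std" "\<And>n. X n = ?F n +>\<^bsub>Std\<^esub> r n"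
      "\<And>n. r (Suc n) \<ominus>\<^bsub>Std\<^esub> r n \<in> ?F n" by (rule R.lim_carrierE[OF X(1)]) (rule that)
    have "\<forall>i<k. s i = r k i" for k
    proof -
      have "seq_fil C A k +>\<^bsub>Seq\<^esub> s = ?i X k" using fun_cong[OF X(2), of k] by (simp add: lim_map_def)
      also have "\<dots> = seq_fil C A k +>\<^bsub>Seq\<^esub> r k" unfolding r(2) by (rule e[OF r(1)])
      finally show ?thesis using eq[OF s, of "r k" k] r(1)[of k] Std_subset by auto
    qed
    then have "\<exists>r\<in>carrier Std. \<forall>i<k. s i = r i" for k by (intro bexI[of _ "r k"] r(1))
    then show "s \<in> std_closure" using s by (simp add: std_closure_def)
  next
    assume "s \<in> std_closure"
    note std_closureD(2)[OF this]
    \<comment> \<open>One approximant is chosen for each length. Two consecutive ones agree with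
      \<open>s\<close>, hence with each other, below \<open>n\<close>, which is coherence.\<close>
    then obtain r where r: "\<And>k. r k \<in> carrier Std" "\<And>k i. i < k \<Longrightarrow> s i = r k i" by metis
    define X where "X k = ?F k +>\<^bsub>Std\<^esub> r k" for k
    have X1: "X \<in> carrier (lim_alg Std ?F)"
      unfolding X_def
    proof (rule R.lim_carrierI[OF r(1)])
      fix n
      have "r (Suc n) i = r n i" if "i < n" for i using r(2)[of i n] r(2)[of i "Suc n"] that by simp
      then show "r (Suc n) \<ominus>\<^bsub>Std\<^esub> r n \<in> ?F n"
        using sub_seq_minus_fil_iff[OF Std_sub r(1) r(1), of "Suc n" n n] by (simp flip: std_alg_eq)
    qed
    have X2: "lim_map Seq (seq_fil C A) s = ?i X"
    proof
      fix k
      have "?i X k = seq_fil C A k +>\<^bsub>Seq\<^esub> r k" unfolding X_def by (rule e[OF r(1)])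
      moreover have "r k \<in> carrier Seq" using r(1) Std_subset by blast
      ultimately show "lim_map Seq (seq_fil C A) s k = ?i X k"
        using eq[OF s, of "r k" k] r(2) by (simp add: lim_map_def)
    qed
    show "s \<in> carrier (std_completion C l A)"
      unfolding mem by (intro conjI bexI[of _ X] s X1 X2)
  qed
  moreover have "carrier (std_completion C l A) \<subseteq> carrier Seq"
  proof
    show "s \<in> carrier Seq" if "s \<in> carrier (std_completion C l A)" for s
      using that unfolding mem by (rule conjunct1)
  qed
  moreover have "std_closure \<subseteq> carrier Seq" using std_closureD(1) by blast
  ultimately show ?thesis by blast
qed

lemma std_completion_eq: "std_completion C l A = Seq\<lparr>carrier := std_closure\<rparr>"
proof -
  have "std_completion C l A = Seq\<lparr>carrier := carrier (std_completion C l A)\<rparr>"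
    by (simp add: std_completion_def)
  then show ?thesis by (simp only: std_completion_carrier)
qed

lemma std_completion_fil_eq: "std_completion_fil C l A = (\<lambda>k. std_closure \<inter> seq_fil C A k)"
  by (rule ext) (simp add: std_completion_fil_def std_completion_carrier)

lemma std_completion_complete:
  "complete_filtered_baxter C l (std_completion C l A) Q (std_completion_fil C l A)"
  unfolding std_completion_eq std_completion_fil_eq
proof (rule filtered_baxter.complete_filteredI[OF sub_seq_filtered[OF std_closure_sub]])
  let ?R = "Seq\<lparr>carrier := std_closure\<rparr>"
  show "baxter_proper ?R Q"
  proof (rule filtered_baxter.proper[OF sub_seq_filtered[OF std_closure_sub]])
    show "\<one>\<^bsub>?R\<^esub> \<notin> std_closure \<inter> seq_fil C A 1"
      using dirlim_nontrivial[OF nontrivial] seq_component(2)[of 0] by (auto simp: seq_fil_mem)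
  qed
  show "s = \<zero>\<^bsub>?R\<^esub>" if s: "\<And>n. s \<in> std_closure \<inter> seq_fil C A n" for s
  proof -
    have "s i = \<zero>\<^bsub>Seq\<^esub> i" for i using s[of "Suc i"] unfolding seq_component(1) by (auto simp: seq_fil_mem)
    then have "s = \<zero>\<^bsub>Seq\<^esub>" by (rule ext)
    then show ?thesis by simp
  qed
  fix x assume x': "\<And>n. x n \<in> carrier ?R"
    and d: "\<And>n. x (Suc n) \<ominus>\<^bsub>?R\<^esub> x n \<in> std_closure \<inter> seq_fil C A n"
  have x: "x n \<in> std_closure" for n using x' by simp
  then have c: "x n \<in> carrier Seq" for n by (simp add: std_closure_def)
  have st: "x (Suc n) i = x n i" if "i < n" for n i
    using d[of n] sub_seq_minus_fil_iff[OF std_closure_sub x x, of "Suc n" n n] that by blast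
  have stable: "x n i = x (Suc i) i" if "i < n" for n i
    using that
  proof (induction n)
    case (Suc n)
    then show ?case using st[of i n] by (cases "i = n") auto
  qed simp
  define y where "y i = x (Suc i) i" for i
  have y: "y \<in> std_closure"
    unfolding std_closure_def
  proof (intro CollectI conjI allI)
    show "y \<in> carrier Seq" using c by (simp add: seq_carrier y_def)
    fix k
    \<comment> \<open>The limit agrees with \<open>x k\<close> in the first \<open>k\<close>
      entries, so an approximant of \<open>x k\<close> also approximates the limit.\<close>
    obtain r where r: "r \<in> carrier Std" "\<forall>i<k. x k i = r i" using std_closureD(2)[OF x[of k]] by blast
    then have "\<forall>i<k. y i = r i" using stable[of _ k] by (simp add: y_def)
    then show "\<exists>r\<in>carrier Std. \<forall>i<k. y i = r i" using r(1) by blast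
  qed
  have "y \<ominus>\<^bsub>?R\<^esub> x n \<in> std_closure \<inter> seq_fil C A n" for n
    unfolding sub_seq_minus_fil_iff[OF std_closure_sub y x] using stable[of _ n] by (simp add: y_def)
  then show "\<exists>y\<in>carrier ?R. \<forall>n. y \<ominus>\<^bsub>?R\<^esub> x n \<in> std_closure \<inter> seq_fil C A n"
    using y by auto
qed

section \<open>Extension of the comparison map to the completions\<close>

lemma Sh_one_notin: "\<one>\<^bsub>ShA\<^esub> \<notin> Sh_fil 1"
  using dirlim_nontrivial[OF nontrivial] seq_component(2)[of 0] by (simp add: Sh_fil_def Phi0_consts)

text \<open>Entry \<open>i\<close> is read off at level \<open>Suc i\<close>, the first of the
  quotients that is bound to determine it.\<close>

definition Phi_hat :: "(nat \<Rightarrow> (nat \<Rightarrow> ('a list \<Rightarrow> 'c) set) set) \<Rightarrow> nat \<Rightarrow> (nat \<times> ('a list \<Rightarrow> 'c) set) set" where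
  "Phi_hat X i = Phi0 (SOME x. x \<in> X (Suc i)) i"

sublocale F: filtered_baxter C l ShA P Sh_fil
  by (rule Sh_filtered)

abbreviation "ShHat \<equiv> lim_alg ShA Sh_fil"

lemma Sh_fil_rcos_eq_iff:
  assumes "x \<in> carrier ShA" "y \<in> carrier ShA"
  shows "Sh_fil k +>\<^bsub>ShA\<^esub> x = Sh_fil k +>\<^bsub>ShA\<^esub> y \<longleftrightarrow> (\<forall>i<k. Phi0 x i = Phi0 y i)"
proof -
  have c: "Phi0 x \<in> carrier Seq" "Phi0 y \<in> carrier Seq" using Phi0_simps(1) assms by blast+
  have "Phi0 (x \<ominus>\<^bsub>ShA\<^esub> y) i = \<zero>\<^bsub>Abar\<^esub> \<longleftrightarrow> Phi0 x i = Phi0 y i" for i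
    unfolding linear_map_minus[OF Phi0_linear Sh.module S.module assms] seq_minus[OF c, of i]
    using c by (simp add: seq_carrier)
  moreover have "x \<ominus>\<^bsub>ShA\<^esub> y \<in> Sh_fil k \<longleftrightarrow> (\<forall>i<k. Phi0 (x \<ominus>\<^bsub>ShA\<^esub> y) i = \<zero>\<^bsub>Abar\<^esub>)"
    using Sh.M.minus_closed[OF assms] by (simp only: Sh_fil_def mem_Collect_eq simp_thms)
  ultimately show ?thesis unfolding F.F.rcos_eq_iff[OF assms] by (simp only:)
qed

text \<open>Representatives from two levels agree in all entries below the smaller level, so any
  level beyond \<open>i\<close> gives the same value and one representative serves for several
  entries.\<close>

lemma Phi_hat_apply:
  assumes X: "X \<in> carrier ShHat" and x: "x \<in> X k" and i: "i < k"
  shows "Phi_hat X i = Phi0 x i"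
proof -
  define y where "y = (SOME y. y \<in> X (Suc i))"
  have y: "y \<in> X (Suc i)" unfolding y_def by (rule someI_ex[OF F.lim_nonempty[OF X]])
  note yc = F.lim_carrier_le(2,3)[OF X order.refl y]
  have "Suc i \<le> k" using i by simp
  note xc = F.lim_carrier_le(2,3)[OF X this x]
  have "Phi0 x i = Phi0 y i"
    using Sh_fil_rcos_eq_iff[OF xc(1) yc(1), of "Suc i"] trans[OF xc(2)[symmetric] yc(2)] lessI[of i] by blast
  then show ?thesis by (simp add: Phi_hat_def y_def)
qed

lemma lim_mem:
  assumes "X \<in> carrier ShHat"
  obtains x where "x \<in> X k" "x \<in> carrier ShA" "X k = Sh_fil k +>\<^bsub>ShA\<^esub> x"
proof -
  obtain x where x: "x \<in> X k" using F.lim_nonempty[OF assms] by (rule exE)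
  show ?thesis by (rule that[OF x F.lim_carrier_le(2,3)[OF assms order.refl x]])
qed

lemma lim_mem_ex: "X \<in> carrier ShHat \<Longrightarrow> \<exists>x. x \<in> X k \<and> x \<in> carrier ShA"
  by (rule lim_mem) auto

lemma Phi_hat_closed:
  assumes X: "X \<in> carrier ShHat"
  shows "Phi_hat X \<in> std_closure"
  unfolding std_closure_def
proof (intro CollectI conjI allI)
  show "Phi_hat X \<in> carrier Seq"
    unfolding seq_carrier
  proof
    fix i
    obtain x where "x \<in> X (Suc i)" "x \<in> carrier ShA" using lim_mem_ex[OF X, of "Suc i"] by blast
    then show "Phi_hat X i \<in> carrier Abar"
      using Phi_hat_apply[OF X, of x "Suc i" i] Phi0_simps(1)[of x x] by (simp add: seq_carrier)
  qed
  fix k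
  obtain x where x: "x \<in> X k" "x \<in> carrier ShA" using lim_mem_ex[OF X, of k] by blast
  have "\<forall>i<k. Phi_hat X i = Phi0 x i" using Phi_hat_apply[OF X x(1)] by simp
  moreover have "Phi0 x \<in> carrier Std" using Phi0_Std x(2) by blast
  ultimately show "\<exists>r\<in>carrier Std. \<forall>i<k. Phi_hat X i = r i" by (rule bexI)
qed

lemma Phi_hat_eqI:
  assumes Z: "Z \<in> carrier ShHat" and "z \<in> carrier ShA" and "Z (Suc i) = Sh_fil (Suc i) +>\<^bsub>ShA\<^esub> z"
  shows "Phi_hat Z i = Phi0 z i"
  by (rule Phi_hat_apply[OF Z, of _ "Suc i"]) (use F.F.a_rcos_self assms in auto)

lemma Phi_hat_hom:
  "baxter_hom C l ShHat (lim_op ShA Sh_fil P) (std_completion C l A) Q Phi_hat"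
  unfolding baxter_hom_def std_completion_eq
proof (intro conjI ring_hom_memI ballI F.lim_baxter baxter_subalgebra_baxter[OF seq_baxter std_closure_sub])
  fix X assume X: "X \<in> carrier ShHat"
  then show "Phi_hat X \<in> carrier (Seq\<lparr>carrier := std_closure\<rparr>)" by (simp add: Phi_hat_closed)
  {
    fix Y assume Y: "Y \<in> carrier ShHat"
    have e: "Phi_hat (X \<oplus>\<^bsub>ShHat\<^esub> Y) i = (Phi_hat X \<oplus>\<^bsub>Seq\<^esub> Phi_hat Y) i \<and>
      Phi_hat (X \<otimes>\<^bsub>ShHat\<^esub> Y) i = (Phi_hat X \<otimes>\<^bsub>Seq\<^esub> Phi_hat Y) i" for i
    proof -
      obtain x where x: "x \<in> X (Suc i)" "x \<in> carrier ShA" using lim_mem_ex[OF X, of "Suc i"] by blast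
      obtain y where y: "y \<in> Y (Suc i)" "y \<in> carrier ShA" using lim_mem_ex[OF Y, of "Suc i"] by blast
      note m = F.lim_mem_closed(1,2)[OF X Y x(1) y(1)]
      have "Phi_hat X i = Phi0 x i" "Phi_hat Y i = Phi0 y i"
        using Phi_hat_apply[OF X x(1)] Phi_hat_apply[OF Y y(1)] by auto
      moreover have "Phi_hat (X \<oplus>\<^bsub>ShHat\<^esub> Y) i = Phi0 (x \<oplus>\<^bsub>ShA\<^esub> y) i"
        by (rule Phi_hat_eqI[OF F.lim_closed(3)[OF X Y] Phi0_simps(2)[OF x(2) y(2)] m(1)])
      moreover have "Phi_hat (X \<otimes>\<^bsub>ShHat\<^esub> Y) i = Phi0 (x \<otimes>\<^bsub>ShA\<^esub> y) i"
        by (rule Phi_hat_eqI[OF F.lim_closed(4)[OF X Y] Phi0_simps(4)[OF x(2) y(2)] m(2)])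
      ultimately show ?thesis
        unfolding seq_component(3)[of _ _ i] seq_component(4)[of _ _ i]
        by (simp only: Phi0_simps(3,5)[OF x(2) y(2)] seq_component(3)[of _ _ i] seq_component(4)[of _ _ i])
    qed
    have m: "Phi_hat (X \<otimes>\<^bsub>ShHat\<^esub> Y) = Phi_hat X \<otimes>\<^bsub>Seq\<^esub> Phi_hat Y" by (rule ext) (rule e[THEN conjunct2])
    have a: "Phi_hat (X \<oplus>\<^bsub>ShHat\<^esub> Y) = Phi_hat X \<oplus>\<^bsub>Seq\<^esub> Phi_hat Y" by (rule ext) (rule e[THEN conjunct1])
    show "Phi_hat (X \<otimes>\<^bsub>ShHat\<^esub> Y) = Phi_hat X \<otimes>\<^bsub>Seq\<lparr>carrier := std_closure\<rparr>\<^esub> Phi_hat Y"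
      "Phi_hat (X \<oplus>\<^bsub>ShHat\<^esub> Y) = Phi_hat X \<oplus>\<^bsub>Seq\<lparr>carrier := std_closure\<rparr>\<^esub> Phi_hat Y"
      using m a by simp_all
  }
  show "Phi_hat (lim_op ShA Sh_fil P X) = Q (Phi_hat X)"
  proof
    fix i
    obtain x where x: "x \<in> X (Suc i)" "x \<in> carrier ShA" using lim_mem_ex[OF X, of "Suc i"] by blast
    have "Phi_hat (lim_op ShA Sh_fil P X) i = Phi0 (P x) i"
      by (rule Phi_hat_eqI[OF F.lim_closed(6)[OF X] Phi0_simps(8)[OF x(2) x(2)] F.lim_mem_closed(4)[OF X X x(1) x(1)]])
    also have "\<dots> = Q (Phi0 x) i" by (simp only: Phi0_simps(9)[OF x(2) x(2)])
    also have "\<dots> = Q (Phi_hat X) i"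
    \<comment> \<open>Entry \<open>i\<close> of \<open>Q\<close> depends on several entries of its
      argument, and the single \<open>x\<close> represents \<open>X\<close> for all of them.\<close>
    proof (rule seq_op_cong_below)
      show "Phi0 x j = Phi_hat X j" if "j < Suc i" for j using Phi_hat_apply[OF X x(1) that] ..
    qed (use Phi_hat_closed[OF X] Phi0_simps(1)[OF x(2) x(2)] in \<open>auto simp: std_closure_def\<close>)
    finally show "Phi_hat (lim_op ShA Sh_fil P X) i = Q (Phi_hat X) i" .
  qed
  fix c assume c: "c \<in> carrier C"
  show "Phi_hat (c \<odot>\<^bsub>ShHat\<^esub> X) = c \<odot>\<^bsub>Seq\<lparr>carrier := std_closure\<rparr>\<^esub> Phi_hat X"
  proof
    fix i
    obtain x where x: "x \<in> X (Suc i)" "x \<in> carrier ShA" using lim_mem_ex[OF X, of "Suc i"] by blast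
    have "Phi_hat (c \<odot>\<^bsub>ShHat\<^esub> X) i = Phi0 (c \<odot>\<^bsub>ShA\<^esub> x) i"
      by (rule Phi_hat_eqI[OF F.lim_closed(5)[OF c X] Phi0_simps(6)[OF x(2) x(2) c]
          F.lim_mem_closed(3)[OF X X x(1) x(1) c]])
    also have "\<dots> = c \<odot>\<^bsub>Abar\<^esub> Phi0 x i" unfolding Phi0_simps(7)[OF x(2) x(2) c] by (rule seq_component(5))
    also have "\<dots> = (c \<odot>\<^bsub>Seq\<^esub> Phi_hat X) i" unfolding seq_component(5) using Phi_hat_apply[OF X x(1)] by simp
    finally show "Phi_hat (c \<odot>\<^bsub>ShHat\<^esub> X) i = (c \<odot>\<^bsub>Seq\<lparr>carrier := std_closure\<rparr>\<^esub> Phi_hat X) i" by simp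
  qed
next
  show "Phi_hat \<one>\<^bsub>ShHat\<^esub> = \<one>\<^bsub>Seq\<lparr>carrier := std_closure\<rparr>\<^esub>"
  proof
    fix i
    have "Phi_hat \<one>\<^bsub>ShHat\<^esub> i = Phi0 \<one>\<^bsub>ShA\<^esub> i"
      by (rule Phi_hat_eqI[OF F.lim_closed(2) Phi0_consts(3)]) (simp add: F.lim_simps)
    then show "Phi_hat \<one>\<^bsub>ShHat\<^esub> i = \<one>\<^bsub>Seq\<lparr>carrier := std_closure\<rparr>\<^esub> i" by (simp add: Phi0_consts)
  qed
qed

lemma Phi_hat_bij: "bij_betw Phi_hat (carrier ShHat) std_closure"
  unfolding bij_betw_def
proof (intro conjI inj_onI equalityI subsetI)
  fix X Y assume X: "X \<in> carrier ShHat" and Y: "Y \<in> carrier ShHat" and eq: "Phi_hat X = Phi_hat Y"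
  show "X = Y"
  proof
    fix k
    obtain x where x: "x \<in> X k" "x \<in> carrier ShA" "X k = Sh_fil k +>\<^bsub>ShA\<^esub> x"
      by (rule lim_mem[OF X]) (rule that)
    obtain y where y: "y \<in> Y k" "y \<in> carrier ShA" "Y k = Sh_fil k +>\<^bsub>ShA\<^esub> y"
      by (rule lim_mem[OF Y]) (rule that)
    have "Phi0 x i = Phi0 y i" if "i < k" for i
      using Phi_hat_apply[OF X x(1) that] Phi_hat_apply[OF Y y(1) that] eq by simp
    then show "X k = Y k" unfolding x(3) y(3) Sh_fil_rcos_eq_iff[OF x(2) y(2)] by blast
  qed
next
  fix s assume "s \<in> Phi_hat ` carrier ShHat"
  then show "s \<in> std_closure" using Phi_hat_closed by blast
next
  fix s assume s: "s \<in> std_closure"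
  \<comment> \<open>Each initial segment of \<open>s\<close> comes from the standard algebra and
    thus from the shuffle algebra. The elements found there agree to growing depth and form the
    preimage.\<close>
  have "\<exists>x\<in>carrier ShA. \<forall>i<k. s i = Phi0 x i" for k
  proof -
    obtain r where "r \<in> carrier Std" "\<forall>i<k. s i = r i" using std_closureD(2)[OF s] by blast
    moreover from this(1) obtain x where "x \<in> carrier ShA" "r = Phi0 x" unfolding Phi0_Std[symmetric] by (rule imageE) (rule that)
    ultimately show ?thesis by (intro bexI[of _ x]) simp_all
  qed
  then obtain x where x: "\<And>k. x k \<in> carrier ShA" "\<And>k i. i < k \<Longrightarrow> s i = Phi0 (x k) i" by metis
  define X where "X k = Sh_fil k +>\<^bsub>ShA\<^esub> x k" for k
  have X: "X \<in> carrier ShHat"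
    unfolding X_def
  proof (rule F.lim_carrierI[OF x(1)])
    fix n
    have "\<forall>i<n. Phi0 (x (Suc n)) i = Phi0 (x n) i" using x(2)[of _ n] x(2)[of _ "Suc n"] by simp
    then show "x (Suc n) \<ominus>\<^bsub>ShA\<^esub> x n \<in> Sh_fil n"
      using Sh_fil_rcos_eq_iff[OF x(1) x(1), of n "Suc n" n] F.F.rcos_eq_iff[OF x(1) x(1), of n "Suc n" n] by simp
  qed
  have e: "s i = Phi_hat X i" for i
    using Phi_hat_eqI[OF X x(1)[of "Suc i"], of i] x(2)[of i "Suc i"] by (simp add: X_def)
  have "s = Phi_hat X" by (rule ext) (rule e)
  then show "s \<in> Phi_hat ` carrier ShHat" using X by (rule image_eqI)
qed

text \<open>Both filtrations say that the first \<open>k\<close> entries vanish, so the comparison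
  map is a homeomorphism and not only an algebraic isomorphism.\<close>

lemma Phi_hat_fil: "Phi_hat ` lim_fil ShA Sh_fil k = std_closure \<inter> seq_fil C A k"
proof -
  have iff: "X \<in> lim_fil ShA Sh_fil k \<longleftrightarrow> Phi_hat X \<in> seq_fil C A k" if X: "X \<in> carrier ShHat" for X
  proof -
    obtain x where x: "x \<in> X k" "x \<in> carrier ShA" "X k = Sh_fil k +>\<^bsub>ShA\<^esub> x"
      by (rule lim_mem[OF X]) (rule that)
    have "X \<in> lim_fil ShA Sh_fil k \<longleftrightarrow> x \<in> Sh_fil k"
      using X F.F.rcos_eq_self_iff[OF x(2), of k]
      by (simp add: lim_fil_def quot_alg_simps(2)[OF F.fil_ideal] x(3))
    also have "\<dots> \<longleftrightarrow> (\<forall>i<k. Phi0 x i = \<zero>\<^bsub>Abar\<^esub>)" using x(2) by (simp only: Sh_fil_def mem_Collect_eq simp_thms)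
    also have "\<dots> \<longleftrightarrow> (\<forall>i<k. Phi_hat X i = \<zero>\<^bsub>Abar\<^esub>)" using Phi_hat_apply[OF X x(1)] by auto
    finally show ?thesis using std_closureD(1)[OF Phi_hat_closed[OF X]] by (simp only: seq_fil_mem simp_thms)
  qed
  have "lim_fil ShA Sh_fil k \<subseteq> carrier ShHat" by (auto simp: lim_fil_def)
  moreover have "Phi_hat ` carrier ShHat = std_closure" using Phi_hat_bij by (simp add: bij_betw_def)
  moreover have "lim_fil ShA Sh_fil k = {X \<in> carrier ShHat. Phi_hat X \<in> seq_fil C A k}"
    using calculation(1) iff by blast
  ultimately show ?thesis by auto
qed

lemma Phi_hat_extends:
  assumes "x \<in> carrier ShA"
  shows "Phi_hat (lim_map ShA Sh_fil x) = Phi C l A x"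
proof
  fix i
  show "Phi_hat (lim_map ShA Sh_fil x) i = Phi C l A x i"
    using Phi_hat_eqI[OF F.lim_map_closed[OF assms] assms, of i] assms by (simp add: Phi_eq F.lim_map_apply)
qed

lemma baxter_fil_Sh_fun: "baxter_fil ShA P = Sh_fil"
  using baxter_fil_Sh by (rule ext)

end

text \<open>The completions are topological objects, so the second claim records more than a
  bijective homomorphism: each side is complete for the filtration it carries, and the comparison
  map takes one filtration onto the other.\<close>

theorem theorem4p9:
  fixes C :: "('c, 'k) ring_scheme" and l :: 'c and A :: "('c, 'a, 'm) module_scheme"
  assumes "algebra C A" and "l \<in> carrier C" and "\<one>\<^bsub>A\<^esub> \<noteq> \<zero>\<^bsub>A\<^esub>"
  shows "baxter_complete C l (seq_alg C A) (seq_op C l A) \<and>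
    ((\<forall>x\<in>carrier (tensor_dirlim C A).
        l \<odot>\<^bsub>tensor_dirlim C A\<^esub> x = \<zero>\<^bsub>tensor_dirlim C A\<^esub> \<longrightarrow> x = \<zero>\<^bsub>tensor_dirlim C A\<^esub>) \<longrightarrow>
      baxter_iso C l (Sh C l A) (Sh_op C A) (std_alg C l A) (seq_op C l A) (Phi C l A) \<and>
      complete_filtered_baxter C l
        (completion (Sh C l A) (Sh_op C A)) (completion_op (Sh C l A) (Sh_op C A))
        (lim_fil (Sh C l A) (baxter_fil (Sh C l A) (Sh_op C A))) \<and>
      complete_filtered_baxter C l
        (std_completion C l A) (seq_op C l A) (std_completion_fil C l A) \<and>
      (\<exists>Phi_hat.
        baxter_iso C l
          (completion (Sh C l A) (Sh_op C A)) (completion_op (Sh C l A) (Sh_op C A))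
          (std_completion C l A) (seq_op C l A) Phi_hat \<and>
        (\<forall>k. Phi_hat ` lim_fil (Sh C l A) (baxter_fil (Sh C l A) (Sh_op C A)) k =
             std_completion_fil C l A k) \<and>
        (\<forall>x\<in>carrier (Sh C l A).
           Phi_hat (completion_map (Sh C l A) (Sh_op C A) x) = Phi C l A x)))"
proof -
  interpret B: baxter_base C A l
    using assms by (intro baxter_base.intro tensor_base.intro baxter_base_axioms.intro)
  show ?thesis
  proof (intro conjI impI)
    show "baxter_complete C l (seq_alg C A) (seq_op C l A)" by (rule B.seq_complete)
    assume reg: "\<forall>x\<in>carrier (tensor_dirlim C A).
        l \<odot>\<^bsub>tensor_dirlim C A\<^esub> x = \<zero>\<^bsub>tensor_dirlim C A\<^esub> \<longrightarrow> x = \<zero>\<^bsub>tensor_dirlim C A\<^esub>"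
    interpret R: baxter_regular C A l
      by (intro baxter_regular.intro baxter_regular_axioms.intro B.baxter_base_axioms) (use reg in blast)
    \<comment> \<open>The Baxter filtration of the shuffle algebra and the filtration by vanishing
      entries are equal as functions of the level, so the two completions are literally the same
      structure.\<close>
    note fil = R.baxter_fil_Sh_fun
    show "baxter_iso C l (Sh C l A) (Sh_op C A) (std_alg C l A) (seq_op C l A) (Phi C l A)"
      by (rule R.Phi_iso)
    show "complete_filtered_baxter C l
        (completion (Sh C l A) (Sh_op C A)) (completion_op (Sh C l A) (Sh_op C A))
        (lim_fil (Sh C l A) (baxter_fil (Sh C l A) (Sh_op C A)))"
      unfolding fil by (rule R.F.lim_complete_filtered[OF R.Sh_one_notin])
    show "complete_filtered_baxter C l
        (std_completion C l A) (seq_op C l A) (std_completion_fil C l A)"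
      by (rule R.std_completion_complete)
    show "\<exists>Phi_hat.
        baxter_iso C l
          (completion (Sh C l A) (Sh_op C A)) (completion_op (Sh C l A) (Sh_op C A))
          (std_completion C l A) (seq_op C l A) Phi_hat \<and>
        (\<forall>k. Phi_hat ` lim_fil (Sh C l A) (baxter_fil (Sh C l A) (Sh_op C A)) k =
             std_completion_fil C l A k) \<and>
        (\<forall>x\<in>carrier (Sh C l A).
           Phi_hat (completion_map (Sh C l A) (Sh_op C A) x) = Phi C l A x)"
      unfolding fil R.std_completion_fil_eq baxter_iso_def R.std_completion_carrier
      by (intro exI[of _ R.Phi_hat] conjI allI ballI R.Phi_hat_hom R.Phi_hat_bij R.Phi_hat_fil R.Phi_hat_extends)
  qed
qed

end
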